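(* Let $m>0$, let $V\in C^1(\mathbb{R},\mathbb{R})$ and suppose that there exist $\varepsilon\in(0,1)$ and $M_\varepsilon>0$ such that $$|V'(x)|\le \varepsilon |V(x)|^2+M_\varepsilon,\qquad x\in\mathbb{R}.$$ Let $H$ be the Dirac operator in $L^2(\mathbb{R},\mathbb{C}^2)$ $$H=-i\partial_x\sigma_1+m\sigma_3+iVI_2,\qquad \mathrm{Dom}(H)=H^1(\mathbb{R},\mathbb{C}^2)\cap \mathrm{Dom}(VI_2).$$ Then the following claims hold. (i) The adjoint operator is $H^*=-i\partial_x\sigma_1+m\sigma_3-iVI_2$ with $\mathrm{Dom}(H^* )=\mathrm{Dom}(H)$. (ii) There exists $C>0$ such that for all $u\in\mathrm{Dom}(H)$ $$\|Hu\|^2+\|u\|^2\ge C\left(\|u'\|^2+\|VI_2u\|^2+\|u\|^2\right),\qquad \|H^*u\|^2+\|u\|^2\ge C\left(\|u'\|^2+\|VI_2u\|^2+\|u\|^2\right).$$ Moreover, $C_c^\infty(\mathbb{R},\mathbb{C}^2)$ is a core of $H$ and of $H^*$. (iii) The resolvent set of $H$ is non-empty; moreover, $\{z\in\mathbb{C}:\operatorname{Re}z\in(-m,m)\}\subset\rho(H)$. (iv) If, in addition, $|V(x)|\to\infty$ as $|x|\to\infty$, then the resolvent of $H$ is compact. In particular, if for some $\gamma>0$ and $x_0\ge0$ $$|V(x)|\gtrsim\langle x\rangle^\gamma,\qquad |x|\ge x_0,\qquad (\ast)$$ then the singular values of $H^{-1}$ satisfy $$s_k(H^{-1})=\mathcal{O}(k^{-1/p_\gamma}),\quad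 k\to+\infty,\qquad p_\gamma=\frac{\gamma+1}{\gamma}.$$ (v) Suppose that $(\ast)$ is satisfied (for some $\gamma>0$, $x_0\geq 0$), with $p_\gamma=\frac{\gamma+1}{\gamma}$. For every $\delta>0$ there exists $c>0$ such that for all $\lambda\in\rho(H)$ with $|\lambda|\ge e$ and $\mathrm{dist}(\lambda,\sigma(H))\ge\delta|\lambda|$, $$\log\|(H-\lambda)^{-1}\|\le c|\lambda|^{p_\gamma}.$$
   Context: $\sigma_1=\begin{pmatrix}0&1\\1&0\end{pmatrix}$, $\sigma_3=\begin{pmatrix}1&0\\0&-1\end{pmatrix}$, $I_2$ is the $2\times2$ identity matrix, so for $u=(u_1,u_2)^t$, $Hu=\big((m+iV)u_1-iu_2',\,-iu_1'+(-m+iV)u_2\big)^t$. $\mathrm{Dom}(VI_2)=\{u\in L^2(\mathbb{R},\mathbb{C}^2):VI_2u\in L^2(\mathbb{R},\mathbb{C}^2)\}$. $\|\cdot\|$ is the norm of $L^2(\mathbb{R},\mathbb{C}^2)$ or the corresponding operator norm. $\sigma(\cdot)$ and $\rho(\cdot)$ denote the spectrum and resolvent set. $\langle x\rangle=(1+x^2)^{1/2}$. $a\gtrsim b$ means $a\ge Cb$ with a constant $C>0$ independent of the variable $x$. The singular values $s_k(T)$, $k\in\mathbb{N}$, of a compact operator $T$ are listed in non-increasing order and repeated according to multiplicity. The convention $\mathrm{dist}(\lambda,\emptyset)=+\infty$ is used. *)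

theory Defs
  imports "HOL-Analysis.Analysis" "HOL-Library.Landau_Symbols"
begin

section \<open>Complex inner product spaces\<close>

text \<open>The form \<open>cinner\<close> is linear in its first argument; norm and topology are those of
  the underlying real inner product \<open>Re (cinner x y)\<close>.\<close>

class complex_inner = real_inner +
  fixes scaleC :: "complex \<Rightarrow> 'a \<Rightarrow> 'a" (infixr \<open>*\<^sub>C\<close> 75)
    and cinner :: "'a \<Rightarrow> 'a \<Rightarrow> complex"
  assumes scaleC_add_right: "c *\<^sub>C (x + y) = c *\<^sub>C x + c *\<^sub>C y"
    and scaleC_add_left: "(c + d) *\<^sub>C x = c *\<^sub>C x + d *\<^sub>C x"
    and scaleC_scaleC: "c *\<^sub>C d *\<^sub>C x = (c * d) *\<^sub>C x"
    and scaleR_scaleC: "r *\<^sub>R x = complex_of_real r *\<^sub>C x"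
    and cinner_commute: "cinner x y = cnj (cinner y x)"
    and cinner_add_left: "cinner (x + y) z = cinner x z + cinner y z"
    and cinner_scaleC_left: "cinner (c *\<^sub>C x) y = c * cinner x y"
    and inner_eq_Re_cinner: "inner x y = Re (cinner x y)"

global_interpretation complex_vector:
  vector_space "scaleC :: complex \<Rightarrow> 'a \<Rightarrow> 'a::complex_inner"
  defines cdim = complex_vector.dim
proof
  fix x :: 'a
  have "1 *\<^sub>C x = 1 *\<^sub>R x" by (simp only: scaleR_scaleC of_real_1)
  then show "1 *\<^sub>C x = x" by simp
qed (simp_all add: scaleC_add_right scaleC_add_left scaleC_scaleC)


section \<open>Unbounded operators, represented by their graphs\<close>

type_synonym 'a operator = "('a \<times> 'a) set"

definition op_on :: "'a set \<Rightarrow> ('a \<Rightarrow> 'a) \<Rightarrow> 'a operator" where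
  "op_on D F = {(u, F u) | u. u \<in> D}"

definition op_app :: "'a operator \<Rightarrow> 'a \<Rightarrow> 'a" where
  "op_app T u = (THE f. (u, f) \<in> T)"

text \<open>The adjoint as a linear relation. It is the graph of a function if and only if the
  domain of \<open>T\<close> is dense, so an identity \<open>op_adjoint T = op_on D F\<close> also says that \<open>T\<close> is
  densely defined.\<close>

definition op_adjoint :: "'a::complex_inner operator \<Rightarrow> 'a operator" where
  "op_adjoint T = {(v, w). \<forall>(u, f)\<in>T. cinner f v = cinner u w}"

text \<open>The closure of the restriction of \<open>T\<close> to \<open>D\<close> is \<open>T\<close>; in particular \<open>T\<close> is closed.\<close>

definition is_core :: "'a::real_normed_vector set \<Rightarrow> 'a operator \<Rightarrow> bool" where
  "is_core D T \<longleftrightarrow> D \<subseteq> Domain T \<and> closure (T \<inter> D \<times> UNIV) = T"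

definition op_shift :: "'a::complex_inner operator \<Rightarrow> complex \<Rightarrow> 'a operator" where
  "op_shift T z = {(u, f - z *\<^sub>C u) | u f. (u, f) \<in> T}"

definition resolvent :: "'a::complex_inner operator \<Rightarrow> complex \<Rightarrow> 'a \<Rightarrow> 'a" where
  "resolvent T z = op_app ((op_shift T z)\<inverse>)"

text \<open>\<open>T - z\<close> is a bijection from the domain of \<open>T\<close> onto the whole space with bounded
  inverse. For a complex linear \<open>T\<close> the inverse is complex linear anyway, and its norm as a
  complex linear map is its \<open>onorm\<close>.\<close>

definition resolvent_set :: "'a::complex_inner operator \<Rightarrow> complex set" where
  "resolvent_set T =
     {z. (\<forall>f. \<exists>!u. (u, f) \<in> op_shift T z) \<and> bounded_linear (resolvent T z)}"

definition spectrum :: "'a::complex_inner operator \<Rightarrow> complex set" where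
  "spectrum T = - resolvent_set T"

text \<open>The infimum is taken in the extended reals so that the distance to the empty set is
  infinite; \<open>infdist\<close> would give 0 there.\<close>

definition dist_to_set :: "complex \<Rightarrow> complex set \<Rightarrow> ereal" where
  "dist_to_set z S = (INF w\<in>S. ereal (dist z w))"

definition compact_operator :: "('a::complex_inner \<Rightarrow> 'a) \<Rightarrow> bool" where
  "compact_operator K \<longleftrightarrow> bounded_linear K \<and> compact (closure (K ` cball 0 1))"

definition eigenspace :: "'a::complex_inner operator \<Rightarrow> complex \<Rightarrow> 'a set" where
  "eigenspace T z = {u. (u, z *\<^sub>C u) \<in> T}"

text \<open>The singular values of a compact operator \<open>K\<close> are the square roots of the eigenvalues
  of \<open>K\<^sup>* K\<close> (in relational composition order: first \<open>K\<close>, then its adjoint), in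
  non-increasing order, each positive one repeated according to its multiplicity, and filled
  up with zeros if there are only finitely many positive ones. The enumeration starts with
  index 0. For a compact operator on a Hilbert space exactly one such sequence exists.\<close>

definition is_singular_value_seq :: "('a::complex_inner \<Rightarrow> 'a) \<Rightarrow> (nat \<Rightarrow> real) \<Rightarrow> bool" where
  "is_singular_value_seq K s \<longleftrightarrow>
     decseq s \<and> (\<forall>k. 0 \<le> s k) \<and>
     (\<forall>\<sigma>>0. finite {k. s k = \<sigma>} \<and>
        card {k. s k = \<sigma>} =
          cdim (eigenspace (op_on UNIV K O op_adjoint (op_on UNIV K)) (complex_of_real (\<sigma>\<^sup>2))))"

definition singular_value :: "('a::complex_inner \<Rightarrow> 'a) \<Rightarrow> nat \<Rightarrow> real" where
  "singular_value K = (THE s. is_singular_value_seq K s)"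


section \<open>The Hilbert space of square integrable spinors on the real line\<close>

text \<open>Classes of Borel functions modulo equality almost everywhere; every Lebesgue measurable
  function agrees almost everywhere with a Borel function.\<close>

definition sq_integrable :: "(real \<Rightarrow> complex^2) \<Rightarrow> bool" where
  "sq_integrable f \<longleftrightarrow>
     f \<in> borel_measurable lborel \<and> integrable lborel (\<lambda>x. (norm (f x))\<^sup>2)"

definition L2_eq :: "(real \<Rightarrow> complex^2) \<Rightarrow> (real \<Rightarrow> complex^2) \<Rightarrow> bool" where
  "L2_eq f g \<longleftrightarrow> sq_integrable f \<and> sq_integrable g \<and> (AE x in lborel. f x = g x)"

definition csprod :: "complex^2 \<Rightarrow> complex^2 \<Rightarrow> complex" where
  "csprod v w = (\<Sum>i\<in>UNIV. v $ i * cnj (w $ i))"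

lemma sq_integrable_measurable [measurable_dest]:
  "sq_integrable f \<Longrightarrow> f \<in> borel_measurable lborel"
  by (simp add: sq_integrable_def)

lemma sq_integrable_zero: "sq_integrable (\<lambda>x. 0)"
  by (simp add: sq_integrable_def)

lemma sq_integrable_bound:
  assumes "sq_integrable f" "g \<in> borel_measurable lborel" "\<And>x. norm (g x) \<le> C * norm (f x)"
  shows "sq_integrable g"
proof -
  have int: "integrable lborel (\<lambda>x. C\<^sup>2 * (norm (f x))\<^sup>2)"
    using assms(1) by (simp add: sq_integrable_def)
  have "(norm (g x))\<^sup>2 \<le> C\<^sup>2 * (norm (f x))\<^sup>2" for x
    using power_mono[OF assms(3)[of x] norm_ge_zero, of 2] by (simp add: power_mult_distrib)
  then have "AE x in lborel. norm ((norm (g x))\<^sup>2) \<le> norm (C\<^sup>2 * (norm (f x))\<^sup>2)"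
    by simp
  moreover have "(\<lambda>x. (norm (g x))\<^sup>2) \<in> borel_measurable lborel"
    using assms(2) by measurable
  ultimately have "integrable lborel (\<lambda>x. (norm (g x))\<^sup>2)"
    using Bochner_Integration.integrable_bound[OF int] by blast
  with assms(2) show ?thesis by (simp add: sq_integrable_def)
qed

lemma sq_integrable_add:
  assumes "sq_integrable f" "sq_integrable g"
  shows "sq_integrable (\<lambda>x. f x + g x)"
proof -
  have [measurable]: "f \<in> borel_measurable lborel" "g \<in> borel_measurable lborel"
    using assms by (auto simp: sq_integrable_def)
  have le: "(norm (a + b))\<^sup>2 \<le> 2 * (norm a)\<^sup>2 + 2 * (norm b)\<^sup>2" for a b :: "complex^2"
  proof -
    have "(norm (a + b))\<^sup>2 \<le> (norm a + norm b)\<^sup>2"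
      by (intro power_mono norm_triangle_ineq norm_ge_zero)
    also have "\<dots> \<le> 2 * (norm a)\<^sup>2 + 2 * (norm b)\<^sup>2"
      using zero_le_power2[of "norm a - norm b"] by (simp add: power2_sum power2_diff)
    finally show ?thesis .
  qed
  have "integrable lborel (\<lambda>x. 2 * (norm (f x))\<^sup>2 + 2 * (norm (g x))\<^sup>2)"
    using assms by (simp add: sq_integrable_def)
  then have "integrable lborel (\<lambda>x. (norm (f x + g x))\<^sup>2)"
  proof (rule Bochner_Integration.integrable_bound)
    show "AE x in lborel. norm ((norm (f x + g x))\<^sup>2)
        \<le> norm (2 * (norm (f x))\<^sup>2 + 2 * (norm (g x))\<^sup>2)"
      using le by simp
  qed measurable
  then show ?thesis by (simp add: sq_integrable_def)
qed

lemma norm_vector_scalar_mult: "norm (c *s (v :: complex^2)) = norm c * norm v"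
  by (simp add: norm_vec_def L2_set_def norm_mult power_mult_distrib real_sqrt_mult
      flip: sum_distrib_left)

lemma continuous_on_csmult: "continuous_on UNIV ((*s) (c::complex) :: complex^2 \<Rightarrow> _)"
  unfolding vector_scalar_mult_def by (intro continuous_intros)

lemma sq_integrable_csmult:
  assumes "sq_integrable f" shows "sq_integrable (\<lambda>x. c *s f x)"
proof (rule sq_integrable_bound[OF assms])
  show "(\<lambda>x. c *s f x) \<in> borel_measurable lborel"
    by (rule borel_measurable_continuous_on[OF continuous_on_csmult sq_integrable_measurable[OF assms]])
  show "norm (c *s f x) \<le> norm c * norm (f x)" for x
    by (simp add: norm_vector_scalar_mult)
qed

lemma csmult_of_real: "complex_of_real r *s (v :: complex^2) = r *\<^sub>R v"
  by (simp add: vec_eq_iff) (simp add: scaleR_conv_of_real)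

lemma sq_integrable_scaleR: "sq_integrable f \<Longrightarrow> sq_integrable (\<lambda>x. r *\<^sub>R f x)"
  using sq_integrable_csmult[of f "complex_of_real r"] by (simp add: csmult_of_real)

lemma inner_eq_Re_csprod: "inner v w = Re (csprod v w)"
  by (simp add: inner_vec_def csprod_def inner_complex_def)

lemma csprod_measurable:
  assumes "f \<in> borel_measurable lborel" "g \<in> borel_measurable lborel"
  shows "(\<lambda>x. csprod (f x) (g x)) \<in> borel_measurable lborel"
proof -
  have "continuous_on UNIV (\<lambda>p. csprod (fst p) (snd p))"
    unfolding csprod_def by (intro continuous_intros)
  moreover have "(\<lambda>x. (f x, g x)) \<in> borel_measurable lborel"
    using assms by measurable
  ultimately show ?thesis
    using borel_measurable_continuous_on[of "\<lambda>p. csprod (fst p) (snd p)" "\<lambda>x. (f x, g x)"] by simp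
qed

lemma norm_csprod_le: "norm (csprod v w) \<le> (norm v)\<^sup>2 + (norm w)\<^sup>2"
proof -
  have "norm (csprod v w) \<le> (\<Sum>i\<in>UNIV. norm (v $ i) * norm (w $ i))"
    unfolding csprod_def by (rule order_trans[OF norm_sum]) (simp add: norm_mult)
  also have "\<dots> \<le> (\<Sum>i\<in>UNIV. (norm (v $ i))\<^sup>2 + (norm (w $ i))\<^sup>2)"
  proof (rule sum_mono)
    fix i
    have "0 \<le> (norm (v $ i) - norm (w $ i))\<^sup>2" "0 \<le> norm (v $ i) * norm (w $ i)" by simp_all
    then show "norm (v $ i) * norm (w $ i) \<le> (norm (v $ i))\<^sup>2 + (norm (w $ i))\<^sup>2"
      unfolding power2_diff by linarith
  qed
  also have "\<dots> = (norm v)\<^sup>2 + (norm w)\<^sup>2"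
    by (simp add: norm_vec_def L2_set_def sum.distrib sum_nonneg)
  finally show ?thesis .
qed

lemma integrable_csprod:
  assumes "sq_integrable f" "sq_integrable g"
  shows "integrable lborel (\<lambda>x. csprod (f x) (g x))"
proof (rule Bochner_Integration.integrable_bound)
  show "integrable lborel (\<lambda>x. (norm (f x))\<^sup>2 + (norm (g x))\<^sup>2)"
    using assms by (simp add: sq_integrable_def)
  show "(\<lambda>x. csprod (f x) (g x)) \<in> borel_measurable lborel"
    using assms by (intro csprod_measurable) (auto simp: sq_integrable_def)
  show "AE x in lborel. norm (csprod (f x) (g x)) \<le> norm ((norm (f x))\<^sup>2 + (norm (g x))\<^sup>2)"
    using norm_csprod_le by (intro AE_I2) (simp add: order_trans)
qed

quotient_type L2 = "real \<Rightarrow> complex^2" / partial: L2_eq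
proof (rule part_equivpI)
  show "\<exists>f. L2_eq f f"
    using sq_integrable_zero by (auto simp: L2_eq_def)
  show "symp L2_eq"
    by (auto simp: symp_def L2_eq_def)
  show "transp L2_eq"
    unfolding transp_def L2_eq_def by (safe; (assumption | eventually_elim; simp))
qed

instantiation L2 :: complex_inner
begin

lift_definition zero_L2 :: L2 is "\<lambda>x. 0"
  by (simp add: L2_eq_def sq_integrable_zero)

lift_definition plus_L2 :: "L2 \<Rightarrow> L2 \<Rightarrow> L2" is "\<lambda>f g x. f x + g x"
  by (auto simp: L2_eq_def sq_integrable_add)

lift_definition scaleC_L2 :: "complex \<Rightarrow> L2 \<Rightarrow> L2" is "\<lambda>c f x. c *s f x"
  by (auto simp: L2_eq_def sq_integrable_csmult)

lift_definition scaleR_L2 :: "real \<Rightarrow> L2 \<Rightarrow> L2" is "\<lambda>r f x. r *\<^sub>R f x"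
  by (auto simp: L2_eq_def sq_integrable_scaleR)

definition uminus_L2 :: "L2 \<Rightarrow> L2" where "uminus_L2 u = (-1) *\<^sub>R u"

definition minus_L2 :: "L2 \<Rightarrow> L2 \<Rightarrow> L2" where "minus_L2 u v = u + - v"

lift_definition cinner_L2 :: "L2 \<Rightarrow> L2 \<Rightarrow> complex" is
  "\<lambda>f g. LINT x|lborel. csprod (f x) (g x)"
  unfolding L2_eq_def
  by (intro integral_cong_AE csprod_measurable) (auto simp: sq_integrable_def)

lemma cinner_smult_L2: "cinner (c *\<^sub>C u) v = c * cinner u v" for u v :: L2
  by transfer (simp add: csprod_def mult.assoc flip: sum_distrib_left)

definition inner_L2 :: "L2 \<Rightarrow> L2 \<Rightarrow> real" where "inner_L2 u v = Re (cinner u v)"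

definition norm_L2 :: "L2 \<Rightarrow> real" where "norm_L2 u = sqrt (inner u u)"

definition sgn_L2 :: "L2 \<Rightarrow> L2" where "sgn_L2 u = inverse (norm u) *\<^sub>R u"

definition dist_L2 :: "L2 \<Rightarrow> L2 \<Rightarrow> real" where "dist_L2 u v = norm (u - v)"

definition uniformity_L2 :: "(L2 \<times> L2) filter" where
  "uniformity_L2 = (INF e\<in>{0<..}. principal {(x, y). dist x y < e})"

definition open_L2 :: "L2 set \<Rightarrow> bool" where
  "open_L2 U \<longleftrightarrow> (\<forall>x\<in>U. eventually (\<lambda>(x', y). x' = x \<longrightarrow> y \<in> U) uniformity)"

instance
proof
  fix u v w :: L2 and a b :: real and c d :: complex
  show "u + v + w = u + (v + w)"
    by transfer (auto simp: L2_eq_def add.assoc intro!: sq_integrable_add)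
  show "u + v = v + u"
    by transfer (auto simp: L2_eq_def add.commute intro!: sq_integrable_add)
  show zero: "0 + u = u"
    by transfer (auto simp: L2_eq_def)
  show "- u + u = 0"
    unfolding uminus_L2_def
    by transfer (auto simp: L2_eq_def sq_integrable_zero)
  show "u - v = u + - v" by (simp add: minus_L2_def)
  show "a *\<^sub>R (u + v) = a *\<^sub>R u + a *\<^sub>R v"
    by transfer (auto simp: L2_eq_def scaleR_add_right intro!: sq_integrable_add sq_integrable_scaleR)
  show "(a + b) *\<^sub>R u = a *\<^sub>R u + b *\<^sub>R u"
    by transfer (auto simp: L2_eq_def scaleR_add_left intro!: sq_integrable_add sq_integrable_scaleR)
  show "a *\<^sub>R b *\<^sub>R u = (a * b) *\<^sub>R u"
    by transfer (auto simp: L2_eq_def intro!: sq_integrable_scaleR)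
  show "1 *\<^sub>R u = u"
    by transfer (auto simp: L2_eq_def)
  show "dist u v = norm (u - v)" by (simp add: dist_L2_def)
  show "sgn u = inverse (norm u) *\<^sub>R u" by (simp add: sgn_L2_def)
  show "(uniformity :: (L2 \<times> L2) filter) = (INF e\<in>{0<..}. principal {(x, y). dist x y < e})"
    by (simp add: uniformity_L2_def)
  show "open U = (\<forall>x\<in>U. \<forall>\<^sub>F (x', y) in uniformity. x' = x \<longrightarrow> y \<in> U)" for U :: "L2 set"
    by (simp add: open_L2_def)
  show "c *\<^sub>C (u + v) = c *\<^sub>C u + c *\<^sub>C v"
    by transfer (auto simp: L2_eq_def intro!: sq_integrable_add sq_integrable_csmult)
  show "(c + d) *\<^sub>C u = c *\<^sub>C u + d *\<^sub>C u"
    by transfer (auto simp: L2_eq_def intro!: sq_integrable_add sq_integrable_csmult)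
  show "c *\<^sub>C d *\<^sub>C u = (c * d) *\<^sub>C u"
    by transfer (auto simp: L2_eq_def intro!: sq_integrable_csmult)
  show scaleR: "a *\<^sub>R u = complex_of_real a *\<^sub>C u"
    by transfer (auto simp: L2_eq_def csmult_of_real intro!: sq_integrable_scaleR)
  have cnj_csprod: "csprod p q = cnj (csprod q p)" for p q
    by (simp add: csprod_def mult.commute)
  show cnj: "cinner u v = cnj (cinner v u)"
  proof transfer
    fix f g :: "real \<Rightarrow> complex^2"
    show "(LINT x|lborel. csprod (f x) (g x)) = cnj (LINT x|lborel. csprod (g x) (f x))"
      unfolding Bochner_Integration.integral_cnj[symmetric] cnj_csprod[symmetric] by (rule refl)
  qed
  have csprod_add: "csprod (p + q) r = csprod p r + csprod q r" for p q r
    by (simp add: csprod_def distrib_right sum.distrib)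
  show add: "cinner (u + v) w = cinner u w + cinner v w"
    by transfer (simp add: L2_eq_def csprod_add integrable_csprod)
  show "cinner (c *\<^sub>C u) v = c * cinner u v"
    by (rule cinner_smult_L2)
  show inner_Re: "inner u v = Re (cinner u v)" for u v :: L2
    by (simp add: inner_L2_def)
  show "inner u v = inner v u"
    unfolding inner_Re by (subst cnj) simp
  show "inner (u + v) w = inner u w + inner v w"
    by (simp add: inner_Re add)
  show "inner (a *\<^sub>R u) v = a * inner u v"
    by (simp add: inner_Re scaleR cinner_smult_L2)
  have Re_int: "Re (LINT x|lborel. csprod (f x) (f x)) = (LINT x|lborel. (norm (f x))\<^sup>2)"
    if "sq_integrable f" for f
    using integral_Re[OF integrable_csprod[OF that that]]
    by (simp add: power2_norm_eq_inner inner_eq_Re_csprod)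
  show "0 \<le> inner u u"
    unfolding inner_Re by transfer (simp add: L2_eq_def Re_int)
  show "(inner u u = 0) = (u = 0)"
    unfolding inner_Re
    by transfer (auto simp: L2_eq_def Re_int sq_integrable_zero sq_integrable_def
        integral_nonneg_eq_0_iff_AE)
  show "norm u = sqrt (inner u u)" by (simp add: norm_L2_def)
qed

end


section \<open>Derivative, multiplication operators and test functions\<close>

definition test_functions :: "(real \<Rightarrow> 'b::real_normed_vector) set" where
  "test_functions = {\<phi>.
     (\<forall>n x. ((\<lambda>g x. vector_derivative g (at x)) ^^ n) \<phi> differentiable (at x)) \<and>
     compact (closure {x. \<phi> x \<noteq> 0})}"

definition Cc_infinity :: "L2 set" where
  "Cc_infinity = abs_L2 ` test_functions"

text \<open>Real-valued test functions suffice: for complex-valued ones split into real and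
  imaginary part.\<close>

definition is_weak_derivative :: "L2 \<Rightarrow> L2 \<Rightarrow> bool" where
  "is_weak_derivative u v \<longleftrightarrow>
     (\<forall>\<phi>\<in>test_functions :: (real \<Rightarrow> real) set.
        (LINT x|lborel. deriv \<phi> x *\<^sub>R rep_L2 u x) = - (LINT x|lborel. \<phi> x *\<^sub>R rep_L2 v x))"

definition H1 :: "L2 set" where
  "H1 = {u. \<exists>v. is_weak_derivative u v}"

definition weak_derivative :: "L2 \<Rightarrow> L2" where
  "weak_derivative u = (THE v. is_weak_derivative u v)"

text \<open>\<open>abs_L2 f\<close> is the class of \<open>f\<close> only for square integrable \<open>f\<close>, so \<open>mult_op V u\<close> is
  meaningful only for \<open>u \<in> mult_dom V\<close>. In the same way, \<open>weak_derivative u\<close> is meaningful only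
  for \<open>u \<in> H1\<close>.\<close>

definition mult_dom :: "(real \<Rightarrow> real) \<Rightarrow> L2 set" where
  "mult_dom V = {u. sq_integrable (\<lambda>x. V x *\<^sub>R rep_L2 u x)}"

definition mult_op :: "(real \<Rightarrow> real) \<Rightarrow> L2 \<Rightarrow> L2" where
  "mult_op V u = abs_L2 (\<lambda>x. V x *\<^sub>R rep_L2 u x)"

definition mat_op :: "complex^2^2 \<Rightarrow> L2 \<Rightarrow> L2" where
  "mat_op A u = abs_L2 (\<lambda>x. A *v rep_L2 u x)"


section \<open>The Dirac operator\<close>

definition \<sigma>1 :: "complex^2^2" where
  "\<sigma>1 = vector [vector [0, 1], vector [1, 0]]"

definition \<sigma>3 :: "complex^2^2" where
  "\<sigma>3 = vector [vector [1, 0], vector [0, -1]]"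

definition dirac :: "real \<Rightarrow> (real \<Rightarrow> real) \<Rightarrow> L2 operator" where
  "dirac m V = op_on (H1 \<inter> mult_dom V)
     (\<lambda>u. (-\<i>) *\<^sub>C mat_op \<sigma>1 (weak_derivative u) + complex_of_real m *\<^sub>C mat_op \<sigma>3 u
           + \<i> *\<^sub>C mult_op V u)"

definition japanese_bracket :: "real \<Rightarrow> real" where
  "japanese_bracket x = sqrt (1 + x\<^sup>2)"

definition potential_growth :: "(real \<Rightarrow> real) \<Rightarrow> real \<Rightarrow> real \<Rightarrow> bool" where
  "potential_growth V \<gamma> x\<^sub>0 \<longleftrightarrow>
     (\<exists>C>0. \<forall>x. \<bar>x\<bar> \<ge> x\<^sub>0 \<longrightarrow> \<bar>V x\<bar> \<ge> C * japanese_bracket x powr \<gamma>)"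

end

theory Submission
  imports "Jordan_Normal_Form.Determinant" "HOL-Complex_Analysis.Complex_Analysis" Defs
begin

no_notation vec_index (infixl "$" 100)
no_notation fps_nth (infixl "$" 75)

text \<open>Write \<open>H\<close> for the Dirac operator and \<open>p = (\<gamma> + 1) / \<gamma>\<close>. Integrating \<open>|H u|\<^sup>2\<close> against a cutoff function and by
  parts leaves \<open>V' |u|\<^sup>2\<close> as the only critical cross term, which the hypothesis on \<open>V'\<close> absorbs. The estimate
  needs only local absolute continuity of \<open>u\<close>; hence it also applies to elements of the adjoint of the
  restriction of \<open>H\<close> to test functions, which gives (i) and (ii). For (iii), pair \<open>(H - z) u\<close> with \<open>\<sigma>3 u\<close>.

  For (iv), cut \<open>[-L, L]\<close> with \<open>L\<close> of order \<open>R powr (1 / \<gamma>)\<close> into about \<open>L R\<close> cells of length \<open>1 / R\<close>. If \<open>u\<close> has mean value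
  zero on each cell, then Poincare's inequality on the cells and \<open>|V| \<ge> R\<close> outside of \<open>[-L, L]\<close> bound \<open>norm u\<close> by a
  multiple of the graph norm divided by \<open>R\<close>; so about \<open>R powr p\<close> singular values of the inverse exceed \<open>C / R\<close>.

  For (v), let \<open>r = norm \<lambda>\<close> and split \<open>K = H\<^sup>-\<^sup>1\<close> into a part of rank \<open>n\<close>, of order \<open>r powr p\<close>, and a part \<open>G\<close> with
  \<open>10 r norm G \<le> 1\<close>. The inverse of \<open>1 - z K\<close> is then given by Cramer's rule for an \<open>n\<close> by \<open>n\<close> matrix whose
  determinant is holomorphic in \<open>z\<close> and vanishes only at points of the spectrum. Hadamard's inequality bounds
  the determinants for \<open>norm z \<le> 4 r\<close> by \<open>exp (8 r S)\<close>, where the sum \<open>S\<close> of the first \<open>n\<close> singular values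
  satisfies \<open>r S \<le> C r powr p\<close>, and a minimum modulus estimate
  yields a lower bound of the same order at distance \<open>\<delta> r\<close> from the zeros.\<close>

section \<open>Hilbert space geometry\<close>

text \<open>Squared cutoffs \<open>1 - (x / N)\<^sup>2\<close> remove the boundary terms, and
  integrability results from the estimate by Fatou's lemma.

  The adjoint is the Dirac operator with potential \<open>- V\<close>, and the hypotheses are even
  in \<open>V\<close>. So every result holds for both operators, and the adjoint of \<open>K\<close>
  is explicit.

  \<open>H\<close> is in general not normal, so the distance to the spectrum alone does not bound
  the resolvent. As \<open>p > 1\<close>, the bound \<open>k powr (- (1 / p))\<close> on the
  singular values is not summable and a determinant of \<open>1 - z K\<close> need not exist. Hence
  the rank \<open>n\<close> is tied to \<open>r\<close>: the first \<open>n\<close> singular values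
  add up to order \<open>n powr (1 - 1 / p)\<close>, that is \<open>r powr (p - 1)\<close>. The
  finite determinant equals 1 at \<open>z = 0\<close>; this normalisation turns its upper bound into
  a lower bound away from its zeros.\<close>

lemma cinner_scaleC_right: "cinner x (c *\<^sub>C y) = cnj c * cinner x y"
  by (metis cinner_commute cinner_scaleC_left complex_cnj_mult)

lemma cinner_add_right: "cinner x (y + z) = cinner x y + cinner x z"
  by (metis cinner_commute cinner_add_left complex_cnj_add)

lemma cinner_eq_0I:
  assumes "inner x y = 0" "inner (\<i> *\<^sub>C x) y = 0"
  shows "cinner x y = 0"
  using assms by (simp add: inner_eq_Re_cinner cinner_scaleC_left complex_eq_iff)

lemma cinner_self: "cinner x x = complex_of_real ((norm x)\<^sup>2)"
proof -
  have "Im (cinner x x) = 0"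
    using cinner_commute[of x x] by (metis cnj.simps(2) complex_eq_iff equal_neg_zero)
  moreover have "Re (cinner x x) = (norm x)\<^sup>2"
    by (simp add: inner_eq_Re_cinner[symmetric] power2_norm_eq_inner)
  ultimately show ?thesis by (simp add: complex_eq_iff)
qed

lemma norm_scaleC: "norm (c *\<^sub>C x) = norm c * norm (x::'a::complex_inner)"
proof -
  have "complex_of_real ((norm (c *\<^sub>C x))\<^sup>2) = c * cnj c * complex_of_real ((norm x)\<^sup>2)"
    by (simp only: cinner_self[symmetric] cinner_scaleC_left cinner_scaleC_right ac_simps)
  also have "\<dots> = complex_of_real ((norm c * norm x)\<^sup>2)"
    by (simp add: complex_norm_square[symmetric] power_mult_distrib)
  finally have "(norm (c *\<^sub>C x))\<^sup>2 = (norm c * norm x)\<^sup>2"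
    using of_real_eq_iff by blast
  then show ?thesis
    by (simp add: power2_eq_iff_nonneg)
qed

text \<open>Multiplying \<open>x\<close> by the conjugate phase of the inner product makes it real
  and nonnegative, so that the real Cauchy-Schwarz inequality applies.\<close>

lemma norm_cinner_le: "norm (cinner x y) \<le> norm x * norm y"
proof -
  let ?c = "cinner x y"
  have "cnj (sgn ?c) * ?c = complex_of_real (norm ?c)"
    using complex_norm_square[of ?c]
    by (cases "?c = 0") (simp_all add: sgn_eq mult.commute power2_eq_square divide_eq_eq)
  then have "norm ?c = Re (cinner (cnj (sgn ?c) *\<^sub>C x) y)"
    by (simp add: cinner_scaleC_left)
  also have "\<dots> \<le> norm (cnj (sgn ?c) *\<^sub>C x) * norm y"
    by (simp add: inner_eq_Re_cinner[symmetric] norm_cauchy_schwarz)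
  also have "\<dots> \<le> norm x * norm y"
    by (intro mult_right_mono) (auto simp: norm_scaleC norm_sgn)
  finally show ?thesis .
qed

interpretation cinner: bounded_bilinear "cinner :: 'a::complex_inner \<Rightarrow> 'a \<Rightarrow> complex"
proof
  show "\<exists>K. \<forall>a b::'a. norm (cinner a b) \<le> norm a * norm b * K"
    by (rule exI[of _ 1]) (simp add: norm_cinner_le)
qed (simp_all add: cinner_add_left cinner_add_right scaleR_scaleC cinner_scaleC_left
      cinner_scaleC_right scaleR_conv_of_real)

interpretation scaleC: bounded_bilinear "scaleC :: complex \<Rightarrow> 'a::complex_inner \<Rightarrow> 'a"
proof
  show "\<exists>K. \<forall>a (b::'a). norm (a *\<^sub>C b) \<le> norm a * norm b * K"
    by (rule exI[of _ 1]) (simp add: norm_scaleC)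
qed (simp_all add: scaleC_add_left scaleC_add_right scaleR_scaleC scaleC_scaleC
      scaleR_conv_of_real mult.commute)

lemma norm_sum_orthogonal:
  fixes x :: "'i \<Rightarrow> 'a::real_inner"
  assumes "finite S" "\<And>i j. i \<in> S \<Longrightarrow> j \<in> S \<Longrightarrow> i \<noteq> j \<Longrightarrow> inner (x i) (x j) = 0"
  shows "(norm (\<Sum>i\<in>S. x i))\<^sup>2 = (\<Sum>i\<in>S. (norm (x i))\<^sup>2)"
  using assms
proof (induction S rule: finite_induct)
  case (insert a S)
  have "inner (x a) (\<Sum>i\<in>S. x i) = 0"
    unfolding inner_sum_right by (intro sum.neutral) (use insert in auto)
  then have "(norm (x a + (\<Sum>i\<in>S. x i)))\<^sup>2 = (norm (x a))\<^sup>2 + (norm (\<Sum>i\<in>S. x i))\<^sup>2"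
    by (simp add: power2_norm_eq_inner inner_add_left inner_add_right inner_commute)
  with insert show ?case by simp
qed simp

lemma inner_0_if_cinner_0: "cinner x y = 0 \<Longrightarrow> inner x y = 0"
  by (simp add: inner_eq_Re_cinner)

text \<open>A minimising sequence for the distance is Cauchy by the parallelogram law. Real
  orthogonality is enough: for a subspace stable under multiplication by \<open>\<i>\<close> it
  implies complex orthogonality, by \<open>cinner_eq_0I\<close>.\<close>

lemma orth_projection:
  fixes S :: "'a::{real_inner, complete_space} set"
  assumes S: "subspace S" "closed S"
  shows "\<exists>p\<in>S. \<forall>s\<in>S. inner (x - p) s = 0"
proof -
  let ?q = "\<lambda>s. (norm (x - s))\<^sup>2"
  define d where "d = Inf (?q ` S)"
  have bdd: "bdd_below (?q ` S)"
    by (rule bdd_belowI[of _ 0]) auto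
  have ne: "?q ` S \<noteq> {}" using subspace_0[OF S(1)] by auto
  have d_le: "d \<le> ?q s" if "s \<in> S" for s
    unfolding d_def using that bdd by (intro cInf_lower) auto
  have "\<exists>s\<in>S. ?q s < d + inverse (Suc n)" for n :: nat
    using cInf_lessD[OF ne, of "d + inverse (Suc n)"] by (auto simp: d_def)
  then obtain s where s: "\<And>n::nat. s n \<in> S" "\<And>n::nat. ?q (s n) < d + inverse (Suc n)"
    by metis
  have par: "(norm (s m - s n))\<^sup>2 \<le> 2 * inverse (Suc m) + 2 * inverse (Suc n)" for m n
  proof -
    \<comment> \<open>The midpoint lies in \<open>S\<close>, hence its squared distance is at least
      \<open>d\<close>; this is what forces \<open>s m\<close> and \<open>s n\<close>
      together.\<close>
    let ?c = "(1/2) *\<^sub>R (s m + s n)"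
    have "?c \<in> S" using s S(1) by (intro subspace_scale subspace_add)
    from d_le[OF this] have "d \<le> ?q ?c" .
    moreover have "(norm (s m - s n))\<^sup>2 = 2 * ?q (s m) + 2 * ?q (s n) - 4 * ?q ?c"
      by (simp add: power2_norm_eq_inner inner_diff_left inner_diff_right inner_add_left
          inner_add_right inner_commute algebra_simps)
    ultimately show ?thesis using s(2)[of m] s(2)[of n] by linarith
  qed
  have "Cauchy s"
  proof (rule metric_CauchyI)
    fix e :: real assume e: "e > 0"
    then obtain N :: nat where N: "inverse (Suc N) < e\<^sup>2 / 4"
      using reals_Archimedean[of "e\<^sup>2/4"] by auto
    show "\<exists>M. \<forall>m\<ge>M. \<forall>n\<ge>M. dist (s m) (s n) < e"
    proof (intro exI[of _ N] allI impI)
      fix m n assume "N \<le> m" "N \<le> n"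
      then have "inverse (Suc m) \<le> inverse (Suc N)" "inverse (Suc n) \<le> inverse (Suc N)"
        by (simp_all add: field_simps)
      with par[of m n] N have "(norm (s m - s n))\<^sup>2 < e\<^sup>2" by linarith
      with e show "dist (s m) (s n) < e"
        by (simp add: dist_norm power2_less_imp_less)
    qed
  qed
  then obtain p where p: "s \<longlonglongrightarrow> p" using Cauchy_convergent convergent_def by blast
  have pS: "p \<in> S" using closed_sequentially[OF S(2)] s(1) p by blast
  have "(\<lambda>n. d + inverse (Suc n)) \<longlonglongrightarrow> d + 0"
    by (intro tendsto_intros LIMSEQ_inverse_real_of_nat)
  moreover have "(\<lambda>n. ?q (s n)) \<longlonglongrightarrow> ?q p" by (intro tendsto_intros p)
  ultimately have qp: "?q p \<le> d"
    using LIMSEQ_le[of "\<lambda>n. ?q (s n)" "?q p" "\<lambda>n. d + inverse (Suc n)" d] s(2)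
    by (simp add: less_imp_le)
  have "inner (x - p) t = 0" if t: "t \<in> S" for t
  proof (cases "t = 0")
    case False
    \<comment> \<open>The minimiser of the quadratic polynomial
      \<open>?q (p + c *\<^sub>R t)\<close> in \<open>c\<close>; a nonzero inner product would push
      its value below \<open>d\<close>.\<close>
    define c where "c = inner (x - p) t / inner t t"
    have tt: "inner t t > 0" using False by simp
    have "p + c *\<^sub>R t \<in> S" using pS t S(1) by (intro subspace_scale subspace_add)
    from d_le[OF this] qp have "?q p \<le> ?q (p + c *\<^sub>R t)" by linarith
    also have "\<dots> = ?q p - 2 * c * inner (x - p) t + c\<^sup>2 * inner t t"
      unfolding power2_norm_eq_inner
      by (simp add: inner_diff_left inner_diff_right inner_add_left
          inner_add_right inner_commute algebra_simps power2_eq_square)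
    also have "\<dots> = ?q p - (inner (x - p) t)\<^sup>2 / inner t t"
      using tt by (simp add: c_def power2_eq_square)
    finally have "(inner (x - p) t)\<^sup>2 / inner t t \<le> 0" by simp
    then show ?thesis using tt by (simp add: divide_le_0_iff)
  qed simp
  with pS show ?thesis by blast
qed

section \<open>Adjoints and closed operators\<close>

text \<open>\<open>subspace\<close> refers to real scalars, as does the projection theorem above;
  the second clause adds complex linearity.\<close>

definition graph_subspace :: "'a::complex_inner operator \<Rightarrow> bool" where
  "graph_subspace T \<longleftrightarrow> subspace T \<and> (\<forall>c u f. (u, f) \<in> T \<longrightarrow> (c *\<^sub>C u, c *\<^sub>C f) \<in> T)"

lemma graph_subspaceI:
  assumes "(0, 0) \<in> T" "\<And>u f v g. (u, f) \<in> T \<Longrightarrow> (v, g) \<in> T \<Longrightarrow> (u + v, f + g) \<in> T"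
    "\<And>c u f. (u, f) \<in> T \<Longrightarrow> (c *\<^sub>C u, c *\<^sub>C f) \<in> T"
  shows "graph_subspace T"
  unfolding graph_subspace_def subspace_def using assms
  by (auto simp: zero_prod_def scaleR_scaleC)

lemma graph_subspace_adjoint: "graph_subspace (op_adjoint T)"
  by (rule graph_subspaceI)
     (auto simp: op_adjoint_def cinner.zero_right cinner_add_right cinner_scaleC_right
       split_beta Ball_def)

lemma closed_adjoint: "closed (op_adjoint T)"
proof -
  have "op_adjoint T = (\<Inter>p\<in>T. {q. cinner (snd p) (fst q) = cinner (fst p) (snd q)})"
    by (force simp: op_adjoint_def)
  moreover have "closed {q. cinner (snd p) (fst q) = cinner (fst p) (snd q)}" for p :: "'a \<times> 'a"
    by (intro closed_Collect_eq cinner.continuous_on continuous_intros)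
  ultimately show ?thesis by auto
qed

lemma adjoint_antimono: "S \<subseteq> T \<Longrightarrow> op_adjoint T \<subseteq> op_adjoint S"
  by (auto simp: op_adjoint_def)

lemma subset_adjoint_adjoint: "T \<subseteq> op_adjoint (op_adjoint T)"
proof (clarsimp simp: op_adjoint_def)
  fix u f v w assume "(u, f) \<in> T" "\<forall>x\<in>T. case x of (u, f) \<Rightarrow> cinner f v = cinner u w"
  then have "cinner f v = cinner u w" by blast
  then show "cinner w u = cinner v f" by (metis cinner_commute)
qed

lemma subspace_closure:
  fixes S :: "'a::real_normed_vector set"
  assumes S: "subspace S"
  shows "subspace (closure S)"
proof (rule subspaceI)
  show "0 \<in> closure S" using subspace_0[OF S] closure_subset by blast
  show "x + y \<in> closure S" if xy: "x \<in> closure S" "y \<in> closure S" for x y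
  proof -
    obtain a b where a: "\<And>n::nat. a n \<in> S" "a \<longlonglongrightarrow> x" and b: "\<And>n::nat. b n \<in> S" "b \<longlonglongrightarrow> y"
      using xy unfolding closure_sequential by metis
    show ?thesis unfolding closure_sequential
      by (rule exI[of _ "\<lambda>n. a n + b n"]) (use a b S in \<open>auto intro: subspace_add tendsto_add\<close>)
  qed
  show "c *\<^sub>R x \<in> closure S" if x: "x \<in> closure S" for c x
  proof -
    obtain a where a: "\<And>n::nat. a n \<in> S" "a \<longlonglongrightarrow> x"
      using x unfolding closure_sequential by metis
    show ?thesis unfolding closure_sequential
      by (rule exI[of _ "\<lambda>n. c *\<^sub>R a n"])
        (use a S in \<open>auto intro: subspace_scale tendsto_scaleR\<close>)
  qed
qed

text \<open>Let \<open>q - p = (a, b)\<close> be the component of an element of the double adjoint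
  that is orthogonal to \<open>T\<close>. Orthogonality to \<open>T\<close> says that the rotated
  pair \<open>(b, - a)\<close> lies in the adjoint; pairing it with \<open>(a, b)\<close> gives
  \<open>(norm a)\<^sup>2 + (norm b)\<^sup>2 = 0\<close>.\<close>

lemma closure_eq_adjoint_adjoint:
  fixes T :: "('a::{complex_inner, complete_space}) operator"
  assumes "graph_subspace T"
  shows "closure T = op_adjoint (op_adjoint T)"
proof
  show "closure T \<subseteq> op_adjoint (op_adjoint T)"
    by (intro closure_minimal subset_adjoint_adjoint closed_adjoint)
  show "op_adjoint (op_adjoint T) \<subseteq> closure T"
  proof
    fix q assume q: "q \<in> op_adjoint (op_adjoint T)"
    have sub: "subspace T" "\<And>c u f. (u, f) \<in> T \<Longrightarrow> (c *\<^sub>C u, c *\<^sub>C f) \<in> T"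
      using assms by (auto simp: graph_subspace_def)
    obtain p where p: "p \<in> closure T" "\<And>s. s \<in> closure T \<Longrightarrow> inner (q - p) s = 0"
      using orth_projection[OF subspace_closure[OF sub(1)] closed_closure] by metis
    have "subspace (op_adjoint (op_adjoint T))"
      using graph_subspace_adjoint by (auto simp: graph_subspace_def)
    moreover have "p \<in> op_adjoint (op_adjoint T)"
      using p(1) closure_minimal[OF subset_adjoint_adjoint closed_adjoint] by blast
    ultimately have r: "q - p \<in> op_adjoint (op_adjoint T)"
      using q by (intro subspace_diff)
    obtain a b where ab: "q - p = (a, b)" by fastforce
    have "(b, - a) \<in> op_adjoint T"
      unfolding op_adjoint_def
    proof clarsimp
      fix x y assume xy: "(x, y) \<in> T"
      have *: "inner (a, b) s = 0" if "s \<in> T" for s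
        using p(2)[of s] that closure_subset ab by auto
      have "inner x a + inner y b = 0" "inner (\<i> *\<^sub>C x) a + inner (\<i> *\<^sub>C y) b = 0"
        using *[OF xy] *[OF sub(2)[OF xy, of \<i>]] by (simp_all add: inner_commute)
      then have "cinner x a + cinner y b = 0"
        unfolding inner_eq_Re_cinner cinner_scaleC_left by (simp add: complex_eq_iff)
      then show "cinner y b = cinner x (- a)"
        unfolding cinner.minus_right eq_neg_iff_add_eq_0 by (simp only: add.commute)
    qed
    with r ab have "cinner (- a) a = cinner b b"
      by (auto simp: op_adjoint_def)
    then have "complex_of_real ((norm a)\<^sup>2 + (norm b)\<^sup>2) = 0"
      unfolding cinner.minus_left cinner_self of_real_add by (metis add.commute add.right_inverse)
    then have "(norm a)\<^sup>2 + (norm b)\<^sup>2 = 0" by (simp only: of_real_eq_0_iff)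
    then have "q - p = 0" using ab by (simp add: sum_power2_eq_zero_iff zero_prod_def)
    then have "q = p" by simp
    with p(1) show "q \<in> closure T" by simp
  qed
qed

text \<open>The lower bound gives injectivity and, as the graph is closed, a closed range. The
  orthogonal complement of the range is the kernel of the adjoint, so surjectivity follows from
  \<open>adj\<close>.\<close>

lemma bijective_if_bounded_below:
  fixes T :: "('a::{complex_inner, complete_space}) operator"
  assumes T: "graph_subspace T" "closed T" and c: "c > 0"
    and below: "\<And>u f. (u, f) \<in> T \<Longrightarrow> c * norm u \<le> norm f"
    and adj: "\<And>v. (v, 0) \<in> op_adjoint T \<Longrightarrow> v = 0"
  shows "\<exists>!u. (u, f) \<in> T"
proof (rule ex_ex1I)
  have sub: "subspace T" "\<And>c u f. (u, f) \<in> T \<Longrightarrow> (c *\<^sub>C u, c *\<^sub>C f) \<in> T"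
    using T by (auto simp: graph_subspace_def)
  fix u v assume "(u, f) \<in> T" "(v, f) \<in> T"
  then have "(u - v, 0) \<in> T" using subspace_diff[OF sub(1)] by force
  from below[OF this] c show "u = v" by (simp add: mult_le_0_iff)
next
  have sub: "subspace T" "\<And>c u f. (u, f) \<in> T \<Longrightarrow> (c *\<^sub>C u, c *\<^sub>C f) \<in> T"
    using T by (auto simp: graph_subspace_def)
  define R where "R = snd ` T"
  have subR: "subspace R" unfolding R_def
    by (intro linear_subspace_image sub) (simp add: linear_snd)
  have clR: "closed R"
    unfolding closed_sequential_limits
  proof (intro allI impI, elim conjE)
    fix g l assume g: "\<forall>n. g n \<in> R" and l: "g \<longlonglongrightarrow> l"
    then have "\<forall>n. \<exists>u. (u, g n) \<in> T" by (fastforce simp: R_def)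
    then obtain u where u: "\<And>n. (u n, g n) \<in> T" by metis
    have "Cauchy u"
    proof (rule metric_CauchyI)
      fix e :: real assume e: "e > 0"
      have "Cauchy g" using l by (rule LIMSEQ_imp_Cauchy)
      then obtain M where M: "\<And>m n. m \<ge> M \<Longrightarrow> n \<ge> M \<Longrightarrow> dist (g m) (g n) < c * e"
        using metric_CauchyD[of g "c * e"] c e by auto
      have "dist (u m) (u n) < e" if "m \<ge> M" "n \<ge> M" for m n
      proof -
        have "(u m - u n, g m - g n) \<in> T" using subspace_diff[OF sub(1) u u] by simp
        from below[OF this] M[OF that] have "c * dist (u m) (u n) < c * e"
          by (simp add: dist_norm)
        with c show ?thesis by simp
      qed
      then show "\<exists>M. \<forall>m\<ge>M. \<forall>n\<ge>M. dist (u m) (u n) < e" by blast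
    qed
    then obtain v where "u \<longlonglongrightarrow> v" using Cauchy_convergent convergent_def by blast
    then have "(\<lambda>n. (u n, g n)) \<longlonglongrightarrow> (v, l)" using l by (intro tendsto_Pair)
    from closed_sequentially[OF T(2) _ this] u have "(v, l) \<in> T" by simp
    then show "l \<in> R" by (force simp: R_def)
  qed
  obtain p where p: "p \<in> R" "\<And>s. s \<in> R \<Longrightarrow> inner (f - p) s = 0"
    using orth_projection[OF subR clR] by metis
  have "(f - p, 0) \<in> op_adjoint T"
    unfolding op_adjoint_def
  proof (clarsimp simp: cinner.zero_right)
    fix u g assume "(u, g) \<in> T"
    then have "g \<in> R" "\<i> *\<^sub>C g \<in> R" using sub(2) by (force simp: R_def)+
    from this[THEN p(2)] show "cinner g (f - p) = 0"
      by (intro cinner_eq_0I) (simp_all add: inner_commute)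
  qed
  then have "f = p" using adj by fastforce
  then show "\<exists>u. (u, f) \<in> T" using p(1) by (auto simp: R_def)
qed

section \<open>Singular value decomposition of compact operators\<close>

lemma compact_operator_subseq:
  fixes K :: "'a::real_normed_vector \<Rightarrow> 'b::real_normed_vector"
  assumes "compact (closure (K ` cball 0 1))" "\<And>n. norm (f n) \<le> 1"
  shows "\<exists>y r. strict_mono (r :: nat \<Rightarrow> nat) \<and> (\<lambda>n. K (f (r n))) \<longlonglongrightarrow> y"
proof -
  have "K (f n) \<in> closure (K ` cball 0 1)" for n
    using assms(2)[of n] closure_subset by (fastforce simp: dist_norm)
  then have mem: "\<forall>n. K (f n) \<in> closure (K ` cball 0 1)" by blast
  have "seq_compact (closure (K ` cball 0 1))" using assms(1) by (simp only: compact_eq_seq_compact_metric)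
  from seq_compactE[OF this mem]
  obtain y r where "strict_mono (r :: nat \<Rightarrow> nat)" "((\<lambda>n. K (f n)) \<circ> r) \<longlonglongrightarrow> y"
    by metis
  then show ?thesis unfolding comp_def by metis
qed

text \<open>The adjoint is a parameter, because for the Dirac operator it is known explicitly: the
  inverse of the operator with potential \<open>- V\<close>. Its complex linearity follows from
  \<open>adjoint\<close>, see \<open>scale'\<close>.\<close>

locale compact_adjoint_pair =
  fixes K K' :: "'a::{complex_inner, banach} \<Rightarrow> 'a"
  assumes bounded: "bounded_linear K" "bounded_linear K'"
    and scale: "K (c *\<^sub>C x) = c *\<^sub>C K x"
    and adjoint: "cinner (K x) y = cinner x (K' y)"
    and compact: "compact (closure (K ` cball 0 1))"
begin

sublocale K: bounded_linear K by (rule bounded)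
sublocale K': bounded_linear K' by (rule bounded)

lemma adjoint': "cinner (K' y) x = cinner y (K x)"
  by (metis adjoint cinner_commute)

lemma norm_K_eq: "complex_of_real ((norm (K x))\<^sup>2) = cinner x (K' (K x))"
  by (simp only: cinner_self[symmetric] adjoint)

lemma inner_K'K: "inner (K' (K x)) y = inner (K x) (K y)"
  by (simp add: inner_eq_Re_cinner adjoint')

definition perp :: "'a set \<Rightarrow> 'a set" where
  "perp E = {f. \<forall>e\<in>E. cinner f e = 0}"

lemma subspace_perp: "subspace (perp E)"
  unfolding subspace_def perp_def
  by (auto simp: cinner.zero_left cinner_add_left cinner.scaleR_left)

lemma closed_perp: "closed (perp E)"
proof -
  have "perp E = (\<Inter>e\<in>E. {f. cinner f e = 0})" by (auto simp: perp_def)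
  moreover have "closed {f. cinner f e = 0}" for e :: 'a
    by (intro closed_Collect_eq cinner.continuous_on continuous_intros)
  ultimately show ?thesis by auto
qed

text \<open>\<open>perp E\<close> is invariant under \<open>K' K\<close>, because \<open>E\<close>
  consists of eigenvectors of this self-adjoint operator. Compactness makes the supremum
  \<open>b\<close> of \<open>norm (K f)\<close> over unit vectors a maximum, and a maximiser is an
  eigenvector for \<open>b\<^sup>2\<close>.\<close>

lemma maximal_vector:
  assumes E: "\<And>e. e \<in> E \<Longrightarrow> \<exists>c. K' (K e) = c *\<^sub>C e" and ne: "f0 \<in> perp E" "K f0 \<noteq> 0"
  shows "\<exists>e\<in>perp E. norm e = 1 \<and> K' (K e) = complex_of_real ((norm (K e))\<^sup>2) *\<^sub>C e
           \<and> (\<forall>f\<in>perp E. norm (K f) \<le> norm (K e) * norm f)"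
proof -
  define N where "N = {norm (K f) | f. f \<in> perp E \<and> norm f = 1}"
  define b where "b = Sup N"
  obtain B where B: "\<And>x. norm (K x) \<le> norm x * B"
    using K.bounded by blast
  have bdd: "bdd_above N"
  proof (rule bdd_aboveI[of _ B])
    fix x assume "x \<in> N"
    then obtain f where "x = norm (K f)" "norm f = 1" by (auto simp: N_def)
    with B[of f] show "x \<le> B" by simp
  qed
  have f0: "f0 \<noteq> 0" using ne(2) K.zero by auto
  let ?g = "inverse (norm f0) *\<^sub>R f0"
  have g: "?g \<in> perp E" "norm ?g = 1"
    using ne(1) subspace_perp[of E] f0 by (auto intro: subspace_scale)
  then have gN: "norm (K ?g) \<in> N" by (force simp: N_def)
  have "0 < norm (K ?g)" using f0 ne(2) by (simp add: K.scaleR)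
  also have "\<dots> \<le> b" unfolding b_def by (rule cSup_upper[OF gN bdd])
  finally have bpos: "b > 0" .
  have le: "norm (K f) \<le> b * norm f" if f: "f \<in> perp E" for f
  proof (cases "f = 0")
    case False
    then have "norm (K (inverse (norm f) *\<^sub>R f)) \<in> N"
      using f subspace_perp[of E] unfolding N_def by (force intro: subspace_scale)
    then have "norm (K (inverse (norm f) *\<^sub>R f)) \<le> b"
      unfolding b_def by (rule cSup_upper[OF _ bdd])
    then show ?thesis using False by (simp add: K.scaleR field_simps)
  qed (simp add: K.zero)
  define A where "A = (\<lambda>f. K' (K f))"
  have A_perp: "A f \<in> perp E" if f: "f \<in> perp E" for f
    unfolding perp_def
  proof clarify
    fix e assume e: "e \<in> E"
    obtain c where "K' (K e) = c *\<^sub>C e" using E[OF e] by blast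
    then have "cinner (A f) e = cnj c * cinner f e"
      by (simp add: A_def adjoint' adjoint cinner_scaleC_right)
    then show "cinner (A f) e = 0" using f e by (simp add: perp_def)
  qed
  have A_le: "norm (A f) \<le> b\<^sup>2 * norm f" if f: "f \<in> perp E" for f
  proof -
    have "(norm (A f))\<^sup>2 = inner (K f) (K (A f))"
      unfolding power2_norm_eq_inner A_def inner_K'K ..
    also have "\<dots> \<le> norm (K f) * norm (K (A f))" by (rule norm_cauchy_schwarz)
    also have "\<dots> \<le> (b * norm f) * (b * norm (A f))"
      using le[OF f] le[OF A_perp[OF f]] bpos by (intro mult_mono) auto
    finally have "norm (A f) * norm (A f) \<le> (b\<^sup>2 * norm f) * norm (A f)"
      by (simp add: power2_eq_square ac_simps)
    then show ?thesis
      using bpos by (cases "A f = 0") (auto simp: mult_le_cancel_right)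
  qed
  have "\<exists>f. f \<in> perp E \<and> norm f = 1 \<and> b - inverse (Suc n) < norm (K f)" for n :: nat
  proof -
    have "b - inverse (Suc n) < Sup N" by (simp add: b_def)
    from less_cSupD[OF _ this] gN show ?thesis by (auto simp: N_def)
  qed
  then obtain f where f: "\<And>n::nat. f n \<in> perp E" "\<And>n. norm (f n) = 1"
    "\<And>n. b - inverse (Suc n) < norm (K (f n))" by metis
  have fb: "norm (K (f n)) \<le> b" for n using le[OF f(1)[of n]] f(2) by simp
  have lim_b: "(\<lambda>n. norm (K (f n))) \<longlonglongrightarrow> b"
  proof (rule tendsto_sandwich[of "\<lambda>n. b - inverse (Suc n)" _ _ "\<lambda>n. b"])
    have "(\<lambda>n. b - inverse (Suc n)) \<longlonglongrightarrow> b - 0"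
      by (intro tendsto_intros LIMSEQ_inverse_real_of_nat)
    then show "(\<lambda>n. b - inverse (Suc n)) \<longlonglongrightarrow> b" by simp
  qed (use f fb in \<open>auto intro!: always_eventually less_imp_le\<close>)
  obtain y r where r: "strict_mono (r :: nat \<Rightarrow> nat)" and y: "(\<lambda>n. K (f (r n))) \<longlonglongrightarrow> y"
    using compact_operator_subseq[OF compact, of f] f(2) by auto
  \<comment> \<open>The right-hand side tends to 0 along the maximising sequence, so
    \<open>b\<^sup>2 *\<^sub>R f n\<close> is close to \<open>K' (K (f n))\<close>. The latter
    converges along a subsequence, and \<open>b > 0\<close>, so \<open>f\<close> itself converges
    there.\<close>
  have sq: "(norm (A (f n) - b\<^sup>2 *\<^sub>R f n))\<^sup>2 \<le> 2 * b ^ 4 - 2 * b\<^sup>2 * (norm (K (f n)))\<^sup>2" for n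
  proof -
    have "(norm (A (f n) - b\<^sup>2 *\<^sub>R f n))\<^sup>2
        = (norm (A (f n)))\<^sup>2 - 2 * b\<^sup>2 * inner (A (f n)) (f n) + b ^ 4 * (norm (f n))\<^sup>2"
      unfolding power2_norm_eq_inner inner_diff_left inner_diff_right inner_scaleR_left
        inner_scaleR_right inner_commute[of "f n" "A (f n)"]
      by (simp add: power4_eq_xxxx power2_eq_square algebra_simps)
    moreover have "inner (A (f n)) (f n) = (norm (K (f n)))\<^sup>2"
      unfolding A_def inner_K'K power2_norm_eq_inner ..
    moreover have "(norm (A (f n)))\<^sup>2 \<le> (b\<^sup>2)\<^sup>2"
      using A_le[OF f(1)[of n]] f(2)[of n] by (intro power_mono) simp_all
    moreover have "(b\<^sup>2)\<^sup>2 = b ^ 4" by (simp add: power4_eq_xxxx power2_eq_square)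
    ultimately show ?thesis by (simp only: f(2) power_one mult_1_right)
  qed
  have "(\<lambda>n. 2 * b ^ 4 - 2 * b\<^sup>2 * (norm (K (f n)))\<^sup>2) \<longlonglongrightarrow> 2 * b ^ 4 - 2 * b\<^sup>2 * b\<^sup>2"
    by (intro tendsto_intros lim_b)
  then have "(\<lambda>n. 2 * b ^ 4 - 2 * b\<^sup>2 * (norm (K (f n)))\<^sup>2) \<longlonglongrightarrow> 0"
    by (simp add: power2_eq_square power4_eq_xxxx)
  then have "(\<lambda>n. (norm (A (f n) - b\<^sup>2 *\<^sub>R f n))\<^sup>2) \<longlonglongrightarrow> 0"
    by (rule Lim_null_comparison[rotated]) (use sq in \<open>simp add: always_eventually\<close>)
  then have "(\<lambda>n. sqrt ((norm (A (f n) - b\<^sup>2 *\<^sub>R f n))\<^sup>2)) \<longlonglongrightarrow> sqrt 0"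
    by (intro tendsto_intros)
  then have "(\<lambda>n. A (f n) - b\<^sup>2 *\<^sub>R f n) \<longlonglongrightarrow> 0"
    by (simp add: tendsto_norm_zero_iff)
  then have d: "(\<lambda>n. A (f (r n)) - b\<^sup>2 *\<^sub>R f (r n)) \<longlonglongrightarrow> 0"
    using LIMSEQ_subseq_LIMSEQ[OF _ r] by (auto simp: comp_def)
  have Ay: "(\<lambda>n. A (f (r n))) \<longlonglongrightarrow> K' y"
    unfolding A_def by (rule K'.tendsto[OF y])
  from tendsto_diff[OF this d] have "(\<lambda>n. b\<^sup>2 *\<^sub>R f (r n)) \<longlonglongrightarrow> K' y" by simp
  then have "(\<lambda>n. inverse (b\<^sup>2) *\<^sub>R b\<^sup>2 *\<^sub>R f (r n)) \<longlonglongrightarrow> inverse (b\<^sup>2) *\<^sub>R K' y"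
    by (intro tendsto_intros)
  then obtain e where e: "(\<lambda>n. f (r n)) \<longlonglongrightarrow> e" "e = inverse (b\<^sup>2) *\<^sub>R K' y"
    using bpos by simp
  have eE: "e \<in> perp E" using closed_sequentially[OF closed_perp _ e(1)] f(1) by simp
  have ne1: "norm e = 1"
    using LIMSEQ_unique[OF tendsto_norm[OF e(1)], of 1] f(2) by simp
  have Ke: "K e = y" using LIMSEQ_unique[OF K.tendsto[OF e(1)] y] .
  have nKe: "norm (K e) = b"
    using LIMSEQ_unique[OF tendsto_norm[OF y] LIMSEQ_subseq_LIMSEQ[OF lim_b r, unfolded comp_def]] Ke
    by simp
  have "K' (K e) = b\<^sup>2 *\<^sub>R e" using e(2) Ke bpos by simp
  then have "K' (K e) = complex_of_real (b\<^sup>2) *\<^sub>C e" by (simp only: scaleR_scaleC)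
  with eE ne1 nKe le show ?thesis by (intro bexI[of _ e]) auto
qed

text \<open>If \<open>K\<close> vanishes on the orthogonal complement, the value 0 keeps the
  sequence total; the corresponding singular value is then 0.\<close>

definition next_vector :: "'a set \<Rightarrow> 'a" where
  "next_vector E = (if \<exists>f\<in>perp E. K f \<noteq> 0 then
     SOME e. e \<in> perp E \<and> norm e = 1 \<and> K' (K e) = complex_of_real ((norm (K e))\<^sup>2) *\<^sub>C e
           \<and> (\<forall>f\<in>perp E. norm (K f) \<le> norm (K e) * norm f) else 0)"

primrec vectors :: "nat \<Rightarrow> 'a list" where
  "vectors 0 = []"
| "vectors (Suc n) = vectors n @ [next_vector (set (vectors n))]"

text \<open>The right singular vectors: orthonormal, but eventually 0 if \<open>K\<close> has finite rank.\<close>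

definition sing_vec :: "nat \<Rightarrow> 'a" where
  "sing_vec n = next_vector (set (vectors n))"

definition sing_val :: "nat \<Rightarrow> real" where
  "sing_val n = norm (K (sing_vec n))"

lemma set_vectors: "set (vectors n) = sing_vec ` {..<n}"
  by (induction n) (auto simp: sing_vec_def lessThan_Suc)

lemma next_vector:
  assumes E: "\<And>e. e \<in> E \<Longrightarrow> \<exists>c. K' (K e) = c *\<^sub>C e"
  shows "next_vector E \<in> perp E" "next_vector E = 0 \<or> norm (next_vector E) = 1"
    "K' (K (next_vector E)) = complex_of_real ((norm (K (next_vector E)))\<^sup>2) *\<^sub>C next_vector E"
    "f \<in> perp E \<Longrightarrow> norm (K f) \<le> norm (K (next_vector E)) * norm f"
proof -
  let ?P = "\<lambda>e. e \<in> perp E \<and> norm e = 1 \<and> K' (K e) = complex_of_real ((norm (K e))\<^sup>2) *\<^sub>C e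
           \<and> (\<forall>f\<in>perp E. norm (K f) \<le> norm (K e) * norm f)"
  let ?Q = "\<lambda>e. e \<in> perp E \<and> (e = 0 \<or> norm e = 1) \<and> K' (K e) = complex_of_real ((norm (K e))\<^sup>2) *\<^sub>C e
           \<and> (\<forall>f\<in>perp E. norm (K f) \<le> norm (K e) * norm f)"
  have "?Q (next_vector E)"
  proof (cases "\<exists>f\<in>perp E. K f \<noteq> 0")
    case True
    then have "\<exists>e. ?P e" using maximal_vector[OF E] by blast
    then have "?P (SOME e. ?P e)" by (rule someI_ex)
    with True show ?thesis unfolding next_vector_def by (simp only: if_True) blast
  next
    case False
    then have "next_vector E = 0" unfolding next_vector_def by (simp only: if_False)
    with False show ?thesis
      by (auto simp: perp_def cinner.zero_left K.zero K'.zero scaleC.zero_right)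
  qed
  then show "next_vector E \<in> perp E" "next_vector E = 0 \<or> norm (next_vector E) = 1"
    "K' (K (next_vector E)) = complex_of_real ((norm (K (next_vector E)))\<^sup>2) *\<^sub>C next_vector E"
    "f \<in> perp E \<Longrightarrow> norm (K f) \<le> norm (K (next_vector E)) * norm f" by blast+
qed

text \<open>Proved first and by strong induction, since the properties of \<open>next_vector\<close>
  are available only once all earlier vectors are known to be eigenvectors.\<close>

lemma eigenvector_sing_vec': "K' (K (sing_vec n)) = complex_of_real ((sing_val n)\<^sup>2) *\<^sub>C sing_vec n"
proof (induction n rule: less_induct)
  case (less n)
  then show ?case unfolding sing_val_def sing_vec_def[of n]
    by (intro next_vector(3)) (auto simp: set_vectors)
qed

lemma
  shows sing_vec_perp: "j < n \<Longrightarrow> cinner (sing_vec n) (sing_vec j) = 0"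
    and sing_vec_norm: "sing_vec n = 0 \<or> norm (sing_vec n) = 1"
    and sing_val_bound: "(\<And>j. j < n \<Longrightarrow> cinner f (sing_vec j) = 0) \<Longrightarrow> norm (K f) \<le> sing_val n * norm f"
proof -
  have E: "\<And>e. e \<in> set (vectors n) \<Longrightarrow> \<exists>c. K' (K e) = c *\<^sub>C e"
    using eigenvector_sing_vec' by (auto simp: set_vectors)
  show "j < n \<Longrightarrow> cinner (sing_vec n) (sing_vec j) = 0"
    using next_vector(1)[OF E] by (simp add: sing_vec_def[of n] set_vectors perp_def)
  show "sing_vec n = 0 \<or> norm (sing_vec n) = 1"
    unfolding sing_vec_def by (rule next_vector(2)[OF E])
  show "(\<And>j. j < n \<Longrightarrow> cinner f (sing_vec j) = 0) \<Longrightarrow> norm (K f) \<le> sing_val n * norm f"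
    using next_vector(4)[OF E] by (simp add: sing_val_def sing_vec_def[of n] set_vectors perp_def)
qed

lemma sing_vec_orth: "j \<noteq> k \<Longrightarrow> cinner (sing_vec j) (sing_vec k) = 0"
  by (metis cinner_commute complex_cnj_zero linorder_neqE_nat sing_vec_perp)

lemma sing_val_nonneg: "0 \<le> sing_val k"
  by (simp add: sing_val_def)

text \<open>The next vector already competed in the maximisation that produced the current
  one.\<close>

lemma decseq_sing_val: "decseq sing_val"
proof (rule decseq_SucI)
  fix n
  have "sing_val (Suc n) \<le> sing_val n * norm (sing_vec (Suc n))"
    unfolding sing_val_def[of "Suc n"] by (rule sing_val_bound) (simp add: sing_vec_perp)
  also have "\<dots> \<le> sing_val n * 1"
    using sing_vec_norm[of "Suc n"] by (intro mult_left_mono sing_val_nonneg) auto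
  finally show "sing_val (Suc n) \<le> sing_val n" by simp
qed

lemma sing_vec_norm_1: "sing_val n > 0 \<Longrightarrow> norm (sing_vec n) = 1"
  using sing_vec_norm[of n] by (auto simp: sing_val_def K.zero)

lemma cinner_K_sing_vec:
  "cinner (K (sing_vec j)) (K (sing_vec k)) = (if j = k then complex_of_real ((sing_val k)\<^sup>2) else 0)"
proof (cases "j = k")
  case True
  show ?thesis unfolding True by (simp add: cinner_self sing_val_def)
next
  case False
  then show ?thesis by (simp add: adjoint eigenvector_sing_vec' cinner_scaleC_right sing_vec_orth)
qed

text \<open>Otherwise \<open>K\<close> would map the orthonormal vectors \<open>sing_vec n\<close>
  to orthogonal vectors of norm at least \<open>\<eta>\<close>. Their mutual distances are at least
  \<open>\<eta>\<close>, so no subsequence converges, against compactness.\<close>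

lemma sing_val_tendsto_0: "sing_val \<longlonglongrightarrow> 0"
proof (rule LIMSEQ_I, rule ccontr)
  fix \<eta> :: real assume \<eta>: "\<eta> > 0" and "\<not> (\<exists>no. \<forall>n\<ge>no. norm (sing_val n - 0) < \<eta>)"
  then have "\<forall>no. \<exists>n\<ge>no. sing_val n \<ge> \<eta>" using sing_val_nonneg by (auto simp: not_less)
  then have ge: "sing_val n \<ge> \<eta>" for n
    using decseqD[OF decseq_sing_val] by (meson order_trans)
  have "norm (sing_vec n) \<le> 1" for n using sing_vec_norm[of n] by auto
  from compact_operator_subseq[OF compact, of sing_vec, OF this]
  obtain y r where r: "strict_mono (r :: nat \<Rightarrow> nat)" and y: "(\<lambda>n. K (sing_vec (r n))) \<longlonglongrightarrow> y"
    by auto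
  have "Cauchy (\<lambda>n. K (sing_vec (r n)))" using y by (rule LIMSEQ_imp_Cauchy)
  then obtain M where M: "\<And>m n. m \<ge> M \<Longrightarrow> n \<ge> M \<Longrightarrow> dist (K (sing_vec (r m))) (K (sing_vec (r n))) < \<eta>"
    using metric_CauchyD \<eta> by metis
  let ?i = "r M" and ?j = "r (Suc M)"
  have ij: "?i \<noteq> ?j" using r by (simp add: strict_mono_eq)
  have "(norm (K (sing_vec ?i) - K (sing_vec ?j)))\<^sup>2 = (sing_val ?i)\<^sup>2 + (sing_val ?j)\<^sup>2"
    using ij unfolding power2_norm_eq_inner
    by (simp only: inner_eq_Re_cinner) (simp add: cinner.diff_left cinner.diff_right cinner_K_sing_vec)
  also have "\<dots> \<ge> \<eta>\<^sup>2"
    using power_mono[OF ge[of ?i], of 2] \<eta> by (simp add: add_increasing2)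
  finally have "\<eta> \<le> norm (K (sing_vec ?i) - K (sing_vec ?j))"
    using \<eta> by (simp add: power2_le_iff_abs_le)
  with M[of M "Suc M"] show False by (simp add: dist_norm)
qed

end

text \<open>If \<open>t k < s k\<close>, then every index \<open>j\<close> with
  \<open>t j = s k\<close> is below \<open>k\<close>, and there \<open>s j = s k\<close> by
  induction and monotonicity. So the index set of the value \<open>s k\<close> for \<open>t\<close>
  lies in that for \<open>s\<close> and misses \<open>k\<close>, although both have the size
  prescribed by the eigenspace.\<close>

lemma is_singular_value_seq_le:
  assumes s: "is_singular_value_seq K s" and t: "is_singular_value_seq K t"
  shows "s k \<le> t k"
proof (induction k rule: less_induct)
  case (less k)
  show ?case
  proof (rule ccontr)
    assume "\<not> s k \<le> t k"
    then have lt: "t k < s k" by simp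
    let ?\<sigma> = "s k"
    have dec: "decseq s" "decseq t" and nonneg: "0 \<le> t k"
      using s t by (auto simp: is_singular_value_seq_def)
    have pos: "?\<sigma> > 0" using lt nonneg by simp
    have sub: "{j. t j = ?\<sigma>} \<subseteq> {j. s j = ?\<sigma>}"
    proof safe
      fix j assume j: "t j = s k"
      have "j < k"
      proof (rule ccontr)
        assume "\<not> j < k"
        then have "t j \<le> t k" using decseqD[OF dec(2), of k j] by simp
        with j lt show False by simp
      qed
      then have "s j \<le> t j" by (rule less)
      moreover have "s k \<le> s j" using decseqD[OF dec(1), of j k] \<open>j < k\<close> by simp
      ultimately show "s j = s k" using j by simp
    qed
    have "finite {j. s j = ?\<sigma>}" "card {j. s j = ?\<sigma>} = card {j. t j = ?\<sigma>}"
      using s t pos by (simp_all add: is_singular_value_seq_def)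
    with sub have "{j. t j = ?\<sigma>} = {j. s j = ?\<sigma>}" by (metis card_subset_eq)
    then have "t k = s k" by blast
    with lt show False by simp
  qed
qed

lemma singular_value_eqI:
  assumes "is_singular_value_seq K s"
  shows "singular_value K = s"
  unfolding singular_value_def
proof (rule the_equality)
  show "is_singular_value_seq K s" by fact
  fix t assume t: "is_singular_value_seq K t"
  show "t = s"
    by (intro ext antisym is_singular_value_seq_le[OF t assms] is_singular_value_seq_le[OF assms t])
qed

section \<open>Existence of the singular value sequence and a min-max bound\<close>

lemma homogeneous_system:
  fixes a :: "nat \<Rightarrow> nat \<Rightarrow> complex"
  shows "\<exists>c. (\<exists>k\<le>n. c k \<noteq> 0) \<and> (\<forall>i<n. (\<Sum>k\<le>n. a i k * c k) = 0)"
proof -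
  \<comment> \<open>A zero row makes the system square with vanishing determinant; a kernel vector
    is the nontrivial solution.\<close>
  define A where "A = Matrix.mat (Suc n) (Suc n) (\<lambda>(i, j). if i < n then a i j else 0)"
  have A: "A \<in> carrier_mat (Suc n) (Suc n)" by (simp add: A_def)
  have "Determinant.det A = (\<Sum>j<Suc n. A $$ (n, j) * cofactor A n j)"
    by (rule laplace_expansion_row[OF A]) simp
  also have "\<dots> = 0" by (intro sum.neutral) (simp add: A_def)
  finally have "Determinant.det A = 0" .
  then obtain v where v: "v \<in> carrier_vec (Suc n)" "v \<noteq> 0\<^sub>v (Suc n)" "A *\<^sub>v v = 0\<^sub>v (Suc n)"
    using det_0_iff_vec_prod_zero[OF A] by blast
  have "\<exists>k\<le>n. vec_index v k \<noteq> 0"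
  proof (rule ccontr)
    assume "\<not> ?thesis"
    then have "v = 0\<^sub>v (Suc n)" using v(1) by (intro eq_vecI) (auto simp: less_Suc_eq_le)
    with v(2) show False ..
  qed
  moreover have "(\<Sum>k\<le>n. a i k * vec_index v k) = 0" if "i < n" for i
  proof -
    have "0 = vec_index (A *\<^sub>v v) i" using v(3) that by simp
    also have "\<dots> = (\<Sum>k<Suc n. A $$ (i, k) * vec_index v k)"
      using that v(1) A by (simp add: scalar_prod_def lessThan_atLeast0)
    also have "\<dots> = (\<Sum>k\<le>n. a i k * vec_index v k)"
      using that by (intro sum.cong) (auto simp: A_def)
    finally show ?thesis by simp
  qed
  ultimately show ?thesis by blast
qed

context compact_adjoint_pair
begin

lemma scale': "K' (c *\<^sub>C x) = c *\<^sub>C K' x"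
proof -
  let ?d = "K' (c *\<^sub>C x) - c *\<^sub>C K' x"
  have "cinner ?d ?d = 0"
    by (simp only: cinner.diff_right cinner_scaleC_right adjoint[symmetric]) simp
  then show ?thesis by (simp add: cinner_self)
qed

lemma eigenspace_K'K: "eigenspace (op_on UNIV K O op_adjoint (op_on UNIV K)) z = {u. K' (K u) = z *\<^sub>C u}"
proof -
  have "(u, w) \<in> op_on UNIV K O op_adjoint (op_on UNIV K) \<longleftrightarrow> (\<forall>v. cinner (K v) (K u) = cinner v w)" for u w
    by (auto simp: op_on_def op_adjoint_def relcomp_unfold)
  moreover have "(\<forall>v. cinner (K v) (K u) = cinner v w) \<longleftrightarrow> w = K' (K u)" for u w
  proof
    assume "\<forall>v. cinner (K v) (K u) = cinner v w"
    then have "cinner (K' (K u) - w) (K' (K u) - w) = 0"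
      by (simp only: cinner.diff_right adjoint[symmetric]) simp
    then show "w = K' (K u)" by (simp add: cinner_self)
  qed (simp add: adjoint)
  ultimately show ?thesis unfolding eigenspace_def by auto
qed

text \<open>The eigenspace for \<open>\<sigma>\<^sup>2\<close> is spanned by the singular vectors
  with value \<open>\<sigma>\<close>. What remains of an eigenvector after projection,
  \<open>u - p\<close>, is orthogonal to every singular vector, so \<open>K\<close> stretches it by
  at most \<open>sing_val N\<close>. As an eigenvector it is stretched by exactly
  \<open>\<sigma>\<close>, and \<open>sing_val N < \<sigma>\<close>, so it vanishes.\<close>

lemma is_singular_value_seq_sing_val: "is_singular_value_seq K sing_val"
  unfolding is_singular_value_seq_def eigenspace_K'K
proof (intro conjI allI impI decseq_sing_val sing_val_nonneg)
  fix \<sigma> :: real assume \<sigma>: "\<sigma> > 0"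
  let ?I = "{k. sing_val k = \<sigma>}"
  obtain N where N: "\<And>n. n \<ge> N \<Longrightarrow> sing_val n < \<sigma>"
    using order_tendstoD(2)[OF sing_val_tendsto_0 \<sigma>] by (auto simp: eventually_sequentially)
  have sub: "?I \<subseteq> {..<N}" using N by (force simp: not_less[symmetric])
  then show fin: "finite ?I" by (rule finite_subset) simp
  let ?V = "{u. K' (K u) = complex_of_real (\<sigma>\<^sup>2) *\<^sub>C u}"
  have nrm: "norm (sing_vec k) = 1" if "k \<in> ?I" for k
    using sing_vec_norm_1 that \<sigma> by auto
  have inj: "inj_on sing_vec ?I"
  proof (rule inj_onI, rule ccontr)
    fix j k assume jk: "j \<in> ?I" "k \<in> ?I" "sing_vec j = sing_vec k" "j \<noteq> k"
    then have "cinner (sing_vec k) (sing_vec k) = 0" using sing_vec_orth by metis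
    with nrm[OF jk(2)] show False by (simp add: cinner_self)
  qed
  let ?B = "sing_vec ` ?I"
  have subV: "complex_vector.subspace ?V"
    unfolding complex_vector.subspace_def
    by (auto simp: K.zero K'.zero K.add K'.add scaleC.zero_right scaleC_add_right scale scale'
        complex_vector.scale_left_commute)
  have BV: "?B \<subseteq> ?V" using eigenvector_sing_vec' by auto
  have ind: "complex_vector.independent ?B"
    unfolding complex_vector.independent_explicit_module
  proof clarify
    fix t c v assume t: "finite t" "t \<subseteq> ?B" "(\<Sum>v\<in>t. c v *\<^sub>C v) = 0" and v: "v \<in> t"
    have "0 = cinner (\<Sum>w\<in>t. c w *\<^sub>C w) v" using t(3) by (simp add: cinner.zero_left)
    also have "\<dots> = (\<Sum>w\<in>t. c w * cinner w v)" by (simp add: cinner.sum_left cinner_scaleC_left)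
    also have "\<dots> = (\<Sum>w\<in>t. if w = v then c v else 0)"
    proof (rule sum.cong[OF refl])
      fix w assume "w \<in> t"
      then obtain j k where jk: "w = sing_vec j" "v = sing_vec k" "k \<in> ?I" using t(2) v by blast
      show "c w * cinner w v = (if w = v then c v else 0)"
        using jk nrm[OF jk(3)] sing_vec_orth[of j k] by (cases "j = k") (auto simp: cinner_self)
    qed
    also have "\<dots> = c v" using t(1) v by simp
    finally show "c v = 0" by simp
  qed
  have span: "u \<in> complex_vector.span ?B" if u: "u \<in> ?V" for u
  proof -
    define p where "p = (\<Sum>k\<in>?I. cinner u (sing_vec k) *\<^sub>C sing_vec k)"
    have pspan: "p \<in> complex_vector.span ?B"
      unfolding p_def
      by (intro complex_vector.span_sum complex_vector.span_scale complex_vector.span_base) auto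
    then have "p \<in> ?V" using complex_vector.span_minimal[OF BV subV] by blast
    then have V: "u - p \<in> ?V" using u complex_vector.subspace_diff[OF subV] by blast
    have orth: "cinner (u - p) (sing_vec j) = 0" for j
    proof (cases "j \<in> ?I")
      case True
      have "cinner p (sing_vec j) = (\<Sum>k\<in>?I. if k = j then cinner u (sing_vec j) else 0)"
        unfolding p_def cinner.sum_left cinner_scaleC_left
        by (intro sum.cong) (use nrm[OF True] in \<open>auto simp: cinner_self sing_vec_orth\<close>)
      then show ?thesis using True fin by (simp add: cinner.diff_left)
    next
      case False
      \<comment> \<open>Eigenvectors of the self-adjoint \<open>K' K\<close> for different
        eigenvalues are orthogonal.\<close>
      have "complex_of_real (\<sigma>\<^sup>2) * cinner (u - p) (sing_vec j)
          = cinner (K' (K (u - p))) (sing_vec j)" using V by (simp add: cinner_scaleC_left)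
      also have "\<dots> = complex_of_real ((sing_val j)\<^sup>2) * cinner (u - p) (sing_vec j)"
        by (simp add: adjoint' adjoint eigenvector_sing_vec' cinner_scaleC_right)
      finally have "cinner (u - p) (sing_vec j) = 0 \<or> complex_of_real (\<sigma>\<^sup>2) = complex_of_real ((sing_val j)\<^sup>2)"
        by (metis mult_cancel_right)
      moreover have "\<sigma>\<^sup>2 \<noteq> (sing_val j)\<^sup>2"
        using False \<sigma> sing_val_nonneg[of j] by (simp add: power2_eq_iff_nonneg)
      ultimately show ?thesis by (simp only: of_real_eq_iff) simp
    qed
    have "complex_of_real ((norm (K (u - p)))\<^sup>2) = complex_of_real (\<sigma>\<^sup>2 * (norm (u - p))\<^sup>2)"
      unfolding norm_K_eq using V by (simp add: cinner_scaleC_right cinner_self)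
    then have "(norm (K (u - p)))\<^sup>2 = (\<sigma> * norm (u - p))\<^sup>2"
      unfolding of_real_eq_iff power_mult_distrib .
    then have "norm (K (u - p)) = \<sigma> * norm (u - p)"
      using \<sigma> by (simp add: power2_eq_iff_nonneg)
    moreover have "norm (K (u - p)) \<le> sing_val N * norm (u - p)"
      by (rule sing_val_bound) (rule orth)
    ultimately have "(\<sigma> - sing_val N) * norm (u - p) \<le> 0" by (simp add: algebra_simps)
    then have "u = p" using N[of N] by (simp add: mult_le_0_iff)
    with pspan show ?thesis by simp
  qed
  have "cdim ?V = card ?B"
    by (rule complex_vector.dim_unique[OF BV _ ind refl]) (use span in blast)
  then show "card ?I = cdim ?V" using card_image[OF inj] by simp
qed

lemma singular_value_eq: "singular_value K = sing_val"
  by (rule singular_value_eqI[OF is_singular_value_seq_sing_val])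

text \<open>One half of the min-max principle. The span of the first \<open>n + 1\<close> singular
  vectors contains a nonzero \<open>f\<close> orthogonal to all \<open>n\<close> vectors
  \<open>\<Psi> i\<close>. If \<open>\<eta> < sing_val n\<close>, then \<open>K\<close> stretches
  every nonzero vector of this span by more than \<open>\<eta>\<close>.\<close>

lemma sing_val_le:
  assumes \<eta>: "\<eta> \<ge> 0" and bound: "\<And>f. (\<And>i. i < n \<Longrightarrow> cinner f (\<Psi> i) = 0) \<Longrightarrow> norm (K f) \<le> \<eta> * norm f"
  shows "sing_val n \<le> \<eta>"
proof (rule ccontr)
  assume "\<not> sing_val n \<le> \<eta>"
  then have gt: "\<eta> < sing_val k" if "k \<le> n" for k
    using decseqD[OF decseq_sing_val that] by simp
  obtain c where c: "\<exists>k\<le>n. c k \<noteq> 0" "\<And>i. i < n \<Longrightarrow> (\<Sum>k\<le>n. cinner (sing_vec k) (\<Psi> i) * c k) = 0"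
    using homogeneous_system[of n "\<lambda>i k. cinner (sing_vec k) (\<Psi> i)"] by blast
  define f where "f = (\<Sum>k\<le>n. c k *\<^sub>C sing_vec k)"
  have "cinner f (\<Psi> i) = 0" if "i < n" for i
    using c(2)[OF that] by (simp add: f_def cinner.sum_left cinner_scaleC_left mult.commute)
  then have le: "norm (K f) \<le> \<eta> * norm f" by (rule bound)
  have n1: "norm (sing_vec k) = 1" if "k \<le> n" for k
    using sing_vec_norm_1 gt[OF that] \<eta> by auto
  have orth: "inner (c j *\<^sub>C sing_vec j) (c k *\<^sub>C sing_vec k) = 0" if "j \<noteq> k" for j k
    by (rule inner_0_if_cinner_0) (simp add: cinner_scaleC_left cinner_scaleC_right sing_vec_orth that)
  have orthK: "inner (c j *\<^sub>C K (sing_vec j)) (c k *\<^sub>C K (sing_vec k)) = 0" if "j \<noteq> k" for j k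
    by (rule inner_0_if_cinner_0) (simp add: cinner_scaleC_left cinner_scaleC_right cinner_K_sing_vec that)
  have nf: "(norm f)\<^sup>2 = (\<Sum>k\<le>n. (norm (c k))\<^sup>2)"
    unfolding f_def by (subst norm_sum_orthogonal) (auto simp: orth norm_scaleC n1)
  have nKf: "(norm (K f))\<^sup>2 = (\<Sum>k\<le>n. (norm (c k))\<^sup>2 * (sing_val k)\<^sup>2)"
    unfolding f_def K.sum scale
    by (subst norm_sum_orthogonal) (auto simp: orthK norm_scaleC sing_val_def power_mult_distrib)
  have "(\<Sum>k\<le>n. (norm (c k))\<^sup>2 * \<eta>\<^sup>2) < (\<Sum>k\<le>n. (norm (c k))\<^sup>2 * (sing_val k)\<^sup>2)"
  proof (rule sum_strict_mono_ex1)
    show "\<forall>k\<in>{..n}. (norm (c k))\<^sup>2 * \<eta>\<^sup>2 \<le> (norm (c k))\<^sup>2 * (sing_val k)\<^sup>2"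
      using gt \<eta> by (auto intro!: mult_left_mono power_mono intro: less_imp_le)
    obtain k where "k \<le> n" "c k \<noteq> 0" using c(1) by blast
    then show "\<exists>k\<in>{..n}. (norm (c k))\<^sup>2 * \<eta>\<^sup>2 < (norm (c k))\<^sup>2 * (sing_val k)\<^sup>2"
      using gt \<eta> by (intro bexI[of _ k] mult_strict_left_mono power_strict_mono) auto
  qed simp
  then have "(\<eta> * norm f)\<^sup>2 < (norm (K f))\<^sup>2"
    unfolding nKf power_mult_distrib nf by (simp add: sum_distrib_left mult.commute)
  then have "\<eta> * norm f < norm (K f)" by (rule power2_less_imp_less) simp
  with le show False by simp
qed

end

section \<open>A compactness criterion by finitely many linear conditions\<close>

lemma gram_schmidt_exists:
  fixes \<Psi> :: "nat \<Rightarrow> 'a::complex_inner"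
  shows "\<exists>e. (\<forall>i<n. e i = 0 \<or> norm (e i) = 1)
    \<and> (\<forall>i<n. \<forall>j<n. i \<noteq> j \<longrightarrow> cinner (e i) (e j) = 0)
    \<and> (\<forall>f. (\<forall>i<n. cinner f (e i) = 0) \<longrightarrow> (\<forall>i<n. cinner f (\<Psi> i) = 0))"
proof (induction n)
  case (Suc n)
  then obtain e where e': "\<forall>i<n. e i = 0 \<or> norm (e i) = 1"
    "\<forall>i<n. \<forall>j<n. i \<noteq> j \<longrightarrow> cinner (e i) (e j) = 0"
    "\<forall>f. (\<forall>i<n. cinner f (e i) = 0) \<longrightarrow> (\<forall>i<n. cinner f (\<Psi> i) = 0)"
    by (elim exE conjE) (rule that)
  note e = e'(1)[rule_format] e'(2)[rule_format] e'(3)[rule_format]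
  define p where "p = (\<Sum>i<n. cinner (\<Psi> n) (e i) *\<^sub>C e i)"
  define w where "w = \<Psi> n - p"
  \<comment> \<open>If \<open>w = 0\<close>, then \<open>g = 0\<close>: linearly dependent vectors
    contribute a zero vector instead of being dropped, which keeps the number \<open>n\<close>
    fixed.\<close>
  define g where "g = inverse (norm w) *\<^sub>R w"
  have wj: "cinner w (e j) = 0" if j: "j < n" for j
  proof -
    have "cinner p (e j) = (\<Sum>i<n. if i = j then cinner (\<Psi> n) (e j) else 0)"
      unfolding p_def cinner.sum_left cinner_scaleC_left
      proof (rule sum.cong[OF refl])
      fix i assume "i \<in> {..<n}"
      then have i: "i < n" by simp
      show "cinner (\<Psi> n) (e i) * cinner (e i) (e j) = (if i = j then cinner (\<Psi> n) (e j) else 0)"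
        using e(1)[OF j] e(2)[OF i j] by (cases "i = j") (auto simp: cinner_self cinner.zero_right)
    qed
    then show ?thesis using j by (simp add: w_def cinner.diff_left)
  qed
  have gj: "cinner g (e j) = 0" "cinner (e j) g = 0" if "j < n" for j
  proof -
    show "cinner g (e j) = 0" using wj[OF that] by (simp add: g_def cinner.scaleR_left)
    then show "cinner (e j) g = 0" by (metis cinner_commute complex_cnj_zero)
  qed
  have g1: "g = 0 \<or> norm g = 1" by (cases "w = 0") (simp_all add: g_def)
  have wg: "w = norm w *\<^sub>R g" by (cases "w = 0") (simp_all add: g_def)
  have ann: "cinner f (\<Psi> n) = 0" if f: "\<And>i. i < n \<Longrightarrow> cinner f (e i) = 0" "cinner f g = 0" for f
  proof -
    have "cinner f p = 0" unfolding p_def cinner.sum_right cinner_scaleC_right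
      using f(1) by (intro sum.neutral) auto
    moreover have "cinner f w = 0" using f(2) by (subst wg) (simp add: cinner.scaleR_right)
    ultimately show ?thesis by (simp add: w_def cinner.diff_right)
  qed
  show ?case
  proof (intro exI[of _ "e(n := g)"] conjI allI impI)
    fix f i assume f: "\<forall>i<Suc n. cinner f ((e(n := g)) i) = 0" and i: "i < Suc n"
    have "cinner f (e i) = 0" if "i < n" for i using f[rule_format, of i] that by simp
    moreover have "cinner f g = 0" using f[rule_format, of n] by simp
    ultimately show "cinner f (\<Psi> i) = 0" using ann e(3) i by (cases "i = n") (auto simp: less_Suc_eq)
  qed (use e g1 gj in \<open>auto simp: less_Suc_eq\<close>)
qed simp

lemma compact_unit_combinations:
  fixes y :: "nat \<Rightarrow> 'a::complex_inner"
  shows "compact {\<Sum>i<n. c i *\<^sub>C y i | c :: nat \<Rightarrow> complex. \<forall>i<n. norm (c i) \<le> 1}"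
proof (induction n)
  case (Suc n)
  let ?C = "\<lambda>n. {\<Sum>i<n. c i *\<^sub>C y i | c :: nat \<Rightarrow> complex. \<forall>i<n. norm (c i) \<le> 1}"
  have "?C (Suc n) = (\<lambda>q. fst q + snd q *\<^sub>C y n) ` (?C n \<times> cball 0 1)" (is "_ = ?R")
  proof safe
    fix c :: "nat \<Rightarrow> complex" assume c: "\<forall>i<Suc n. norm (c i) \<le> 1"
    have "((\<Sum>i<n. c i *\<^sub>C y i), c n) \<in> ?C n \<times> cball 0 1" using c by (auto simp: less_Suc_eq)
    then show "(\<Sum>i<Suc n. c i *\<^sub>C y i) \<in> ?R" by (rule rev_image_eqI) simp
  next
    fix b :: complex and c :: "nat \<Rightarrow> complex" assume "b \<in> cball 0 1" "\<forall>i<n. norm (c i) \<le> 1"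
    then show "\<exists>c'. fst (\<Sum>i<n. c i *\<^sub>C y i, b) + snd (\<Sum>i<n. c i *\<^sub>C y i, b) *\<^sub>C y n
        = (\<Sum>i<Suc n. c' i *\<^sub>C y i) \<and> (\<forall>i<Suc n. norm (c' i) \<le> 1)"
      by (intro exI[of _ "c(n := b)"]) (auto simp: less_Suc_eq)
  qed
  moreover have "compact ?R"
    by (intro compact_continuous_image compact_Times Suc.IH compact_cball continuous_intros
        scaleC.continuous_on)
  ultimately show ?case by metis
qed simp

text \<open>For \<open>p\<close> the projection of \<open>f\<close> onto the span of the
  \<open>e i\<close>, the vector \<open>K p\<close> stays in a compact set of finite dimension, and
  \<open>K f\<close> differs from it by at most \<open>\<eta>\<close>. Hence the image of the unit
  ball is totally bounded.\<close>

lemma compact_if_small_on_annihilators: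
  fixes K :: "'a::complex_inner \<Rightarrow> 'b::{complex_inner, complete_space}"
  assumes K: "bounded_linear K" "\<And>c x. K (c *\<^sub>C x) = c *\<^sub>C K x"
    and small: "\<And>\<eta>. \<eta> > 0 \<Longrightarrow>
      \<exists>n (\<Psi> :: nat \<Rightarrow> 'a). \<forall>f. (\<forall>i<n. cinner f (\<Psi> i) = 0) \<longrightarrow> norm (K f) \<le> \<eta> * norm f"
  shows "compact (closure (K ` cball 0 1))"
  unfolding compact_eq_totally_bounded
proof (intro conjI allI impI)
  interpret K: bounded_linear K by (rule K(1))
  show "complete (closure (K ` cball 0 1))" by (simp add: complete_eq_closed)
  fix \<epsilon> :: real assume "\<epsilon> > 0"
  \<comment> \<open>One \<open>\<eta>\<close> for the finite rank part and one for the remainder;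
    the closed balls of radius \<open>2 * \<eta> = \<epsilon> / 2\<close> also cover the closure and
    lie in the open balls of radius \<open>\<epsilon>\<close>.\<close>
  define \<eta> where "\<eta> = \<epsilon> / 4"
  have \<eta>: "\<eta> > 0" using \<open>\<epsilon> > 0\<close> by (simp add: \<eta>_def)
  obtain n and \<Psi> :: "nat \<Rightarrow> 'a" where \<Psi>: "\<And>f. (\<forall>i<n. cinner f (\<Psi> i) = 0) \<Longrightarrow> norm (K f) \<le> \<eta> * norm f"
    using small[OF \<eta>] by blast
  obtain e where e': "\<forall>i<n. e i = 0 \<or> norm (e i) = 1"
    "\<forall>i<n. \<forall>j<n. i \<noteq> j \<longrightarrow> cinner (e i) (e j) = 0"
    "\<forall>f. (\<forall>i<n. cinner f (e i) = 0) \<longrightarrow> (\<forall>i<n. cinner f (\<Psi> i) = 0)"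
    using gram_schmidt_exists[of n \<Psi>] by (elim exE conjE) (rule that)
  note e = e'(1)[rule_format] e'(2)[rule_format] e'(3)[rule_format]
  define C where "C = {\<Sum>i<n. c i *\<^sub>C K (e i) | c :: nat \<Rightarrow> complex. \<forall>i<n. norm (c i) \<le> 1}"
  have "compact C" unfolding C_def by (rule compact_unit_combinations)
  then obtain k where k: "finite k" "C \<subseteq> (\<Union>x\<in>k. ball x \<eta>)"
    using \<eta> unfolding compact_eq_totally_bounded by blast
  have near: "\<exists>x\<in>k. dist x (K f) \<le> 2 * \<eta>" if f: "norm f \<le> 1" for f
  proof -
    define p where "p = (\<Sum>i<n. cinner f (e i) *\<^sub>C e i)"
    have o: "cinner (f - p) (e j) = 0" if j: "j < n" for j
    proof -
      have "cinner p (e j) = (\<Sum>i<n. if i = j then cinner f (e j) else 0)"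
        unfolding p_def cinner.sum_left cinner_scaleC_left
        proof (rule sum.cong[OF refl])
      fix i assume "i \<in> {..<n}"
      then have i: "i < n" by simp
      show "cinner (f) (e i) * cinner (e i) (e j) = (if i = j then cinner (f) (e j) else 0)"
        using e(1)[OF j] e(2)[OF i j] by (cases "i = j") (auto simp: cinner_self cinner.zero_right)
    qed
      then show ?thesis using j by (simp add: cinner.diff_left)
    qed
    then have "cinner (f - p) p = 0"
      unfolding p_def cinner.sum_right cinner_scaleC_right by (intro sum.neutral) auto
    then have "inner (f - p) p = 0" by (rule inner_0_if_cinner_0)
    then have "(norm f)\<^sup>2 = (norm (f - p))\<^sup>2 + (norm p)\<^sup>2"
      unfolding power2_norm_eq_inner by (simp add: inner_diff_left inner_diff_right inner_commute)
    then have "(norm (f - p))\<^sup>2 \<le> 1\<^sup>2" using power_mono[OF f norm_ge_zero, of 2] by (simp add: add_increasing2) (meson le_add_same_cancel1 order_trans zero_le_power2)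
    then have fp: "norm (f - p) \<le> 1" by (rule power2_le_imp_le) simp
    have "norm (K (f - p)) \<le> \<eta> * norm (f - p)" by (rule \<Psi>) (use e(3) o in blast)
    also have "\<dots> \<le> \<eta> * 1" using fp \<eta> by (intro mult_left_mono) auto
    finally have d: "dist (K p) (K f) \<le> \<eta>" by (simp add: dist_norm K.diff norm_minus_commute)
    have "norm (cinner f (e i)) \<le> 1" if "i < n" for i
      using norm_cinner_le[of f "e i"] mult_mono[OF f, of "norm (e i)" 1] e(1)[OF that] by fastforce
    then have "\<forall>i<n. norm (cinner f (e i)) \<le> 1" by blast
    then have "K p \<in> C" unfolding C_def p_def K.sum K(2) by (intro CollectI exI[of _ "\<lambda>i. cinner f (e i)"]) simp
    then obtain x where x: "x \<in> k" "dist x (K p) < \<eta>" using k(2) by auto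
    have "dist x (K f) \<le> dist x (K p) + dist (K p) (K f)" by (rule dist_triangle)
    with d x show ?thesis by (intro bexI[of _ x]) auto
  qed
  have "closure (K ` cball 0 1) \<subseteq> (\<Union>x\<in>k. cball x (2 * \<eta>))"
    by (rule closure_minimal) (use near k(1) in \<open>fastforce simp: dist_norm intro: closed_UN\<close>)+
  also have "\<dots> \<subseteq> (\<Union>x\<in>k. ball x \<epsilon>)" using \<open>\<epsilon> > 0\<close> by (auto simp: \<eta>_def)
  finally show "\<exists>k. finite k \<and> closure (K ` cball 0 1) \<subseteq> (\<Union>x\<in>k. ball x \<epsilon>)" using k(1) by blast
qed

section \<open>Locally absolutely continuous functions\<close>

text \<open>\<open>F\<close> is locally absolutely continuous with almost everywhere derivative \<open>f\<close>.\<close>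

definition prim :: "(real \<Rightarrow> complex) \<Rightarrow> (real \<Rightarrow> complex) \<Rightarrow> bool" where
  "prim f F \<longleftrightarrow> f \<in> borel_measurable borel \<and>
     (\<forall>a b. a \<le> b \<longrightarrow> set_integrable lborel {a..b} f \<and> F b - F a = (LINT x:{a..b}|lborel. f x))"

lemma prim_measurable: "prim f F \<Longrightarrow> f \<in> borel_measurable borel"
  by (simp add: prim_def)

lemma prim_integrable: "prim f F \<Longrightarrow> set_integrable lborel {a..b} f"
  by (cases "a \<le> b") (auto simp: prim_def set_integrable_def)

lemma prim_eq: "prim f F \<Longrightarrow> a \<le> b \<Longrightarrow> F b - F a = (LINT x:{a..b}|lborel. f x)"
  by (simp add: prim_def)

lemma prim_continuous:
  assumes "prim f F"
  shows "continuous_on S F"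
proof -
  have "continuous_on {a..b} F" for a b
  proof -
    have "continuous_on {a..b} (\<lambda>x. F a + integral {a..x} f)"
      by (intro continuous_intros indefinite_integral_continuous_1 set_borel_integral_eq_integral
          prim_integrable[OF assms])
    moreover have "F a + integral {a..x} f = F x" if "x \<in> {a..b}" for x
      using prim_eq[OF assms, of a x] that
      by (simp add: set_borel_integral_eq_integral prim_integrable[OF assms] algebra_simps)
    moreover from this have "continuous_on {a..b} (\<lambda>x. F a + integral {a..x} f) \<longleftrightarrow> continuous_on {a..b} F"
      by (intro continuous_on_cong refl) auto
    ultimately show ?thesis by blast
  qed
  then have "isCont F x" for x
    using continuous_on_interior[of "{x - 1..x + 1}" F x] by simp
  then show ?thesis by (simp add: continuous_at_imp_continuous_on)
qed

lemma prim_borel: "prim f F \<Longrightarrow> F \<in> borel_measurable borel"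
  by (rule borel_measurable_continuous_onI[OF prim_continuous])

lemma primI_continuous:
  assumes "\<And>x. (F has_vector_derivative f x) (at x)" "continuous_on UNIV f"
  shows "prim f F"
  unfolding prim_def
proof (intro conjI allI impI)
  show "f \<in> borel_measurable borel" by (rule borel_measurable_continuous_onI[OF assms(2)])
  fix a b :: real assume "a \<le> b"
  have c: "continuous_on {a..b} f" using assms(2) continuous_on_subset by blast
  then show "set_integrable lborel {a..b} f" by (rule borel_integrable_atLeastAtMost')
  show "F b - F a = (LINT x:{a..b}|lborel. f x)"
    unfolding set_lebesgue_integral_def
    by (rule integral_FTC_Icc[symmetric, OF \<open>a \<le> b\<close> _ c]) (rule has_vector_derivative_at_within[OF assms(1)])
qed

lemma prim_const: "prim (\<lambda>x. 0) (\<lambda>x. c)"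
  by (rule primI_continuous) auto

lemma prim_add:
  assumes "prim f F" "prim g G"
  shows "prim (\<lambda>x. f x + g x) (\<lambda>x. F x + G x)"
  using assms unfolding prim_def
  by (auto simp: set_integral_add algebra_simps)

lemma prim_cmult:
  assumes "prim f F"
  shows "prim (\<lambda>x. c * f x) (\<lambda>x. c * F x)"
  using assms unfolding prim_def by (auto simp flip: right_diff_distrib)

lemma prim_diff:
  assumes "prim f F" "prim g G"
  shows "prim (\<lambda>x. f x - g x) (\<lambda>x. F x - G x)"
  using prim_add[OF assms(1) prim_cmult[OF assms(2), of "-1"]] by simp

lemma prim_cnj:
  assumes "prim f F"
  shows "prim (\<lambda>x. cnj (f x)) (\<lambda>x. cnj (F x))"
  using assms unfolding prim_def set_integrable_def set_lebesgue_integral_def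
  by (auto simp: complex_cnj_scaleR[symmetric] simp del: complex_cnj_scaleR
     simp flip: complex_cnj_diff intro!: borel_measurable_continuous_on[of cnj] continuous_intros)

lemma prim_cong_AE:
  assumes "prim f F" "g \<in> borel_measurable borel" "AE x in lborel. f x = g x"
  shows "prim g F"
  unfolding prim_def
proof (intro conjI allI impI assms(2))
  fix a b :: real assume ab: "a \<le> b"
  have m: "(\<lambda>x. indicat_real {a..b} x *\<^sub>R f x) \<in> borel_measurable lborel"
    "(\<lambda>x. indicat_real {a..b} x *\<^sub>R g x) \<in> borel_measurable lborel"
    using assms(2) prim_measurable[OF assms(1)] by (auto intro!: borel_measurable_scaleR)
  have ae: "AE x in lborel. indicat_real {a..b} x *\<^sub>R f x = indicat_real {a..b} x *\<^sub>R g x"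
    using assms(3) by eventually_elim simp
  show "set_integrable lborel {a..b} g"
    using prim_integrable[OF assms(1), of a b] integrable_cong_AE[OF m ae]
    by (simp add: set_integrable_def)
  show "F b - F a = (LINT x:{a..b}|lborel. g x)"
    using prim_eq[OF assms(1) ab] integral_cong_AE[OF m ae] by (simp add: set_lebesgue_integral_def)
qed

lemma set_integrable_mult_continuous:
  fixes f g :: "real \<Rightarrow> complex"
  assumes "set_integrable lborel {a..b} f" "continuous_on UNIV g"
  shows "set_integrable lborel {a..b} (\<lambda>x. f x * g x)"
proof -
  have "bounded (g ` {a..b})"
    by (intro compact_imp_bounded compact_continuous_image continuous_on_subset[OF assms(2)]) auto
  then obtain B where B: "\<And>x. x \<in> {a..b} \<Longrightarrow> norm (g x) \<le> B" unfolding bounded_iff by blast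
  have "integrable lborel (\<lambda>x. B * norm (indicator {a..b} x *\<^sub>R f x))"
    using assms(1) unfolding set_integrable_def
    by (intro integrable_mult_right integrable_norm)
  then have "integrable lborel (\<lambda>x. (indicator {a..b} x *\<^sub>R f x) * g x)"
  proof (rule Bochner_Integration.integrable_bound)
    show "(\<lambda>x. (indicator {a..b} x *\<^sub>R f x) * g x) \<in> borel_measurable lborel"
      using assms borel_measurable_continuous_onI[OF assms(2)]
      by (intro borel_measurable_times) (auto simp: set_integrable_def)
    show "AE x in lborel. norm ((indicator {a..b} x *\<^sub>R f x) * g x)
        \<le> norm (B * norm (indicator {a..b} x *\<^sub>R f x))"
    proof (rule AE_I2)
      fix x
      show "norm ((indicator {a..b} x *\<^sub>R f x) * g x) \<le> norm (B * norm (indicator {a..b} x *\<^sub>R f x))"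
      proof (cases "x \<in> {a..b}")
        case True
        then have "norm (f x) * norm (g x) \<le> norm (f x) * B" by (intro mult_left_mono B) auto
        also have "\<dots> \<le> \<bar>B\<bar> * norm (f x)" by (simp add: mult.commute mult_right_mono)
        finally show ?thesis using True by (simp add: norm_mult abs_mult)
      qed simp
    qed
  qed
  then show ?thesis by (simp add: set_integrable_def)
qed

lemma set_integrable_mult_continuous_real:
  fixes h k :: "real \<Rightarrow> real"
  assumes "continuous_on UNIV h" "set_integrable lborel {a..b} k"
  shows "set_integrable lborel {a..b} (\<lambda>x. h x * k x)"
proof -
  have "set_integrable lborel {a..b} (\<lambda>x. complex_of_real (k x) * complex_of_real (h x))"
  proof (rule set_integrable_mult_continuous)
    have "integrable lborel (\<lambda>x. complex_of_real (indicat_real {a..b} x *\<^sub>R k x))"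
      using assms(2) unfolding set_integrable_def by (rule integrable_of_real)
    then show "set_integrable lborel {a..b} (\<lambda>x. complex_of_real (k x))"
      unfolding set_integrable_def by (simp add: scaleR_conv_of_real)
  qed (intro continuous_intros assms)
  then have "integrable lborel (\<lambda>x. Re (indicat_real {a..b} x *\<^sub>R (complex_of_real (k x) * complex_of_real (h x))))"
    unfolding set_integrable_def by (rule integrable_Re)
  then show ?thesis by (simp add: set_integrable_def mult.commute)
qed

text \<open>Fubini's theorem on the half-planes \<open>t \<le> x\<close> and
  \<open>x \<le> t\<close>, which meet in a single point of every section. This is integration by
  parts for merely integrable densities.\<close>

lemma integral_product_triangles:
  fixes f g :: "real \<Rightarrow> complex"
  assumes f: "integrable lborel f" and g: "integrable lborel g"
  shows "(LINT x|lborel. f x) * (LINT x|lborel. g x)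
    = (LINT x|lborel. f x * (LINT t:{..x}|lborel. g t)) + (LINT t|lborel. g t * (LINT x:{..t}|lborel. f x))"
proof -
  have [measurable]: "f \<in> borel_measurable borel" "g \<in> borel_measurable borel"
    using f g by auto
  define h where "h = (\<lambda>x t. if t \<le> x then f x * g t else 0)"
  define k where "k = (\<lambda>x t. if x \<le> t then f x * g t else 0)"
  have mes: "case_prod h \<in> borel_measurable (lborel \<Otimes>\<^sub>M lborel)" "case_prod k \<in> borel_measurable (lborel \<Otimes>\<^sub>M lborel)"
    unfolding h_def k_def by measurable
  have int_pt: "integrable lborel (\<lambda>t. f x * g t)" for x using g by simp
  have int_h: "integrable lborel (h x)" "integrable lborel (k x)" for x
    unfolding h_def k_def by (rule Bochner_Integration.integrable_bound[OF int_pt[of x]]; simp)+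
  have bnd: "integrable lborel (\<lambda>x. norm (f x) * (LINT t|lborel. norm (g t)))" using f by simp
  have le: "(LINT t|lborel. norm (h x t)) \<le> norm (f x) * (LINT t|lborel. norm (g t))"
    "(LINT t|lborel. norm (k x t)) \<le> norm (f x) * (LINT t|lborel. norm (g t))" for x
    unfolding integral_mult_right_zero[symmetric]
    by (rule integral_mono; (use int_h g in \<open>simp add: h_def k_def norm_mult\<close>)?)+
  have pos: "0 \<le> norm (f x) * (LINT t|lborel. norm (g t))" for x by simp
  have meas_n: "(\<lambda>x. LINT t|lborel. norm (h x t)) \<in> borel_measurable lborel"
    "(\<lambda>x. LINT t|lborel. norm (k x t)) \<in> borel_measurable lborel"
    using mes by measurable
  have int_n: "integrable lborel (\<lambda>x. LINT t|lborel. norm (h x t))"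
    "integrable lborel (\<lambda>x. LINT t|lborel. norm (k x t))"
    by (rule Bochner_Integration.integrable_bound[OF bnd meas_n(1)], rule AE_I2, use le(1) pos in simp,
        rule Bochner_Integration.integrable_bound[OF bnd meas_n(2)], rule AE_I2, use le(2) pos in simp)
  have int: "integrable (lborel \<Otimes>\<^sub>M lborel) (case_prod h)" "integrable (lborel \<Otimes>\<^sub>M lborel) (case_prod k)"
    using int_h int_n by (auto intro!: lborel_pair.Fubini_integrable mes AE_I2)
  have Ih: "f x * (LINT t:{..x}|lborel. g t) = (LINT t|lborel. h x t)" for x
    unfolding set_lebesgue_integral_def integral_mult_right_zero[symmetric]
    by (intro Bochner_Integration.integral_cong) (auto simp: h_def)
  have Ik: "g t * (LINT x:{..t}|lborel. f x) = (LINT x|lborel. k x t)" for t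
    unfolding set_lebesgue_integral_def integral_mult_right_zero[symmetric]
    by (intro Bochner_Integration.integral_cong) (auto simp: k_def)
  have hk: "(LINT t|lborel. h x t) + (LINT t|lborel. k x t) = f x * (LINT t|lborel. g t)" for x
  proof -
    have "(LINT t|lborel. h x t) + (LINT t|lborel. k x t) = (LINT t|lborel. h x t + k x t)"
      using int_h by simp
    also have "\<dots> = (LINT t|lborel. f x * g t)"
    proof (rule integral_cong_AE)
      show "AE t in lborel. h x t + k x t = f x * g t"
        using AE_lborel_singleton[of x] by eventually_elim (auto simp: h_def k_def)
    qed (use int_h int_pt in auto)
    finally show ?thesis by simp
  qed
  have "(LINT x|lborel. f x * (LINT t:{..x}|lborel. g t)) + (LINT t|lborel. g t * (LINT x:{..t}|lborel. f x))
      = (LINT x|lborel. (LINT t|lborel. h x t)) + (LINT x|lborel. (LINT t|lborel. k x t))"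
    unfolding Ih Ik using lborel_pair.Fubini_integral[OF int(2)] by simp
  also have "\<dots> = (LINT x|lborel. (LINT t|lborel. h x t) + (LINT t|lborel. k x t))"
    using lborel_pair.integrable_fst'[OF int(1)] lborel_pair.integrable_fst'[OF int(2)] by simp
  also have "\<dots> = (LINT x|lborel. f x) * (LINT t|lborel. g t)" unfolding hk by simp
  finally show ?thesis ..
qed

text \<open>For \<open>f\<close> and \<open>g\<close> cut off to \<open>{a..b}\<close>, the inner
  integrals of the triangle formula are \<open>F x - F a\<close> and \<open>G x - G a\<close>;
  expanding the products gives the Leibniz rule.\<close>

lemma prim_mult:
  assumes fF: "prim f F" and gG: "prim g G"
  shows "prim (\<lambda>x. f x * G x + F x * g x) (\<lambda>x. F x * G x)"
  unfolding prim_def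
proof (intro conjI allI impI)
  have [measurable]: "f \<in> borel_measurable borel" "F \<in> borel_measurable borel"
    "g \<in> borel_measurable borel" "G \<in> borel_measurable borel"
    using assms by (auto intro: prim_measurable prim_borel)
  show "(\<lambda>x. f x * G x + F x * g x) \<in> borel_measurable borel" by measurable
  fix a b :: real assume ab: "a \<le> b"
  have int: "set_integrable lborel {a..b} (\<lambda>x. f x * G x)" "set_integrable lborel {a..b} (\<lambda>x. F x * g x)"
    using set_integrable_mult_continuous[OF prim_integrable[OF fF] prim_continuous[OF gG], of a b]
      set_integrable_mult_continuous[OF prim_integrable[OF gG] prim_continuous[OF fF], of a b]
    by (simp_all add: mult.commute)
  then show "set_integrable lborel {a..b} (\<lambda>x. f x * G x + F x * g x)" by (rule set_integral_add)
  define f1 where "f1 = (\<lambda>x. indicat_real {a..b} x *\<^sub>R f x)"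
  define g1 where "g1 = (\<lambda>x. indicat_real {a..b} x *\<^sub>R g x)"
  have i1: "integrable lborel f1" "integrable lborel g1"
    using prim_integrable[OF fF, of a b] prim_integrable[OF gG, of a b]
    by (simp_all add: f1_def g1_def set_integrable_def)
  have part: "(LINT t:{..x}|lborel. indicat_real {a..b} t *\<^sub>R h t) = H x - H a"
    if "prim h H" "x \<in> {a..b}" for h H x
  proof -
    have "(LINT t:{..x}|lborel. indicat_real {a..b} t *\<^sub>R h t) = (LINT t:{a..x}|lborel. h t)"
      unfolding set_lebesgue_integral_def
      by (intro Bochner_Integration.integral_cong) (use that in \<open>auto simp: indicator_def\<close>)
    with prim_eq[OF that(1), of a x] that(2) show ?thesis by simp
  qed
  have cf: "integrable lborel (\<lambda>x. G a * f1 x)" "integrable lborel (\<lambda>x. F a * g1 x)" using i1 by simp_all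
  have c1: "integrable lborel (\<lambda>x. f1 x * G x)" "integrable lborel (\<lambda>x. F x * g1 x)"
    using int by (simp_all add: f1_def g1_def set_integrable_def)
  have "(LINT x|lborel. f1 x) * (LINT x|lborel. g1 x)
      = (LINT x|lborel. f1 x * G x - G a * f1 x) + (LINT x|lborel. F x * g1 x - F a * g1 x)"
    unfolding integral_product_triangles[OF i1]
  proof (intro arg_cong2[where f = "(+)"] Bochner_Integration.integral_cong refl)
    show "f1 x * (LINT t:{..x}|lborel. g1 t) = f1 x * G x - G a * f1 x" for x
      using part[OF gG, of x] by (cases "x \<in> {a..b}") (simp_all add: f1_def g1_def right_diff_distrib mult.commute)
    show "g1 x * (LINT t:{..x}|lborel. f1 t) = F x * g1 x - F a * g1 x" for x
      using part[OF fF, of x] by (cases "x \<in> {a..b}") (simp_all add: f1_def g1_def right_diff_distrib mult.commute)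
  qed
  moreover have e: "(LINT x|lborel. f1 x) = F b - F a" "(LINT x|lborel. g1 x) = G b - G a"
    using prim_eq[OF fF ab] prim_eq[OF gG ab] by (simp_all add: f1_def g1_def set_lebesgue_integral_def)
  moreover have "(LINT x:{a..b}|lborel. f x * G x + F x * g x) = (LINT x|lborel. f1 x * G x) + (LINT x|lborel. F x * g1 x)"
    using set_integral_add(2)[OF int] by (simp add: f1_def g1_def set_lebesgue_integral_def)
  ultimately show "F b * G b - F a * G a = (LINT x:{a..b}|lborel. f x * G x + F x * g x)"
    unfolding Bochner_Integration.integral_diff[OF c1(1) cf(1)] Bochner_Integration.integral_diff[OF c1(2) cf(2)]
      integral_mult_right_zero e by (simp add: algebra_simps)
qed

text \<open>Takes the place of an argument that \<open>P\<close> vanishes at infinity. The parabola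
  \<open>chi n\<close> vanishes at both ends of \<open>{-N n..N n}\<close>, so no boundary terms
  arise, and the error is at most \<open>2 / N n\<close> times the integral of
  \<open>norm (P x)\<close>.\<close>

lemma prim_integral_eq_0:
  assumes pP: "prim p P" and p: "integrable lborel p" and P: "integrable lborel P"
  shows "(LINT x|lborel. p x) = 0"
proof -
  define N :: "nat \<Rightarrow> real" where "N n = real (Suc n)" for n
  have Npos: "N n > 0" for n by (simp add: N_def)
  have Ninv: "(\<lambda>n. inverse (N n)) \<longlonglongrightarrow> 0" unfolding N_def by (rule LIMSEQ_inverse_real_of_nat)
  have Nlarge: "\<forall>\<^sub>F n in sequentially. \<bar>x\<bar> \<le> N n" for x
  proof -
    obtain k where "\<bar>x\<bar> < real k" using reals_Archimedean2 by blast
    then show ?thesis by (intro eventually_sequentiallyI[of k]) (simp add: N_def)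
  qed
  define chi :: "nat \<Rightarrow> real \<Rightarrow> real" where "chi n x = 1 - (x / N n)\<^sup>2" for n x
  define dchi :: "nat \<Rightarrow> real \<Rightarrow> real" where "dchi n x = - (2 * x / (N n)\<^sup>2)" for n x
  have cont: "continuous_on S (chi n)" "continuous_on S (dchi n)" for S n
    using Npos[of n] unfolding chi_def dchi_def by (auto intro!: continuous_intros)
  have prim_chi: "prim (\<lambda>x. complex_of_real (dchi n x)) (\<lambda>x. complex_of_real (chi n x))" for n
  proof (rule primI_continuous)
    show "((\<lambda>x. complex_of_real (chi n x)) has_vector_derivative complex_of_real (dchi n x)) (at x)" for x
      unfolding chi_def dchi_def
      by (intro has_vector_derivative_of_real)
         (use Npos[of n] in \<open>auto simp: power_divide power2_eq_square intro!: derivative_eq_intros\<close>)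
  qed (intro continuous_intros cont)
  have [measurable]: "p \<in> borel_measurable borel" using pP by (rule prim_measurable)
  have [measurable]: "chi n \<in> borel_measurable borel" for n
    by (rule borel_measurable_continuous_onI[OF cont(1)])
  have eq: "(LINT x|lborel. indicat_real {-N n..N n} x *\<^sub>R (complex_of_real (chi n x) * p x))
     = - (LINT x|lborel. indicat_real {-N n..N n} x *\<^sub>R (complex_of_real (dchi n x) * P x))" for n
  proof -
    have c: "continuous_on UNIV (\<lambda>x. complex_of_real (chi n x))"
      "continuous_on UNIV (\<lambda>x. complex_of_real (dchi n x) * P x)"
      using prim_continuous[OF pP] by (auto intro!: continuous_intros cont)
    have i: "set_integrable lborel {-N n..N n} (\<lambda>x. complex_of_real (chi n x) * p x)"
      "set_integrable lborel {-N n..N n} (\<lambda>x. complex_of_real (dchi n x) * P x)"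
      using set_integrable_mult_continuous[OF prim_integrable[OF pP] c(1), of "- N n" "N n"]
      by (simp add: mult.commute) (intro borel_integrable_atLeastAtMost' continuous_on_subset[OF c(2)] subset_UNIV)
    have "0 = complex_of_real (chi n (N n)) * P (N n) - complex_of_real (chi n (- N n)) * P (- N n)"
      using Npos[of n] by (simp add: chi_def)
    also have "\<dots> = (LINT x:{-N n..N n}|lborel. complex_of_real (dchi n x) * P x + complex_of_real (chi n x) * p x)"
      by (rule prim_eq[OF prim_mult[OF prim_chi pP]]) (use Npos[of n] in simp)
    also have "\<dots> = (LINT x:{-N n..N n}|lborel. complex_of_real (dchi n x) * P x) + (LINT x:{-N n..N n}|lborel. complex_of_real (chi n x) * p x)"
      by (rule set_integral_add(2)[OF i(2,1)])
    finally show ?thesis by (simp add: set_lebesgue_integral_def eq_neg_iff_add_eq_0 add.commute)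
  qed
  have chi01: "0 \<le> chi n x" "chi n x \<le> 1" if "x \<in> {-N n..N n}" for n x
  proof -
    have "\<bar>x / N n\<bar> \<le> 1" using that Npos[of n] by (simp add: abs_le_iff divide_le_eq)
    then have "(x / N n)\<^sup>2 \<le> 1" by (simp add: abs_square_le_1)
    then show "0 \<le> chi n x" "chi n x \<le> 1" by (simp_all add: chi_def)
  qed
  have lim1: "(\<lambda>n. LINT x|lborel. indicat_real {-N n..N n} x *\<^sub>R (complex_of_real (chi n x) * p x)) \<longlonglongrightarrow> (LINT x|lborel. p x)"
  proof (rule integral_dominated_convergence[where w = "\<lambda>x. norm (p x)"])
    show "AE x in lborel. (\<lambda>n. indicat_real {-N n..N n} x *\<^sub>R (complex_of_real (chi n x) * p x)) \<longlonglongrightarrow> p x"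
    proof (rule AE_I2)
      fix x :: real
      have "(\<lambda>n. 1 - (x * inverse (N n))\<^sup>2) \<longlonglongrightarrow> 1 - (x * 0)\<^sup>2"
        by (intro tendsto_intros Ninv)
      then have "(\<lambda>n. complex_of_real (chi n x) * p x) \<longlonglongrightarrow> complex_of_real 1 * p x"
        unfolding chi_def divide_inverse by (intro tendsto_intros) simp
      then have "(\<lambda>n. complex_of_real (chi n x) * p x) \<longlonglongrightarrow> p x" by simp
      moreover have "\<forall>\<^sub>F n in sequentially. complex_of_real (chi n x) * p x
          = indicat_real {-N n..N n} x *\<^sub>R (complex_of_real (chi n x) * p x)"
        using Nlarge[of x] by eventually_elim (auto simp: abs_le_iff indicator_def)
      ultimately show "(\<lambda>n. indicat_real {-N n..N n} x *\<^sub>R (complex_of_real (chi n x) * p x)) \<longlonglongrightarrow> p x"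
        by (rule Lim_transform_eventually)
    qed
    show "AE x in lborel. norm (indicat_real {-N n..N n} x *\<^sub>R (complex_of_real (chi n x) * p x)) \<le> norm (p x)" for n
      using chi01[of _ n] by (intro AE_I2) (auto simp: indicator_def norm_mult mult_left_le_one_le)
    show "(\<lambda>x. indicat_real {-N n..N n} x *\<^sub>R (complex_of_real (chi n x) * p x)) \<in> borel_measurable lborel" for n
      by measurable
  qed (use p in auto)
  have lim0: "(\<lambda>n. LINT x|lborel. indicat_real {-N n..N n} x *\<^sub>R (complex_of_real (dchi n x) * P x)) \<longlonglongrightarrow> 0"
  proof (rule Lim_null_comparison)
    show "\<forall>\<^sub>F n in sequentially. norm (LINT x|lborel. indicat_real {-N n..N n} x *\<^sub>R (complex_of_real (dchi n x) * P x))
       \<le> 2 * inverse (N n) * (LINT x|lborel. norm (P x))"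
    proof (rule always_eventually, rule allI)
      fix n
      have b: "norm (indicat_real {-N n..N n} x *\<^sub>R (complex_of_real (dchi n x) * P x)) \<le> 2 * inverse (N n) * norm (P x)" for x
      proof (cases "x \<in> {-N n..N n}")
        case True
        then have "2 * \<bar>x\<bar> * inverse ((N n)\<^sup>2) \<le> 2 * N n * inverse ((N n)\<^sup>2)"
          by (intro mult_right_mono) auto
        then have "\<bar>dchi n x\<bar> \<le> 2 * inverse (N n)"
          using Npos[of n] by (simp add: dchi_def abs_mult divide_inverse power2_eq_square)
        then show ?thesis using True by (simp add: norm_mult mult_right_mono)
      qed (use Npos[of n] in simp)
      have i: "integrable lborel (\<lambda>x. 2 * inverse (N n) * norm (P x))" using P by simp
      have "norm (LINT x|lborel. indicat_real {-N n..N n} x *\<^sub>R (complex_of_real (dchi n x) * P x))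
        \<le> (LINT x|lborel. 2 * inverse (N n) * norm (P x))"
        by (intro integral_norm_bound[THEN order_trans] integral_mono' i b) (use Npos[of n] in simp)
      then show "norm (LINT x|lborel. indicat_real {-N n..N n} x *\<^sub>R (complex_of_real (dchi n x) * P x))
       \<le> 2 * inverse (N n) * (LINT x|lborel. norm (P x))" by simp
    qed
    have "(\<lambda>n. 2 * inverse (N n) * (LINT x|lborel. norm (P x))) \<longlonglongrightarrow> 2 * 0 * (LINT x|lborel. norm (P x))"
      by (intro tendsto_intros Ninv)
    then show "(\<lambda>n. 2 * inverse (N n) * (LINT x|lborel. norm (P x))) \<longlonglongrightarrow> 0" by simp
  qed
  from tendsto_minus[OF lim0] lim1 show ?thesis unfolding eq
    using LIMSEQ_unique by fastforce
qed

text \<open>Intervals form an intersection-stable generator of the Borel sets, so the integrals over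
  all Borel sets vanish. Cutting off to \<open>{-N..N}\<close> first makes the function
  integrable.\<close>

lemma AE_eq_0_if_interval_integrals_0:
  fixes k :: "real \<Rightarrow> complex"
  assumes k: "\<And>a b. set_integrable lborel {a..b} k" and z: "\<And>a b. a \<le> b \<Longrightarrow> (LINT x:{a..b}|lborel. k x) = 0"
  shows "AE x in lborel. k x = 0"
proof -
  have loc: "AE x in lborel. indicat_real {-real N..real N} x *\<^sub>R k x = 0" for N :: nat
  proof -
    define f where "f = (\<lambda>x. indicat_real {-real N..real N} x *\<^sub>R k x)"
    have f: "integrable lborel f" using k unfolding f_def set_integrable_def by blast
    have fA: "set_integrable lborel A f" if "A \<in> sets borel" for A
      unfolding set_integrable_def by (intro integrable_mult_indicator f) (use that in simp)
    have "(LINT x:A|lborel. f x) = 0" if "A \<in> sets borel" for A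
    proof -
      let ?G = "range (\<lambda>(a, b). {a..b::real})"
      have sb: "sets borel = sigma_sets UNIV ?G"
        unfolding borel_eq_atLeastAtMost by (simp add: sets_measure_of)
      have A: "A \<in> sigma_sets UNIV ?G" using that unfolding sb .
      have stable: "Int_stable ?G"
        by (auto simp: Int_stable_def)
      have pow: "?G \<subseteq> Pow UNIV" by simp
      have bas: "(LINT x:{a..b}|lborel. f x) = 0" for a b
      proof -
        have "(LINT x:{a..b}|lborel. f x) = (LINT x:{max a (-real N)..min b (real N)}|lborel. k x)"
          unfolding set_lebesgue_integral_def f_def
          by (intro Bochner_Integration.integral_cong) (auto simp: indicator_def)
        also have "\<dots> = 0"
          by (cases "max a (-real N) \<le> min b (real N)", rule z, assumption) (simp add: set_lebesgue_integral_def)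
        finally show ?thesis .
      qed
      have tot: "(LINT x|lborel. f x) = 0"
        using z[of "-real N" "real N"] unfolding f_def set_lebesgue_integral_def by simp
      show ?thesis
        using A
      proof (induction rule: sigma_sets_induct_disjoint[OF stable pow, consumes 1, case_names basic empty compl union])
        case (basic B) then show ?case using bas by auto
      next
        case empty then show ?case by (simp add: set_lebesgue_integral_def)
      next
        case (compl B)
        then have B: "B \<in> sets borel" "UNIV - B \<in> sets borel" unfolding sb by (auto intro: sigma_sets.intros)
        have "(LINT x:B \<union> (UNIV - B)|lborel. f x) = (LINT x:B|lborel. f x) + (LINT x:UNIV - B|lborel. f x)"
          by (intro set_integral_Un fA B) auto
        with compl(2) tot show ?case by (simp add: set_lebesgue_integral_def)
      next
        case (union B)
        then have B: "\<And>i. B i \<in> sets borel" unfolding sb by (auto intro: sigma_sets.intros)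
        have "(LINT x:(\<Union>i. B i)|lborel. f x) = (\<Sum>i. (LINT x:(B i)|lborel. f x))"
        proof (rule lebesgue_integral_countable_add)
          show "set_integrable lborel (\<Union>i. B i) f" by (rule fA) (use B in auto)
        qed (use B union(1) in \<open>auto simp: disjoint_family_on_def\<close>)
        with union(3) show ?case by simp
      qed
    qed
    then have "AE x in lborel. f x = 0" by (intro sigma_finite_measure.density_zero[OF sigma_finite_lborel f]) simp
    then show ?thesis by (simp add: f_def)
  qed
  then have "AE x in lborel. \<forall>N. indicat_real {-real N..real N} x *\<^sub>R k x = 0"
    unfolding AE_all_countable using loc by blast
  then show ?thesis
  proof eventually_elim
    case (elim x)
    obtain N where "\<bar>x\<bar> < real N" using reals_Archimedean2 by blast
    with elim[rule_format, of N] show ?case by (auto simp: indicator_def split: if_splits)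
  qed
qed

section \<open>Test functions\<close>

text \<open>Smooth functions, for \<open>c > 0\<close>, that vanish to infinite order at 0. The
  powers of \<open>inverse t\<close> are included because differentiation produces them.\<close>

definition flat_exp :: "nat \<Rightarrow> real \<Rightarrow> real \<Rightarrow> real" where
  "flat_exp k c t = (if t > 0 then inverse t ^ k * exp (- c * inverse t) else 0)"

text \<open>Closed under differentiation, so that membership alone yields differentiability of all
  iterated derivatives without a formula for them.\<close>

inductive_set flat_algebra :: "(real \<Rightarrow> real) set" where
  left: "c > 0 \<Longrightarrow> (\<lambda>x. flat_exp k c (x - a)) \<in> flat_algebra"
| right: "c > 0 \<Longrightarrow> (\<lambda>x. flat_exp k c (a - x)) \<in> flat_algebra"
| add: "f \<in> flat_algebra \<Longrightarrow> g \<in> flat_algebra \<Longrightarrow> (\<lambda>x. f x + g x) \<in> flat_algebra"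
| mult: "f \<in> flat_algebra \<Longrightarrow> g \<in> flat_algebra \<Longrightarrow> (\<lambda>x. f x * g x) \<in> flat_algebra"
| scale: "f \<in> flat_algebra \<Longrightarrow> (\<lambda>x. r * f x) \<in> flat_algebra"

text \<open>The function is the difference quotient of \<open>flat_exp k c\<close> at 0; the
  substitution \<open>x = inverse t\<close> reduces the limit to the decay of
  \<open>x ^ Suc k / exp x\<close>.\<close>

lemma flat_exp_tendsto_0:
  assumes "c > 0"
  shows "((\<lambda>t. inverse t * flat_exp k c t) \<longlongrightarrow> 0) (at 0)"
proof -
  have "((\<lambda>x::real. x ^ Suc k / exp x) \<longlongrightarrow> 0) at_top" by (rule tendsto_power_div_exp_0)
  then have "((\<lambda>x. (c * x) ^ Suc k / exp (c * x)) \<longlongrightarrow> 0) at_top"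
    by (rule filterlim_compose) (intro filterlim_tendsto_pos_mult_at_top[OF tendsto_const] assms filterlim_ident)
  then have "((\<lambda>x. inverse (c ^ Suc k) * ((c * x) ^ Suc k / exp (c * x))) \<longlongrightarrow> inverse (c ^ Suc k) * 0) at_top"
    by (intro tendsto_intros)
  then have "((\<lambda>x. x ^ Suc k * exp (- c * x)) \<longlongrightarrow> 0) at_top"
    using assms by (simp add: power_mult_distrib exp_minus field_simps)
  then have r: "((\<lambda>t. inverse t ^ Suc k * exp (- c * inverse t)) \<longlongrightarrow> 0) (at_right 0)"
    by (rule filterlim_compose) (rule filterlim_inverse_at_top_right)
  have "((\<lambda>t. inverse t * flat_exp k c t) \<longlongrightarrow> 0) (at_right 0)"
    by (rule Lim_transform_eventually[OF r])
       (auto simp: flat_exp_def eventually_at_right_field intro: exI[of _ 1])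
  moreover have "((\<lambda>t. inverse t * flat_exp k c t) \<longlongrightarrow> 0) (at_left 0)"
    by (rule Lim_transform_eventually[OF tendsto_const])
       (auto simp: flat_exp_def eventually_at_left_field intro: exI[of _ "-1"])
  ultimately show ?thesis by (simp add: filterlim_split_at)
qed

lemma flat_exp_deriv:
  assumes c: "c > 0"
  shows "(flat_exp k c has_real_derivative (c * flat_exp (k + 2) c t - real k * flat_exp (k + 1) c t)) (at t)"
proof -
  consider "t > 0" | "t < 0" | "t = 0" by linarith
  then show ?thesis
  proof cases
    case 1
    have "((\<lambda>t. inverse t ^ k * exp (- c * inverse t)) has_real_derivative
        real k * (inverse t ^ (k - 1) * - (inverse t)\<^sup>2) * exp (- c * inverse t)
        + inverse t ^ k * (exp (- c * inverse t) * (c * (inverse t)\<^sup>2))) (at t)"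
      using 1 by (auto intro!: derivative_eq_intros simp: power2_eq_square)
    also have "real k * (inverse t ^ (k - 1) * - (inverse t)\<^sup>2) * exp (- c * inverse t)
        + inverse t ^ k * (exp (- c * inverse t) * (c * (inverse t)\<^sup>2))
        = c * flat_exp (k + 2) c t - real k * flat_exp (k + 1) c t"
      unfolding flat_exp_def using 1 by (cases k) (simp_all add: power2_eq_square power_add algebra_simps)
    finally have D: "((\<lambda>t. inverse t ^ k * exp (- c * inverse t)) has_real_derivative
        (c * flat_exp (k + 2) c t - real k * flat_exp (k + 1) c t)) (at t)" .
    have "\<forall>\<^sub>F s in nhds t. flat_exp k c s = inverse s ^ k * exp (- c * inverse s)"
      using eventually_nhds_in_open[of "{0<..}" t] 1 by (auto simp: flat_exp_def elim!: eventually_mono)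
    from DERIV_cong_ev[OF refl this refl] D show ?thesis by blast
  next
    case 2
    have "((\<lambda>t. 0) has_real_derivative 0) (at t)" by simp
    moreover have "c * flat_exp (k + 2) c t - real k * flat_exp (k + 1) c t = 0"
      using 2 by (simp add: flat_exp_def)
    moreover have "\<forall>\<^sub>F s in nhds t. flat_exp k c s = 0"
      using eventually_nhds_in_open[of "{..<0}" t] 2 by (auto simp: flat_exp_def elim!: eventually_mono)
    ultimately show ?thesis using DERIV_cong_ev[OF refl _ refl, of "flat_exp k c" "\<lambda>_. 0" t] by simp
  next
    case 3
    have "((\<lambda>h. (flat_exp k c (0 + h) - flat_exp k c 0) / h) \<longlongrightarrow> 0) (at 0)"
      using flat_exp_tendsto_0[OF c, of k] by (simp add: flat_exp_def[of k c 0] divide_inverse mult.commute)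
    then have "(flat_exp k c has_real_derivative 0) (at 0)" by (simp add: DERIV_def)
    moreover have "c * flat_exp (k + 2) c 0 - real k * flat_exp (k + 1) c 0 = 0" by (simp add: flat_exp_def)
    ultimately show ?thesis using 3 by simp
  qed
qed

lemma flat_algebra_deriv:
  "f \<in> flat_algebra \<Longrightarrow> \<exists>g\<in>flat_algebra. \<forall>x. (f has_real_derivative g x) (at x)"
proof (induction rule: flat_algebra.induct)
  case (left c k a)
  have a: "(\<lambda>x. c * flat_exp (k + 2) c (x - a) + (- real k) * flat_exp (k + 1) c (x - a)) \<in> flat_algebra"
    by (intro flat_algebra.intros left)
  have b: "((\<lambda>x. flat_exp k c (x - a)) has_real_derivative
      c * flat_exp (k + 2) c (x - a) + (- real k) * flat_exp (k + 1) c (x - a)) (at x)" for x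
    by (rule DERIV_chain'[OF _ flat_exp_deriv[OF left], THEN DERIV_cong]) (auto intro!: derivative_eq_intros)
  show ?case by (rule bexI[OF allI a]) (rule b)
next
  case (right c k a)
  have a: "(\<lambda>x. (-1) * (c * flat_exp (k + 2) c (a - x) + (- real k) * flat_exp (k + 1) c (a - x))) \<in> flat_algebra"
    by (intro flat_algebra.intros right)
  have b: "((\<lambda>x. flat_exp k c (a - x)) has_real_derivative
      (-1) * (c * flat_exp (k + 2) c (a - x) + (- real k) * flat_exp (k + 1) c (a - x))) (at x)" for x
    by (rule DERIV_chain'[where f = "\<lambda>x. a - x" and D = "-1", OF _ flat_exp_deriv[OF right], THEN DERIV_cong])
       (auto intro!: derivative_eq_intros)
  show ?case by (rule bexI[OF allI a]) (rule b)
next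
  case (add f g)
  then obtain f' g' where "f' \<in> flat_algebra" "g' \<in> flat_algebra"
    "\<And>x. (f has_real_derivative f' x) (at x)" "\<And>x. (g has_real_derivative g' x) (at x)" by blast
  then show ?case by (intro bexI[of _ "\<lambda>x. f' x + g' x"] allI DERIV_add flat_algebra.add)
next
  case (mult f g)
  then obtain f' g' where *: "f' \<in> flat_algebra" "g' \<in> flat_algebra"
    "\<And>x. (f has_real_derivative f' x) (at x)" "\<And>x. (g has_real_derivative g' x) (at x)" by blast
  have "(\<lambda>x. f' x * g x + g' x * f x) \<in> flat_algebra"
    using * mult by (intro flat_algebra.add flat_algebra.mult)
  then show ?case by (rule bexI[rotated]) (intro allI DERIV_mult *)
next
  case (scale f r)
  then obtain f' where "f' \<in> flat_algebra" "\<And>x. (f has_real_derivative f' x) (at x)" by blast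
  then show ?case by (intro bexI[of _ "\<lambda>x. r * f' x"] allI DERIV_cmult flat_algebra.scale)
qed

lemma funpow_vector_derivative_flat_algebra:
  "f \<in> flat_algebra \<Longrightarrow> ((\<lambda>g x. vector_derivative g (at x)) ^^ n) f \<in> flat_algebra"
proof (induction n arbitrary: f)
  case (Suc n)
  obtain g where g: "g \<in> flat_algebra" "\<And>x. (f has_real_derivative g x) (at x)"
    using flat_algebra_deriv[OF Suc.prems] by blast
  have "(\<lambda>x. vector_derivative f (at x)) = g"
    using g(2) by (auto simp: has_real_derivative_iff_has_vector_derivative intro: vector_derivative_at)
  with Suc.IH[OF g(1)] show ?case by (simp only: funpow_Suc_right comp_def)
qed simp

lemma test_functionsI_support:
  assumes "\<And>n x. ((\<lambda>g x. vector_derivative g (at x)) ^^ n) \<phi> differentiable (at x)"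
    and "\<And>x. \<phi> x \<noteq> 0 \<Longrightarrow> x \<in> {a..b::real}"
  shows "\<phi> \<in> test_functions"
proof -
  have "{x. \<phi> x \<noteq> 0} \<subseteq> {a..b}" using assms(2) by auto
  then have "bounded {x. \<phi> x \<noteq> 0}" by (rule bounded_subset[OF bounded_closed_interval])
  then have "compact (closure {x. \<phi> x \<noteq> 0})" by (simp only: compact_closure)
  with assms(1) show ?thesis by (simp add: test_functions_def)
qed

lemma flat_algebra_continuous: "f \<in> flat_algebra \<Longrightarrow> continuous_on S f"
  using flat_algebra_deriv by (metis DERIV_isCont continuous_at_imp_continuous_on)

text \<open>The zero mean makes the primitive vanish to the right of the support as well. This
  supplies the derivatives of test functions that du Bois-Reymond's argument uses.\<close>

lemma primitive_test_function:
  assumes \<beta>: "\<beta> \<in> flat_algebra" and supp: "\<And>x. x \<notin> {a..b} \<Longrightarrow> \<beta> x = 0"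
    and int: "(LINT x|lborel. \<beta> x) = 0"
  shows "\<exists>\<phi>\<in>test_functions. deriv \<phi> = \<beta>"
proof -
  \<comment> \<open>Starting at \<open>a - 1\<close> puts \<open>a\<close> itself into the interior
    of an interval on which the fundamental theorem is applied.\<close>
  define \<phi> where "\<phi> x = integral {a - 1..x} \<beta>" for x
  have c: "continuous_on S \<beta>" for S by (rule flat_algebra_continuous[OF \<beta>])
  have left: "\<phi> x = 0" if "x < a" for x
  proof -
    have "\<phi> x = integral {a - 1..x} (\<lambda>x. 0)"
      unfolding \<phi>_def by (intro integral_cong supp) (use that in auto)
    then show ?thesis by simp
  qed
  have right: "\<phi> x = 0" if "x > b" for x
  proof -
    have "\<phi> x = (LINT x:{a - 1..x}|lborel. \<beta> x)"
      unfolding \<phi>_def by (intro set_borel_integral_eq_integral(2)[symmetric] borel_integrable_atLeastAtMost' c)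
    also have "\<dots> = (LINT x|lborel. \<beta> x)"
      unfolding set_lebesgue_integral_def
    proof (intro Bochner_Integration.integral_cong refl)
      fix y show "indicat_real {a - 1..x} y *\<^sub>R \<beta> y = \<beta> y"
        using supp[of y] that by (cases "y \<in> {a..b}") (auto simp: indicator_def)
    qed
    finally show ?thesis using int by simp
  qed
  have D: "(\<phi> has_real_derivative \<beta> x) (at x)" for x
  proof (cases "x < a")
    case True
    have "\<forall>\<^sub>F s in nhds x. \<phi> s = 0"
      using eventually_nhds_in_open[of "{..<a}" x] True left by (auto elim!: eventually_mono)
    then have "(\<phi> has_real_derivative 0) (at x) \<longleftrightarrow> ((\<lambda>s. 0) has_real_derivative 0) (at x)"
      by (intro DERIV_cong_ev refl)
    with supp[of x] True show ?thesis by simp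
  next
    case False
    have "((\<lambda>u. integral {a - 1..u} \<beta>) has_real_derivative \<beta> x) (at x within {a - 1..x + 1})"
      by (rule integral_has_real_derivative[OF c]) (use False in auto)
    then show ?thesis
      using False at_within_interior[of x "{a - 1..x + 1}"] unfolding \<phi>_def[abs_def] by simp
  qed
  have vd: "(\<lambda>x. vector_derivative \<phi> (at x)) = \<beta>"
    using D by (auto simp: has_real_derivative_iff_has_vector_derivative intro: vector_derivative_at)
  have "((\<lambda>g x. vector_derivative g (at x)) ^^ n) \<phi> differentiable (at x)" for n x
  proof (cases n)
    case 0 then show ?thesis using D[of x] by (auto simp: real_differentiable_def)
  next
    case (Suc k)
    then have "((\<lambda>g x. vector_derivative g (at x)) ^^ n) \<phi> = ((\<lambda>g x. vector_derivative g (at x)) ^^ k) \<beta>"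
      by (simp only: funpow_Suc_right comp_def vd)
    with flat_algebra_deriv[OF funpow_vector_derivative_flat_algebra[OF \<beta>, of k]]
    show ?thesis by (auto simp: real_differentiable_def)
  qed
  moreover have "\<phi> x \<noteq> 0 \<Longrightarrow> x \<in> {a..b}" for x using left right by (force simp: not_less[symmetric])
  ultimately have "\<phi> \<in> test_functions" by (rule test_functionsI_support)
  moreover have "deriv \<phi> = \<beta>" using D by (auto intro: DERIV_imp_deriv)
  ultimately show ?thesis by blast
qed

text \<open>The parameter \<open>inverse (Suc n)\<close> tends to 0, so that the bumps tend
  pointwise to the indicator function of \<open>{a<..<b}\<close> while their support stays
  fixed.\<close>

definition bump :: "nat \<Rightarrow> real \<Rightarrow> real \<Rightarrow> real \<Rightarrow> real" where
  "bump n a b x = flat_exp 0 (inverse (Suc n)) (x - a) * flat_exp 0 (inverse (Suc n)) (b - x)"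

lemma bump_flat_algebra: "bump n a b \<in> flat_algebra"
proof -
  have "(\<lambda>x. flat_exp 0 (inverse (Suc n)) (x - a) * flat_exp 0 (inverse (Suc n)) (b - x)) \<in> flat_algebra"
    by (intro flat_algebra.intros) auto
  then show ?thesis by (simp add: bump_def[abs_def])
qed

lemma bump_support: "x \<notin> {a<..<b} \<Longrightarrow> bump n a b x = 0"
  by (auto simp: bump_def flat_exp_def)

lemma bump_bounds: "0 \<le> bump n a b x" "bump n a b x \<le> 1"
  unfolding bump_def flat_exp_def by (auto intro!: mult_le_one)

lemma bump_tendsto: "(\<lambda>n. bump n a b x) \<longlonglongrightarrow> indicat_real {a<..<b} x"
proof (cases "x \<in> {a<..<b}")
  case True
  have "(\<lambda>n. exp (- inverse (Suc n) * inverse (x - a)) * exp (- inverse (Suc n) * inverse (b - x)))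
     \<longlonglongrightarrow> exp (- 0 * inverse (x - a)) * exp (- 0 * inverse (b - x))"
    by (intro tendsto_intros LIMSEQ_inverse_real_of_nat)
  then show ?thesis using True by (simp add: bump_def flat_exp_def)
qed (simp add: bump_support)

lemma bump_integral_tendsto:
  fixes k :: "real \<Rightarrow> complex"
  assumes k: "set_integrable lborel {a..b} k" "k \<in> borel_measurable borel"
  shows "(\<lambda>n. LINT x|lborel. bump n a b x *\<^sub>R k x) \<longlonglongrightarrow> (LINT x:{a..b}|lborel. k x)"
    "integrable lborel (\<lambda>x. bump n a b x *\<^sub>R k x)"
proof -
  have mes: "bump n a b \<in> borel_measurable borel" for n
    by (rule borel_measurable_continuous_onI[OF flat_algebra_continuous[OF bump_flat_algebra]])
  have w: "integrable lborel (\<lambda>x. norm (indicat_real {a..b} x *\<^sub>R k x))"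
    using k(1) unfolding set_integrable_def by (rule integrable_norm)
  have b: "norm (bump n a b x *\<^sub>R k x) \<le> norm (indicat_real {a..b} x *\<^sub>R k x)" for n x
    using bump_bounds[of n a b x] bump_support[of x a b n]
    by (cases "x \<in> {a<..<b}") (auto simp: indicator_def mult_left_le_one_le)
  have m: "(\<lambda>x. bump n a b x *\<^sub>R k x) \<in> borel_measurable lborel" for n
    using mes k(2) by (auto intro: borel_measurable_scaleR)
  show "integrable lborel (\<lambda>x. bump n a b x *\<^sub>R k x)"
    by (rule Bochner_Integration.integrable_bound[OF w m]) (use b in simp)
  have "(\<lambda>n. LINT x|lborel. bump n a b x *\<^sub>R k x) \<longlonglongrightarrow> (LINT x|lborel. indicat_real {a..b} x *\<^sub>R k x)"
  proof (rule integral_dominated_convergence[OF _ m w])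
    show "AE x in lborel. (\<lambda>n. bump n a b x *\<^sub>R k x) \<longlonglongrightarrow> indicat_real {a..b} x *\<^sub>R k x"
      using AE_lborel_singleton[of a] AE_lborel_singleton[of b]
    proof eventually_elim
      case (elim x)
      then have "indicat_real {a<..<b} x = indicat_real {a..b} x" by (auto simp: indicator_def)
      then show ?case using tendsto_scaleR[OF bump_tendsto[of a b x] tendsto_const[of "k x"]] by simp
    qed
  qed (use b k in \<open>auto intro!: borel_measurable_scaleR\<close>)
  then show "(\<lambda>n. LINT x|lborel. bump n a b x *\<^sub>R k x) \<longlonglongrightarrow> (LINT x:{a..b}|lborel. k x)"
    by (simp add: set_lebesgue_integral_def)
qed

lemma test_function_facts:
  fixes \<phi> :: "real \<Rightarrow> 'b::real_normed_vector"
  assumes "\<phi> \<in> test_functions"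
  defines "\<phi>' \<equiv> \<lambda>x. vector_derivative \<phi> (at x)"
  shows "(\<phi> has_vector_derivative \<phi>' x) (at x)" "continuous_on S \<phi>" "continuous_on S \<phi>'"
    "\<phi>' \<in> test_functions" "\<exists>R>0. \<forall>x. \<bar>x\<bar> \<ge> R \<longrightarrow> \<phi> x = 0 \<and> \<phi>' x = 0"
proof -
  have d: "((\<lambda>g x. vector_derivative g (at x)) ^^ n) \<phi> differentiable (at x)" for n x
    using assms(1) by (simp add: test_functions_def)
  have cpt: "compact (closure {x. \<phi> x \<noteq> 0})"
    using assms(1) by (simp add: test_functions_def)
  have d': "((\<lambda>g x. vector_derivative g (at x)) ^^ n) \<phi>' differentiable (at x)" for n x
    using d[of "Suc n" x] unfolding funpow_Suc_right comp_def \<phi>'_def by simp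
  have hv: "(\<phi> has_vector_derivative \<phi>' x) (at x)" for x
    using d[of 0 x] vector_derivative_works unfolding \<phi>'_def by auto
  then show "(\<phi> has_vector_derivative \<phi>' x) (at x)" .
  show "continuous_on S \<phi>"
    using d[of 0] by (auto intro!: continuous_at_imp_continuous_on differentiable_imp_continuous_within)
  show "continuous_on S \<phi>'"
    using d'[of 0] by (auto intro!: continuous_at_imp_continuous_on differentiable_imp_continuous_within)
  obtain R where R: "R > 0" "\<And>x. \<phi> x \<noteq> 0 \<Longrightarrow> \<bar>x\<bar> \<le> R"
    using compact_imp_bounded[OF cpt] closure_subset[of "{x. \<phi> x \<noteq> 0}"] unfolding bounded_pos by fastforce
  have z: "\<phi>' x = 0" if "\<bar>x\<bar> > R" for x
  proof -
    have "((\<lambda>s. 0) has_vector_derivative 0) (at x)" by simp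
    then have "(\<phi> has_vector_derivative 0) (at x)"
    proof (rule has_vector_derivative_transform_within_open[of _ _ _ "{s. \<bar>s\<bar> > R}"])
      show "open {s. \<bar>s\<bar> > R}" by (intro open_Collect_less continuous_intros)
    qed (use that R(2) in \<open>auto simp: not_le[symmetric]\<close>)
    then show ?thesis unfolding \<phi>'_def by (rule vector_derivative_at)
  qed
  show "\<exists>R>0. \<forall>x. \<bar>x\<bar> \<ge> R \<longrightarrow> \<phi> x = 0 \<and> \<phi>' x = 0"
    using R z by (intro exI[of _ "R + 1"]) force
  show "\<phi>' \<in> test_functions"
    by (rule test_functionsI_support[of _ "-R" R, OF d']) (use z in \<open>force simp: not_less[symmetric]\<close>)
qed

lemma test_function_integral_by_parts:
  fixes \<phi> :: "real \<Rightarrow> real"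
  assumes pr: "prim h G" and \<phi>: "\<phi> \<in> test_functions"
  shows "integrable lborel (\<lambda>x. deriv \<phi> x *\<^sub>R G x)" "integrable lborel (\<lambda>x. \<phi> x *\<^sub>R h x)"
    "(LINT x|lborel. deriv \<phi> x *\<^sub>R G x) = - (LINT x|lborel. \<phi> x *\<^sub>R h x)"
proof -
  let ?d = "\<lambda>x. vector_derivative \<phi> (at x)"
  note facts = test_function_facts[OF \<phi>]
  have d: "deriv \<phi> = ?d"
    by (rule ext, rule DERIV_imp_deriv) (simp add: has_real_derivative_iff_has_vector_derivative facts(1))
  obtain R where R: "R > 0" "\<And>x. \<bar>x\<bar> \<ge> R \<Longrightarrow> \<phi> x = 0" "\<And>x. \<bar>x\<bar> \<ge> R \<Longrightarrow> ?d x = 0" using facts(5) by blast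
  have p\<phi>: "prim (\<lambda>x. complex_of_real (?d x)) (\<lambda>x. complex_of_real (\<phi> x))"
    by (intro primI_continuous has_vector_derivative_of_real continuous_on_of_real facts(3))
       (simp add: has_real_derivative_iff_has_vector_derivative facts(1))
  have c: "continuous_on S (\<lambda>x. complex_of_real (?d x) * G x)" "continuous_on S (\<lambda>x. complex_of_real (\<phi> x))" for S
    by (intro continuous_intros facts prim_continuous[OF pr])+
  have i: "set_integrable lborel {-R..R} (\<lambda>x. complex_of_real (?d x) * G x)"
    "set_integrable lborel {-R..R} (\<lambda>x. complex_of_real (\<phi> x) * h x)"
    using borel_integrable_atLeastAtMost'[OF c(1)]
      set_integrable_mult_continuous[OF prim_integrable[OF pr] c(2), of "-R" R] by (simp_all add: mult.commute)
  have e: "indicat_real {-R..R} x *\<^sub>R (complex_of_real (?d x) * G x) = ?d x *\<^sub>R G x"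
    "indicat_real {-R..R} x *\<^sub>R (complex_of_real (\<phi> x) * h x) = \<phi> x *\<^sub>R h x" for x
    using R(2,3)[of x] by (cases "\<bar>x\<bar> \<ge> R"; auto simp: indicator_def scaleR_conv_of_real)+
  show "integrable lborel (\<lambda>x. deriv \<phi> x *\<^sub>R G x)" "integrable lborel (\<lambda>x. \<phi> x *\<^sub>R h x)"
    using i unfolding set_integrable_def e d by simp_all
  have "0 = complex_of_real (\<phi> R) * G R - complex_of_real (\<phi> (- R)) * G (- R)"
    using R by simp
  also have "\<dots> = (LINT x:{-R..R}|lborel. complex_of_real (?d x) * G x + complex_of_real (\<phi> x) * h x)"
    by (rule prim_eq[OF prim_mult[OF p\<phi> pr]]) (use R in simp)
  also have "\<dots> = (LINT x:{-R..R}|lborel. complex_of_real (?d x) * G x) + (LINT x:{-R..R}|lborel. complex_of_real (\<phi> x) * h x)"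
    by (rule set_integral_add(2)[OF i])
  finally show "(LINT x|lborel. deriv \<phi> x *\<^sub>R G x) = - (LINT x|lborel. \<phi> x *\<^sub>R h x)"
    unfolding set_lebesgue_integral_def e d by (simp add: eq_neg_iff_add_eq_0)
qed

lemma prim_exists:
  assumes "h \<in> borel_measurable borel" "\<And>a b. set_integrable lborel {a..b} h"
  shows "\<exists>G. prim h G"
proof -
  define G where "G x = (if 0 \<le> x then LINT t:{0..x}|lborel. h t else - (LINT t:{x..0}|lborel. h t))" for x
  have split: "(LINT t:{a..c}|lborel. h t) = (LINT t:{a..b}|lborel. h t) + (LINT t:{b..c}|lborel. h t)"
    if "a \<le> b" "b \<le> c" for a b c
  proof -
    have "(LINT t:{a..b} \<union> {b..c}|lborel. h t) = (LINT t:{a..b}|lborel. h t) + (LINT t:{b..c}|lborel. h t)"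
      by (rule set_integral_Un_AE) (use AE_lborel_singleton[of b] assms(2) in \<open>auto elim!: eventually_mono\<close>)
    with that show ?thesis by (simp add: ivl_disj_un_two_touch)
  qed
  have "G b - G a = (LINT t:{a..b}|lborel. h t)" if "a \<le> b" for a b
    using split[of a b 0] split[of a 0 b] split[of 0 a b] that by (auto simp: G_def)
  then show ?thesis using assms by (auto simp: prim_def)
qed

text \<open>Subtract a primitive \<open>G\<close> of \<open>h\<close>: the difference
  \<open>k = g - G\<close> is annihilated by every derivative of a test function. Differences of
  suitably scaled bumps are such derivatives; letting the bumps tend to indicator functions shows
  that \<open>k\<close> is almost everywhere a constant \<open>\<kappa>\<close>.\<close>

lemma du_Bois_Reymond:
  fixes g h :: "real \<Rightarrow> complex"
  assumes g: "g \<in> borel_measurable borel" "\<And>a b. set_integrable lborel {a..b} g"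
    and h: "h \<in> borel_measurable borel" "\<And>a b. set_integrable lborel {a..b} h"
    and weak: "\<And>\<phi>::real \<Rightarrow> real. \<phi> \<in> test_functions \<Longrightarrow>
      (LINT x|lborel. deriv \<phi> x *\<^sub>R g x) = - (LINT x|lborel. \<phi> x *\<^sub>R h x)"
  shows "\<exists>F. prim h F \<and> (AE x in lborel. g x = F x)"
proof -
  obtain G where G: "prim h G" using prim_exists[OF h] by blast
  have Gi: "set_integrable lborel {a..b} G" for a b
    by (rule borel_integrable_atLeastAtMost'[OF prim_continuous[OF G]])
  define k where "k = (\<lambda>x. g x - G x)"
  have k: "k \<in> borel_measurable borel" "\<And>a b. set_integrable lborel {a..b} k"
    unfolding k_def using g prim_borel[OF G] Gi by (auto intro!: borel_measurable_diff set_integral_diff)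
  have bumps: "(LINT x|lborel. bump n 0 1 x) *\<^sub>R (LINT x|lborel. bump n a b x *\<^sub>R k x)
      = (LINT x|lborel. bump n a b x) *\<^sub>R (LINT x|lborel. bump n 0 1 x *\<^sub>R k x)" for n a b
  proof -
    define I where "I = (LINT x|lborel. bump n 0 1 x)"
    define J where "J = (LINT x|lborel. bump n a b x)"
    have int1: "integrable lborel (bump n c d)" for c d
    proof -
      have "integrable lborel (\<lambda>x. bump n c d x *\<^sub>R (1::complex))"
        by (rule bump_integral_tendsto(2)) (auto intro: borel_integrable_atLeastAtMost')
      from integrable_Re[OF this] show ?thesis by simp
    qed
    \<comment> \<open>The combination of the two bumps with mean value zero; by
      \<open>primitive_test_function\<close> it is the derivative of a test function.\<close>
    define \<beta> where "\<beta> x = I * bump n a b x + (- J) * bump n 0 1 x" for x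
    have fl: "\<beta> \<in> flat_algebra"
      unfolding \<beta>_def[abs_def] by (intro flat_algebra.intros bump_flat_algebra)
    have supp: "\<beta> x = 0" if "x \<notin> {min a 0..max b 1}" for x
      unfolding \<beta>_def by (subst (1 2) bump_support) (use that in auto)
    have int: "(LINT x|lborel. \<beta> x) = 0"
      unfolding \<beta>_def using int1 by (simp add: I_def J_def)
    obtain \<phi> where \<phi>: "\<phi> \<in> test_functions" "deriv \<phi> = \<beta>"
      using primitive_test_function[OF fl supp int] by blast
    have ig: "integrable lborel (\<lambda>x. \<beta> x *\<^sub>R g x)"
    proof -
      have "integrable lborel (\<lambda>x. I *\<^sub>R (bump n a b x *\<^sub>R g x) + (- J) *\<^sub>R (bump n 0 1 x *\<^sub>R g x))"
        by (intro Bochner_Integration.integrable_add integrable_scaleR_right bump_integral_tendsto(2) g)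
      then show ?thesis by (simp add: \<beta>_def algebra_simps)
    qed
    have "(LINT x|lborel. \<beta> x *\<^sub>R k x) = (LINT x|lborel. \<beta> x *\<^sub>R g x) - (LINT x|lborel. \<beta> x *\<^sub>R G x)"
      using ig test_function_integral_by_parts(1)[OF G \<phi>(1)] by (simp add: k_def scaleR_diff_right \<phi>(2))
    also have "\<dots> = 0"
      using weak[OF \<phi>(1)] test_function_integral_by_parts(3)[OF G \<phi>(1)] by (simp add: \<phi>(2))
    finally have "0 = (LINT x|lborel. \<beta> x *\<^sub>R k x)" ..
    also have "\<dots> = (LINT x|lborel. I *\<^sub>R (bump n a b x *\<^sub>R k x) - J *\<^sub>R (bump n 0 1 x *\<^sub>R k x))"
      by (intro Bochner_Integration.integral_cong) (auto simp: \<beta>_def algebra_simps)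
    also have "\<dots> = I *\<^sub>R (LINT x|lborel. bump n a b x *\<^sub>R k x) - J *\<^sub>R (LINT x|lborel. bump n 0 1 x *\<^sub>R k x)"
      by (subst Bochner_Integration.integral_diff)
        (intro integrable_scaleR_right bump_integral_tendsto(2)[OF k(2) k(1)], intro integrable_scaleR_right bump_integral_tendsto(2)[OF k(2) k(1)], simp only: integral_scaleR_right)
    finally show ?thesis unfolding I_def J_def by simp
  qed
  have lim1: "(\<lambda>n. LINT x|lborel. bump n a b x) \<longlonglongrightarrow> b - a" if "a \<le> b" for a b
  proof -
    have "(\<lambda>n. LINT x|lborel. bump n a b x *\<^sub>R (1::complex)) \<longlonglongrightarrow> (LINT x:{a..b}|lborel. 1)"
      by (rule bump_integral_tendsto(1)) (auto intro: borel_integrable_atLeastAtMost')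
    then have "(\<lambda>n. complex_of_real (LINT x|lborel. bump n a b x)) \<longlonglongrightarrow> complex_of_real (b - a)"
      using that by (simp add: scaleR_conv_of_real set_integral_const del: of_real_diff)
    then show ?thesis using tendsto_of_real_iff by blast
  qed
  define \<kappa> where "\<kappa> = (LINT x:{0..1}|lborel. k x)"
  \<comment> \<open>In the limit of the bumps, \<open>k\<close> turns out to have the same mean
    value over \<open>{a..b}\<close> as over the unit interval.\<close>
  have avg: "(LINT x:{a..b}|lborel. k x) = (b - a) *\<^sub>R \<kappa>" if "a \<le> b" for a b
  proof (rule LIMSEQ_unique)
    show "(\<lambda>n. (LINT x|lborel. bump n 0 1 x) *\<^sub>R (LINT x|lborel. bump n a b x *\<^sub>R k x)) \<longlonglongrightarrow> (LINT x:{a..b}|lborel. k x)"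
      using tendsto_scaleR[OF lim1[of 0 1] bump_integral_tendsto(1)[OF k(2) k(1), of a b]] by simp
    show "(\<lambda>n. (LINT x|lborel. bump n 0 1 x) *\<^sub>R (LINT x|lborel. bump n a b x *\<^sub>R k x)) \<longlonglongrightarrow> (b - a) *\<^sub>R \<kappa>"
      unfolding bumps \<kappa>_def by (intro tendsto_scaleR lim1 that bump_integral_tendsto(1)[OF k(2) k(1)])
  qed
  have ci: "set_integrable lborel {a..b} (\<lambda>x. \<kappa>)" for a b :: real
    by (intro borel_integrable_atLeastAtMost' continuous_on_const)
  have "AE x in lborel. k x - \<kappa> = 0"
  proof (rule AE_eq_0_if_interval_integrals_0)
    show "set_integrable lborel {a..b} (\<lambda>x. k x - \<kappa>)" for a b by (intro set_integral_diff k ci)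
    show "(LINT x:{a..b}|lborel. k x - \<kappa>) = 0" if "a \<le> b" for a b
      using that by (simp add: set_integral_diff(2)[OF k(2) ci] avg[OF that] set_integral_const)
  qed
  then have "AE x in lborel. g x = G x + \<kappa>" by eventually_elim (simp add: k_def algebra_simps)
  moreover have "prim h (\<lambda>x. G x + \<kappa>)" using prim_add[OF G prim_const[of \<kappa>]] by simp
  ultimately show ?thesis by blast
qed

lemma continuous_AE_eq_imp_eq:
  fixes F G :: "real \<Rightarrow> complex"
  assumes "continuous_on UNIV F" "continuous_on UNIV G" "AE x in lborel. F x = G x"
  shows "F = G"
proof (rule ccontr)
  assume "F \<noteq> G"
  then have ne: "{x. F x \<noteq> G x} \<noteq> {}" by auto
  have op: "open {x. F x \<noteq> G x}" by (rule open_Collect_neq[OF assms(1,2)])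
  have "{x. F x \<noteq> G x} \<in> null_sets lborel"
    using assms(3) AE_iff_null_sets[of "{x. F x \<noteq> G x}" lborel] op by simp
  then have "negligible {x. F x \<noteq> G x}"
    by (simp add: negligible_iff_null_sets null_sets_completionI)
  with open_not_negligible[OF op ne] show False ..
qed

lemma prim_unique_deriv:
  assumes "prim f F" "prim g F"
  shows "AE x in lborel. f x = g x"
proof -
  have "AE x in lborel. f x - g x = 0"
    using prim_integrable[OF prim_diff[OF assms]] prim_diff[OF assms]
    by (intro AE_eq_0_if_interval_integrals_0) (auto simp: prim_def)
  then show ?thesis by simp
qed

section \<open>Poincare's inequality on an interval\<close>

lemma set_integral_singleton: "(LINT x:{a::real}|lborel. f x) = 0"
  unfolding set_lebesgue_integral_def
proof (rule integral_eq_zero_AE)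
  show "AE x in lborel. indicat_real {a} x *\<^sub>R f x = 0"
    using AE_lborel_singleton[of a] by eventually_elim simp
qed

lemma integral_Cauchy_Schwarz_interval:
  fixes f :: "real \<Rightarrow> complex"
  assumes ab: "a \<le> b" and f: "set_integrable lborel {a..b} f" "set_integrable lborel {a..b} (\<lambda>x. (norm (f x))\<^sup>2)"
  shows "(LINT x:{a..b}|lborel. norm (f x))\<^sup>2 \<le> (b - a) * (LINT x:{a..b}|lborel. (norm (f x))\<^sup>2)"
proof -
  have nf: "set_integrable lborel {a..b} (\<lambda>x. norm (f x))" by (rule set_integrable_norm[OF f(1)])
  define I where "I = (LINT x:{a..b}|lborel. norm (f x))"
  define J where "J = (LINT x:{a..b}|lborel. (norm (f x))\<^sup>2)"
  have c: "set_integrable lborel {a..b} (\<lambda>x. c)" for c :: real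
    by (intro borel_integrable_atLeastAtMost' continuous_intros)
  have pos: "0 \<le> J - 2 * t * I + t\<^sup>2 * (b - a)" for t
  proof -
    have "0 \<le> (LINT x:{a..b}|lborel. (norm (f x) - t)\<^sup>2)"
      unfolding set_lebesgue_integral_def by (intro integral_nonneg_AE) auto
    also have "\<dots> = (LINT x:{a..b}|lborel. ((norm (f x))\<^sup>2 - (2 * t) * norm (f x)) + t\<^sup>2)"
      by (simp add: power2_diff algebra_simps)
    also have "\<dots> = (LINT x:{a..b}|lborel. (norm (f x))\<^sup>2 - (2 * t) * norm (f x)) + (LINT x:{a..b}|lborel. t\<^sup>2)"
      by (intro set_integral_add set_integral_diff set_integrable_mult_right f nf c)
    also have "(LINT x:{a..b}|lborel. (norm (f x))\<^sup>2 - (2 * t) * norm (f x)) = J - 2 * t * I"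
      unfolding I_def J_def by (subst set_integral_diff) (auto intro: f nf)
    also have "(LINT x:{a..b}|lborel. t\<^sup>2) = t\<^sup>2 * (b - a)"
      using ab by (simp add: set_integral_const)
    finally show ?thesis .
  qed
  show ?thesis
  proof (cases "a = b")
    case True
    then show ?thesis by (simp add: set_integral_singleton)
  next
    case False
    define d where "d = b - a"
    have d: "d > 0" using ab False by (simp add: d_def)
    \<comment> \<open>\<open>t = I / d\<close>, the mean value of \<open>norm (f x)\<close>,
      minimises the quadratic polynomial in \<open>pos\<close>.\<close>
    have "0 \<le> J - 2 * (I / d) * I + (I / d)\<^sup>2 * d" using pos[of "I / d"] by (simp add: d_def)
    also have "\<dots> = J - I\<^sup>2 / d" using d by (simp add: power2_eq_square)
    finally show ?thesis
      unfolding I_def[symmetric] J_def[symmetric] d_def[symmetric] using d by (simp add: field_simps)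
  qed
qed

text \<open>Averaging \<open>F x - F y\<close> over \<open>y\<close> bounds
  \<open>norm (F x)\<close> by the integral of \<open>norm (f y)\<close>, since \<open>F\<close> has
  mean value zero. Cauchy-Schwarz then produces the constant \<open>(b - a)\<^sup>2\<close>; only
  its dependence on the length matters later.\<close>

lemma Poincare_interval:
  assumes ab: "a \<le> b" and fF: "prim f F" and f2: "set_integrable lborel {a..b} (\<lambda>x. (norm (f x))\<^sup>2)"
    and mean: "(LINT x:{a..b}|lborel. F x) = 0"
  shows "(LINT x:{a..b}|lborel. (norm (F x))\<^sup>2) \<le> (b - a)\<^sup>2 * (LINT x:{a..b}|lborel. (norm (f x))\<^sup>2)"
proof -
  define I where "I = (LINT x:{a..b}|lborel. norm (f x))"
  have nf: "set_integrable lborel {c..d} (\<lambda>x. norm (f x))" for c d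
    by (rule set_integrable_norm[OF prim_integrable[OF fF]])
  have diff: "norm (F x - F y) \<le> I" if xy: "x \<in> {a..b}" "y \<in> {a..b}" for x y
  proof -
    have *: "norm (F d - F c) \<le> I" if "a \<le> c" "c \<le> d" "d \<le> b" for c d
    proof -
      have "norm (F d - F c) \<le> (LINT x:{c..d}|lborel. norm (f x))"
        unfolding prim_eq[OF fF \<open>c \<le> d\<close>] by (rule set_integral_norm_bound[OF prim_integrable[OF fF]])
      also have "\<dots> \<le> I"
        unfolding I_def set_lebesgue_integral_def
        by (rule integral_mono; (use nf in \<open>simp add: set_integrable_def\<close>)?)
           (use that in \<open>auto simp: indicator_def\<close>)
      finally show ?thesis .
    qed
    show ?thesis using *[of x y] *[of y x] xy by (cases "x \<le> y") (auto simp: norm_minus_commute)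
  qed
  have Fi: "set_integrable lborel {a..b} F" by (rule borel_integrable_atLeastAtMost'[OF prim_continuous[OF fF]])
  have c: "set_integrable lborel {a..b} (\<lambda>x. c)" for c :: "'a::{banach,second_countable_topology}"
    by (intro borel_integrable_atLeastAtMost' continuous_intros)
  show ?thesis
  proof (cases "a = b")
    case True
    then show ?thesis by (simp add: set_integral_singleton)
  next
    case False
    have bound: "norm (F x) \<le> I" if x: "x \<in> {a..b}" for x
    proof -
      have "(b - a) * norm (F x) = norm ((LINT y:{a..b}|lborel. F x) - (LINT y:{a..b}|lborel. F y))"
        using mean ab by (simp add: set_integral_const)
      also have "\<dots> = norm (LINT y:{a..b}|lborel. F x - F y)"
        by (subst set_integral_diff(2)[OF c Fi]) simp
      also have "\<dots> \<le> (LINT y:{a..b}|lborel. norm (F x - F y))"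
        by (rule set_integral_norm_bound) (intro set_integral_diff c Fi)
      also have "\<dots> \<le> (LINT y:{a..b}|lborel. I)"
        by (rule set_integral_mono) (use diff x in \<open>auto intro!: set_integrable_norm set_integral_diff c Fi\<close>)
      also have "\<dots> = (b - a) * I" using ab by (simp add: set_integral_const)
      finally show ?thesis using False ab by simp
    qed
    have "(LINT x:{a..b}|lborel. (norm (F x))\<^sup>2) \<le> (LINT x:{a..b}|lborel. I\<^sup>2)"
    proof (rule set_integral_mono)
      show "set_integrable lborel {a..b} (\<lambda>x. (norm (F x))\<^sup>2)"
        by (intro borel_integrable_atLeastAtMost' continuous_intros prim_continuous[OF fF])
    qed (use bound c in \<open>auto intro!: power_mono\<close>)
    also have "\<dots> = (b - a) * I\<^sup>2" using ab by (simp add: set_integral_const)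
    also have "\<dots> \<le> (b - a) * ((b - a) * (LINT x:{a..b}|lborel. (norm (f x))\<^sup>2))"
      unfolding I_def
      by (intro mult_left_mono integral_Cauchy_Schwarz_interval[OF ab prim_integrable[OF fF] f2]) (use ab in simp)
    finally show ?thesis by (simp add: power2_eq_square mult.assoc)
  qed
qed

section \<open>The space \<open>L2\<close>\<close>

lemma sq_rep: "sq_integrable (rep_L2 u)"
  using Quotient_rep_reflp[OF Quotient_L2, of u] by (simp add: L2_eq_def)

lemma L2_eq_rep: "L2_eq (rep_L2 u) (rep_L2 u)"
  by (simp add: L2_eq_def sq_rep)

lemma abs_rep: "abs_L2 (rep_L2 u) = u"
  by (rule Quotient_abs_rep[OF Quotient_L2])

lemma rep_abs: "sq_integrable f \<Longrightarrow> AE x in lborel. rep_L2 (abs_L2 f) x = f x"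
  using Quotient_rep_abs[OF Quotient_L2, of f] by (simp add: L2_eq_def)

lemma abs_eqI: "sq_integrable f \<Longrightarrow> sq_integrable g \<Longrightarrow> AE x in lborel. f x = g x \<Longrightarrow> abs_L2 f = abs_L2 g"
  using Quotient_rel_abs[OF Quotient_L2, of f g] by (simp add: L2_eq_def)

lemma L2_eqI: "AE x in lborel. rep_L2 u x = rep_L2 v x \<Longrightarrow> u = v"
  using abs_eqI[OF sq_rep sq_rep] by (metis abs_rep)

lemma rep_plus: "AE x in lborel. rep_L2 (u + v) x = rep_L2 u x + rep_L2 v x"
proof -
  have "u + v = abs_L2 (\<lambda>x. rep_L2 u x + rep_L2 v x)"
    using plus_L2.abs_eq[OF L2_eq_rep L2_eq_rep, of u v] by (simp add: abs_rep)
  then show ?thesis using rep_abs[OF sq_integrable_add[OF sq_rep sq_rep]] by metis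
qed

lemma rep_scaleC: "AE x in lborel. rep_L2 (c *\<^sub>C u) x = c *s rep_L2 u x"
proof -
  have "c *\<^sub>C u = abs_L2 (\<lambda>x. c *s rep_L2 u x)"
    using scaleC_L2.abs_eq[OF L2_eq_rep, of c u] by (simp add: abs_rep)
  then show ?thesis using rep_abs[OF sq_integrable_csmult[OF sq_rep]] by metis
qed

lemma rep_minus: "AE x in lborel. rep_L2 (u - v) x = rep_L2 u x - rep_L2 v x"
proof -
  have "u - v = u + (-1) *\<^sub>C v" by (simp add: complex_vector.scale_minus_left complex_vector.scale_one)
  then show ?thesis
    using rep_plus[of u "(-1) *\<^sub>C v"] rep_scaleC[of "-1" v] by (auto simp: vec_eq_iff elim: eventually_elim2)
qed

lemma rep_measurable [measurable]: "rep_L2 u \<in> borel_measurable borel"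
  using sq_integrable_measurable[OF sq_rep] by simp

lemma cinner_L2_eq: "cinner u v = (LINT x|lborel. csprod (rep_L2 u x) (rep_L2 v x))"
  using cinner_L2.abs_eq[OF L2_eq_rep L2_eq_rep, of u v] by (simp add: abs_rep)

lemma integrable_norm_sq: "integrable lborel (\<lambda>x. (norm (rep_L2 u x))\<^sup>2)"
  using sq_rep[of u] by (simp add: sq_integrable_def)

lemma norm_L2_sq: "(norm u)\<^sup>2 = (LINT x|lborel. (norm (rep_L2 u x))\<^sup>2)"
proof -
  have "(norm u)\<^sup>2 = Re (cinner u u)" by (simp add: cinner_self)
  also have "\<dots> = (LINT x|lborel. (norm (rep_L2 u x))\<^sup>2)"
    unfolding cinner_L2_eq integral_Re[OF integrable_csprod[OF sq_rep sq_rep], symmetric]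
    by (simp add: power2_norm_eq_inner inner_eq_Re_csprod)
  finally show ?thesis .
qed

lemma norm_vec2_sq: "(norm (v :: complex^2))\<^sup>2 = (norm (v $ 1))\<^sup>2 + (norm (v $ 2))\<^sup>2"
  by (simp add: norm_vec_def L2_set_def sum_2)

lemma csprod_2: "csprod v w = v $ 1 * cnj (w $ 1) + v $ 2 * cnj (w $ 2)"
  by (simp add: csprod_def sum_2)

lemma measurable_vec2I:
  fixes f :: "real \<Rightarrow> complex^2"
  assumes "(\<lambda>x. f x $ 1) \<in> borel_measurable borel" "(\<lambda>x. f x $ 2) \<in> borel_measurable borel"
  shows "f \<in> borel_measurable borel"
proof -
  have c: "continuous_on UNIV (\<lambda>p. (\<chi> i. if i = 1 then fst p else snd p) :: complex^2)"
  proof (rule continuous_on_vec_lambda)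
    show "continuous_on UNIV (\<lambda>p :: complex \<times> complex. if i = 1 then fst p else snd p)" for i :: 2
      by (cases "i = 1") (auto intro: continuous_intros)
  qed
  have "(\<lambda>x. (f x $ 1, f x $ 2)) \<in> borel_measurable borel"
    using assms by (intro borel_measurable_Pair)
  from borel_measurable_continuous_on[OF c this]
  have "(\<lambda>x. (\<chi> i. if i = 1 then f x $ 1 else f x $ 2) :: complex^2) \<in> borel_measurable borel"
    unfolding fst_conv snd_conv .
  moreover have "(\<chi> i. if i = 1 then f x $ 1 else f x $ 2) = f x" for x
    by (simp add: vec_eq_iff forall_2)
  ultimately show ?thesis by simp
qed

text \<open>A subsequence with \<open>\<Sum>k. 2 ^ k * (norm (w (k + 1) - w k))\<^sup>2 < \<infinity>\<close> converges pointwise almost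
  everywhere; Fatou's lemma turns this into convergence in norm.\<close>

instance L2 :: complete_space
proof
  fix X :: "nat \<Rightarrow> L2" assume X: "Cauchy X"
  have "\<exists>r. strict_mono r \<and> (\<forall>n k. k \<ge> r n \<longrightarrow> dist (X (r n)) (X k) < (1/4) ^ n)"
  proof -
    have "\<exists>M. \<forall>m\<ge>M. \<forall>k\<ge>M. dist (X m) (X k) < (1/4) ^ n" for n
      using metric_CauchyD[OF X, of "(1/4) ^ n"] by simp
    then obtain M where M: "\<And>n m k. m \<ge> M n \<Longrightarrow> k \<ge> M n \<Longrightarrow> dist (X m) (X k) < (1/4) ^ n" by metis
    \<comment> \<open>The summand \<open>n\<close> makes the sequence strictly increasing, and the
      sum makes it dominate \<open>M n\<close>.\<close>
    define r where "r n = n + (\<Sum>i\<le>n. M i)" for n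
    have "strict_mono r" by (rule strict_monoI_Suc) (simp add: r_def)
    moreover have "M n \<le> r n" for n
      unfolding r_def by (rule trans_le_add2) (rule member_le_sum; simp)
    ultimately show ?thesis using M by (intro exI[of _ r]) (meson order_trans)
  qed
  then obtain r where r: "strict_mono r" "\<And>n k. k \<ge> r n \<Longrightarrow> dist (X (r n)) (X k) < (1/4) ^ n" by blast
  define w where "w k = rep_L2 (X (r k))" for k
  have wm [measurable]: "w k \<in> borel_measurable borel" for k unfolding w_def by measurable
  have wn: "(LINT x|lborel. (norm (w j x - w k x))\<^sup>2) = (dist (X (r j)) (X (r k)))\<^sup>2"
    and wi: "integrable lborel (\<lambda>x. (norm (w j x - w k x))\<^sup>2)" for j k
  proof -
    have ae: "AE x in lborel. (norm (rep_L2 (X (r j) - X (r k)) x))\<^sup>2 = (norm (w j x - w k x))\<^sup>2"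
      using rep_minus[of "X (r j)" "X (r k)"] by eventually_elim (simp add: w_def)
    show "(LINT x|lborel. (norm (w j x - w k x))\<^sup>2) = (dist (X (r j)) (X (r k)))\<^sup>2"
      unfolding dist_norm norm_L2_sq by (rule integral_cong_AE[symmetric]) (use ae in auto)
    show "integrable lborel (\<lambda>x. (norm (w j x - w k x))\<^sup>2)"
      using integrable_norm_sq[of "X (r j) - X (r k)"] integrable_cong_AE[OF _ _ ae] by simp
  qed
  define d where "d k x = 2 ^ k * (norm (w (Suc k) x - w k x))\<^sup>2" for k x
  have di: "integrable lborel (d k)" for k unfolding d_def using wi by simp
  have dI: "(LINT x|lborel. d k x) \<le> (1/2) ^ k" for k
  proof -
    have "dist (X (r (Suc k))) (X (r k)) \<le> (1/4) ^ k"
      using r(2)[of k "r (Suc k)"] strict_monoD[OF r(1), of k "Suc k"] by (simp add: dist_commute)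
    then have "(dist (X (r (Suc k))) (X (r k)))\<^sup>2 \<le> ((1/4) ^ k)\<^sup>2" by (rule power_mono) simp
    also have "\<dots> \<le> (1/4) ^ k * 1" unfolding power2_eq_square by (rule mult_left_mono) (simp_all add: power_le_one)
    finally have "2 ^ k * (dist (X (r (Suc k))) (X (r k)))\<^sup>2 \<le> 2 ^ k * (1/4) ^ k" by simp
    also have "\<dots> = (1/2::real) ^ k" by (simp flip: power_mult_distrib)
    finally show ?thesis using wn[of "Suc k" k] by (simp add: d_def)
  qed
  have ae: "AE x in lborel. summable (\<lambda>k. d k x)"
  proof -
    have "(\<integral>\<^sup>+x. (\<Sum>k. ennreal (d k x)) \<partial>lborel) = (\<Sum>k. \<integral>\<^sup>+x. ennreal (d k x) \<partial>lborel)"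
      by (rule nn_integral_suminf) (simp add: d_def)
    also have "\<dots> \<le> (\<Sum>k. ennreal ((1/2) ^ k))"
    proof (rule suminf_le)
      fix k
      show "(\<integral>\<^sup>+x. ennreal (d k x) \<partial>lborel) \<le> ennreal ((1/2) ^ k)"
      proof -
        have "(\<integral>\<^sup>+x. ennreal (d k x) \<partial>lborel) = ennreal (LINT x|lborel. d k x)"
          by (rule nn_integral_eq_integral[OF di]) (simp add: d_def)
        then show ?thesis using dI[of k] by (simp add: ennreal_leI)
      qed
    qed auto
    also have "\<dots> = ennreal (\<Sum>k. (1/2) ^ k)"
      by (rule suminf_ennreal2) (auto intro: summable_geometric)
    also have "\<dots> < \<infinity>" by simp
    finally have "AE x in lborel. (\<Sum>k. ennreal (d k x)) \<noteq> \<infinity>"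
      by (intro nn_integral_PInf_AE) (auto simp: d_def)
    then show ?thesis
      by eventually_elim (rule summable_suminf_not_top, auto simp: d_def)
  qed
  have conv: "AE x in lborel. convergent (\<lambda>k. w k x)"
    using ae
  proof eventually_elim
    case (elim x)
    have "(\<lambda>k. d k x) \<longlonglongrightarrow> 0" using elim by (rule summable_LIMSEQ_zero)
    then have "\<forall>\<^sub>F k in sequentially. d k x < 1" by (rule order_tendstoD(2)) simp
    \<comment> \<open>The terms of a convergent series are eventually below 1; the weight
      \<open>2 ^ k\<close> then leaves a geometric bound on the increments.\<close>
    then have le: "\<forall>\<^sub>F k in sequentially. norm (w (Suc k) x - w k x) \<le> (sqrt (1/2)) ^ k"
    proof eventually_elim
      case (elim k)
      then have "(norm (w (Suc k) x - w k x))\<^sup>2 \<le> (1/2) ^ k"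
        by (simp add: d_def power_one_over field_simps)
      also have "\<dots> = ((sqrt (1/2)) ^ k)\<^sup>2"
        by (simp add: power_mult[symmetric] mult.commute[of k]) (simp add: power_mult)
      finally show ?case by (rule power2_le_imp_le) simp
    qed
    have "sqrt (1/2) < 1" by (simp add: real_less_lsqrt)
    then have "summable (\<lambda>k. (sqrt (1/2)) ^ k)" by (intro summable_geometric) simp
    then have "summable (\<lambda>k. w (Suc k) x - w k x)"
      by (rule summable_comparison_test_ev[OF le])
    then have "convergent (\<lambda>n. \<Sum>k<n. w (Suc k) x - w k x)" by (simp add: summable_iff_convergent)
    then obtain l where "(\<lambda>n. w n x - w 0 x) \<longlonglongrightarrow> l"
      unfolding convergent_def using sum_lessThan_telescope[of "\<lambda>k. w k x"] by auto
    then have "(\<lambda>n. (w n x - w 0 x) + w 0 x) \<longlonglongrightarrow> l + w 0 x" by (intro tendsto_intros)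
    then show ?case by (auto simp: convergent_def)
  qed
  define f where "f x = lim (\<lambda>k. w k x)" for x
  have fm: "f \<in> borel_measurable borel" unfolding f_def[abs_def] by (rule borel_measurable_lim_metric) (rule wm)
  have lim: "AE x in lborel. (\<lambda>k. w k x) \<longlonglongrightarrow> f x"
    using conv by eventually_elim (simp add: f_def convergent_LIMSEQ_iff)
  have fat: "(\<integral>\<^sup>+x. ennreal ((norm (f x - w k x))\<^sup>2) \<partial>lborel) \<le> ennreal (((1/4) ^ k)\<^sup>2)" for k
  proof -
    have "(\<integral>\<^sup>+x. ennreal ((norm (f x - w k x))\<^sup>2) \<partial>lborel)
        = (\<integral>\<^sup>+x. liminf (\<lambda>j. ennreal ((norm (w j x - w k x))\<^sup>2)) \<partial>lborel)"
    proof (rule nn_integral_cong_AE)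
      show "AE x in lborel. ennreal ((norm (f x - w k x))\<^sup>2) = liminf (\<lambda>j. ennreal ((norm (w j x - w k x))\<^sup>2))"
        using lim
      proof eventually_elim
        case (elim x)
        then have "(\<lambda>j. ennreal ((norm (w j x - w k x))\<^sup>2)) \<longlonglongrightarrow> ennreal ((norm (f x - w k x))\<^sup>2)"
          by (intro tendsto_ennrealI tendsto_intros)
        then show ?case using lim_imp_Liminf[OF trivial_limit_sequentially] by metis
      qed
    qed
    also have "\<dots> \<le> liminf (\<lambda>j. \<integral>\<^sup>+x. ennreal ((norm (w j x - w k x))\<^sup>2) \<partial>lborel)"
      by (rule nn_integral_liminf) measurable
    also have "\<dots> \<le> ennreal (((1/4) ^ k)\<^sup>2)"
    proof (rule Liminf_le)
      show "\<forall>\<^sub>F j in sequentially. (\<integral>\<^sup>+x. ennreal ((norm (w j x - w k x))\<^sup>2) \<partial>lborel) \<le> ennreal (((1/4) ^ k)\<^sup>2)"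
      proof (rule eventually_sequentiallyI[of k])
        fix j assume "k \<le> j"
        then have "dist (X (r j)) (X (r k)) \<le> (1/4) ^ k"
          using r(2)[of k "r j"] strict_mono_leD[OF r(1), of k j] by (simp add: dist_commute)
        then have "(dist (X (r j)) (X (r k)))\<^sup>2 \<le> ((1/4) ^ k)\<^sup>2" by (rule power_mono) simp
        then show "(\<integral>\<^sup>+x. ennreal ((norm (w j x - w k x))\<^sup>2) \<partial>lborel) \<le> ennreal (((1/4) ^ k)\<^sup>2)"
          by (subst nn_integral_eq_integral[OF wi]) (auto simp: wn intro: ennreal_leI)
      qed
    qed simp
    finally show ?thesis .
  qed
  have fi: "integrable lborel (\<lambda>x. (norm (f x - w k x))\<^sup>2)" for k
  proof (rule integrableI_nonneg)
    show "(\<integral>\<^sup>+x. ennreal ((norm (f x - w k x))\<^sup>2) \<partial>lborel) < \<infinity>"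
      using fat[of k] by (rule order.strict_trans1) simp
  qed (use fm in auto)
  have sqf: "sq_integrable f"
  proof -
    have "sq_integrable (\<lambda>x. f x - w 0 x)" using fi[of 0] fm by (simp add: sq_integrable_def)
    from sq_integrable_add[OF this, of "w 0"] show ?thesis using sq_rep[of "X (r 0)"] by (simp add: w_def)
  qed
  have dist_le: "dist (abs_L2 f) (X (r k)) \<le> (1/4) ^ k" for k
  proof -
    have "(dist (abs_L2 f) (X (r k)))\<^sup>2 = (LINT x|lborel. (norm (f x - w k x))\<^sup>2)"
      unfolding dist_norm norm_L2_sq
    proof (rule integral_cong_AE)
      show "AE x in lborel. (norm (rep_L2 (abs_L2 f - X (r k)) x))\<^sup>2 = (norm (f x - w k x))\<^sup>2"
        using rep_minus[of "abs_L2 f" "X (r k)"] rep_abs[OF sqf] by eventually_elim (simp add: w_def)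
    qed (use fm in auto)
    also have "\<dots> \<le> ((1/4) ^ k)\<^sup>2"
      using fat[of k] by (subst (asm) nn_integral_eq_integral[OF fi]) (auto simp: ennreal_le_iff)
    finally show ?thesis by (rule power2_le_imp_le) simp
  qed
  have "(\<lambda>k. dist (X (r k)) (abs_L2 f)) \<longlonglongrightarrow> 0"
  proof (rule Lim_null_comparison)
    show "\<forall>\<^sub>F k in sequentially. norm (dist (X (r k)) (abs_L2 f)) \<le> (1/4) ^ k"
      using dist_le by (simp add: dist_commute)
  qed (rule LIMSEQ_power_zero, simp)
  then have "(X \<circ> r) \<longlonglongrightarrow> abs_L2 f" unfolding comp_def by (rule tendsto_dist_iff[THEN iffD2])
  from Cauchy_converges_subseq[OF X r(1) this] show "convergent X" by (auto simp: convergent_def)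
qed

instance L2 :: banach ..

section \<open>Components of spinors and weak derivatives\<close>

definition spinor :: "complex \<Rightarrow> complex \<Rightarrow> complex^2" where
  "spinor z w = (\<chi> i. if i = 1 then z else w)"

lemma spinor_nth [simp]: "spinor z w $ 1 = z" "spinor z w $ 2 = w"
  by (simp_all add: spinor_def)

lemma spinor_eqI: "v $ 1 = z \<Longrightarrow> v $ 2 = w \<Longrightarrow> v = spinor z w"
  by (simp add: vec_eq_iff forall_2)

lemma measurable_nth [measurable]: "(\<lambda>x. rep_L2 u x $ i) \<in> borel_measurable borel"
  by (rule borel_measurable_continuous_on[OF _ rep_measurable]) (intro continuous_intros)

lemma measurable_spinor [measurable]:
  fixes a b :: "real \<Rightarrow> complex"
  assumes "a \<in> borel_measurable borel" "b \<in> borel_measurable borel"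
  shows "(\<lambda>x. spinor (a x) (b x)) \<in> borel_measurable borel"
  using assms by (intro measurable_vec2I) simp_all

lemma sq_integrable_spinor_iff:
  fixes a b :: "real \<Rightarrow> complex"
  assumes "a \<in> borel_measurable borel" "b \<in> borel_measurable borel"
  shows "sq_integrable (\<lambda>x. spinor (a x) (b x)) \<longleftrightarrow> integrable lborel (\<lambda>x. (norm (a x))\<^sup>2 + (norm (b x))\<^sup>2)"
  using measurable_spinor[OF assms] by (simp add: sq_integrable_def norm_vec2_sq)

lemma L2_eqI': "AE x in lborel. rep_L2 u x $ 1 = rep_L2 v x $ 1 \<Longrightarrow> AE x in lborel. rep_L2 u x $ 2 = rep_L2 v x $ 2 \<Longrightarrow> u = v"
  by (rule L2_eqI) (auto simp: vec_eq_iff forall_2 elim: eventually_elim2)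

lemma nth_sq_integrable: "integrable lborel (\<lambda>x. (norm (rep_L2 u x $ i))\<^sup>2)"
proof (rule Bochner_Integration.integrable_bound[OF integrable_norm_sq[of u]])
  show "AE x in lborel. norm ((norm (rep_L2 u x $ i))\<^sup>2) \<le> norm ((norm (rep_L2 u x))\<^sup>2)"
    by (intro AE_I2) (simp add: power_mono component_le_norm_cart Finite_Cartesian_Product.norm_nth_le)
qed measurable

lemma set_integrable_if_sq:
  fixes f :: "real \<Rightarrow> complex"
  assumes "f \<in> borel_measurable borel" "set_integrable lborel {a..b} (\<lambda>x. (norm (f x))\<^sup>2)"
  shows "set_integrable lborel {a..b} f"
proof -
  have "set_integrable lborel {a..b} (\<lambda>x. 1 + (norm (f x))\<^sup>2)"
    using assms(2) by (intro set_integral_add) (auto intro: borel_integrable_atLeastAtMost')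
  then show ?thesis
    unfolding set_integrable_def
  proof (rule Bochner_Integration.integrable_bound)
    show "AE x in lborel. norm (indicat_real {a..b} x *\<^sub>R f x) \<le> norm (indicat_real {a..b} x *\<^sub>R (1 + (norm (f x))\<^sup>2))"
    proof (rule AE_I2)
      fix x
      have "0 \<le> (norm (f x) - 1)\<^sup>2 + (norm (f x))\<^sup>2 + 1" by simp
      then have "norm (f x) \<le> 1 + (norm (f x))\<^sup>2" by (simp add: power2_diff)
      then show "norm (indicat_real {a..b} x *\<^sub>R f x) \<le> norm (indicat_real {a..b} x *\<^sub>R (1 + (norm (f x))\<^sup>2))"
        by (simp add: indicator_def)
    qed
  qed (use assms in measurable)
qed

lemma set_integrable_of_integrable:
  fixes f :: "real \<Rightarrow> 'b::{banach, second_countable_topology}"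
  shows "integrable lborel f \<Longrightarrow> set_integrable lborel {a..b} f"
  unfolding set_integrable_def by (intro integrable_mult_indicator) auto

lemma nth_set_integrable: "set_integrable lborel {a..b} (\<lambda>x. rep_L2 u x $ i)"
  by (intro set_integrable_if_sq measurable_nth set_integrable_of_integrable nth_sq_integrable)

lemma integrable_test_scaleR:
  assumes c: "continuous_on UNIV \<psi>" and R: "\<And>x. \<bar>x\<bar> \<ge> R \<Longrightarrow> \<psi> x = 0"
  shows "integrable lborel (\<lambda>x. \<psi> x *\<^sub>R rep_L2 u x)"
proof -
  have "bounded (\<psi> ` {-R..R})"
    by (intro compact_imp_bounded compact_continuous_image continuous_on_subset[OF c]) auto
  then obtain B where B: "B > 0" "\<And>x. x \<in> {-R..R} \<Longrightarrow> norm (\<psi> x) \<le> B" unfolding bounded_pos by blast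
  have "integrable lborel (\<lambda>x. B * (indicat_real {-R..R} x + (norm (rep_L2 u x))\<^sup>2))"
    by (intro integrable_mult_right Bochner_Integration.integrable_add integrable_norm_sq integrable_real_indicator) (auto simp: emeasure_lborel_Icc_eq)
  then show ?thesis
  proof (rule Bochner_Integration.integrable_bound)
    have "\<psi> \<in> borel_measurable borel" by (rule borel_measurable_continuous_onI[OF c])
    then show "(\<lambda>x. \<psi> x *\<^sub>R rep_L2 u x) \<in> borel_measurable lborel" by simp
    show "AE x in lborel. norm (\<psi> x *\<^sub>R rep_L2 u x) \<le> norm (B * (indicat_real {-R..R} x + (norm (rep_L2 u x))\<^sup>2))"
    proof (rule AE_I2)
      fix x
      show "norm (\<psi> x *\<^sub>R rep_L2 u x) \<le> norm (B * (indicat_real {-R..R} x + (norm (rep_L2 u x))\<^sup>2))"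
      proof (cases "\<bar>x\<bar> \<ge> R")
        case False
        then have x: "x \<in> {-R..R}" by auto
        have "0 \<le> (norm (rep_L2 u x) - 1)\<^sup>2 + (norm (rep_L2 u x))\<^sup>2 + 1" by simp
        then have "norm (rep_L2 u x) \<le> 1 + (norm (rep_L2 u x))\<^sup>2" by (simp add: power2_diff)
        then have "norm (\<psi> x) * norm (rep_L2 u x) \<le> B * (1 + (norm (rep_L2 u x))\<^sup>2)"
          using B(2)[OF x] B(1) by (intro mult_mono) auto
        then show ?thesis using x B(1) by (simp add: indicator_def)
      qed (simp add: R)
    qed
  qed
qed

lemma integrable_test_derivative:
  fixes \<phi> :: "real \<Rightarrow> real"
  assumes "\<phi> \<in> test_functions"
  shows "integrable lborel (\<lambda>x. \<phi> x *\<^sub>R rep_L2 u x)" "integrable lborel (\<lambda>x. deriv \<phi> x *\<^sub>R rep_L2 u x)"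
proof -
  note facts = test_function_facts[OF assms]
  have d: "deriv \<phi> = (\<lambda>x. vector_derivative \<phi> (at x))"
    by (rule ext, rule DERIV_imp_deriv) (simp add: has_real_derivative_iff_has_vector_derivative facts(1))
  obtain R where "\<And>x. \<bar>x\<bar> \<ge> R \<Longrightarrow> \<phi> x = 0" "\<And>x. \<bar>x\<bar> \<ge> R \<Longrightarrow> vector_derivative \<phi> (at x) = 0"
    using facts(5) by blast
  then show "integrable lborel (\<lambda>x. \<phi> x *\<^sub>R rep_L2 u x)" "integrable lborel (\<lambda>x. deriv \<phi> x *\<^sub>R rep_L2 u x)"
    unfolding d by (auto intro!: integrable_test_scaleR facts(2,3))
qed

text \<open>Du Bois-Reymond's lemma in each component. Weak differentiability becomes the existence
  of a locally absolutely continuous representative, for which the product rule and boundary values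
  make sense.\<close>

lemma is_weak_derivative_iff:
  "is_weak_derivative u v \<longleftrightarrow>
     (\<forall>i. \<exists>F. prim (\<lambda>x. rep_L2 v x $ i) F \<and> (AE x in lborel. rep_L2 u x $ i = F x))"
proof -
  have nth: "(LINT x|lborel. f x) $ i = (LINT x|lborel. f x $ i)"
    if "integrable lborel f" for f :: "real \<Rightarrow> complex^2" and i
    using integral_bounded_linear[OF bounded_linear_vec_nth that, of i] by simp
  have comp: "((LINT x|lborel. deriv \<phi> x *\<^sub>R rep_L2 u x) = - (LINT x|lborel. \<phi> x *\<^sub>R rep_L2 v x)) \<longleftrightarrow>
     (\<forall>i. (LINT x|lborel. deriv \<phi> x *\<^sub>R (rep_L2 u x $ i)) = - (LINT x|lborel. \<phi> x *\<^sub>R (rep_L2 v x $ i)))"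
    if "\<phi> \<in> test_functions" for \<phi> :: "real \<Rightarrow> real"
    unfolding vec_eq_iff vector_uminus_component nth[OF integrable_test_derivative(1)[OF that]]
      nth[OF integrable_test_derivative(2)[OF that]] vector_scaleR_component ..
  show ?thesis
  proof
    assume w: "is_weak_derivative u v"
    show "\<forall>i. \<exists>F. prim (\<lambda>x. rep_L2 v x $ i) F \<and> (AE x in lborel. rep_L2 u x $ i = F x)"
    proof
      fix i
      show "\<exists>F. prim (\<lambda>x. rep_L2 v x $ i) F \<and> (AE x in lborel. rep_L2 u x $ i = F x)"
        by (rule du_Bois_Reymond) (use w comp in \<open>auto simp: is_weak_derivative_def nth_set_integrable\<close>)
    qed
  next
    assume p: "\<forall>i. \<exists>F. prim (\<lambda>x. rep_L2 v x $ i) F \<and> (AE x in lborel. rep_L2 u x $ i = F x)"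
    show "is_weak_derivative u v"
      unfolding is_weak_derivative_def
    proof
      fix \<phi> :: "real \<Rightarrow> real" assume \<phi>: "\<phi> \<in> test_functions"
      note facts = test_function_facts[OF \<phi>]
      have d: "deriv \<phi> = (\<lambda>x. vector_derivative \<phi> (at x))"
        by (rule ext, rule DERIV_imp_deriv) (simp add: has_real_derivative_iff_has_vector_derivative facts(1))
      have [measurable]: "deriv \<phi> \<in> borel_measurable borel"
        unfolding d by (rule borel_measurable_continuous_onI[OF facts(3)])
      show "(LINT x|lborel. deriv \<phi> x *\<^sub>R rep_L2 u x) = - (LINT x|lborel. \<phi> x *\<^sub>R rep_L2 v x)"
        unfolding comp[OF \<phi>]
      proof
        fix i
        obtain F where F: "prim (\<lambda>x. rep_L2 v x $ i) F" "AE x in lborel. rep_L2 u x $ i = F x" using p by blast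
        have [measurable]: "F \<in> borel_measurable borel" by (rule prim_borel[OF F(1)])
        have "(LINT x|lborel. deriv \<phi> x *\<^sub>R (rep_L2 u x $ i)) = (LINT x|lborel. deriv \<phi> x *\<^sub>R F x)"
          by (rule integral_cong_AE) (use F(2) in \<open>auto elim!: eventually_mono\<close>)
        then show "(LINT x|lborel. deriv \<phi> x *\<^sub>R (rep_L2 u x $ i)) = - (LINT x|lborel. \<phi> x *\<^sub>R (rep_L2 v x $ i))"
          using test_function_integral_by_parts(3)[OF F(1) \<phi>] by simp
      qed
    qed
  qed
qed

lemma is_weak_derivative_unique:
  assumes "is_weak_derivative u v" "is_weak_derivative u w"
  shows "v = w"
proof -
  have "AE x in lborel. rep_L2 v x $ i = rep_L2 w x $ i" for i
  proof -
    obtain F G where F: "prim (\<lambda>x. rep_L2 v x $ i) F" "AE x in lborel. rep_L2 u x $ i = F x"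
      and G: "prim (\<lambda>x. rep_L2 w x $ i) G" "AE x in lborel. rep_L2 u x $ i = G x"
      using assms unfolding is_weak_derivative_iff by blast
    have "AE x in lborel. F x = G x" using F(2) G(2) by eventually_elim simp
    then have "F = G" by (rule continuous_AE_eq_imp_eq[OF prim_continuous[OF F(1)] prim_continuous[OF G(1)]])
    with F(1) G(1) show ?thesis by (intro prim_unique_deriv) auto
  qed
  then show ?thesis by (intro L2_eqI') auto
qed

lemma weak_derivative_eqI: "is_weak_derivative u v \<Longrightarrow> weak_derivative u = v"
  unfolding weak_derivative_def using is_weak_derivative_unique by blast

lemma H1_weak_derivative: "u \<in> H1 \<Longrightarrow> is_weak_derivative u (weak_derivative u)"
  using weak_derivative_eqI by (auto simp: H1_def)

lemma is_weak_derivativeI: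
  assumes "prim a' a" "prim b' b" "AE x in lborel. rep_L2 u x = spinor (a x) (b x)"
    "AE x in lborel. rep_L2 v x = spinor (a' x) (b' x)"
  shows "is_weak_derivative u v"
proof -
  have p: "prim (\<lambda>x. rep_L2 v x $ 1) a" "prim (\<lambda>x. rep_L2 v x $ 2) b"
    by (rule prim_cong_AE[OF assms(1)] prim_cong_AE[OF assms(2)]; (use assms(4) in \<open>auto elim!: eventually_mono\<close>)?)+
  have q: "AE x in lborel. rep_L2 u x $ 1 = a x" "AE x in lborel. rep_L2 u x $ 2 = b x"
    using assms(3) by (auto elim!: eventually_mono)
  show ?thesis unfolding is_weak_derivative_iff forall_2 using p q by blast
qed

text \<open>The representatives \<open>a\<close> and \<open>b\<close> are continuous, while the
  derivatives are taken from the class \<open>weak_derivative u\<close>, so that their square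
  integrability is immediate.\<close>

definition ac_rep :: "L2 \<Rightarrow> (real \<Rightarrow> complex) \<Rightarrow> (real \<Rightarrow> complex) \<Rightarrow> bool" where
  "ac_rep u a b \<longleftrightarrow> prim (\<lambda>x. rep_L2 (weak_derivative u) x $ 1) a \<and> prim (\<lambda>x. rep_L2 (weak_derivative u) x $ 2) b
     \<and> (AE x in lborel. rep_L2 u x = spinor (a x) (b x))"

lemma ac_rep_exists: "u \<in> H1 \<Longrightarrow> \<exists>a b. ac_rep u a b"
proof -
  assume "u \<in> H1"
  from H1_weak_derivative[OF this] obtain a b where
    a: "prim (\<lambda>x. rep_L2 (weak_derivative u) x $ 1) a" "AE x in lborel. rep_L2 u x $ 1 = a x" and
    b: "prim (\<lambda>x. rep_L2 (weak_derivative u) x $ 2) b" "AE x in lborel. rep_L2 u x $ 2 = b x"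
    unfolding is_weak_derivative_iff by blast
  have "AE x in lborel. rep_L2 u x = spinor (a x) (b x)"
    using a(2) b(2) by eventually_elim (rule spinor_eqI)
  with a b show ?thesis unfolding ac_rep_def by blast
qed

section \<open>The Dirac operator in components\<close>

lemma rep_mat_op:
  "AE x in lborel. rep_L2 (mat_op \<sigma>1 u) x = spinor (rep_L2 u x $ 2) (rep_L2 u x $ 1)"
  "AE x in lborel. rep_L2 (mat_op \<sigma>3 u) x = spinor (rep_L2 u x $ 1) (- (rep_L2 u x $ 2))"
proof -
  have s: "\<sigma>1 *v w = spinor (w $ 2) (w $ 1)" "\<sigma>3 *v w = spinor (w $ 1) (- (w $ 2))" for w
    by (rule spinor_eqI; simp add: \<sigma>1_def \<sigma>3_def matrix_vector_mult_def sum_2)+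
  have i: "integrable lborel (\<lambda>x. (norm (rep_L2 u x $ 1))\<^sup>2 + (norm (rep_L2 u x $ 2))\<^sup>2)"
    "integrable lborel (\<lambda>x. (norm (rep_L2 u x $ 2))\<^sup>2 + (norm (rep_L2 u x $ 1))\<^sup>2)"
    by (intro Bochner_Integration.integrable_add nth_sq_integrable)+
  show "AE x in lborel. rep_L2 (mat_op \<sigma>1 u) x = spinor (rep_L2 u x $ 2) (rep_L2 u x $ 1)"
    unfolding mat_op_def s by (rule rep_abs, subst sq_integrable_spinor_iff) (use i in auto)
  show "AE x in lborel. rep_L2 (mat_op \<sigma>3 u) x = spinor (rep_L2 u x $ 1) (- (rep_L2 u x $ 2))"
    unfolding mat_op_def s by (rule rep_abs, subst sq_integrable_spinor_iff) (use i in auto)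
qed

lemma rep_mult_op: "u \<in> mult_dom V \<Longrightarrow> AE x in lborel. rep_L2 (mult_op V u) x = V x *\<^sub>R rep_L2 u x"
  unfolding mult_op_def mult_dom_def by (rule rep_abs) simp

definition dirac_fun :: "real \<Rightarrow> (real \<Rightarrow> real) \<Rightarrow> L2 \<Rightarrow> L2" where
  "dirac_fun m V u = (-\<i>) *\<^sub>C mat_op \<sigma>1 (weak_derivative u) + complex_of_real m *\<^sub>C mat_op \<sigma>3 u
           + \<i> *\<^sub>C mult_op V u"

lemma dirac_eq: "dirac m V = op_on (H1 \<inter> mult_dom V) (dirac_fun m V)"
  by (simp add: dirac_def dirac_fun_def[abs_def])

lemma rep_dirac_fun:
  assumes "u \<in> mult_dom V"
  shows "AE x in lborel. rep_L2 (dirac_fun m V u) x =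
    spinor (- \<i> * rep_L2 (weak_derivative u) x $ 2 + (of_real m + \<i> * of_real (V x)) * rep_L2 u x $ 1)
     (- \<i> * rep_L2 (weak_derivative u) x $ 1 + (- of_real m + \<i> * of_real (V x)) * rep_L2 u x $ 2)"
  unfolding dirac_fun_def
  using rep_plus[of "(-\<i>) *\<^sub>C mat_op \<sigma>1 (weak_derivative u) + complex_of_real m *\<^sub>C mat_op \<sigma>3 u" "\<i> *\<^sub>C mult_op V u"]
    rep_plus[of "(-\<i>) *\<^sub>C mat_op \<sigma>1 (weak_derivative u)" "complex_of_real m *\<^sub>C mat_op \<sigma>3 u"]
    rep_scaleC[of "-\<i>" "mat_op \<sigma>1 (weak_derivative u)"] rep_scaleC[of "complex_of_real m" "mat_op \<sigma>3 u"]
    rep_scaleC[of \<i> "mult_op V u"] rep_mat_op(1)[of "weak_derivative u"] rep_mat_op(2)[of u] rep_mult_op[OF assms]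
proof eventually_elim
  case (elim x)
  show ?case unfolding elim by (rule spinor_eqI) (simp_all add: scaleR_conv_of_real[of _ "rep_L2 u x $ _"] algebra_simps)
qed

lemma sq_integrable_AE_cong:
  assumes "f \<in> borel_measurable borel" "AE x in lborel. f x = g x" "sq_integrable g"
  shows "sq_integrable f"
proof -
  have "integrable lborel (\<lambda>x. (norm (f x))\<^sup>2) \<longleftrightarrow> integrable lborel (\<lambda>x. (norm (g x))\<^sup>2)"
    by (rule integrable_cong_AE) (use assms in \<open>auto simp: sq_integrable_def elim!: eventually_mono\<close>)
  with assms show ?thesis by (simp add: sq_integrable_def)
qed

lemma mult_dom_uminus: "mult_dom (\<lambda>x. - V x) = mult_dom V"
proof -
  have "sq_integrable (\<lambda>x. - V x *\<^sub>R rep_L2 u x) \<longleftrightarrow> sq_integrable (\<lambda>x. V x *\<^sub>R rep_L2 u x)" for u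
    using sq_integrable_scaleR[of "\<lambda>x. V x *\<^sub>R rep_L2 u x" "-1"] sq_integrable_scaleR[of "\<lambda>x. - V x *\<^sub>R rep_L2 u x" "-1"]
    by auto
  then show ?thesis by (simp add: mult_dom_def)
qed

lemma mult_op_uminus: "u \<in> mult_dom V \<Longrightarrow> mult_op (\<lambda>x. - V x) u = (-1) *\<^sub>C mult_op V u"
proof (rule L2_eqI)
  assume u: "u \<in> mult_dom V"
  then have "u \<in> mult_dom (\<lambda>x. - V x)" by (simp add: mult_dom_uminus)
  from rep_mult_op[OF this] rep_mult_op[OF u] rep_scaleC[of "-1" "mult_op V u"]
  show "AE x in lborel. rep_L2 (mult_op (\<lambda>x. - V x) u) x = rep_L2 ((-1) *\<^sub>C mult_op V u) x"
  proof eventually_elim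
    case (elim x)
    show ?case unfolding elim by (simp add: vec_eq_iff)
  qed
qed

lemma dirac_uminus:
  "dirac m (\<lambda>x. - V x) = op_on (H1 \<inter> mult_dom V)
     (\<lambda>u. (-\<i>) *\<^sub>C mat_op \<sigma>1 (weak_derivative u) + complex_of_real m *\<^sub>C mat_op \<sigma>3 u - \<i> *\<^sub>C mult_op V u)"
proof -
  have "\<i> *\<^sub>C mult_op (\<lambda>x. - V x) u = - (\<i> *\<^sub>C mult_op V u)" if "u \<in> mult_dom V" for u
    using that by (simp add: mult_op_uminus scaleC_scaleC complex_vector.scale_minus_left)
  then show ?thesis unfolding dirac_def mult_dom_uminus op_on_def by auto
qed

section \<open>The basic estimate\<close>

lemma complex_norm2: "(norm z)\<^sup>2 = (Re z)\<^sup>2 + (Im z)\<^sup>2"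
  by (rule cmod_power2)

text \<open>Derivatives and values mix only through \<open>a' * cnj b + a * cnj b'\<close>, which is
  the derivative of \<open>a * cnj b\<close>. Integration by parts moves this derivative onto the
  coefficient, where it produces \<open>V'\<close>.\<close>

lemma dirac_pointwise:
  fixes a b a' b' :: complex and m v :: real
  shows "(norm (- \<i> * b' + (of_real m + \<i> * of_real v) * a))\<^sup>2 + (norm (- \<i> * a' + (- of_real m + \<i> * of_real v) * b))\<^sup>2
    = (norm a')\<^sup>2 + (norm b')\<^sup>2 + (m\<^sup>2 + v\<^sup>2) * ((norm a)\<^sup>2 + (norm b)\<^sup>2)
      - 2 * Re ((of_real v - \<i> * of_real m) * (a' * cnj b + a * cnj b'))"
  unfolding complex_norm2 by (simp add: power2_eq_square algebra_simps)

lemma two_norm_mult_le: "2 * norm (a * cnj b) \<le> (norm a)\<^sup>2 + (norm b)\<^sup>2"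
  using zero_le_power2[of "norm a - norm b"] by (simp add: norm_mult power2_diff)

locale dirac_potential =
  fixes m :: real and V V' :: "real \<Rightarrow> real" and \<epsilon> M :: real
  assumes m: "m > 0" and V': "\<And>x. (V has_real_derivative V' x) (at x)" and V'_cont: "continuous_on UNIV V'"
    and \<epsilon>: "0 < \<epsilon>" "\<epsilon> < 1" and M: "M > 0" and V'_bound: "\<And>x. \<bar>V' x\<bar> \<le> \<epsilon> * (V x)\<^sup>2 + M"
begin

text \<open>All hypotheses are even in \<open>V\<close>. Together with \<open>adjoint_eq\<close>
  this makes every result of the locale available for the adjoint.\<close>

lemma uminus: "dirac_potential m (\<lambda>x. - V x) (\<lambda>x. - V' x) \<epsilon> M"
  by unfold_locales (use m V' V'_cont \<epsilon> M V'_bound in \<open>auto intro!: continuous_intros DERIV_minus\<close>)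

lemma V_cont: "continuous_on S V"
  using V' by (intro continuous_at_imp_continuous_on) (auto intro: DERIV_isCont)

lemma V_borel [measurable]: "V \<in> borel_measurable borel"
  by (rule borel_measurable_continuous_onI[OF V_cont])

text \<open>Half of the gap \<open>1 - \<epsilon>\<close>: of the coefficient 1 of
  \<open>(V x)\<^sup>2\<close>, the bound on \<open>V'\<close> consumes \<open>\<epsilon>\<close>,
  the slope of the cutoff consumes \<open>\<kappa>\<close>, and \<open>\<kappa>\<close>
  remains.\<close>

definition \<kappa> :: real where "\<kappa> = (1 - \<epsilon>) / 2"

text \<open>\<open>M\<close> comes from the bound on \<open>V'\<close>, \<open>1 / \<kappa>\<close>
  from Young's inequality for the product of the cutoff's slope with \<open>V\<close>, and
  \<open>2 * m\<close> from its product with \<open>m\<close>.\<close>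

definition C0 :: real where "C0 = M + 1 / \<kappa> + 2 * m"

lemma \<kappa>: "\<kappa> > 0" "1 - \<epsilon> - \<kappa> = \<kappa>" "\<kappa> \<le> 1" using \<epsilon> by (simp_all add: \<kappa>_def field_simps)

lemma C0: "C0 > 0" using \<kappa> m M by (simp add: C0_def add_pos_pos)

definition energy :: "(real \<Rightarrow> complex) \<Rightarrow> (real \<Rightarrow> complex) \<Rightarrow> (real \<Rightarrow> complex) \<Rightarrow> (real \<Rightarrow> complex) \<Rightarrow> real \<Rightarrow> real" where
  "energy a b a' b' x = (norm (a' x))\<^sup>2 + (norm (b' x))\<^sup>2 + \<kappa> * (V x)\<^sup>2 * ((norm (a x))\<^sup>2 + (norm (b x))\<^sup>2)"

text \<open>The density of the squared norm of \<open>H u\<close>, written for four independent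
  functions: the estimate is also applied to spinors whose membership in the domain is still to be
  proved.\<close>

definition gnorm :: "(real \<Rightarrow> complex) \<Rightarrow> (real \<Rightarrow> complex) \<Rightarrow> (real \<Rightarrow> complex) \<Rightarrow> (real \<Rightarrow> complex) \<Rightarrow> real \<Rightarrow> real" where
  "gnorm a b a' b' x = (norm (- \<i> * b' x + (of_real m + \<i> * of_real (V x)) * a x))\<^sup>2
     + (norm (- \<i> * a' x + (- of_real m + \<i> * of_real (V x)) * b x))\<^sup>2"

text \<open>The expression under \<open>Re\<close> is the derivative of
  \<open>\<theta>\<^sup>2 * (V - \<i> * m) * a * cnj b\<close> when \<open>\<theta>'\<close>,
  \<open>a'\<close> and \<open>b'\<close> are derivatives, so it integrates to zero. What is left is
  a pointwise bound on the coefficient of \<open>a * cnj b\<close>.\<close>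

lemma cutoff_pointwise:
  fixes \<theta> \<theta>' :: real
  assumes \<theta>: "0 \<le> \<theta>" "\<theta> \<le> 1" "\<bar>\<theta>'\<bar> \<le> 1"
  shows "\<theta>\<^sup>2 * energy a b a' b' x - C0 * ((norm (a x))\<^sup>2 + (norm (b x))\<^sup>2) \<le> \<theta>\<^sup>2 * gnorm a b a' b' x
    + 2 * Re ((of_real (2 * \<theta> * \<theta>') * (of_real (V x) - \<i> * of_real m) + of_real (\<theta>\<^sup>2 * V' x)) * (a x * cnj (b x))
       + of_real (\<theta>\<^sup>2) * (of_real (V x) - \<i> * of_real m) * (a' x * cnj (b x) + a x * cnj (b' x)))"
proof -
  define n where "n = (norm (a x))\<^sup>2 + (norm (b x))\<^sup>2"
  define f where "f = (norm (a' x))\<^sup>2 + (norm (b' x))\<^sup>2"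
  define W where "W = of_real (2 * \<theta> * \<theta>') * (of_real (V x) - \<i> * of_real m) + complex_of_real (\<theta>\<^sup>2 * V' x)"
  define q where "q = Re ((of_real (V x) - \<i> * of_real m) * (a' x * cnj (b x) + a x * cnj (b' x)))"
  have n0: "0 \<le> n" by (simp add: n_def)
  have g: "gnorm a b a' b' x = f + (m\<^sup>2 + (V x)\<^sup>2) * n - 2 * q"
    unfolding gnorm_def f_def n_def q_def by (rule dirac_pointwise)
  have e: "energy a b a' b' x = f + \<kappa> * (V x)\<^sup>2 * n" unfolding energy_def f_def n_def ..
  have W_le: "norm W \<le> \<theta>\<^sup>2 * (\<epsilon> + \<kappa>) * (V x)\<^sup>2 + C0"
  proof -
    have "norm (complex_of_real (V x) - \<i> * of_real m) \<le> \<bar>V x\<bar> + m"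
      using m by (intro norm_triangle_le_diff) (simp add: norm_mult)
    then have "norm W \<le> \<bar>2 * \<theta> * \<theta>'\<bar> * (\<bar>V x\<bar> + m) + \<bar>\<theta>\<^sup>2 * V' x\<bar>"
      unfolding W_def by (intro norm_triangle_le add_mono) (simp_all only: norm_mult norm_of_real mult_left_mono abs_ge_zero order_refl)
    also have "\<dots> \<le> (2 * \<theta>) * (\<bar>V x\<bar> + m) + \<theta>\<^sup>2 * (\<epsilon> * (V x)\<^sup>2 + M)"
    proof (intro add_mono mult_right_mono)
      show "\<bar>2 * \<theta> * \<theta>'\<bar> \<le> 2 * \<theta>" using \<theta> by (simp add: abs_mult mult_left_le)
      show "\<bar>\<theta>\<^sup>2 * V' x\<bar> \<le> \<theta>\<^sup>2 * (\<epsilon> * (V x)\<^sup>2 + M)"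
        unfolding abs_mult using V'_bound[of x] by (simp add: mult_left_mono)
    qed (use m in simp)
    also have "\<dots> \<le> \<theta>\<^sup>2 * (\<epsilon> + \<kappa>) * (V x)\<^sup>2 + C0"
    proof -
      \<comment> \<open>Young's inequality, weighted such that the part with
        \<open>(V x)\<^sup>2\<close> costs exactly \<open>\<kappa>\<close>.\<close>
      have "0 \<le> (sqrt \<kappa> * (\<theta> * \<bar>V x\<bar>) - 1 / sqrt \<kappa>)\<^sup>2" by simp
      also have "\<dots> = \<kappa> * (\<theta>\<^sup>2 * (V x)\<^sup>2) - 2 * (\<theta> * \<bar>V x\<bar>) + 1 / \<kappa>"
        using \<kappa>(1) by (simp add: power2_diff power_mult_distrib power_divide)
      finally have "2 * (\<theta> * \<bar>V x\<bar>) \<le> \<kappa> * (\<theta>\<^sup>2 * (V x)\<^sup>2) + 1 / \<kappa>" by simp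
      moreover have "2 * \<theta> * m \<le> 2 * m" using \<theta> m by (simp add: mult_left_le_one_le)
      moreover have "\<theta>\<^sup>2 * M \<le> M" using \<theta> M by (simp add: mult_left_le_one_le power_le_one)
      ultimately show ?thesis by (simp add: C0_def algebra_simps)
    qed
    finally show ?thesis .
  qed
  have "- (2 * Re (W * (a x * cnj (b x)))) \<le> 2 * norm (W * (a x * cnj (b x)))"
    using abs_Re_le_cmod[of "W * (a x * cnj (b x))"] by linarith
  also have "\<dots> = norm W * (2 * norm (a x * cnj (b x)))" by (simp add: norm_mult)
  also have "\<dots> \<le> (\<theta>\<^sup>2 * (\<epsilon> + \<kappa>) * (V x)\<^sup>2 + C0) * n"
    unfolding n_def by (intro mult_mono W_le two_norm_mult_le) (use W_le norm_ge_zero order_trans in \<open>blast, auto\<close>)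
  finally have *: "- (2 * Re (W * (a x * cnj (b x)))) \<le> \<theta>\<^sup>2 * (\<epsilon> + \<kappa>) * (V x)\<^sup>2 * n + C0 * n"
    by (simp add: algebra_simps)
  have "\<epsilon> + \<kappa> = 1 - \<kappa>" using \<kappa>(2) by simp
  with * have **: "- (2 * Re (W * (a x * cnj (b x)))) \<le> \<theta>\<^sup>2 * (V x)\<^sup>2 * n - \<theta>\<^sup>2 * \<kappa> * (V x)\<^sup>2 * n + C0 * n"
    by (simp add: algebra_simps)
  have q2: "Re (of_real (\<theta>\<^sup>2) * (of_real (V x) - \<i> * of_real m) * (a' x * cnj (b x) + a x * cnj (b' x))) = \<theta>\<^sup>2 * q"
    unfolding q_def mult.assoc Re_complex_of_real[symmetric] by (simp add: algebra_simps del: of_real_power)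
  have "0 \<le> \<theta>\<^sup>2 * m\<^sup>2 * n" using n0 by simp
  with ** show ?thesis
    unfolding W_def[symmetric] plus_complex.simps q2 g e n_def[symmetric] by (simp add: algebra_simps)
qed

text \<open>The integration by parts uses a differentiable cutoff that vanishes at both ends of the
  interval, so a parabola serves. \<open>N \<ge> 2\<close> bounds its slope, at most
  \<open>2 / N\<close> in modulus, by 1.\<close>

lemma cutoff_estimate:
  assumes a: "prim a' a" and b: "prim b' b" and N: "N \<ge> 2"
    and f2: "set_integrable lborel {-N..N} (\<lambda>x. (norm (a' x))\<^sup>2)" "set_integrable lborel {-N..N} (\<lambda>x. (norm (b' x))\<^sup>2)"
  defines "\<theta> \<equiv> \<lambda>x. 1 - (x / N)\<^sup>2"
  shows "(LINT x:{-N..N}|lborel. (\<theta> x)\<^sup>2 * energy a b a' b' x) \<le>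
    (LINT x:{-N..N}|lborel. gnorm a b a' b' x) + C0 * (LINT x:{-N..N}|lborel. (norm (a x))\<^sup>2 + (norm (b x))\<^sup>2)"
    "set_integrable lborel {-N..N} (\<lambda>x. (\<theta> x)\<^sup>2 * energy a b a' b' x)"
    "set_integrable lborel {-N..N} (gnorm a b a' b')"
proof -
  let ?J = "{-N..N}"
  define \<theta>' where "\<theta>' x = - 2 * x / N\<^sup>2" for x
  define P where "P x = a x * cnj (b x)" for x
  define p where "p x = a' x * cnj (b x) + a x * cnj (b' x)" for x
  define W where "W x = of_real ((\<theta> x)\<^sup>2) * (of_real (V x) - \<i> * of_real m)" for x
  define w where "w x = of_real (2 * \<theta> x * \<theta>' x) * (of_real (V x) - \<i> * of_real m) + complex_of_real ((\<theta> x)\<^sup>2 * V' x)" for x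
  have Npos: "N > 0" using N by simp
  have d\<theta>: "(\<theta> has_real_derivative \<theta>' x) (at x)" for x
    unfolding \<theta>_def \<theta>'_def using Npos
    by (auto intro!: derivative_eq_intros simp: power2_eq_square)
  have c: "continuous_on S \<theta>" "continuous_on S \<theta>'" for S
    using Npos unfolding \<theta>_def \<theta>'_def by (auto intro!: continuous_intros)
  have V'c: "continuous_on S V'" for S using V'_cont continuous_on_subset by blast
  have pP: "prim p P" unfolding p_def P_def by (rule prim_mult[OF a prim_cnj[OF b]])
  have dW: "(W has_vector_derivative w x) (at x)" for x
  proof -
    have "((\<lambda>x. of_real ((\<theta> x)\<^sup>2 * V x) - \<i> * of_real ((\<theta> x)\<^sup>2 * m)) has_vector_derivative
       of_real (2 * \<theta> x * \<theta>' x * V x + (\<theta> x)\<^sup>2 * V' x) - \<i> * of_real (2 * \<theta> x * \<theta>' x * m)) (at x)"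
      by (intro has_vector_derivative_diff has_vector_derivative_of_real has_vector_derivative_mult_right)
        (auto intro!: derivative_eq_intros d\<theta> V' simp: algebra_simps)
    moreover have "of_real (2 * \<theta> x * \<theta>' x * V x + (\<theta> x)\<^sup>2 * V' x) - \<i> * of_real (2 * \<theta> x * \<theta>' x * m) = w x"
      by (simp add: w_def algebra_simps)
    moreover have "(\<lambda>x. of_real ((\<theta> x)\<^sup>2 * V x) - \<i> * of_real ((\<theta> x)\<^sup>2 * m)) = W"
      by (simp add: W_def algebra_simps fun_eq_iff)
    ultimately show ?thesis by simp
  qed
  have pW: "prim w W"
    by (rule primI_continuous[OF dW]) (unfold w_def, intro continuous_intros c V_cont V'c)
  have ints: "set_integrable lborel ?J (\<lambda>x. w x * P x + W x * p x)" by (rule prim_integrable[OF prim_mult[OF pW pP]])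
  have "(LINT x:?J|lborel. w x * P x + W x * p x) = W N * P N - W (- N) * P (- N)"
    by (rule prim_eq[OF prim_mult[OF pW pP], symmetric]) (use Npos in simp)
  also have "\<dots> = 0" using Npos by (simp add: W_def \<theta>_def)
  finally have int0: "(LINT x:?J|lborel. w x * P x + W x * p x) = 0" .
  have intR: "set_integrable lborel ?J (\<lambda>x. 2 * Re (w x * P x + W x * p x))"
    "(LINT x:?J|lborel. 2 * Re (w x * P x + W x * p x)) = 0"
  proof -
    have i: "integrable lborel (\<lambda>x. Re (indicat_real ?J x *\<^sub>R (w x * P x + W x * p x)))"
      using ints unfolding set_integrable_def by (rule integrable_Re)
    have e: "indicat_real ?J x *\<^sub>R (2 * Re (w x * P x + W x * p x)) = 2 * Re (indicat_real ?J x *\<^sub>R (w x * P x + W x * p x))" for x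
      by (simp add: indicator_def)
    show "set_integrable lborel ?J (\<lambda>x. 2 * Re (w x * P x + W x * p x))"
      unfolding set_integrable_def e by (intro integrable_mult_right i)
    show "(LINT x:?J|lborel. 2 * Re (w x * P x + W x * p x)) = 0"
      unfolding set_lebesgue_integral_def e integral_mult_right_zero
      using int0 integral_Re[OF ints[unfolded set_integrable_def]] by (simp add: set_lebesgue_integral_def)
  qed
  have ac: "continuous_on S a" "continuous_on S b" for S using a b by (auto intro: prim_continuous)
  have n2: "set_integrable lborel ?J (\<lambda>x. (norm (a x))\<^sup>2 + (norm (b x))\<^sup>2)"
    by (intro borel_integrable_atLeastAtMost' continuous_intros ac)
  note am = set_integrable_mult_continuous_real
  have en: "set_integrable lborel ?J (energy a b a' b')"
    unfolding energy_def
    by (intro set_integral_add f2 am n2 continuous_intros V_cont)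
  then show enx: "set_integrable lborel ?J (\<lambda>x. (\<theta> x)\<^sup>2 * energy a b a' b' x)"
    by (intro am continuous_intros c)
  have geq: "gnorm a b a' b' x = ((norm (a' x))\<^sup>2 + (norm (b' x))\<^sup>2) + (m\<^sup>2 + (V x)\<^sup>2) * ((norm (a x))\<^sup>2 + (norm (b x))\<^sup>2)
     - 2 * Re ((of_real (V x) - \<i> * of_real m) * p x)" for x
    unfolding gnorm_def p_def by (rule dirac_pointwise)
  have rp: "set_integrable lborel ?J (\<lambda>x. 2 * Re ((of_real (V x) - \<i> * of_real m) * p x))"
  proof -
    have "set_integrable lborel ?J (\<lambda>x. p x * (of_real (V x) - \<i> * of_real m))"
      by (intro set_integrable_mult_continuous prim_integrable[OF pP] continuous_intros V_cont)
    then have "integrable lborel (\<lambda>x. 2 * Re (indicat_real ?J x *\<^sub>R (p x * (of_real (V x) - \<i> * of_real m))))"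
      unfolding set_integrable_def by (intro integrable_mult_right integrable_Re)
    then show ?thesis unfolding set_integrable_def
      by (rule Bochner_Integration.integrable_cong[THEN iffD1, rotated 2]) (auto simp: indicator_def mult.commute)
  qed
  show gi: "set_integrable lborel ?J (gnorm a b a' b')"
    unfolding geq[abs_def] by (intro set_integral_diff set_integral_add f2 rp am n2 continuous_intros V_cont)
  have \<theta>J: "0 \<le> \<theta> x" "\<theta> x \<le> 1" "\<bar>\<theta>' x\<bar> \<le> 1" if x: "x \<in> ?J" for x
  proof -
    have ax: "\<bar>x\<bar> \<le> N" using x by auto
    then have "\<bar>x / N\<bar> \<le> 1" using Npos by (simp add: abs_divide)
    then have "(x / N)\<^sup>2 \<le> 1" by (simp add: abs_square_le_1)
    then show "0 \<le> \<theta> x" "\<theta> x \<le> 1" by (simp_all add: \<theta>_def)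
    have "2 * \<bar>x\<bar> \<le> N * N" using ax N by (intro mult_mono) auto
    then show "\<bar>\<theta>' x\<bar> \<le> 1" using Npos by (simp add: \<theta>'_def abs_mult power2_eq_square divide_le_eq)
  qed
  have gx: "set_integrable lborel ?J (\<lambda>x. (\<theta> x)\<^sup>2 * gnorm a b a' b' x)" by (intro am gi continuous_intros c)
  have cn: "set_integrable lborel ?J (\<lambda>x. C0 * ((norm (a x))\<^sup>2 + (norm (b x))\<^sup>2))"
    by (rule set_integrable_mult_right) (rule n2)
  have "(LINT x:?J|lborel. (\<theta> x)\<^sup>2 * energy a b a' b' x - C0 * ((norm (a x))\<^sup>2 + (norm (b x))\<^sup>2))
      \<le> (LINT x:?J|lborel. (\<theta> x)\<^sup>2 * gnorm a b a' b' x + 2 * Re (w x * P x + W x * p x))"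
  proof (rule set_integral_mono)
    fix x assume x: "x \<in> ?J"
    show "(\<theta> x)\<^sup>2 * energy a b a' b' x - C0 * ((norm (a x))\<^sup>2 + (norm (b x))\<^sup>2)
        \<le> (\<theta> x)\<^sup>2 * gnorm a b a' b' x + 2 * Re (w x * P x + W x * p x)"
      unfolding w_def P_def W_def p_def by (rule cutoff_pointwise[OF \<theta>J[OF x]])
  qed (intro set_integral_diff set_integral_add enx cn gx intR)+
  also have "\<dots> = (LINT x:?J|lborel. (\<theta> x)\<^sup>2 * gnorm a b a' b' x)"
    by (simp only: set_integral_add(2)[OF gx intR(1)] intR(2) add_0_right)
  also have "\<dots> \<le> (LINT x:?J|lborel. gnorm a b a' b' x)"
    by (rule set_integral_mono[OF gx gi]) (use \<theta>J in \<open>auto simp: gnorm_def intro!: mult_left_le_one_le power_le_one\<close>)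
  finally show "(LINT x:?J|lborel. (\<theta> x)\<^sup>2 * energy a b a' b' x) \<le>
    (LINT x:?J|lborel. gnorm a b a' b' x) + C0 * (LINT x:?J|lborel. (norm (a x))\<^sup>2 + (norm (b x))\<^sup>2)"
    unfolding set_integral_diff(2)[OF enx cn] set_integral_mult_right by linarith
qed

text \<open>The derivatives are assumed square integrable only locally. That they and the product
  with \<open>V\<close> are square integrable on the whole line is a conclusion, by Fatou's lemma as
  the cutoffs tend to 1.\<close>

lemma a_priori_estimate:
  assumes a: "prim a' a" and b: "prim b' b"
    and f2: "\<And>N. set_integrable lborel {-N..N} (\<lambda>x. (norm (a' x))\<^sup>2)" "\<And>N. set_integrable lborel {-N..N} (\<lambda>x. (norm (b' x))\<^sup>2)"
    and n: "integrable lborel (\<lambda>x. (norm (a x))\<^sup>2 + (norm (b x))\<^sup>2)" and g: "integrable lborel (gnorm a b a' b')"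
  shows "integrable lborel (energy a b a' b')"
    "(LINT x|lborel. energy a b a' b' x) \<le> (LINT x|lborel. gnorm a b a' b' x) + C0 * (LINT x|lborel. (norm (a x))\<^sup>2 + (norm (b x))\<^sup>2)"
proof -
  define B where "B = (LINT x|lborel. gnorm a b a' b' x) + C0 * (LINT x|lborel. (norm (a x))\<^sup>2 + (norm (b x))\<^sup>2)"
  have [measurable]: "a \<in> borel_measurable borel" "b \<in> borel_measurable borel" "a' \<in> borel_measurable borel" "b' \<in> borel_measurable borel"
    using a b by (auto intro: prim_borel prim_measurable)
  have em [measurable]: "energy a b a' b' \<in> borel_measurable borel" unfolding energy_def[abs_def] by measurable
  have e0: "0 \<le> energy a b a' b' x" for x using \<kappa>(1) by (simp add: energy_def)
  have g0: "0 \<le> gnorm a b a' b' x" for x by (simp add: gnorm_def)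
  \<comment> \<open>The half-width \<open>k + 2\<close> meets the requirement
    \<open>N \<ge> 2\<close> of the cutoff estimate.\<close>
  define h where "h k x = indicat_real {- real (k + 2)..real (k + 2)} x * ((1 - (x / real (k + 2))\<^sup>2)\<^sup>2 * energy a b a' b' x)" for k :: nat and x
  have hm [measurable]: "h k \<in> borel_measurable borel" for k unfolding h_def[abs_def] by measurable
  have h0: "0 \<le> h k x" for k x using e0[of x] by (simp add: h_def)
  have hB: "(\<integral>\<^sup>+x. ennreal (h k x) \<partial>lborel) \<le> ennreal B" for k
  proof -
    let ?N = "real (k + 2)"
    note ce = cutoff_estimate[OF a b _ f2[of ?N]]
    have hi: "integrable lborel (h k)" using ce(2) unfolding set_integrable_def h_def by simp
    have "(LINT x|lborel. h k x) \<le> (LINT x:{-?N..?N}|lborel. gnorm a b a' b' x) + C0 * (LINT x:{-?N..?N}|lborel. (norm (a x))\<^sup>2 + (norm (b x))\<^sup>2)"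
      using ce(1) unfolding set_lebesgue_integral_def h_def by simp
    also have "\<dots> \<le> B"
      unfolding B_def set_lebesgue_integral_def
      by (intro add_mono mult_left_mono integral_mono' g n)
         (use g0 C0 in \<open>auto simp: indicator_def\<close>)
    finally show ?thesis by (subst nn_integral_eq_integral[OF hi]) (auto simp: h0 intro: ennreal_leI)
  qed
  have lim: "(\<lambda>k. h k x) \<longlonglongrightarrow> energy a b a' b' x" for x
  proof -
    have inv: "(\<lambda>k. inverse (real (k + 2))) \<longlonglongrightarrow> 0"
      using LIMSEQ_ignore_initial_segment[OF LIMSEQ_inverse_real_of_nat, of 1] by simp
    have "(\<lambda>k. (1 - (x * inverse (real (k + 2)))\<^sup>2)\<^sup>2 * energy a b a' b' x) \<longlonglongrightarrow> (1 - (x * 0)\<^sup>2)\<^sup>2 * energy a b a' b' x"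
      by (intro tendsto_intros inv)
    then have "(\<lambda>k. (1 - (x / real (k + 2))\<^sup>2)\<^sup>2 * energy a b a' b' x) \<longlonglongrightarrow> energy a b a' b' x"
      by (simp add: divide_inverse)
    moreover have "\<forall>\<^sub>F k in sequentially. (1 - (x / real (k + 2))\<^sup>2)\<^sup>2 * energy a b a' b' x = h k x"
    proof -
      obtain K where "\<bar>x\<bar> < real K" using reals_Archimedean2 by blast
      then show ?thesis by (intro eventually_sequentiallyI[of K]) (auto simp: h_def indicator_def)
    qed
    ultimately show ?thesis by (rule Lim_transform_eventually)
  qed
  have "(\<integral>\<^sup>+x. ennreal (energy a b a' b' x) \<partial>lborel) = (\<integral>\<^sup>+x. liminf (\<lambda>k. ennreal (h k x)) \<partial>lborel)"
    using lim_imp_Liminf[OF trivial_limit_sequentially tendsto_ennrealI[OF lim]] by simp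
  also have "\<dots> \<le> liminf (\<lambda>k. \<integral>\<^sup>+x. ennreal (h k x) \<partial>lborel)" by (rule nn_integral_liminf) measurable
  also have "\<dots> \<le> ennreal B" by (rule Liminf_le) (use hB in auto)
  finally have nn: "(\<integral>\<^sup>+x. ennreal (energy a b a' b' x) \<partial>lborel) \<le> ennreal B" .
  show int: "integrable lborel (energy a b a' b')"
  proof (rule integrableI_nonneg)
    show "(\<integral>\<^sup>+x. ennreal (energy a b a' b' x) \<partial>lborel) < \<infinity>" using nn by (rule order.strict_trans1) simp
  qed (use e0 in auto)
  have B0: "0 \<le> B" unfolding B_def using g0 C0 by (intro add_nonneg_nonneg mult_nonneg_nonneg integral_nonneg_AE) auto
  show "(LINT x|lborel. energy a b a' b' x) \<le> (LINT x|lborel. gnorm a b a' b' x) + C0 * (LINT x|lborel. (norm (a x))\<^sup>2 + (norm (b x))\<^sup>2)"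
    using nn nn_integral_eq_integral[OF int] e0 B0 unfolding B_def[symmetric] by (simp add: ennreal_le_iff)
qed

end

section \<open>Resolvents\<close>

lemma op_shift_iff: "(u, g) \<in> op_shift T z \<longleftrightarrow> (u, g + z *\<^sub>C u) \<in> T"
  unfolding op_shift_def by (auto simp: algebra_simps)

lemma op_adjoint_shift: "op_adjoint (op_shift T z) = op_shift (op_adjoint T) (cnj z)"
proof -
  have "(v, w) \<in> op_adjoint (op_shift T z) \<longleftrightarrow> (v, w + cnj z *\<^sub>C v) \<in> op_adjoint T" for v w
  proof -
    have "cinner (f - z *\<^sub>C u) v = cinner u w \<longleftrightarrow> cinner f v = cinner u (w + cnj z *\<^sub>C v)" for u f
      by (simp add: cinner.diff_left cinner.add_right cinner_scaleC_left cinner_scaleC_right algebra_simps)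
    moreover have "(\<forall>(u, g)\<in>op_shift T z. cinner g v = cinner u w) \<longleftrightarrow> (\<forall>(u, f)\<in>T. cinner (f - z *\<^sub>C u) v = cinner u w)"
      unfolding op_shift_def by blast
    ultimately show ?thesis unfolding op_adjoint_def by simp
  qed
  then show ?thesis by (auto simp: op_shift_iff)
qed

lemma resolvent_eqI:
  assumes "z \<in> resolvent_set T" "(u, f + z *\<^sub>C u) \<in> T"
  shows "resolvent T z f = u"
proof -
  have "(f, u) \<in> (op_shift T z)\<inverse>" using assms(2) by (simp add: op_shift_iff)
  moreover have "v = u" if "(f, v) \<in> (op_shift T z)\<inverse>" for v
    using assms that calculation unfolding resolvent_set_def by auto
  ultimately show ?thesis unfolding resolvent_def op_app_def by (rule the_equality)
qed

lemma resolvent_in: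
  assumes "z \<in> resolvent_set T"
  shows "(resolvent T z f, f + z *\<^sub>C resolvent T z f) \<in> T"
proof -
  obtain u where u: "(u, f) \<in> op_shift T z" using assms unfolding resolvent_set_def by blast
  then have "(u, f + z *\<^sub>C u) \<in> T" by (simp add: op_shift_iff)
  with resolvent_eqI[OF assms this] show ?thesis by simp
qed

lemma resolvent_bounded_linear: "z \<in> resolvent_set T \<Longrightarrow> bounded_linear (resolvent T z)"
  by (simp add: resolvent_set_def)

lemma resolvent_scaleC:
  assumes "graph_subspace T" "z \<in> resolvent_set T"
  shows "resolvent T z (c *\<^sub>C f) = c *\<^sub>C resolvent T z f"
proof (rule resolvent_eqI[OF assms(2)])
  have "(c *\<^sub>C resolvent T z f, c *\<^sub>C (f + z *\<^sub>C resolvent T z f)) \<in> T"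
    using assms(1) resolvent_in[OF assms(2)] unfolding graph_subspace_def by blast
  then show "(c *\<^sub>C resolvent T z f, c *\<^sub>C f + z *\<^sub>C c *\<^sub>C resolvent T z f) \<in> T"
    by (simp add: scaleC_add_right scaleC_scaleC mult.commute)
qed

text \<open>For mutually adjoint operators two lower bounds suffice: an adjoint is closed, and the
  bound for \<open>S\<close> at \<open>cnj z\<close> makes the adjoint of the shifted
  \<open>T\<close> injective.\<close>

lemma resolvent_setI:
  fixes T S :: "('a::{complex_inner, complete_space}) operator"
  assumes TS: "T = op_adjoint S" "op_adjoint T = S" and c: "c > 0"
    and T: "\<And>u f. (u, f) \<in> T \<Longrightarrow> c * norm u \<le> norm (f - z *\<^sub>C u)"
    and S: "\<And>u f. (u, f) \<in> S \<Longrightarrow> c * norm u \<le> norm (f - cnj z *\<^sub>C u)"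
  shows "z \<in> resolvent_set T" "norm (resolvent T z f) \<le> norm f / c"
proof -
  let ?Tz = "op_shift T z"
  have eq: "?Tz = op_adjoint (op_shift S (cnj z))" by (simp add: op_adjoint_shift TS(1))
  have gs: "graph_subspace ?Tz" "closed ?Tz" unfolding eq by (rule graph_subspace_adjoint closed_adjoint)+
  have below: "c * norm u \<le> norm g" if "(u, g) \<in> ?Tz" for u g
    using T[of u "g + z *\<^sub>C u"] that by (simp add: op_shift_iff)
  have adj: "v = 0" if "(v, 0) \<in> op_adjoint ?Tz" for v
    using S[of v "0 + cnj z *\<^sub>C v"] that c by (simp add: op_adjoint_shift TS(2) op_shift_iff mult_le_0_iff)
  have ex1: "\<exists>!u. (u, f) \<in> ?Tz" for f
    by (rule bijective_if_bounded_below[OF gs c below adj])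
  define R where "R = resolvent T z"
  have R: "(R f, f) \<in> ?Tz" for f
    using theI'[OF ex1[of f]] by (simp add: R_def resolvent_def op_app_def)
  have un: "u = R f" if "(u, f) \<in> ?Tz" for u f using ex1[of f] R[of f] that by blast
  have sub: "subspace ?Tz" using gs(1) by (simp add: graph_subspace_def)
  have nR: "norm (R f) \<le> norm f / c" for f
    using below[OF R[of f]] c by (simp add: field_simps)
  have "bounded_linear R"
  proof (rule bounded_linear_intro[of _ "1 / c"])
    show "R (x + y) = R x + R y" for x y
      by (rule un[symmetric]) (use subspace_add[OF sub R[of x] R[of y]] in simp)
    show "R (r *\<^sub>R x) = r *\<^sub>R R x" for r x
      by (rule un[symmetric]) (use subspace_scale[OF sub R[of x], of r] in simp)
  qed (use nR in simp)
  with ex1 show "z \<in> resolvent_set T" by (simp add: resolvent_set_def R_def)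
  show "norm (resolvent T z f) \<le> norm f / c" using nR by (simp add: R_def)
qed

section \<open>Smooth spinors\<close>

lemma funpow_vector_derivative_linear:
  fixes \<phi> :: "real \<Rightarrow> 'b::real_normed_vector" and L :: "'b \<Rightarrow> 'c::real_normed_vector"
  assumes L: "bounded_linear L"
    and \<phi>: "\<And>n x. ((\<lambda>g x. vector_derivative g (at x)) ^^ n) \<phi> differentiable (at x)"
  shows "((\<lambda>g x. vector_derivative g (at x)) ^^ n) (\<lambda>x. L (\<phi> x)) = (\<lambda>x. L (((\<lambda>g x. vector_derivative g (at x)) ^^ n) \<phi> x))"
proof (induction n)
  case (Suc n)
  have "vector_derivative (\<lambda>x. L (((\<lambda>g x. vector_derivative g (at x)) ^^ n) \<phi> x)) (at x)
     = L (vector_derivative (((\<lambda>g x. vector_derivative g (at x)) ^^ n) \<phi>) (at x))" for x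
    by (rule vector_derivative_at) (rule bounded_linear.has_vector_derivative[OF L vector_derivative_works[THEN iffD1, OF \<phi>]])
  then show ?case by (simp add: Suc)
qed simp

lemma test_functions_linear:
  assumes L: "bounded_linear L" and \<phi>: "\<phi> \<in> test_functions"
  shows "(\<lambda>x. L (\<phi> x)) \<in> test_functions"
proof -
  have d: "((\<lambda>g x. vector_derivative g (at x)) ^^ n) \<phi> differentiable (at x)" for n x
    using \<phi> by (simp add: test_functions_def)
  obtain R where R: "\<And>x. \<bar>x\<bar> \<ge> R \<Longrightarrow> \<phi> x = 0" using test_function_facts(5)[OF \<phi>] by blast
  show ?thesis
  proof (rule test_functionsI_support[of _ "-R" R])
    show "((\<lambda>g x. vector_derivative g (at x)) ^^ n) (\<lambda>x. L (\<phi> x)) differentiable (at x)" for n x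
      unfolding funpow_vector_derivative_linear[OF L d]
      using bounded_linear.has_vector_derivative[OF L vector_derivative_works[THEN iffD1, OF d]]
      by (rule differentiableI_vector)
    show "x \<in> {-R..R}" if "L (\<phi> x) \<noteq> 0" for x
      using R[of x] that linear_simps(3)[OF L] by (cases "\<bar>x\<bar> \<ge> R") auto
  qed
qed

lemma test_functions_add:
  assumes "f \<in> test_functions" "g \<in> test_functions"
  shows "(\<lambda>x. f x + g x) \<in> test_functions"
proof -
  let ?D = "\<lambda>g x. vector_derivative g (at x)"
  have df: "(?D ^^ n) f differentiable (at x)" and dg: "(?D ^^ n) g differentiable (at x)" for n x
    using assms by (auto simp: test_functions_def)
  have eq: "(?D ^^ n) (\<lambda>x. f x + g x) = (\<lambda>x. (?D ^^ n) f x + (?D ^^ n) g x)" for n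
  proof (induction n)
    case (Suc n)
    have "vector_derivative (\<lambda>x. (?D ^^ n) f x + (?D ^^ n) g x) (at x) = vector_derivative ((?D ^^ n) f) (at x) + vector_derivative ((?D ^^ n) g) (at x)" for x
      by (intro vector_derivative_at has_vector_derivative_add vector_derivative_works[THEN iffD1] df dg)
    then show ?case by (simp add: Suc)
  qed simp
  obtain R where R: "\<And>x. \<bar>x\<bar> \<ge> R \<Longrightarrow> f x = 0" using test_function_facts(5)[OF assms(1)] by blast
  obtain S where S: "\<And>x. \<bar>x\<bar> \<ge> S \<Longrightarrow> g x = 0" using test_function_facts(5)[OF assms(2)] by blast
  show ?thesis
  proof (rule test_functionsI_support[of _ "- max R S" "max R S"])
    show "(?D ^^ n) (\<lambda>x. f x + g x) differentiable (at x)" for n x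
      unfolding eq by (intro differentiable_add df dg)
    show "x \<in> {- max R S..max R S}" if "f x + g x \<noteq> 0" for x
      using R[of x] S[of x] that by (cases "\<bar>x\<bar> \<ge> max R S") auto
  qed
qed

lemma test_function_spinor:
  fixes f :: "real \<Rightarrow> complex^2"
  assumes f: "f \<in> test_functions"
  defines "f' \<equiv> \<lambda>x. vector_derivative f (at x)"
  shows "sq_integrable f" "prim (\<lambda>x. f' x $ i) (\<lambda>x. f x $ i)" "sq_integrable f'"
    "is_weak_derivative (abs_L2 f) (abs_L2 f')" "abs_L2 f \<in> H1" "weak_derivative (abs_L2 f) = abs_L2 f'"
    "continuous_on UNIV V \<Longrightarrow> abs_L2 f \<in> mult_dom V"
proof -
  note facts = test_function_facts[OF f]
  have sqt: "sq_integrable (\<lambda>x. W x *\<^sub>R g x)" if W: "continuous_on UNIV W" and g: "g \<in> test_functions" for W and g :: "real \<Rightarrow> complex^2"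
  proof -
    note gf = test_function_facts[OF g]
    obtain R where R: "\<And>x. \<bar>x\<bar> \<ge> R \<Longrightarrow> g x = 0" using gf(5) by blast
    have c: "continuous_on UNIV (\<lambda>x. W x *\<^sub>R g x)" using W gf(2) by (intro continuous_intros)
    have "set_integrable lborel {-R..R} (\<lambda>x. (norm (W x *\<^sub>R g x))\<^sup>2)"
      by (intro borel_integrable_atLeastAtMost' continuous_intros continuous_on_subset[OF W] gf(2)) auto
    moreover have "indicat_real {-R..R} x *\<^sub>R (norm (W x *\<^sub>R g x))\<^sup>2 = (norm (W x *\<^sub>R g x))\<^sup>2" for x
      using R[of x] by (cases "\<bar>x\<bar> \<ge> R") (auto simp: indicator_def)
    ultimately have "integrable lborel (\<lambda>x. (norm (W x *\<^sub>R g x))\<^sup>2)" by (simp only: set_integrable_def)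
    then show ?thesis
      using borel_measurable_continuous_onI[OF c] by (simp add: sq_integrable_def)
  qed
  have f't: "f' \<in> test_functions" unfolding f'_def by (rule facts(4))
  show sf: "sq_integrable f" "sq_integrable f'"
    using sqt[of "\<lambda>x. 1" f] sqt[of "\<lambda>x. 1" f'] f f't by simp_all
  have p: "prim (\<lambda>x. f' x $ i) (\<lambda>x. f x $ i)" for i
    unfolding f'_def
    by (intro primI_continuous bounded_linear.has_vector_derivative[OF bounded_linear_vec_nth] facts(1) continuous_intros facts(3))
  then show "prim (\<lambda>x. f' x $ i) (\<lambda>x. f x $ i)" .
  show w: "is_weak_derivative (abs_L2 f) (abs_L2 f')"
  proof (rule is_weak_derivativeI[OF p[of 1] p[of 2]])
    show "AE x in lborel. rep_L2 (abs_L2 f) x = spinor (f x $ 1) (f x $ 2)"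
      using rep_abs[OF sf(1)] by eventually_elim (simp add: spinor_eqI)
    show "AE x in lborel. rep_L2 (abs_L2 f') x = spinor (f' x $ 1) (f' x $ 2)"
      using rep_abs[OF sf(2)] by eventually_elim (simp add: spinor_eqI)
  qed
  then show "abs_L2 f \<in> H1" "weak_derivative (abs_L2 f) = abs_L2 f'"
    using weak_derivative_eqI by (auto simp: H1_def)
  show "abs_L2 f \<in> mult_dom V" if V: "continuous_on UNIV V"
    unfolding mult_dom_def mem_Collect_eq
    by (rule sq_integrable_AE_cong[OF _ _ sqt[OF V f]])
       (use rep_abs[OF sf(1)] borel_measurable_continuous_onI[OF V] in \<open>auto elim!: eventually_mono\<close>)
qed

lemma bounded_linear_spinor: "bounded_linear (\<lambda>r. r *\<^sub>R spinor z w)"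
  by (rule bounded_linear_scaleR_left)

lemma abs_plus: "sq_integrable f \<Longrightarrow> sq_integrable g \<Longrightarrow> abs_L2 f + abs_L2 g = abs_L2 (\<lambda>x. f x + g x)"
  by (simp add: plus_L2.abs_eq L2_eq_def)

lemma abs_scaleC: "sq_integrable f \<Longrightarrow> c *\<^sub>C abs_L2 f = abs_L2 (\<lambda>x. c *s f x)"
  by (simp add: scaleC_L2.abs_eq L2_eq_def)

lemma bounded_linear_csmult: "bounded_linear (\<lambda>v :: complex^2. c *s v)"
  by (rule bounded_linear_intro[of _ "norm c"])
     (simp_all add: vec_eq_iff algebra_simps norm_vector_scalar_mult)

lemma Cc_infinity_subspace:
  "0 \<in> Cc_infinity" "u \<in> Cc_infinity \<Longrightarrow> v \<in> Cc_infinity \<Longrightarrow> u + v \<in> Cc_infinity"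
  "u \<in> Cc_infinity \<Longrightarrow> c *\<^sub>C u \<in> Cc_infinity"
proof -
  have sc: "c *\<^sub>C u \<in> Cc_infinity" if "u \<in> Cc_infinity" for c u
    using that test_functions_linear[OF bounded_linear_csmult[of c]] unfolding Cc_infinity_def
    by (auto simp: abs_scaleC test_function_spinor(1))
  then show "u \<in> Cc_infinity \<Longrightarrow> c *\<^sub>C u \<in> Cc_infinity" .
  show "u \<in> Cc_infinity \<Longrightarrow> v \<in> Cc_infinity \<Longrightarrow> u + v \<in> Cc_infinity"
    unfolding Cc_infinity_def by (auto simp: abs_plus test_function_spinor(1) test_functions_add)
  have "bump 0 0 1 \<in> test_functions"
  proof (rule test_functionsI_support[of _ 0 1])
    show "((\<lambda>g x. vector_derivative g (at x)) ^^ n) (bump 0 0 1) differentiable (at x)" for n x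
      using flat_algebra_deriv[OF funpow_vector_derivative_flat_algebra[OF bump_flat_algebra[of 0 0 1], of n]]
      by (auto simp: real_differentiable_def)
    show "x \<in> {0..1}" if "bump 0 0 1 x \<noteq> 0" for x
      using bump_support[of x 0 1 0] that by (cases "x \<in> {0<..<1}") auto
  qed
  from test_functions_linear[OF bounded_linear_spinor this, of 0 0]
  have "abs_L2 (\<lambda>x. bump 0 0 1 x *\<^sub>R spinor 0 0) \<in> Cc_infinity" unfolding Cc_infinity_def by blast
  from sc[OF this, of 0] show "0 \<in> Cc_infinity" by (simp add: scaleC.zero_left)
qed

lemma integrable_nth_mult_cnj: "integrable lborel (\<lambda>x. rep_L2 u x $ i * cnj (rep_L2 v x $ j))"
proof (rule Bochner_Integration.integrable_bound)
  show "integrable lborel (\<lambda>x. (norm (rep_L2 u x $ i))\<^sup>2 + (norm (rep_L2 v x $ j))\<^sup>2)"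
    by (intro Bochner_Integration.integrable_add nth_sq_integrable)
  show "AE x in lborel. norm (rep_L2 u x $ i * cnj (rep_L2 v x $ j)) \<le> norm ((norm (rep_L2 u x $ i))\<^sup>2 + (norm (rep_L2 v x $ j))\<^sup>2)"
  proof (rule AE_I2)
    fix x show "norm (rep_L2 u x $ i * cnj (rep_L2 v x $ j)) \<le> norm ((norm (rep_L2 u x $ i))\<^sup>2 + (norm (rep_L2 v x $ j))\<^sup>2)"
      using two_norm_mult_le[of "rep_L2 u x $ i" "rep_L2 v x $ j"] norm_ge_zero[of "rep_L2 u x $ i * cnj (rep_L2 v x $ j)"]
      unfolding real_norm_def by linarith
  qed
  have "(\<lambda>x. cnj (rep_L2 v x $ j)) \<in> borel_measurable borel"
    by (rule borel_measurable_continuous_on[OF _ measurable_nth]) (intro continuous_intros)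
  then show "(\<lambda>x. rep_L2 u x $ i * cnj (rep_L2 v x $ j)) \<in> borel_measurable lborel" by simp
qed

lemma integrable_AE_cong:
  fixes f g :: "real \<Rightarrow> 'b::{banach, second_countable_topology}"
  assumes "integrable lborel f" "g \<in> borel_measurable borel" "AE x in lborel. f x = g x"
  shows "integrable lborel g" "(LINT x|lborel. g x) = (LINT x|lborel. f x)"
  using integrable_cong_AE[of f lborel g] integral_cong_AE[of f lborel g] assms by auto

lemma cinner_mat_op_\<sigma>3: "cinner u (mat_op \<sigma>3 v) = cinner (mat_op \<sigma>3 u) v"
  unfolding cinner_L2_eq
  by (rule integral_cong_AE, (intro csprod_measurable sq_integrable_measurable[OF sq_rep])+)
     (use rep_mat_op(2)[of u] rep_mat_op(2)[of v] in eventually_elim, simp add: csprod_2)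

lemma norm_mat_op_\<sigma>3: "norm (mat_op \<sigma>3 u) = norm u"
proof -
  have "(norm (mat_op \<sigma>3 u))\<^sup>2 = (norm u)\<^sup>2"
    unfolding norm_L2_sq
    by (rule integral_cong_AE) (use rep_mat_op(2)[of u] in \<open>auto simp: norm_vec2_sq elim!: eventually_mono\<close>)
  then show ?thesis by (simp add: power2_eq_iff_nonneg)
qed

context dirac_potential
begin

lemma graph_estimate:
  assumes u: "u \<in> H1" "u \<in> mult_dom V"
  shows "(norm (weak_derivative u))\<^sup>2 + \<kappa> * (norm (mult_op V u))\<^sup>2 \<le> (norm (dirac_fun m V u))\<^sup>2 + C0 * (norm u)\<^sup>2"
proof -
  obtain a b where ab: "ac_rep u a b" using ac_rep_exists[OF u(1)] by blast
  define a' where "a' x = rep_L2 (weak_derivative u) x $ 1" for x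
  define b' where "b' x = rep_L2 (weak_derivative u) x $ 2" for x
  have p: "prim a' a" "prim b' b" and r: "AE x in lborel. rep_L2 u x = spinor (a x) (b x)"
    using ab unfolding ac_rep_def a'_def b'_def by auto
  have [measurable]: "a \<in> borel_measurable borel" "b \<in> borel_measurable borel" "a' \<in> borel_measurable borel" "b' \<in> borel_measurable borel"
    using p by (auto intro: prim_borel prim_measurable)
  have f2: "set_integrable lborel {-N..N} (\<lambda>x. (norm (a' x))\<^sup>2)" "set_integrable lborel {-N..N} (\<lambda>x. (norm (b' x))\<^sup>2)" for N
    unfolding a'_def b'_def by (intro set_integrable_of_integrable nth_sq_integrable)+
  have "AE x in lborel. (norm (rep_L2 u x))\<^sup>2 = (norm (a x))\<^sup>2 + (norm (b x))\<^sup>2"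
    using r by eventually_elim (simp add: norm_vec2_sq)
  note n = integrable_AE_cong[OF integrable_norm_sq _ this]
  have "AE x in lborel. (norm (rep_L2 (dirac_fun m V u) x))\<^sup>2 = gnorm a b a' b' x"
    using rep_dirac_fun[OF u(2), of m] r
    by eventually_elim (simp add: norm_vec2_sq gnorm_def a'_def b'_def)
  note g = integrable_AE_cong[OF integrable_norm_sq _ this]
  have gm: "gnorm a b a' b' \<in> borel_measurable borel" unfolding gnorm_def[abs_def] by measurable
  have em: "energy a b a' b' \<in> borel_measurable borel" unfolding energy_def[abs_def] by measurable
  have "integrable lborel (\<lambda>x. (norm (rep_L2 (weak_derivative u) x))\<^sup>2 + \<kappa> * (norm (rep_L2 (mult_op V u) x))\<^sup>2)"
    by (intro Bochner_Integration.integrable_add integrable_mult_right integrable_norm_sq)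
  moreover have "AE x in lborel. (norm (rep_L2 (weak_derivative u) x))\<^sup>2 + \<kappa> * (norm (rep_L2 (mult_op V u) x))\<^sup>2 = energy a b a' b' x"
    using r rep_mult_op[OF u(2)]
    by eventually_elim (simp add: norm_vec2_sq energy_def a'_def b'_def power_mult_distrib algebra_simps)
  ultimately have "(LINT x|lborel. energy a b a' b' x) = (LINT x|lborel. (norm (rep_L2 (weak_derivative u) x))\<^sup>2 + \<kappa> * (norm (rep_L2 (mult_op V u) x))\<^sup>2)"
    using em by (intro integrable_AE_cong(2))
  also have "\<dots> = (norm (weak_derivative u))\<^sup>2 + \<kappa> * (norm (mult_op V u))\<^sup>2"
    unfolding norm_L2_sq using integrable_norm_sq by simp
  finally have e: "(LINT x|lborel. energy a b a' b' x) = (norm (weak_derivative u))\<^sup>2 + \<kappa> * (norm (mult_op V u))\<^sup>2" .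
  have nm: "(\<lambda>x. (norm (a x))\<^sup>2 + (norm (b x))\<^sup>2) \<in> borel_measurable borel" by measurable
  show ?thesis
    using a_priori_estimate(2)[OF p f2 n(1)[OF nm] g(1)[OF gm]]
    unfolding e g(2)[OF gm] n(2)[OF nm] norm_L2_sq[symmetric] .
qed

text \<open>Pointwise, \<open>\<i>\<close> times the difference of the two integrands is the
  derivative \<open>q\<close> of \<open>P\<close>; the mass terms cancel, and so do the potential
  terms because the sign of \<open>V\<close> changes. Both \<open>q\<close> and \<open>P\<close> are
  integrable, so \<open>prim_integral_eq_0\<close> applies.\<close>

lemma dirac_symmetric:
  assumes u: "u \<in> H1" "u \<in> mult_dom V" and v: "v \<in> H1" "v \<in> mult_dom V"
  shows "cinner (dirac_fun m V u) v = cinner u (dirac_fun m (\<lambda>x. - V x) v)"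
proof -
  obtain a b c d where ab: "ac_rep u a b" and cd: "ac_rep v c d" using ac_rep_exists u(1) v(1) by blast
  define D where "D w i x = rep_L2 (weak_derivative w) x $ i" for w i x
  have p: "prim (D u 1) a" "prim (D u 2) b" "prim (D v 1) c" "prim (D v 2) d"
    and r: "AE x in lborel. rep_L2 u x = spinor (a x) (b x)" "AE x in lborel. rep_L2 v x = spinor (c x) (d x)"
    using ab cd unfolding ac_rep_def D_def by auto
  define P where "P x = b x * cnj (c x) + a x * cnj (d x)" for x
  define q where "q x = (D u 2 x * cnj (c x) + b x * cnj (D v 1 x)) + (D u 1 x * cnj (d x) + a x * cnj (D v 2 x))" for x
  have qP: "prim q P" unfolding q_def P_def by (intro prim_add prim_mult p prim_cnj)
  define A where "A x = csprod (rep_L2 (dirac_fun m V u) x) (rep_L2 v x)" for x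
  define B where "B x = csprod (rep_L2 u x) (rep_L2 (dirac_fun m (\<lambda>x. - V x) v) x)" for x
  have i: "integrable lborel A" "integrable lborel B" unfolding A_def B_def by (intro integrable_csprod sq_rep)+
  have v': "v \<in> mult_dom (\<lambda>x. - V x)" using v(2) by (simp add: mult_dom_uminus)
  have "AE x in lborel. \<i> * (A x - B x) = q x"
    using rep_dirac_fun[OF u(2), of m] rep_dirac_fun[OF v', of m] r
  proof eventually_elim
    case (elim x)
    show ?case unfolding A_def B_def elim by (simp add: csprod_2 q_def D_def algebra_simps)
  qed
  note iq = integrable_AE_cong[OF _ prim_measurable[OF qP] this]
  have Pi: "integrable lborel P"
  proof (rule integrable_AE_cong(1))
    show "integrable lborel (\<lambda>x. rep_L2 u x $ 2 * cnj (rep_L2 v x $ 1) + rep_L2 u x $ 1 * cnj (rep_L2 v x $ 2))"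
      by (intro Bochner_Integration.integrable_add integrable_nth_mult_cnj)
    show "AE x in lborel. rep_L2 u x $ 2 * cnj (rep_L2 v x $ 1) + rep_L2 u x $ 1 * cnj (rep_L2 v x $ 2) = P x"
      using r by eventually_elim (simp add: P_def)
  qed (rule prim_borel[OF qP])
  have iAB: "integrable lborel (\<lambda>x. \<i> * (A x - B x))" using i by simp
  have "0 = (LINT x|lborel. \<i> * (A x - B x))"
    using prim_integral_eq_0[OF qP iq(1)[OF iAB] Pi] iq(2)[OF iAB] by simp
  also have "\<dots> = \<i> * ((LINT x|lborel. A x) - (LINT x|lborel. B x))" using i by simp
  finally show ?thesis by (simp add: cinner_L2_eq A_def B_def)
qed

text \<open>In the real part of the pairing of \<open>H u\<close> with \<open>\<sigma>3 u\<close>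
  the potential disappears, since \<open>\<i> * V\<close> meets a real density. The derivative term
  is the imaginary part of an exact derivative and integrates to zero, which leaves
  \<open>m * (norm u)\<^sup>2\<close>. As the inner product of \<open>u\<close> and
  \<open>\<sigma>3 u\<close> is real, \<open>z\<close> enters only through its real part.\<close>

lemma below:
  assumes u: "u \<in> H1" "u \<in> mult_dom V"
  shows "(m - \<bar>Re z\<bar>) * norm u \<le> norm (dirac_fun m V u - z *\<^sub>C u)"
proof -
  obtain a b where ab: "ac_rep u a b" using ac_rep_exists u(1) by blast
  define D where "D i x = rep_L2 (weak_derivative u) x $ i" for i x
  have p: "prim (D 1) a" "prim (D 2) b" and r: "AE x in lborel. rep_L2 u x = spinor (a x) (b x)"
    using ab unfolding ac_rep_def D_def by auto
  define P where "P x = a x * cnj (b x)" for x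
  define q where "q x = D 1 x * cnj (b x) + a x * cnj (D 2 x)" for x
  have qP: "prim q P" unfolding q_def P_def by (intro prim_mult p prim_cnj)
  have Pi: "integrable lborel P"
    by (rule integrable_AE_cong(1)[OF integrable_nth_mult_cnj[of u 1 u 2] prim_borel[OF qP]])
       (use r in \<open>auto simp: P_def elim!: eventually_mono\<close>)
  have qi: "integrable lborel q"
  proof (rule integrable_AE_cong(1)[OF _ prim_measurable[OF qP]])
    show "integrable lborel (\<lambda>x. D 1 x * cnj (rep_L2 u x $ 2) + rep_L2 u x $ 1 * cnj (D 2 x))"
      unfolding D_def by (intro Bochner_Integration.integrable_add integrable_nth_mult_cnj)
    show "AE x in lborel. D 1 x * cnj (rep_L2 u x $ 2) + rep_L2 u x $ 1 * cnj (D 2 x) = q x"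
      using r by eventually_elim (simp add: q_def)
  qed
  let ?H = "dirac_fun m V u" and ?S = "mat_op \<sigma>3 u"
  have ci: "integrable lborel (\<lambda>x. csprod (rep_L2 ?H x) (rep_L2 ?S x))" by (intro integrable_csprod sq_rep)
  have "AE x in lborel. Re (csprod (rep_L2 ?H x) (rep_L2 ?S x)) = m * (norm (rep_L2 u x))\<^sup>2 - Im (q x)"
    using rep_dirac_fun[OF u(2), of m] rep_mat_op(2)[of u] r
  proof eventually_elim
    case (elim x)
    show ?case unfolding elim norm_vec2_sq complex_norm2
      by (simp add: csprod_2 q_def D_def power2_eq_square algebra_simps)
  qed
  then have "Re (cinner ?H ?S) = (LINT x|lborel. m * (norm (rep_L2 u x))\<^sup>2 - Im (q x))"
    unfolding cinner_L2_eq integral_Re[OF ci, symmetric]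
    using integrable_norm_sq[of u] integrable_Im[OF qi] integrable_Re[OF ci] by (intro integral_cong_AE) auto
  also have "\<dots> = m * (norm u)\<^sup>2"
    using integrable_norm_sq[of u] integrable_Im[OF qi] prim_integral_eq_0[OF qP qi Pi]
    by (simp add: norm_L2_sq integral_Im[OF qi])
  finally have H: "Re (cinner ?H ?S) = m * (norm u)\<^sup>2" .
  have im: "Im (cinner u ?S) = 0"
    using cinner_commute[of u ?S] cinner_mat_op_\<sigma>3[of u u] by (metis cnj.simps(2) neg_equal_zero)
  have "norm (cinner u ?S) \<le> norm u * norm ?S" by (rule norm_cinner_le)
  then have s: "\<bar>Re (cinner u ?S)\<bar> \<le> (norm u)\<^sup>2"
    using abs_Re_le_cmod[of "cinner u ?S"] by (simp add: norm_mat_op_\<sigma>3 power2_eq_square)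
  have "Re z * Re (cinner u ?S) \<le> \<bar>Re z\<bar> * \<bar>Re (cinner u ?S)\<bar>" by (simp flip: abs_mult)
  also have "\<dots> \<le> \<bar>Re z\<bar> * (norm u)\<^sup>2" using s by (rule mult_left_mono) simp
  finally have "(m - \<bar>Re z\<bar>) * (norm u)\<^sup>2 \<le> Re (cinner (?H - z *\<^sub>C u) ?S)"
    using H im by (simp add: cinner.diff_left cinner_scaleC_left algebra_simps)
  also have "\<dots> \<le> norm (?H - z *\<^sub>C u) * norm ?S"
    using norm_cinner_le complex_Re_le_cmod order_trans by blast
  finally have "((m - \<bar>Re z\<bar>) * norm u) * norm u \<le> norm (?H - z *\<^sub>C u) * norm u"
    by (simp add: norm_mat_op_\<sigma>3 power2_eq_square)
  then show ?thesis by (cases "u = 0") (auto simp: mult_le_cancel_right)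
qed

text \<open>Testing shows that \<open>v\<close> solves the first-order system in the weak sense,
  hence it is locally absolutely continuous by du Bois-Reymond's lemma. The a priori estimate for
  \<open>- V\<close> then places it in the domain.\<close>

lemma adjoint_test_functions:
  assumes vw: "(v, w) \<in> op_adjoint (dirac m V \<inter> Cc_infinity \<times> UNIV)"
  shows "(v, w) \<in> dirac m (\<lambda>x. - V x)"
proof -
  interpret neg: dirac_potential m "\<lambda>x. - V x" "\<lambda>x. - V' x" \<epsilon> M by (rule uminus)
  \<comment> \<open>The equations of the operator with potential \<open>- V\<close>, solved for the
    derivatives of the two components of \<open>v\<close>.\<close>
  define h1 where "h1 x = \<i> * (rep_L2 w x $ 2 + (of_real m + \<i> * of_real (V x)) * rep_L2 v x $ 2)" for x
  define h2 where "h2 x = \<i> * (rep_L2 w x $ 1 - (of_real m - \<i> * of_real (V x)) * rep_L2 v x $ 1)" for x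
  have hm [measurable]: "h1 \<in> borel_measurable borel" "h2 \<in> borel_measurable borel"
    unfolding h1_def[abs_def] h2_def[abs_def] by measurable
  have hsq: "set_integrable lborel {s..t} (\<lambda>x. (norm (h1 x))\<^sup>2)" "set_integrable lborel {s..t} (\<lambda>x. (norm (h2 x))\<^sup>2)" for s t
  proof -
    have le: "(norm (\<i> * (y + c * z)))\<^sup>2 \<le> 2 * (norm y)\<^sup>2 + 2 * ((norm c)\<^sup>2 * (norm z)\<^sup>2)" for y c z :: complex
    proof -
      have "(norm (\<i> * (y + c * z)))\<^sup>2 \<le> (norm y + norm c * norm z)\<^sup>2"
        by (intro power_mono) (simp_all add: norm_mult norm_triangle_le norm_triangle_ineq[THEN order_trans])
      also have "\<dots> \<le> 2 * (norm y)\<^sup>2 + 2 * ((norm c)\<^sup>2 * (norm z)\<^sup>2)"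
        using zero_le_power2[of "norm y - norm c * norm z"] by (simp add: power2_sum power2_diff power_mult_distrib)
      finally show ?thesis .
    qed
    have nc: "(norm (complex_of_real m + \<i> * complex_of_real (V x)))\<^sup>2 = m\<^sup>2 + (V x)\<^sup>2"
      "(norm (complex_of_real m - \<i> * complex_of_real (V x)))\<^sup>2 = m\<^sup>2 + (V x)\<^sup>2" for x
      by (simp_all add: complex_norm2)
    have bi: "set_integrable lborel {s..t} (\<lambda>x. 2 * (norm (rep_L2 w x $ i))\<^sup>2 + 2 * ((m\<^sup>2 + (V x)\<^sup>2) * (norm (rep_L2 v x $ j))\<^sup>2))" for i j
      by (intro set_integral_add set_integrable_mult_right set_integrable_mult_continuous_real continuous_intros V_cont
          set_integrable_of_integrable nth_sq_integrable)
    have bd: "set_integrable lborel {s..t} (\<lambda>x. (norm (h x))\<^sup>2)"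
      if "h \<in> borel_measurable borel" "\<And>x. (norm (h x))\<^sup>2 \<le> 2 * (norm (rep_L2 w x $ i))\<^sup>2 + 2 * ((m\<^sup>2 + (V x)\<^sup>2) * (norm (rep_L2 v x $ j))\<^sup>2)" for h :: "real \<Rightarrow> complex" and i j
      using bi[of i j] unfolding set_integrable_def
    proof (rule Bochner_Integration.integrable_bound)
      show "AE x in lborel. norm (indicat_real {s..t} x *\<^sub>R (norm (h x))\<^sup>2) \<le> norm (indicat_real {s..t} x *\<^sub>R (2 * (norm (rep_L2 w x $ i))\<^sup>2 + 2 * ((m\<^sup>2 + (V x)\<^sup>2) * (norm (rep_L2 v x $ j))\<^sup>2)))"
      proof (rule AE_I2)
        fix x show "norm (indicat_real {s..t} x *\<^sub>R (norm (h x))\<^sup>2) \<le> norm (indicat_real {s..t} x *\<^sub>R (2 * (norm (rep_L2 w x $ i))\<^sup>2 + 2 * ((m\<^sup>2 + (V x)\<^sup>2) * (norm (rep_L2 v x $ j))\<^sup>2)))"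
          using that(2)[of x] by (simp add: indicator_def)
      qed
    qed (use that(1) in measurable)
    show "set_integrable lborel {s..t} (\<lambda>x. (norm (h1 x))\<^sup>2)"
      by (rule bd[OF hm(1), where i = 2 and j = 2]) (unfold h1_def nc(1)[symmetric], rule le)
    show "set_integrable lborel {s..t} (\<lambda>x. (norm (h2 x))\<^sup>2)"
    proof (rule bd[OF hm(2)])
      show "(norm (h2 x))\<^sup>2 \<le> 2 * (norm (rep_L2 w x $ 1))\<^sup>2 + 2 * ((m\<^sup>2 + (V x)\<^sup>2) * (norm (rep_L2 v x $ 1))\<^sup>2)" for x
      proof -
        have h: "h2 x = \<i> * (rep_L2 w x $ 1 + (- (of_real m - \<i> * of_real (V x))) * rep_L2 v x $ 1)"
          by (simp add: h2_def algebra_simps)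
        show ?thesis unfolding h nc(2)[symmetric] norm_minus_cancel[symmetric, of "of_real m - \<i> * of_real (V x)"] by (rule le)
      qed
    qed
  qed
  have test: "cinner v (dirac_fun m V u) = cinner w u" if u: "u \<in> Cc_infinity" for u
  proof -
    have "u \<in> H1 \<inter> mult_dom V" using u test_function_spinor(5,7) V_cont unfolding Cc_infinity_def by blast
    with u have "(u, dirac_fun m V u) \<in> dirac m V \<inter> Cc_infinity \<times> UNIV" by (auto simp: dirac_eq op_on_def)
    then have "cinner (dirac_fun m V u) v = cinner u w" using vw unfolding op_adjoint_def by blast
    then show ?thesis by (metis cinner_commute)
  qed
  have weak: "(LINT x|lborel. deriv \<phi> x *\<^sub>R (rep_L2 v x $ 1)) = - (LINT x|lborel. \<phi> x *\<^sub>R h1 x)"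
    "(LINT x|lborel. deriv \<phi> x *\<^sub>R (rep_L2 v x $ 2)) = - (LINT x|lborel. \<phi> x *\<^sub>R h2 x)"
    if \<phi>: "\<phi> \<in> test_functions" for \<phi> :: "real \<Rightarrow> real"
  proof -
    note facts = test_function_facts[OF \<phi>]
    have d: "deriv \<phi> = (\<lambda>x. vector_derivative \<phi> (at x))"
      by (rule ext, rule DERIV_imp_deriv) (simp add: has_real_derivative_iff_has_vector_derivative facts(1))
    obtain R where R: "\<And>x. \<bar>x\<bar> \<ge> R \<Longrightarrow> \<phi> x = 0" using facts(5) by blast
    have I: "integrable lborel (\<lambda>x. \<psi> x *\<^sub>R (rep_L2 y x $ i))" if "integrable lborel (\<lambda>x. \<psi> x *\<^sub>R rep_L2 y x)" for \<psi> y i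
      using integrable_bounded_linear[OF bounded_linear_vec_nth that, of i] by simp
    note i1 = I[OF integrable_test_derivative(1)[OF \<phi>]] I[OF integrable_test_derivative(2)[OF \<phi>]]
    have iV: "integrable lborel (\<lambda>x. (\<phi> x * V x) *\<^sub>R (rep_L2 y x $ i))" for y i
      by (rule I, rule integrable_test_scaleR[of _ R]) (use R in \<open>auto intro!: continuous_intros facts(2) V_cont\<close>)
    have r: "AE x in lborel. rep_L2 (dirac_fun m V (abs_L2 (\<lambda>x. \<phi> x *\<^sub>R spinor s t))) x =
        spinor (- \<i> * (deriv \<phi> x *\<^sub>R t) + (of_real m + \<i> * of_real (V x)) * (\<phi> x *\<^sub>R s))
         (- \<i> * (deriv \<phi> x *\<^sub>R s) + (- of_real m + \<i> * of_real (V x)) * (\<phi> x *\<^sub>R t))"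
      "AE x in lborel. rep_L2 (abs_L2 (\<lambda>x. \<phi> x *\<^sub>R spinor s t)) x = \<phi> x *\<^sub>R spinor s t"
      "abs_L2 (\<lambda>x. \<phi> x *\<^sub>R spinor s t) \<in> Cc_infinity" for s t
    proof -
      have t: "(\<lambda>x. \<phi> x *\<^sub>R spinor s t) \<in> test_functions" by (rule test_functions_linear[OF bounded_linear_spinor \<phi>])
      have vd: "vector_derivative (\<lambda>x. \<phi> x *\<^sub>R spinor s t) (at x) = deriv \<phi> x *\<^sub>R spinor s t" for x
        unfolding d by (rule vector_derivative_at) (rule bounded_linear.has_vector_derivative[OF bounded_linear_spinor facts(1)])
      note ts = test_function_spinor[OF t, unfolded vd]
      show "AE x in lborel. rep_L2 (dirac_fun m V (abs_L2 (\<lambda>x. \<phi> x *\<^sub>R spinor s t))) x =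
        spinor (- \<i> * (deriv \<phi> x *\<^sub>R t) + (of_real m + \<i> * of_real (V x)) * (\<phi> x *\<^sub>R s))
         (- \<i> * (deriv \<phi> x *\<^sub>R s) + (- of_real m + \<i> * of_real (V x)) * (\<phi> x *\<^sub>R t))"
        using rep_dirac_fun[OF ts(7)[OF V_cont], of m] rep_abs[OF ts(1)] rep_abs[OF ts(3)]
      proof eventually_elim
        case (elim x)
        show ?case unfolding elim(1) ts(6) elim(2,3) by simp
      qed
      show "AE x in lborel. rep_L2 (abs_L2 (\<lambda>x. \<phi> x *\<^sub>R spinor s t)) x = \<phi> x *\<^sub>R spinor s t"
        by (rule rep_abs[OF ts(1)])
      show "abs_L2 (\<lambda>x. \<phi> x *\<^sub>R spinor s t) \<in> Cc_infinity" unfolding Cc_infinity_def using t by blast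
    qed
    note mes = i1[THEN borel_measurable_integrable] iV[THEN borel_measurable_integrable]
    have sc: "r *\<^sub>R z = of_real r * z" for r and z :: complex by (rule scaleR_conv_of_real)
    \<comment> \<open>Testing with the upper unit spinor yields the equation for the derivative of
      the second component, testing with the lower one that for the first.\<close>
    have e1: "cinner v (dirac_fun m V (abs_L2 (\<lambda>x. \<phi> x *\<^sub>R spinor 1 0)))
        = (LINT x|lborel. of_real m * (\<phi> x *\<^sub>R (rep_L2 v x $ 1)) - \<i> * ((\<phi> x * V x) *\<^sub>R (rep_L2 v x $ 1)) + \<i> * (deriv \<phi> x *\<^sub>R (rep_L2 v x $ 2)))"
      unfolding cinner_L2_eq
    proof (rule integral_cong_AE)
      show "AE x in lborel. csprod (rep_L2 v x) (rep_L2 (dirac_fun m V (abs_L2 (\<lambda>x. \<phi> x *\<^sub>R spinor 1 0))) x) = of_real m * (\<phi> x *\<^sub>R (rep_L2 v x $ 1)) - \<i> * ((\<phi> x * V x) *\<^sub>R (rep_L2 v x $ 1)) + \<i> * (deriv \<phi> x *\<^sub>R (rep_L2 v x $ 2))"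
        using r(1)[of 1 0] by eventually_elim (simp add: csprod_2 sc algebra_simps)
    qed (intro csprod_measurable sq_integrable_measurable[OF sq_rep] borel_measurable_add borel_measurable_diff borel_measurable_times borel_measurable_const mes)+
    have e2: "cinner v (dirac_fun m V (abs_L2 (\<lambda>x. \<phi> x *\<^sub>R spinor 0 1)))
        = (LINT x|lborel. - of_real m * (\<phi> x *\<^sub>R (rep_L2 v x $ 2)) - \<i> * ((\<phi> x * V x) *\<^sub>R (rep_L2 v x $ 2)) + \<i> * (deriv \<phi> x *\<^sub>R (rep_L2 v x $ 1)))"
      unfolding cinner_L2_eq
    proof (rule integral_cong_AE)
      show "AE x in lborel. csprod (rep_L2 v x) (rep_L2 (dirac_fun m V (abs_L2 (\<lambda>x. \<phi> x *\<^sub>R spinor 0 1))) x) = - of_real m * (\<phi> x *\<^sub>R (rep_L2 v x $ 2)) - \<i> * ((\<phi> x * V x) *\<^sub>R (rep_L2 v x $ 2)) + \<i> * (deriv \<phi> x *\<^sub>R (rep_L2 v x $ 1))"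
        using r(1)[of 0 1] by eventually_elim (simp add: csprod_2 sc algebra_simps)
    qed (intro csprod_measurable sq_integrable_measurable[OF sq_rep] borel_measurable_add borel_measurable_diff borel_measurable_times borel_measurable_const mes)+
    have e3: "cinner w (abs_L2 (\<lambda>x. \<phi> x *\<^sub>R spinor s t)) = (LINT x|lborel. cnj s * (\<phi> x *\<^sub>R (rep_L2 w x $ 1)) + cnj t * (\<phi> x *\<^sub>R (rep_L2 w x $ 2)))" for s t
      unfolding cinner_L2_eq
    proof (rule integral_cong_AE)
      show "AE x in lborel. csprod (rep_L2 w x) (rep_L2 (abs_L2 (\<lambda>x. \<phi> x *\<^sub>R spinor s t)) x) = cnj s * (\<phi> x *\<^sub>R (rep_L2 w x $ 1)) + cnj t * (\<phi> x *\<^sub>R (rep_L2 w x $ 2))"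
        using r(2)[of s t] by eventually_elim (simp add: csprod_2 sc algebra_simps)
    qed (intro csprod_measurable sq_integrable_measurable[OF sq_rep] borel_measurable_add borel_measurable_diff borel_measurable_times borel_measurable_const mes)+
    define X where "X = (\<lambda>y i. LINT x|lborel. \<phi> x *\<^sub>R (rep_L2 y x $ i))"
    define Y where "Y = (\<lambda>i. LINT x|lborel. (\<phi> x * V x) *\<^sub>R (rep_L2 v x $ i))"
    define Z where "Z = (\<lambda>i. LINT x|lborel. deriv \<phi> x *\<^sub>R (rep_L2 v x $ i))"
    have E1: "of_real m * X v 1 - \<i> * Y 1 + \<i> * Z 2 = X w 1"
      using test[OF r(3)[of 1 0]] unfolding e1 e3 X_def Y_def Z_def
      by (simp only: integral_mult_right_zero Bochner_Integration.integral_add Bochner_Integration.integral_diff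
          Bochner_Integration.integrable_add Bochner_Integration.integrable_diff integrable_mult_right i1 iV
          complex_cnj_one complex_cnj_zero mult_1 mult_zero_left add_0_left add_0_right)
    have E2: "- of_real m * X v 2 - \<i> * Y 2 + \<i> * Z 1 = X w 2"
      using test[OF r(3)[of 0 1]] unfolding e2 e3 X_def Y_def Z_def
      by (simp only: integral_mult_right_zero Bochner_Integration.integral_add Bochner_Integration.integral_diff
          Bochner_Integration.integrable_add Bochner_Integration.integrable_diff integrable_mult_right i1 iV
          complex_cnj_one complex_cnj_zero mult_1 mult_zero_left add_0_left add_0_right)
    have F1: "(LINT x|lborel. \<phi> x *\<^sub>R h1 x) = \<i> * (X w 2 + of_real m * X v 2 + \<i> * Y 2)"
    proof -
      have "\<phi> x *\<^sub>R h1 x = \<i> * (\<phi> x *\<^sub>R (rep_L2 w x $ 2) + of_real m * (\<phi> x *\<^sub>R (rep_L2 v x $ 2)) + \<i> * ((\<phi> x * V x) *\<^sub>R (rep_L2 v x $ 2)))" for x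
        by (simp add: h1_def scaleR_conv_of_real algebra_simps)
      then show ?thesis unfolding X_def Y_def using i1 iV by (simp only: integral_mult_right_zero Bochner_Integration.integral_add Bochner_Integration.integral_diff
          Bochner_Integration.integrable_add Bochner_Integration.integrable_diff integrable_mult_right)
    qed
    have F2: "(LINT x|lborel. \<phi> x *\<^sub>R h2 x) = \<i> * (X w 1 - of_real m * X v 1 + \<i> * Y 1)"
    proof -
      have "\<phi> x *\<^sub>R h2 x = \<i> * (\<phi> x *\<^sub>R (rep_L2 w x $ 1) - of_real m * (\<phi> x *\<^sub>R (rep_L2 v x $ 1)) + \<i> * ((\<phi> x * V x) *\<^sub>R (rep_L2 v x $ 1)))" for x
        by (simp add: h2_def scaleR_conv_of_real algebra_simps)
      then show ?thesis unfolding X_def Y_def using i1 iV by (simp only: integral_mult_right_zero Bochner_Integration.integral_add Bochner_Integration.integral_diff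
          Bochner_Integration.integrable_add Bochner_Integration.integrable_diff integrable_mult_right)
    qed
    show "(LINT x|lborel. deriv \<phi> x *\<^sub>R (rep_L2 v x $ 1)) = - (LINT x|lborel. \<phi> x *\<^sub>R h1 x)"
      unfolding F1 E2[symmetric] by (simp add: Z_def algebra_simps del: mult_scaleR_right)
    show "(LINT x|lborel. deriv \<phi> x *\<^sub>R (rep_L2 v x $ 2)) = - (LINT x|lborel. \<phi> x *\<^sub>R h2 x)"
      unfolding F2 E1[symmetric] by (simp add: Z_def algebra_simps del: mult_scaleR_right)
  qed
  obtain a where a: "prim h1 a" "AE x in lborel. rep_L2 v x $ 1 = a x"
    using du_Bois_Reymond[OF _ nth_set_integrable hm(1) set_integrable_if_sq[OF hm(1) hsq(1)] weak(1)] by auto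
  obtain b where b: "prim h2 b" "AE x in lborel. rep_L2 v x $ 2 = b x"
    using du_Bois_Reymond[OF _ nth_set_integrable hm(2) set_integrable_if_sq[OF hm(2) hsq(2)] weak(2)] by auto
  have [measurable]: "a \<in> borel_measurable borel" "b \<in> borel_measurable borel"
    using a b by (auto intro: prim_borel)
  have vab: "AE x in lborel. rep_L2 v x = spinor (a x) (b x)"
    using a(2) b(2) by eventually_elim (rule spinor_eqI)
  have n: "integrable lborel (\<lambda>x. (norm (a x))\<^sup>2 + (norm (b x))\<^sup>2)"
    by (rule integrable_AE_cong(1)[OF integrable_norm_sq[of v]]) (use vab in \<open>auto simp: norm_vec2_sq elim!: eventually_mono\<close>)
  have g: "integrable lborel (neg.gnorm a b h1 h2)"
  proof (rule integrable_AE_cong(1)[OF integrable_norm_sq[of w]])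
    show "AE x in lborel. (norm (rep_L2 w x))\<^sup>2 = neg.gnorm a b h1 h2 x"
      using a(2) b(2)
    proof eventually_elim
      case (elim x)
      have "- \<i> * h2 x + (complex_of_real m + \<i> * complex_of_real (- V x)) * a x = rep_L2 w x $ 1"
        "- \<i> * h1 x + (- complex_of_real m + \<i> * complex_of_real (- V x)) * b x = rep_L2 w x $ 2"
        unfolding h1_def h2_def elim[symmetric] by (simp_all add: algebra_simps)
      then show ?case unfolding neg.gnorm_def norm_vec2_sq by simp
    qed
    show "neg.gnorm a b h1 h2 \<in> borel_measurable borel" unfolding neg.gnorm_def[abs_def] by measurable
  qed
  \<comment> \<open>So far \<open>h1\<close> and \<open>h2\<close> are only locally square
    integrable. Square integrability of \<open>v\<close> and \<open>w\<close> now gives it on the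
    whole line, and for the product of \<open>V\<close> with \<open>v\<close> too.\<close>
  have en: "integrable lborel (neg.energy a b h1 h2)"
    by (rule neg.a_priori_estimate(1)[OF a(1) b(1) hsq n g])
  have hi: "integrable lborel (\<lambda>x. (norm (h1 x))\<^sup>2 + (norm (h2 x))\<^sup>2)"
    by (rule Bochner_Integration.integrable_bound[OF en]) (use neg.\<kappa>(1) in \<open>auto simp: neg.energy_def\<close>)
  have Vi: "integrable lborel (\<lambda>x. (V x)\<^sup>2 * ((norm (a x))\<^sup>2 + (norm (b x))\<^sup>2))"
  proof (rule Bochner_Integration.integrable_bound)
    show "integrable lborel (\<lambda>x. neg.energy a b h1 h2 x / \<kappa>)" using en by simp
    show "AE x in lborel. norm ((V x)\<^sup>2 * ((norm (a x))\<^sup>2 + (norm (b x))\<^sup>2)) \<le> norm (neg.energy a b h1 h2 x / \<kappa>)"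
      using \<kappa>(1) by (auto simp: neg.energy_def field_simps intro!: AE_I2)
  qed measurable
  have sqh: "sq_integrable (\<lambda>x. spinor (h1 x) (h2 x))" using hi by (simp add: sq_integrable_spinor_iff)
  have wd: "is_weak_derivative v (abs_L2 (\<lambda>x. spinor (h1 x) (h2 x)))"
    by (rule is_weak_derivativeI[OF a(1) b(1) vab rep_abs[OF sqh]])
  then have H1: "v \<in> H1" "weak_derivative v = abs_L2 (\<lambda>x. spinor (h1 x) (h2 x))"
    using weak_derivative_eqI by (auto simp: H1_def)
  have "sq_integrable (\<lambda>x. spinor (of_real (V x) * a x) (of_real (V x) * b x))"
    using Vi by (subst sq_integrable_spinor_iff) (auto simp: norm_mult power_mult_distrib algebra_simps)
  then have dom: "v \<in> mult_dom V"
    unfolding mult_dom_def mem_Collect_eq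
  proof (rule sq_integrable_AE_cong[rotated 2])
    show "AE x in lborel. V x *\<^sub>R rep_L2 v x = spinor (of_real (V x) * a x) (of_real (V x) * b x)"
      using vab
    proof eventually_elim
      case (elim x)
      show ?case unfolding elim
        by (rule spinor_eqI) (simp_all add: scaleR_conv_of_real[where 'a = complex])
    qed
    show "(\<lambda>x. V x *\<^sub>R rep_L2 v x) \<in> borel_measurable borel" by measurable
  qed
  then have dom': "v \<in> mult_dom (\<lambda>x. - V x)" by (simp add: mult_dom_uminus)
  have "dirac_fun m (\<lambda>x. - V x) v = w"
  proof (rule L2_eqI)
    show "AE x in lborel. rep_L2 (dirac_fun m (\<lambda>x. - V x) v) x = rep_L2 w x"
      using rep_dirac_fun[OF dom', of m] rep_abs[OF sqh]
    proof eventually_elim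
      case (elim x)
      show ?case unfolding elim(1) H1(2) elim(2)
        by (rule spinor_eqI[symmetric]) (simp_all add: h1_def h2_def algebra_simps)
    qed
  qed
  with H1(1) dom' show ?thesis by (auto simp: dirac_eq op_on_def)
qed

text \<open>A circle of inclusions: symmetry puts the operator with \<open>- V\<close> into the
  adjoint, restriction to test functions enlarges the adjoint, and
  \<open>adjoint_test_functions\<close> leads back. The second equation is what makes the test
  functions a core.\<close>

lemma adjoint_eq:
  "op_adjoint (dirac m V) = dirac m (\<lambda>x. - V x)"
  "op_adjoint (dirac m V \<inter> Cc_infinity \<times> UNIV) = dirac m (\<lambda>x. - V x)"
proof -
  have 1: "dirac m (\<lambda>x. - V x) \<subseteq> op_adjoint (dirac m V)"
    using dirac_symmetric unfolding dirac_eq op_on_def op_adjoint_def mult_dom_uminus by auto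
  have 2: "op_adjoint (dirac m V) \<subseteq> op_adjoint (dirac m V \<inter> Cc_infinity \<times> UNIV)"
    by (rule adjoint_antimono) auto
  have 3: "op_adjoint (dirac m V \<inter> Cc_infinity \<times> UNIV) \<subseteq> dirac m (\<lambda>x. - V x)"
    using adjoint_test_functions by auto
  show "op_adjoint (dirac m V) = dirac m (\<lambda>x. - V x)"
    "op_adjoint (dirac m V \<inter> Cc_infinity \<times> UNIV) = dirac m (\<lambda>x. - V x)"
    using 1 2 3 by blast+
qed

lemma dirac_eq_adjoint: "dirac m V = op_adjoint (dirac m (\<lambda>x. - V x))"
  using dirac_potential.adjoint_eq(1)[OF uminus] by simp

lemma graph_subspace_dirac: "graph_subspace (dirac m V)"
  unfolding dirac_eq_adjoint by (rule graph_subspace_adjoint)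

lemma Domain_dirac: "Domain (dirac m V) = H1 \<inter> mult_dom V"
  by (auto simp: dirac_eq op_on_def Domain_unfold)

text \<open>The closure of the restriction is its double adjoint. Its adjoint is already the
  operator with \<open>- V\<close>, whose adjoint is the full operator.\<close>

lemma core: "is_core Cc_infinity (dirac m V)"
  unfolding is_core_def
proof
  show "Cc_infinity \<subseteq> Domain (dirac m V)"
    unfolding Domain_dirac Cc_infinity_def using test_function_spinor(5,7) V_cont by blast
  have "graph_subspace (dirac m V \<inter> Cc_infinity \<times> UNIV)"
  proof (rule graph_subspaceI)
    have T: "subspace (dirac m V)" using graph_subspace_dirac by (simp add: graph_subspace_def)
    show "(0, 0) \<in> dirac m V \<inter> Cc_infinity \<times> UNIV"
      using subspace_0[OF T] Cc_infinity_subspace(1) by (simp add: zero_prod_def)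
    show "(u + v, f + g) \<in> dirac m V \<inter> Cc_infinity \<times> UNIV"
      if "(u, f) \<in> dirac m V \<inter> Cc_infinity \<times> UNIV" "(v, g) \<in> dirac m V \<inter> Cc_infinity \<times> UNIV" for u f v g
      using that subspace_add[OF T, of "(u, f)" "(v, g)"] Cc_infinity_subspace(2) by auto
    show "(c *\<^sub>C u, c *\<^sub>C f) \<in> dirac m V \<inter> Cc_infinity \<times> UNIV"
      if "(u, f) \<in> dirac m V \<inter> Cc_infinity \<times> UNIV" for c u f
      using that graph_subspace_dirac Cc_infinity_subspace(3) by (auto simp: graph_subspace_def)
  qed
  then show "closure (dirac m V \<inter> Cc_infinity \<times> UNIV) = dirac m V"
    by (simp add: closure_eq_adjoint_adjoint adjoint_eq(2) dirac_eq_adjoint[symmetric])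
qed

lemma strip_resolvent:
  assumes "\<bar>Re z\<bar> < m"
  shows "z \<in> resolvent_set (dirac m V)" "norm (resolvent (dirac m V) z f) \<le> norm f / (m - \<bar>Re z\<bar>)"
proof -
  interpret neg: dirac_potential m "\<lambda>x. - V x" "\<lambda>x. - V' x" \<epsilon> M by (rule uminus)
  have c: "m - \<bar>Re z\<bar> > 0" using assms by simp
  have 1: "(m - \<bar>Re z\<bar>) * norm u \<le> norm (f - z *\<^sub>C u)" if "(u, f) \<in> dirac m V" for u f
    using that below by (auto simp: dirac_eq op_on_def)
  have 2: "(m - \<bar>Re z\<bar>) * norm u \<le> norm (f - cnj z *\<^sub>C u)" if "(u, f) \<in> dirac m (\<lambda>x. - V x)" for u f
    using that neg.below[of u "cnj z"] by (auto simp: dirac_eq op_on_def)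
  show "z \<in> resolvent_set (dirac m V)" "norm (resolvent (dirac m V) z f) \<le> norm f / (m - \<bar>Re z\<bar>)"
    using resolvent_setI[OF dirac_eq_adjoint adjoint_eq(1) c 1 2] by blast+
qed

end

section \<open>Compactness and decay of the singular values\<close>

lemma set_integral_split:
  fixes f :: "real \<Rightarrow> 'b::{banach, second_countable_topology}"
  assumes "integrable lborel f" "a \<le> b" "b \<le> c"
  shows "(LINT x:{a..c}|lborel. f x) = (LINT x:{a..b}|lborel. f x) + (LINT x:{b..c}|lborel. f x)"
proof -
  have "(LINT t:{a..b} \<union> {b..c}|lborel. f t) = (LINT t:{a..b}|lborel. f t) + (LINT t:{b..c}|lborel. f t)"
    by (rule set_integral_Un_AE)
       (use AE_lborel_singleton[of b] set_integrable_of_integrable[OF assms(1)] in \<open>auto elim!: eventually_mono\<close>)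
  with assms show ?thesis by (simp add: ivl_disj_un_two_touch)
qed

lemma Poincare_cells:
  assumes aF: "prim f F" and f2: "integrable lborel (\<lambda>x. (norm (f x))\<^sup>2)" and F2: "integrable lborel (\<lambda>x. (norm (F x))\<^sup>2)"
    and h: "h \<ge> 0" and mean: "\<And>j. j < n \<Longrightarrow> (LINT x:{c + real j * h..c + real (Suc j) * h}|lborel. F x) = 0"
  shows "(LINT x:{c..c + real n * h}|lborel. (norm (F x))\<^sup>2) \<le> h\<^sup>2 * (LINT x:{c..c + real n * h}|lborel. (norm (f x))\<^sup>2)"
  using mean
proof (induction n)
  case 0
  then show ?case by (simp add: set_integral_singleton)
next
  case (Suc n)
  have le: "c \<le> c + real n * h" "c + real n * h \<le> c + real (Suc n) * h" using h by (simp_all add: algebra_simps)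
  have "(LINT x:{c + real n * h..c + real (Suc n) * h}|lborel. (norm (F x))\<^sup>2)
     \<le> (c + real (Suc n) * h - (c + real n * h))\<^sup>2 * (LINT x:{c + real n * h..c + real (Suc n) * h}|lborel. (norm (f x))\<^sup>2)"
    by (rule Poincare_interval[OF le(2) aF set_integrable_of_integrable[OF f2] Suc.prems]) simp
  also have "c + real (Suc n) * h - (c + real n * h) = h" by (simp add: algebra_simps)
  finally show ?case
    using Suc.IH Suc.prems unfolding set_integral_split[OF F2 le] set_integral_split[OF f2 le]
    by (simp add: distrib_left)
qed

context dirac_potential
begin

text \<open>The conditions are zero means of both components on each of \<open>N\<close> cells of
  \<open>{-L..L}\<close>, hence \<open>2 * N\<close> of them. Inside, Poincare's inequality with
  cell length \<open>2 * L / N\<close> applies; outside, \<open>norm (V x *\<^sub>R u)\<close>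
  dominates \<open>R * norm u\<close> pointwise.\<close>

lemma norm_le_on_annihilator:
  fixes N :: nat
  assumes L: "L > 0" and N: "N > 0" and R: "R > 0" and VR: "\<And>x. \<bar>x\<bar> \<ge> L \<Longrightarrow> R \<le> \<bar>V x\<bar>"
  shows "\<exists>\<Psi> :: nat \<Rightarrow> L2. \<forall>u. u \<in> H1 \<and> u \<in> mult_dom V \<and> (\<forall>k<2 * N. cinner u (\<Psi> k) = 0) \<longrightarrow>
    (norm u)\<^sup>2 \<le> (2 * L / N)\<^sup>2 * (norm (weak_derivative u))\<^sup>2 + (norm (mult_op V u))\<^sup>2 / R\<^sup>2"
proof -
  define h where "h = 2 * L / N"
  have h: "h > 0" "- L + real N * h = L" using L N by (simp_all add: h_def)
  define J where "J j = {- L + real j * h..- L + real (Suc j) * h}" for j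
  define e :: "nat \<Rightarrow> complex^2" where "e r = (if r = 0 then spinor 1 0 else spinor 0 1)" for r
  \<comment> \<open>The index \<open>k\<close> encodes the cell \<open>k div 2\<close> and the
    component \<open>k mod 2\<close>.\<close>
  define \<psi> where "\<psi> k x = indicat_real (J (k div 2)) x *\<^sub>R e (k mod 2)" for k x
  have Jm: "J j \<in> sets borel" for j by (simp add: J_def)
  have sq: "sq_integrable (\<psi> k)" for k
  proof -
    have "(norm (\<psi> k x))\<^sup>2 = indicat_real (J (k div 2)) x" for x
      by (simp add: \<psi>_def e_def norm_vec2_sq indicator_def)
    moreover have "integrable lborel (indicat_real (J (k div 2)))"
      by (rule integrable_real_indicator) (auto simp: J_def emeasure_lborel_Icc_eq)
    moreover have "\<psi> k \<in> borel_measurable borel"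
      unfolding \<psi>_def[abs_def] using Jm by measurable
    ultimately show ?thesis by (simp add: sq_integrable_def)
  qed
  show ?thesis
  proof (intro exI[of _ "\<lambda>k. abs_L2 (\<psi> k)"] allI impI, elim conjE)
    fix u assume u: "u \<in> H1" "u \<in> mult_dom V" and orth: "\<forall>k<2 * N. cinner u (abs_L2 (\<psi> k)) = 0"
    obtain a b where ab: "ac_rep u a b" using ac_rep_exists u(1) by blast
    define D where "D i x = rep_L2 (weak_derivative u) x $ i" for i x
    have p: "prim (D 1) a" "prim (D 2) b" and r: "AE x in lborel. rep_L2 u x = spinor (a x) (b x)"
      using ab unfolding ac_rep_def D_def by auto
    have am [measurable]: "a \<in> borel_measurable borel" "b \<in> borel_measurable borel" using p by (auto intro: prim_borel)
    have D2: "integrable lborel (\<lambda>x. (norm (D i x))\<^sup>2)" for i unfolding D_def by (rule nth_sq_integrable)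
    have a2: "integrable lborel (\<lambda>x. (norm (a x))\<^sup>2)"
      by (rule integrable_AE_cong(1)[OF nth_sq_integrable[of u 1]]) (use r in \<open>auto elim!: eventually_mono\<close>)
    have b2: "integrable lborel (\<lambda>x. (norm (b x))\<^sup>2)"
      by (rule integrable_AE_cong(1)[OF nth_sq_integrable[of u 2]]) (use r in \<open>auto elim!: eventually_mono\<close>)
    have cin: "cinner u (abs_L2 (\<psi> k)) = (LINT x:J (k div 2)|lborel. (if k mod 2 = 0 then a x else b x))" for k
      unfolding cinner_L2_eq set_lebesgue_integral_def
    proof (rule integral_cong_AE)
      show "AE x in lborel. csprod (rep_L2 u x) (rep_L2 (abs_L2 (\<psi> k)) x) = indicat_real (J (k div 2)) x *\<^sub>R (if k mod 2 = 0 then a x else b x)"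
        using r rep_abs[OF sq[of k]]
        by eventually_elim (simp add: csprod_2 \<psi>_def e_def indicator_def)
      show "(\<lambda>x. indicat_real (J (k div 2)) x *\<^sub>R (if k mod 2 = 0 then a x else b x)) \<in> borel_measurable lborel"
        using Jm by (cases "k mod 2 = 0") (simp_all, measurable)
    qed (intro csprod_measurable sq_integrable_measurable[OF sq_rep])
    have ma: "(LINT x:J j|lborel. a x) = 0" "(LINT x:J j|lborel. b x) = 0" if "j < N" for j
      using orth[rule_format, of "2 * j"] orth[rule_format, of "Suc (2 * j)"] cin[of "2 * j"] cin[of "Suc (2 * j)"] that by auto
    have ca: "(LINT x:{-L..L}|lborel. (norm (a x))\<^sup>2) \<le> h\<^sup>2 * (LINT x:{-L..L}|lborel. (norm (D 1 x))\<^sup>2)"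
      using Poincare_cells[OF p(1) D2 a2, of h N "-L"] ma h by (simp add: J_def)
    have cb: "(LINT x:{-L..L}|lborel. (norm (b x))\<^sup>2) \<le> h\<^sup>2 * (LINT x:{-L..L}|lborel. (norm (D 2 x))\<^sup>2)"
      using Poincare_cells[OF p(2) D2 b2, of h N "-L"] ma h by (simp add: J_def)
    have sub: "(LINT x:{-L..L}|lborel. (norm (D i x))\<^sup>2) \<le> (LINT x|lborel. (norm (D i x))\<^sup>2)" for i
      unfolding set_lebesgue_integral_def by (rule integral_mono'[OF D2]) (auto simp: indicator_def)
    have wd: "(norm (weak_derivative u))\<^sup>2 = (LINT x|lborel. (norm (D 1 x))\<^sup>2) + (LINT x|lborel. (norm (D 2 x))\<^sup>2)"
      unfolding norm_L2_sq norm_vec2_sq using D2 by (simp add: D_def)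
    have inner: "(LINT x:{-L..L}|lborel. (norm (a x))\<^sup>2 + (norm (b x))\<^sup>2) \<le> h\<^sup>2 * (norm (weak_derivative u))\<^sup>2"
    proof -
      have "(LINT x:{-L..L}|lborel. (norm (a x))\<^sup>2 + (norm (b x))\<^sup>2) = (LINT x:{-L..L}|lborel. (norm (a x))\<^sup>2) + (LINT x:{-L..L}|lborel. (norm (b x))\<^sup>2)"
        by (rule set_integral_add(2)) (intro set_integrable_of_integrable a2 b2)+
      also have "\<dots> \<le> h\<^sup>2 * (LINT x:{-L..L}|lborel. (norm (D 1 x))\<^sup>2) + h\<^sup>2 * (LINT x:{-L..L}|lborel. (norm (D 2 x))\<^sup>2)"
        using ca cb by simp
      also have "\<dots> \<le> h\<^sup>2 * (norm (weak_derivative u))\<^sup>2"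
        unfolding wd distrib_left by (intro add_mono mult_left_mono sub) auto
      finally show ?thesis .
    qed
    have outer: "(LINT x:-{-L..L}|lborel. (norm (a x))\<^sup>2 + (norm (b x))\<^sup>2) \<le> (norm (mult_op V u))\<^sup>2 / R\<^sup>2"
    proof -
      have i: "integrable lborel (\<lambda>x. (norm (rep_L2 (mult_op V u) x))\<^sup>2 / R\<^sup>2)" using integrable_norm_sq by simp
      have "(LINT x:-{-L..L}|lborel. (norm (a x))\<^sup>2 + (norm (b x))\<^sup>2) \<le> (LINT x|lborel. (norm (rep_L2 (mult_op V u) x))\<^sup>2 / R\<^sup>2)"
        unfolding set_lebesgue_integral_def
      proof (rule integral_mono_AE[OF _ i])
        show "integrable lborel (\<lambda>x. indicat_real (- {- L..L}) x *\<^sub>R ((norm (a x))\<^sup>2 + (norm (b x))\<^sup>2))"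
          by (intro integrable_mult_indicator Bochner_Integration.integrable_add a2 b2) auto
        show "AE x in lborel. indicat_real (- {- L..L}) x *\<^sub>R ((norm (a x))\<^sup>2 + (norm (b x))\<^sup>2) \<le> (norm (rep_L2 (mult_op V u) x))\<^sup>2 / R\<^sup>2"
          using r rep_mult_op[OF u(2)]
        proof eventually_elim
          case (elim x)
          show ?case
          proof (cases "x \<in> {-L..L}")
            case False
            then have "\<bar>x\<bar> \<ge> L" by auto
            then have "R\<^sup>2 \<le> (V x)\<^sup>2" using VR[of x] R by (simp add: abs_le_square_iff[symmetric])
            then have "R\<^sup>2 * ((norm (a x))\<^sup>2 + (norm (b x))\<^sup>2) \<le> (V x)\<^sup>2 * ((norm (a x))\<^sup>2 + (norm (b x))\<^sup>2)"
              by (rule mult_right_mono) simp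
            also have "\<dots> = (norm (rep_L2 (mult_op V u) x))\<^sup>2"
              unfolding elim by (simp add: norm_vec2_sq power_mult_distrib)
            finally show ?thesis using False R by (simp add: field_simps)
          qed simp
        qed
      qed
      also have "\<dots> = (norm (mult_op V u))\<^sup>2 / R\<^sup>2" by (simp add: norm_L2_sq)
      finally show ?thesis .
    qed
    have "(norm u)\<^sup>2 = (LINT x|lborel. (norm (a x))\<^sup>2 + (norm (b x))\<^sup>2)"
      unfolding norm_L2_sq by (rule integral_cong_AE) (use r in \<open>auto simp: norm_vec2_sq elim!: eventually_mono\<close>)
    also have "\<dots> = (LINT x:{-L..L} \<union> -{-L..L}|lborel. (norm (a x))\<^sup>2 + (norm (b x))\<^sup>2)"
      by (simp add: set_lebesgue_integral_def)
    also have "\<dots> = (LINT x:{-L..L}|lborel. (norm (a x))\<^sup>2 + (norm (b x))\<^sup>2) + (LINT x:-{-L..L}|lborel. (norm (a x))\<^sup>2 + (norm (b x))\<^sup>2)"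
    proof (rule set_integral_Un)
      show "set_integrable lborel {-L..L} (\<lambda>x. (norm (a x))\<^sup>2 + (norm (b x))\<^sup>2)"
        "set_integrable lborel (-{-L..L}) (\<lambda>x. (norm (a x))\<^sup>2 + (norm (b x))\<^sup>2)"
        unfolding set_integrable_def
        by (rule integrable_mult_indicator, simp, intro Bochner_Integration.integrable_add a2 b2)+
    qed auto
    finally show "(norm u)\<^sup>2 \<le> (2 * L / N)\<^sup>2 * (norm (weak_derivative u))\<^sup>2 + (norm (mult_op V u))\<^sup>2 / R\<^sup>2"
      using inner outer unfolding h_def by linarith
  qed
qed

abbreviation K :: "L2 \<Rightarrow> L2" where "K \<equiv> resolvent (dirac m V) 0"
abbreviation K' :: "L2 \<Rightarrow> L2" where "K' \<equiv> resolvent (dirac m (\<lambda>x. - V x)) 0"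

lemma zero_in_resolvent_set: "0 \<in> resolvent_set (dirac m V)"
  using strip_resolvent(1)[of 0] m by simp

lemma K_in: "(K f, f) \<in> dirac m V"
  using resolvent_in[OF zero_in_resolvent_set, of f] by (simp add: scaleC.zero_left)

lemma K'_in: "(K' f, f) \<in> op_adjoint (dirac m V)"
  unfolding adjoint_eq(1) by (rule dirac_potential.K_in[OF uminus])

lemma K_adjoint: "cinner (K f) g = cinner f (K' g)"
  using K'_in[of g] K_in[of f] unfolding op_adjoint_def by fastforce

lemma K_bounded_linear: "bounded_linear K" "bounded_linear K'"
  using resolvent_bounded_linear zero_in_resolvent_set dirac_potential.zero_in_resolvent_set[OF uminus] by blast+

lemma K_scaleC: "K (c *\<^sub>C f) = c *\<^sub>C K f"
  by (rule resolvent_scaleC[OF graph_subspace_dirac zero_in_resolvent_set])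

text \<open>By \<open>norm (K f) \<le> norm f / m\<close> the right-hand side of the graph estimate
  for \<open>K f\<close> is at most \<open>(1 + C0 / m\<^sup>2) * (norm f)\<^sup>2\<close>. The
  factor \<open>2 / \<kappa>\<close> covers the sum of the two terms on its left, because
  \<open>\<kappa> \<le> 1\<close>.\<close>

definition C1 :: real where "C1 = sqrt (2 * (1 + C0 / m\<^sup>2) / \<kappa>)"

lemma C1: "C1 > 0" using C0 \<kappa>(1) m by (simp add: C1_def add_pos_pos)

text \<open>Conditions on \<open>K f\<close> become conditions on \<open>f\<close> through the
  adjoint, with \<open>K' (\<Psi> k)\<close> in place of \<open>\<Psi> k\<close>. The choice
  \<open>2 * L * R \<le> N\<close> makes the cells no longer than \<open>1 / R\<close>, so that the
  inside and the outside of \<open>{-L..L}\<close> contribute at the same order.\<close>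

lemma K_small_on_annihilator:
  assumes L: "L > 0" and N: "N > 0" "2 * L * R \<le> real N" and R: "R > 0" and VR: "\<And>x. \<bar>x\<bar> \<ge> L \<Longrightarrow> R \<le> \<bar>V x\<bar>"
  shows "\<exists>\<Psi> :: nat \<Rightarrow> L2. \<forall>f. (\<forall>k<2 * N. cinner f (\<Psi> k) = 0) \<longrightarrow> norm (K f) \<le> (C1 / R) * norm f"
proof -
  obtain \<Psi> :: "nat \<Rightarrow> L2" where \<Psi>: "\<And>u. u \<in> H1 \<Longrightarrow> u \<in> mult_dom V \<Longrightarrow> (\<And>k. k < 2 * N \<Longrightarrow> cinner u (\<Psi> k) = 0) \<Longrightarrow>
    (norm u)\<^sup>2 \<le> (2 * L / N)\<^sup>2 * (norm (weak_derivative u))\<^sup>2 + (norm (mult_op V u))\<^sup>2 / R\<^sup>2"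
    using norm_le_on_annihilator[OF L N(1) R VR] by blast
  show ?thesis
  proof (intro exI[of _ "\<lambda>k. K' (\<Psi> k)"] allI impI)
    fix f assume f: "\<forall>k<2 * N. cinner f (K' (\<Psi> k)) = 0"
    have u: "K f \<in> H1" "K f \<in> mult_dom V" "dirac_fun m V (K f) = f"
      using K_in[of f] by (auto simp: dirac_eq op_on_def)
    define E where "E = 1 + C0 / m\<^sup>2"
    have E: "E > 0" using C0 m by (simp add: E_def add_pos_pos)
    have "norm (K f) \<le> norm f / m" using strip_resolvent(2)[of 0 f] m by simp
    then have "(norm (K f))\<^sup>2 \<le> (norm f / m)\<^sup>2" by (rule power_mono) simp
    then have "C0 * (norm (K f))\<^sup>2 \<le> C0 * (norm f / m)\<^sup>2" using C0 by simp
    moreover have "(norm f)\<^sup>2 + C0 * (norm f / m)\<^sup>2 = E * (norm f)\<^sup>2"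
      by (simp add: E_def power_divide algebra_simps)
    ultimately have e: "(norm (weak_derivative (K f)))\<^sup>2 + \<kappa> * (norm (mult_op V (K f)))\<^sup>2 \<le> E * (norm f)\<^sup>2"
      using graph_estimate[OF u(1,2)] u(3) by simp
    have "2 * L / N \<le> 1 / R" using N R by (simp add: field_simps)
    then have hR: "(2 * L / N)\<^sup>2 \<le> 1 / R\<^sup>2" using L power_mono[of "2 * L / N" "1 / R" 2] by (simp add: power_divide)
    have "(norm (K f))\<^sup>2 \<le> (2 * L / N)\<^sup>2 * (norm (weak_derivative (K f)))\<^sup>2 + (norm (mult_op V (K f)))\<^sup>2 / R\<^sup>2"
      by (rule \<Psi>[OF u(1,2)]) (use f K_adjoint in simp)
    also have "\<dots> \<le> 1 / R\<^sup>2 * (norm (weak_derivative (K f)))\<^sup>2 + (norm (mult_op V (K f)))\<^sup>2 / R\<^sup>2"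
      using hR by (intro add_mono mult_right_mono) auto
    also have "\<dots> = ((norm (weak_derivative (K f)))\<^sup>2 + (norm (mult_op V (K f)))\<^sup>2) / R\<^sup>2" by (simp add: add_divide_distrib)
    also have "\<dots> \<le> (2 * E / \<kappa> * (norm f)\<^sup>2) / R\<^sup>2"
    proof (rule divide_right_mono)
      have 1: "(norm (weak_derivative (K f)))\<^sup>2 \<le> E * (norm f)\<^sup>2"
        using e \<kappa>(1) by (smt (verit) mult_nonneg_nonneg zero_le_power2)
      have "\<kappa> * (norm (mult_op V (K f)))\<^sup>2 \<le> E * (norm f)\<^sup>2"
        using e by (smt (verit) zero_le_power2)
      then have 2: "(norm (mult_op V (K f)))\<^sup>2 \<le> E * (norm f)\<^sup>2 / \<kappa>" using \<kappa>(1) by (simp add: field_simps)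
      have "E * (norm f)\<^sup>2 * \<kappa> \<le> E * (norm f)\<^sup>2 * 1" using E \<kappa> by (intro mult_left_mono) auto
      then have "E * (norm f)\<^sup>2 \<le> E * (norm f)\<^sup>2 / \<kappa>" using \<kappa>(1) by (simp add: field_simps)
      moreover have "2 * E / \<kappa> * (norm f)\<^sup>2 = E * (norm f)\<^sup>2 / \<kappa> + E * (norm f)\<^sup>2 / \<kappa>" by (simp add: add_divide_distrib[symmetric])
      ultimately show "(norm (weak_derivative (K f)))\<^sup>2 + (norm (mult_op V (K f)))\<^sup>2 \<le> 2 * E / \<kappa> * (norm f)\<^sup>2"
        using 1 2 by linarith
    qed simp
    also have "\<dots> = ((C1 / R) * norm f)\<^sup>2"
      using E \<kappa>(1) by (simp add: C1_def E_def power_mult_distrib power_divide)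
    finally show "norm (K f) \<le> (C1 / R) * norm f"
      by (rule power2_le_imp_le) (use C1 R in simp)
  qed
qed

lemma compact_K:
  assumes V: "filterlim (\<lambda>x. \<bar>V x\<bar>) at_top at_infinity"
  shows "compact (closure (K ` cball 0 1))"
proof (rule compact_if_small_on_annihilators[OF K_bounded_linear(1) K_scaleC])
  fix \<eta> :: real assume \<eta>: "\<eta> > 0"
  define R where "R = C1 / \<eta>"
  have R: "R > 0" "C1 / R = \<eta>" using C1 \<eta> by (simp_all add: R_def)
  have "\<forall>\<^sub>F x in at_infinity. R \<le> \<bar>V x\<bar>" using V by (simp add: filterlim_at_top)
  then obtain L0 where L0: "\<And>x. norm x \<ge> L0 \<Longrightarrow> R \<le> \<bar>V x\<bar>" by (auto simp: eventually_at_infinity)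
  define L where "L = max L0 1"
  define N where "N = nat \<lceil>2 * L * R\<rceil>"
  have VR: "R \<le> \<bar>V x\<bar>" if "\<bar>x\<bar> \<ge> L" for x using L0[of x] that by (simp add: L_def)
  have L: "L > 0" by (simp add: L_def)
  then have "2 * L * R > 0" using R by simp
  then have N: "N > 0" "2 * L * R \<le> real N" by (simp_all add: N_def)
  show "\<exists>n (\<Psi> :: nat \<Rightarrow> L2). \<forall>f. (\<forall>i<n. cinner f (\<Psi> i) = 0) \<longrightarrow> norm (K f) \<le> \<eta> * norm f"
    using K_small_on_annihilator[OF L N R(1) VR] unfolding R(2) by blast
qed

lemma compact_adjoint_pair_K:
  assumes V: "filterlim (\<lambda>x. \<bar>V x\<bar>) at_top at_infinity"
  shows "compact_adjoint_pair K K'"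
  by (rule compact_adjoint_pair.intro[OF K_bounded_linear K_scaleC K_adjoint compact_K[OF V]])

lemma growth_imp_filterlim:
  assumes "potential_growth V \<gamma> x0" "\<gamma> > 0"
  shows "filterlim (\<lambda>x. \<bar>V x\<bar>) at_top at_infinity"
    "\<exists>A>0. \<forall>R\<ge>1. \<exists>N>0. real (2 * N) \<le> A * R powr ((\<gamma> + 1) / \<gamma>) \<and>
       (\<exists>\<Psi> :: nat \<Rightarrow> L2. \<forall>f. (\<forall>k<2 * N. cinner f (\<Psi> k) = 0) \<longrightarrow> norm (K f) \<le> (C1 / R) * norm f)"
proof -
  obtain C where C: "C > 0" "\<And>x. \<bar>x\<bar> \<ge> x0 \<Longrightarrow> C * japanese_bracket x powr \<gamma> \<le> \<bar>V x\<bar>"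
    using assms unfolding potential_growth_def by blast
  define y where "y = max x0 1"
  have y: "y \<ge> 1" by (simp add: y_def)
  \<comment> \<open>From this distance on the growth condition gives
    \<open>R \<le> \<bar>V x\<bar>\<close>; the summand \<open>y\<close> keeps it beyond
    \<open>x0\<close> and positive.\<close>
  define L where "L R = y + (R / C) powr (1 / \<gamma>)" for R
  have LR: "R \<le> \<bar>V x\<bar>" if R: "R > 0" and x: "\<bar>x\<bar> \<ge> L R" for R x
  proof -
    have "\<bar>x\<bar> \<ge> x0" using x powr_ge_zero[of "R / C" "1 / \<gamma>"] unfolding L_def y_def by linarith
    then have "C * japanese_bracket x powr \<gamma> \<le> \<bar>V x\<bar>" by (rule C(2))
    moreover have "R / C \<le> japanese_bracket x powr \<gamma>"
    proof -
      have "(R / C) powr (1 / \<gamma>) \<le> \<bar>x\<bar>" using x y by (simp add: L_def)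
      also have "\<bar>x\<bar> \<le> japanese_bracket x" unfolding japanese_bracket_def by (rule real_le_rsqrt) simp
      finally have "((R / C) powr (1 / \<gamma>)) powr \<gamma> \<le> japanese_bracket x powr \<gamma>"
        using assms(2) by (intro powr_mono2) auto
      then show ?thesis using assms(2) R C(1) by (simp add: powr_powr)
    qed
    ultimately show ?thesis using C(1) by (simp add: field_simps)
  qed
  show "filterlim (\<lambda>x. \<bar>V x\<bar>) at_top at_infinity"
    unfolding filterlim_at_top_gt[where c = 0]
  proof (intro allI impI)
    fix Z :: real assume "Z > 0"
    then show "\<forall>\<^sub>F x in at_infinity. Z \<le> \<bar>V x\<bar>"
      using LR[of Z] unfolding eventually_at_infinity by (intro exI[of _ "L Z"]) auto
  qed
  \<comment> \<open>Chosen such that \<open>L R \<le> C2 * R powr (1 / \<gamma>)\<close> for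
    \<open>R \<ge> 1\<close>. About \<open>2 * L R * R\<close> cells are used, which gives the
    exponent \<open>1 / \<gamma> + 1\<close>.\<close>
  define C2 where "C2 = y + (1 / C) powr (1 / \<gamma>)"
  have C2: "C2 > 0" using y by (simp add: C2_def add_pos_nonneg)
  show "\<exists>A>0. \<forall>R\<ge>1. \<exists>N>0. real (2 * N) \<le> A * R powr ((\<gamma> + 1) / \<gamma>) \<and>
       (\<exists>\<Psi> :: nat \<Rightarrow> L2. \<forall>f. (\<forall>k<2 * N. cinner f (\<Psi> k) = 0) \<longrightarrow> norm (K f) \<le> (C1 / R) * norm f)"
  proof (intro exI[of _ "2 * (2 * C2 + 1)"] conjI allI impI)
    show "0 < 2 * (2 * C2 + 1)" using C2 by simp
    fix R :: real assume R: "R \<ge> 1"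
    define N where "N = nat \<lceil>2 * L R * R\<rceil>"
    have L: "L R > 0" using y by (simp add: L_def add_pos_nonneg)
    then have pos: "2 * L R * R > 0" using R by simp
    then have N: "N > 0" "2 * L R * R \<le> real N" by (simp_all add: N_def)
    have R1: "1 \<le> R powr (1 / \<gamma>)" using R assms(2) by (simp add: ge_one_powr_ge_zero)
    have "(R / C) powr (1 / \<gamma>) = (1 / C) powr (1 / \<gamma>) * R powr (1 / \<gamma>)"
      using R C(1) by (simp flip: powr_mult)
    moreover have "y * 1 \<le> y * R powr (1 / \<gamma>)" using R1 y by (intro mult_left_mono) auto
    ultimately have "L R \<le> C2 * R powr (1 / \<gamma>)" by (simp add: L_def C2_def algebra_simps)
    then have "L R * R \<le> C2 * R powr (1 / \<gamma>) * R" using R by (intro mult_right_mono) auto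
    also have "\<dots> = C2 * R powr ((\<gamma> + 1) / \<gamma>)"
      using R assms(2) by (simp add: add_divide_distrib powr_add)
    finally have LC: "L R * R \<le> C2 * R powr ((\<gamma> + 1) / \<gamma>)" .
    have "1 \<le> R powr ((\<gamma> + 1) / \<gamma>)" using R assms(2) by (simp add: ge_one_powr_ge_zero)
    moreover have "real N \<le> 2 * L R * R + 1" using pos by (simp add: N_def)
    ultimately have "real (2 * N) \<le> 2 * (2 * C2 + 1) * R powr ((\<gamma> + 1) / \<gamma>)" using LC by (simp add: algebra_simps)
    moreover have "\<exists>\<Psi> :: nat \<Rightarrow> L2. \<forall>f. (\<forall>k<2 * N. cinner f (\<Psi> k) = 0) \<longrightarrow> norm (K f) \<le> (C1 / R) * norm f"
      by (rule K_small_on_annihilator[OF L N _ LR]) (use R in auto)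
    ultimately show "\<exists>N>0. real (2 * N) \<le> 2 * (2 * C2 + 1) * R powr ((\<gamma> + 1) / \<gamma>) \<and>
       (\<exists>\<Psi> :: nat \<Rightarrow> L2. \<forall>f. (\<forall>k<2 * N. cinner f (\<Psi> k) = 0) \<longrightarrow> norm (K f) \<le> (C1 / R) * norm f)"
      using N(1) by blast
  qed
qed

text \<open>\<open>R\<close> is chosen with \<open>A * R powr p = (n + 1) / 2\<close>, so that the
  \<open>2 * N\<close> conditions are at most \<open>n\<close> in number. For the finitely many
  \<open>n\<close> where this \<open>R\<close> would be below 1, the constant \<open>B\<close>
  contains the largest singular value. \<open>Suc n\<close> keeps the bound meaningful at index
  0.\<close>

lemma singular_value_bound:
  assumes g: "potential_growth V \<gamma> x0" "\<gamma> > 0"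
  shows "\<exists>B>0. \<forall>n. singular_value K n \<le> B * real (Suc n) powr (- (1 / ((\<gamma> + 1) / \<gamma>)))"
proof -
  interpret S: compact_adjoint_pair K K' by (rule compact_adjoint_pair_K[OF growth_imp_filterlim(1)[OF g]])
  define p where "p = (\<gamma> + 1) / \<gamma>"
  have p: "p > 0" using g(2) by (simp add: p_def)
  obtain A where A: "A > 0" "\<And>R. R \<ge> 1 \<Longrightarrow> \<exists>N>0. real (2 * N) \<le> A * R powr p \<and>
       (\<exists>\<Psi> :: nat \<Rightarrow> L2. \<forall>f. (\<forall>k<2 * N. cinner f (\<Psi> k) = 0) \<longrightarrow> norm (K f) \<le> (C1 / R) * norm f)"
    using growth_imp_filterlim(2)[OF g] unfolding p_def by blast
  define B where "B = C1 * (2 * A) powr (1 / p) + S.sing_val 0 * (2 * A) powr (1 / p) + 1"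
  have B: "B > 0" using C1 S.sing_val_nonneg[of 0] by (simp add: B_def add_nonneg_pos add_nonneg_nonneg)
  have "S.sing_val n \<le> B * real (Suc n) powr (- (1 / p))" for n
  proof (cases "real (Suc n) \<ge> 2 * A")
    case True
    define R where "R = (real (Suc n) / (2 * A)) powr (1 / p)"
    have R: "R \<ge> 1" unfolding R_def using True A(1) p by (intro ge_one_powr_ge_zero) auto
    have Rp: "A * R powr p = real (Suc n) / 2" using A(1) p by (simp add: R_def powr_powr)
    obtain N \<Psi> where N: "N > 0" "real (2 * N) \<le> A * R powr p"
      and \<Psi>: "\<forall>f. (\<forall>k<2 * N. cinner f ((\<Psi> :: nat \<Rightarrow> L2) k) = 0) \<longrightarrow> norm (K f) \<le> (C1 / R) * norm f"
      using A(2)[OF R] by blast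
    have "real (2 * N) < real (Suc n)" using N(2) unfolding Rp by simp
    then have "2 * N \<le> n" by linarith
    then have "S.sing_val n \<le> S.sing_val (2 * N)" by (rule decseqD[OF S.decseq_sing_val])
    also have "\<dots> \<le> C1 / R" by (rule S.sing_val_le[where \<Psi> = \<Psi>]) (use C1 R \<Psi> in auto)
    also have "C1 / R = C1 * (2 * A) powr (1 / p) * real (Suc n) powr (- (1 / p))"
    proof -
      have "R = real (Suc n) powr (1 / p) / (2 * A) powr (1 / p)" unfolding R_def by (rule powr_divide)
      then show ?thesis by (simp add: powr_minus_divide del: of_nat_Suc)
    qed
    also have "\<dots> \<le> B * real (Suc n) powr (- (1 / p))"
      using S.sing_val_nonneg[of 0] by (intro mult_right_mono) (simp_all add: B_def)
    finally show ?thesis .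
  next
    case False
    have "1 = real (Suc n) powr (1 / p) * real (Suc n) powr (- (1 / p))" by (simp flip: powr_add)
    also have "\<dots> \<le> (2 * A) powr (1 / p) * real (Suc n) powr (- (1 / p))"
      using False p by (intro mult_right_mono powr_mono2) auto
    finally have "S.sing_val 0 * 1 \<le> S.sing_val 0 * ((2 * A) powr (1 / p) * real (Suc n) powr (- (1 / p)))"
      by (rule mult_left_mono) (rule S.sing_val_nonneg)
    also have "\<dots> \<le> B * real (Suc n) powr (- (1 / p))"
      unfolding mult.assoc[symmetric] using C1 by (intro mult_right_mono) (simp_all add: B_def)
    finally show ?thesis using decseqD[OF S.decseq_sing_val, of 0 n] by simp
  qed
  with B show ?thesis unfolding S.singular_value_eq p_def by blast
qed

text \<open>By the resolvent identity \<open>R f = K (f + z R f)\<close>, the image of the unit ball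
  lies in a multiple of its image under \<open>K\<close>.\<close>

lemma compact_resolvent:
  assumes V: "filterlim (\<lambda>x. \<bar>V x\<bar>) at_top at_infinity" and z: "z \<in> resolvent_set (dirac m V)"
  shows "compact_operator (resolvent (dirac m V) z)"
proof -
  let ?R = "resolvent (dirac m V) z"
  interpret R: bounded_linear ?R by (rule resolvent_bounded_linear[OF z])
  interpret K: bounded_linear K by (rule K_bounded_linear(1))
  have KR: "?R f = K (f + z *\<^sub>C ?R f)" for f
    using resolvent_in[OF z, of f] by (intro resolvent_eqI[OF zero_in_resolvent_set, symmetric]) (simp add: scaleC.zero_left)
  obtain c where c: "c > 0" "\<And>f. norm (?R f) \<le> norm f * c" using R.pos_bounded by blast
  define d where "d = 1 + norm z * c"
  have d: "d > 0" using c(1) by (simp add: d_def add_pos_nonneg)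
  have "compact ((*\<^sub>R) d ` closure (K ` cball 0 1))"
    by (intro compact_continuous_image compact_K V continuous_intros)
  moreover have "?R ` cball 0 1 \<subseteq> (*\<^sub>R) d ` closure (K ` cball 0 1)"
  proof
    fix w assume "w \<in> ?R ` cball 0 1"
    then obtain f where f: "w = ?R f" "norm f \<le> 1" by auto
    define g where "g = inverse d *\<^sub>R (f + z *\<^sub>C ?R f)"
    have "norm (f + z *\<^sub>C ?R f) \<le> norm f + norm z * norm (?R f)"
      by (rule norm_triangle_le) (simp add: norm_scaleC)
    also have "\<dots> \<le> 1 + norm z * (1 * c)"
      using f(2) c by (intro add_mono mult_left_mono) (auto intro: order_trans[OF c(2)])
    finally have "inverse d * norm (f + z *\<^sub>C ?R f) \<le> inverse d * d"
      using d by (intro mult_left_mono) (auto simp: d_def)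
    then have "norm g \<le> 1" using d unfolding g_def norm_scaleR by simp
    then have "K g \<in> closure (K ` cball 0 1)" using closure_subset[of "K ` cball 0 1"] by (auto simp: dist_norm)
    moreover have "w = d *\<^sub>R K g" using d KR[of f] f(1) by (simp add: g_def K.scaleR)
    ultimately show "w \<in> (*\<^sub>R) d ` closure (K ` cball 0 1)" by blast
  qed
  ultimately have "closure (?R ` cball 0 1) \<subseteq> (*\<^sub>R) d ` closure (K ` cball 0 1)"
    by (intro closure_minimal compact_imp_closed)
  with \<open>compact ((*\<^sub>R) d ` closure (K ` cball 0 1))\<close> have "compact (closure (?R ` cball 0 1))"
    by (metis closed_closure compact_Int_closed inf.absorb_iff2)
  then show ?thesis unfolding compact_operator_def using R.bounded_linear_axioms by blast
qed

end

section \<open>A minimum modulus estimate\<close>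

text \<open>The Harnack constant \<open>(R + r) / (R - r)\<close> is at most 2 for
  \<open>3 * r \<le> R\<close>. It comes from Schwarz's lemma for \<open>g\<close>, the rescaled
  Cayley transform of \<open>h\<close>, which maps the right half-plane to the disc and
  \<open>h 0\<close> to 0.\<close>

lemma Harnack_origin:
  fixes h :: "complex \<Rightarrow> complex"
  assumes h: "h holomorphic_on ball 0 R" and pos: "\<And>z. z \<in> ball 0 R \<Longrightarrow> 0 < Re (h z)"
    and w: "norm w = r" "3 * r \<le> R" "0 < r"
  shows "Re (h w) \<le> 2 * Re (h 0)"
proof -
  have R: "R > 0" using w by linarith
  define a where "a = h 0"
  define g where "g z = (h (of_real R * z) - a) / (h (of_real R * z) + cnj a)" for z
  have in_ball: "of_real R * z \<in> ball 0 R" if "norm z < 1" for z :: complex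
    using that R by (simp add: norm_mult)
  have apos: "0 < Re a" unfolding a_def using pos[of 0] R by simp
  have nz: "h (of_real R * z) + cnj a \<noteq> 0" if "norm z < 1" for z
    using pos[OF in_ball[OF that]] apos by (metis add_pos_pos cnj.simps(1) order_less_irrefl plus_complex.simps(1) zero_complex.simps(1))
  have hol: "g holomorphic_on ball 0 1"
    unfolding g_def
  proof (intro holomorphic_intros holomorphic_on_compose_gen[OF _ h, unfolded comp_def])
    show "h (of_real R * z) + cnj a \<noteq> 0" if "z \<in> ball 0 1" for z using nz that by simp
  qed (use in_ball in auto)
  have lt: "norm (u - a) < norm (u + cnj a)" if "0 < Re u" for u
  proof -
    have "(norm (u - a))\<^sup>2 < (norm (u + cnj a))\<^sup>2"
      unfolding complex_norm2 using mult_pos_pos[OF that apos] by (simp add: power2_sum power2_diff mult.commute)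
    then show ?thesis by (rule power2_less_imp_less) simp
  qed
  have g1: "norm (g z) < 1" if "norm z < 1" for z
    using lt[OF pos[OF in_ball[OF that]]] nz[OF that] by (simp add: g_def norm_divide)
  have "g 0 = 0" by (simp add: g_def a_def)
  define z where "z = w / of_real R"
  have z: "norm z \<le> 1/3" using w R by (simp add: z_def norm_divide field_simps)
  have "norm (g z) \<le> norm z" by (rule Schwarz_Lemma(1)[OF hol \<open>g 0 = 0\<close> g1]) (use z in auto)
  with z have gz: "norm (g z) \<le> 1/3" by linarith
  have Rz: "of_real R * z = w" using R by (simp add: z_def)
  have "g z * (h w + cnj a) = h w - a"
    using nz[of z] z unfolding g_def Rz by simp
  then have "norm (h w - a) = norm (g z) * norm (h w + cnj a)" by (metis norm_mult)
  also have "\<dots> \<le> 1/3 * norm (h w + cnj a)" by (rule mult_right_mono[OF gz]) simp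
  finally have n: "3 * norm (h w - a) \<le> norm (h w + cnj a)" by simp
  have "(3 * norm (h w - a))\<^sup>2 \<le> (norm (h w + cnj a))\<^sup>2" by (rule power_mono[OF n]) simp
  then have q: "9 * ((Re (h w) - Re a)\<^sup>2 + (Im (h w) - Im a)\<^sup>2) \<le> (Re (h w) + Re a)\<^sup>2 + (Im (h w) - Im a)\<^sup>2"
    by (simp add: power_mult_distrib complex_norm2)
  have "9 * (Re (h w) - Re a)\<^sup>2 \<le> (Re (h w) + Re a)\<^sup>2"
    using q zero_le_power2[of "Im (h w) - Im a"] unfolding distrib_left by linarith
  then have "(3 * (Re (h w) - Re a))\<^sup>2 \<le> (Re (h w) + Re a)\<^sup>2" unfolding power_mult_distrib by simp
  then have "3 * (Re (h w) - Re a) \<le> Re (h w) + Re a"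
    by (rule power2_le_imp_le) (use pos[of w] w apos in auto)
  then show ?thesis by (simp add: a_def)
qed

text \<open>Zeros in \<open>cball 0 (3 * r)\<close> are divided out one by one with Blaschke factors for the disc of radius
  \<open>4 * r\<close>. Each division increases \<open>norm (D 0)\<close> by the factor 4/3 and preserves the bound \<open>B\<close>,
  so that there are at most \<open>n\<close> of them.\<close>

lemma minimum_modulus_induct:
  fixes D :: "complex \<Rightarrow> complex"
  assumes "D holomorphic_on ball 0 (5 * r)" and r: "r > 0" and "\<And>z. norm z \<le> 4 * r \<Longrightarrow> norm (D z) \<le> B" and B: "B > 0"
    and w: "norm w = r" and q: "q > 0" "q \<le> 1"
    and "\<And>z. norm z \<le> 3 * r \<Longrightarrow> D z = 0 \<Longrightarrow> 19 * q * r \<le> 4 * norm (w - z)"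
    and "B \<le> norm (D 0) * (4/3) ^ n"
  shows "q ^ n * (norm (D 0))\<^sup>2 \<le> (B + 1) * norm (D w)"
  using assms(1,3,8,9)
proof (induction n arbitrary: D)
  \<comment> \<open>Without zeros, \<open>h = ln (B + 1) - log D\<close> has positive real part, and
    \<open>Re (h w) \<le> 2 * Re (h 0)\<close> bounds \<open>norm (D w)\<close> from below; the
    factor 2 is the origin of the square of \<open>norm (D 0)\<close>. Using \<open>B + 1\<close>
    instead of \<open>B\<close> makes the positivity strict.\<close>
  have main: "(norm (D 0))\<^sup>2 \<le> (B + 1) * norm (D w)"
    if hol: "D holomorphic_on ball 0 (5 * r)" and DB: "\<And>z. norm z \<le> 4 * r \<Longrightarrow> norm (D z) \<le> B"
      and nz: "\<And>z. norm z \<le> 3 * r \<Longrightarrow> D z \<noteq> 0" for D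
  proof -
    have "D holomorphic_on ball 0 (3 * r)" by (rule holomorphic_on_subset[OF hol]) (use r in auto)
    then obtain g where g: "g holomorphic_on ball 0 (3 * r)" "\<And>z. z \<in> ball 0 (3 * r) \<Longrightarrow> D z = exp (g z)"
      by (rule contractible_imp_holomorphic_log) (use nz in \<open>auto intro: convex_imp_contractible\<close>)
    define h where "h z = of_real (ln (B + 1)) - g z" for z
    have D: "norm (D z) = (B + 1) * exp (- Re (h z))" if "norm z < 3 * r" for z
      using g(2)[of z] that B by (simp add: h_def exp_diff norm_exp_eq_Re exp_minus)
    have "Re (h w) \<le> 2 * Re (h 0)"
    proof (rule Harnack_origin[of h "3 * r"])
      show "h holomorphic_on ball 0 (3 * r)" unfolding h_def by (intro holomorphic_intros g(1))
      show "0 < Re (h z)" if z: "z \<in> ball 0 (3 * r)" for z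
      proof -
        have "exp (Re (g z)) = norm (D z)" using g(2)[OF z] by (simp add: norm_exp_eq_Re)
        also have "\<dots> \<le> B" by (rule DB) (use z r in auto)
        finally have "exp (Re (g z)) < exp (ln (B + 1))" using B by simp
        then show ?thesis by (simp add: h_def)
      qed
    qed (use w r in auto)
    then have "exp (- Re (h 0)) ^ 2 \<le> exp (- Re (h w))"
      by (simp add: power2_eq_square flip: exp_add)
    then have "(B + 1)\<^sup>2 * exp (- Re (h 0)) ^ 2 \<le> (B + 1)\<^sup>2 * exp (- Re (h w))" by (rule mult_left_mono) simp
    then show ?thesis
      using D[of 0] D[of w] w r by (simp add: power_mult_distrib power2_eq_square ac_simps)
  qed
  {
    case 0
    show ?case
    proof (cases "\<exists>z. norm z \<le> 3 * r \<and> D z = 0")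
      case False
      then show ?thesis using main[OF 0(1,2)] by simp
    next
      case True
      then obtain z0 where z0: "norm z0 \<le> 3 * r" "D z0 = 0" by blast
      have "norm (D 0) \<le> B" using 0(2)[of 0] r by simp
      with 0(4) have DB: "norm (D 0) = B" by simp
      \<comment> \<open>No division is left: \<open>D\<close> attains its bound at the centre, so it
        is constant by the maximum principle and cannot vanish at \<open>z0\<close>, as
        \<open>B > 0\<close>.\<close>
      have cst: "D constant_on ball 0 (4 * r)"
      proof (rule maximum_modulus_principle[OF _ _ _ open_ball subset_refl, of D 0 "4 * r" 0])
        show "D holomorphic_on ball 0 (4 * r)" by (rule holomorphic_on_subset[OF 0(1)]) (use r in auto)
        show "norm (D z) \<le> norm (D 0)" if "z \<in> ball 0 (4 * r)" for z using 0(2)[of z] that DB by simp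
      qed (use r in auto)
      then have "D 0 = D z0" using z0(1) r unfolding constant_on_def by auto
      with z0 DB B show ?thesis by simp
    qed
  next
    case (Suc n)
    show ?case
    proof (cases "\<exists>z. norm z \<le> 3 * r \<and> D z = 0")
      case False
      then have "(norm (D 0))\<^sup>2 \<le> (B + 1) * norm (D w)" using main[OF Suc.prems(1,2)] by simp
      moreover have "q ^ Suc n * (norm (D 0))\<^sup>2 \<le> (norm (D 0))\<^sup>2"
        using q by (intro mult_left_le_one_le power_le_one) auto
      ultimately show ?thesis by linarith
    next
      case True
      then obtain z0 where z0: "norm z0 \<le> 3 * r" "D z0 = 0" by blast
      have open5: "open (ball 0 (5 * r) :: complex set)" by simp
      define D1 where "D1 z = (if z = z0 then deriv D z0 else (D z - D z0) / (z - z0))" for z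
      have hol1: "D1 holomorphic_on ball 0 (5 * r)"
        unfolding D1_def[abs_def] by (rule pole_lemma_open[OF Suc.prems(1) open5])
      have D1: "D z = (z - z0) * D1 z" for z using z0(2) by (simp add: D1_def)
      \<comment> \<open>The denominator of the Blaschke factor. On the circle of radius
        \<open>4 * r\<close> it has the same modulus as \<open>z - z0\<close>, so \<open>E\<close>
        keeps the bound \<open>B\<close>; at 0 its modulus is \<open>4 * r\<close> against
        \<open>norm z0 \<le> 3 * r\<close>, whence the factor 4/3.\<close>
      define bl where "bl z = (of_real ((4 * r)\<^sup>2) - cnj z0 * z) / of_real (4 * r)" for z :: complex
      define E where "E z = D1 z * bl z" for z
      have holE: "E holomorphic_on ball 0 (5 * r)"
        unfolding E_def bl_def by (intro holomorphic_intros hol1) (use r in auto)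
      have bl_eq: "norm (bl z) = norm (z - z0)" if z: "norm z = 4 * r" for z
      proof -
        have "of_real ((4 * r)\<^sup>2) = z * cnj z" using complex_norm_square[of z] z by simp
        then have "of_real ((4 * r)\<^sup>2) - cnj z0 * z = z * cnj (z - z0)" by (simp add: algebra_simps)
        then have "norm (bl z) = norm z * norm (z - z0) / (4 * r)"
          using r unfolding bl_def by (simp add: norm_divide norm_mult del: complex_cnj_diff)
        then show ?thesis using z r by simp
      qed
      have E_sphere: "norm (E z) \<le> B" if "norm z = 4 * r" for z
        using Suc.prems(2)[of z] that bl_eq[OF that] by (simp add: E_def D1 norm_mult mult.commute)
      have EB: "norm (E z) \<le> B" if z: "norm z \<le> 4 * r" for z
      proof (rule maximum_modulus_frontier[of E "cball 0 (4 * r)"])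
        show "E holomorphic_on interior (cball 0 (4 * r))" by (rule holomorphic_on_subset[OF holE]) (use r in auto)
        show "continuous_on (closure (cball 0 (4 * r))) E"
          by (rule holomorphic_on_imp_continuous_on[OF holomorphic_on_subset[OF holE]]) (use r in auto)
        show "norm (E z) \<le> B" if "z \<in> frontier (cball 0 (4 * r))" for z using that by (intro E_sphere) simp
      qed (use z in auto)
      have Ezero: "19 * q * r \<le> 4 * norm (w - z)" if "norm z \<le> 3 * r" "E z = 0" for z
      proof (cases "bl z = 0")
        \<comment> \<open>A zero of \<open>bl\<close> has modulus at least
          \<open>16 * r / 3\<close>, hence the case is impossible: multiplication by
          \<open>bl\<close> creates no zeros in the disc of radius \<open>3 * r\<close>.\<close>
        case True
        then have "of_real ((4 * r)\<^sup>2) = cnj z0 * z" using r by (simp add: bl_def)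
        then have "norm (complex_of_real ((4 * r)\<^sup>2)) = norm z0 * norm z" by (simp only: norm_mult complex_mod_cnj)
        also have "\<dots> \<le> (3 * r) * (3 * r)" using z0(1) that(1) r by (intro mult_mono) auto
        finally have "(4 * r)\<^sup>2 \<le> (3 * r) * (3 * r)" by (simp only: norm_of_real abs_power2)
        then have "16 * (r * r) \<le> 9 * (r * r)" by (simp add: power2_eq_square)
        then show ?thesis using r by (simp add: mult_le_0_iff)
      next
        case False
        then have "D z = 0" using that(2) D1 by (simp add: E_def)
        then show ?thesis by (rule Suc.prems(3)[OF that(1)])
      qed
      have E0: "norm (D 0) * (4/3) \<le> norm (E 0)"
      proof -
        have "norm (E 0) * norm z0 = norm (D1 0) * norm z0 * (4 * r)"
          using r by (simp add: E_def bl_def norm_mult norm_divide power2_eq_square)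
        also have "\<dots> = norm (D 0) * (4 * r)" by (simp add: D1[of 0] norm_mult mult.commute)
        finally have e: "norm (E 0) * norm z0 = norm (D 0) * (4 * r)" .
        have "norm (E 0) * norm z0 \<le> norm (E 0) * (3 * r)" using z0(1) by (rule mult_left_mono) simp
        with e have "r * (norm (D 0) * 4) \<le> r * (norm (E 0) * 3)" by (simp add: algebra_simps)
        then have "norm (D 0) * 4 \<le> norm (E 0) * 3" using r by (rule mult_left_le_imp_le)
        then show ?thesis by simp
      qed
      have "B \<le> norm (D 0) * (4/3) * (4/3) ^ n" using Suc.prems(4) by (simp add: mult.assoc)
      also have "\<dots> \<le> norm (E 0) * (4/3) ^ n" by (rule mult_right_mono[OF E0]) simp
      finally have IH: "q ^ n * (norm (E 0))\<^sup>2 \<le> (B + 1) * norm (E w)"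
        using Suc.IH[OF holE EB Ezero] by blast
      \<comment> \<open>Origin of the number 19: \<open>norm (bl w)\<close> is at most
        \<open>(16 + 3) * r / 4\<close>, so each division costs at most a factor \<open>q\<close> at
        \<open>w\<close>.\<close>
      have "norm (bl w) * (4 * r) \<le> 19 * (r * r)"
      proof -
        have "norm (bl w) * (4 * r) = norm (of_real ((4 * r)\<^sup>2) - cnj z0 * w)"
          using r by (simp add: bl_def norm_divide)
        also have "\<dots> \<le> norm (complex_of_real ((4 * r)\<^sup>2)) + norm (cnj z0 * w)" by (rule norm_triangle_ineq4)
        also have "\<dots> \<le> (4 * r)\<^sup>2 + (3 * r) * r"
          using z0(1) w r by (intro add_mono) (simp_all only: norm_mult complex_mod_cnj norm_of_real abs_power2 mult_right_mono less_imp_le)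
        finally show ?thesis by (simp add: power2_eq_square)
      qed
      then have "r * (norm (bl w) * 4) \<le> r * (19 * r)" by (simp add: algebra_simps)
      then have "norm (bl w) * 4 \<le> 19 * r" using r by (rule mult_left_le_imp_le)
      then have "q * (norm (bl w) * 4) \<le> q * (19 * r)" using q by (intro mult_left_mono) auto
      also have "\<dots> \<le> 4 * norm (w - z0)" using Suc.prems(3)[OF z0] by (simp add: algebra_simps)
      finally have qb: "q * norm (bl w) \<le> norm (w - z0)" by simp
      have "q ^ Suc n * (norm (D 0))\<^sup>2 \<le> q * (q ^ n * (norm (E 0))\<^sup>2)"
      proof -
        have "norm (D 0) \<le> norm (E 0)" using E0 norm_ge_zero[of "D 0"] by linarith
        then have "(norm (D 0))\<^sup>2 \<le> (norm (E 0))\<^sup>2" by (rule power_mono) simp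
        then show ?thesis using q by (simp add: mult_left_mono)
      qed
      also have "\<dots> \<le> q * ((B + 1) * norm (E w))" using IH q by (intro mult_left_mono) auto
      also have "\<dots> = (B + 1) * (norm (D1 w) * (q * norm (bl w)))" by (simp add: E_def norm_mult algebra_simps)
      also have "\<dots> \<le> (B + 1) * (norm (D1 w) * norm (w - z0))" using B qb by (intro mult_left_mono) auto
      also have "\<dots> = (B + 1) * norm (D w)" by (simp add: D1[of w] norm_mult mult.commute)
      finally show ?thesis .
    qed
  }
qed

section \<open>Hadamard's inequality\<close>

text \<open>Gram-Schmidt without normalisation, for sequences of which only the first
  \<open>n\<close> entries enter the inner product. The change of basis is triangular with ones on
  the diagonal, and subtracting the projection does not increase norms.\<close>

lemma orthogonal_columns_exist:
  fixes a :: "nat \<Rightarrow> nat \<Rightarrow> complex"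
  shows "\<exists>w u. (\<forall>k<l. \<forall>i. a k i = w k i + (\<Sum>j<k. u j k * w j i))
    \<and> (\<forall>j<l. \<forall>k<l. j \<noteq> k \<longrightarrow> (\<Sum>i<n. w j i * cnj (w k i)) = 0)
    \<and> (\<forall>k<l. (\<Sum>i<n. (norm (w k i))\<^sup>2) \<le> (\<Sum>i<n. (norm (a k i))\<^sup>2))"
proof (induction l)
  case (Suc l)
  then obtain w u where IH: "\<forall>k<l. \<forall>i. a k i = w k i + (\<Sum>j<k. u j k * w j i)"
    "\<forall>j<l. \<forall>k<l. j \<noteq> k \<longrightarrow> (\<Sum>i<n. w j i * cnj (w k i)) = 0"
    "\<forall>k<l. (\<Sum>i<n. (norm (w k i))\<^sup>2) \<le> (\<Sum>i<n. (norm (a k i))\<^sup>2)"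
    by (elim exE conjE) (rule that)
  define ip :: "(nat \<Rightarrow> complex) \<Rightarrow> (nat \<Rightarrow> complex) \<Rightarrow> complex" where "ip x y = (\<Sum>i<n. x i * cnj (y i))" for x y
  have ip_self: "ip x x = of_real (\<Sum>i<n. (norm (x i))\<^sup>2)" for x
    unfolding ip_def of_real_sum complex_norm_square ..
  have ip0: "ip y x = 0" if "ip x x = 0" for x y
  proof -
    have "(\<Sum>i<n. (norm (x i))\<^sup>2) = 0" using that unfolding ip_self of_real_eq_0_iff .
    then have "\<forall>i<n. x i = 0" by (simp add: sum_nonneg_eq_0_iff)
    then show ?thesis by (simp add: ip_def)
  qed
  have ip_cnj: "cnj (ip x y) = ip y x" for x y by (simp add: ip_def mult.commute)
  \<comment> \<open>If \<open>w j\<close> vanishes on the first \<open>n\<close> entries, the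
    quotient is \<open>0 / 0 = 0\<close>, and by \<open>ip0\<close> the numerator is 0 as
    well.\<close>
  define c where "c j = ip (a l) (w j) / ip (w j) (w j)" for j
  define p where "p i = (\<Sum>j<l. c j * w j i)" for i
  define v where "v i = a l i - p i" for i
  have ip_p: "ip p y = (\<Sum>j<l. c j * ip (w j) y)" for y
    unfolding ip_def p_def sum_distrib_right sum_distrib_left by (subst sum.swap) (simp add: mult.assoc)
  have vw: "ip v (w j) = 0" if j: "j < l" for j
  proof -
    have "ip p (w j) = (\<Sum>k<l. if k = j then c j * ip (w j) (w j) else 0)"
      unfolding ip_p by (intro sum.cong) (use IH(2) j in \<open>auto simp: ip_def\<close>)
    also have "\<dots> = ip (a l) (w j)" using j ip0[of "w j" "a l"] by (simp add: c_def)
    finally show ?thesis by (simp add: ip_def v_def left_diff_distrib sum_subtractf)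
  qed
  have wv: "ip (w j) v = 0" if "j < l" for j using vw[OF that] by (metis ip_cnj complex_cnj_zero)
  have "ip p v = 0" unfolding ip_p using wv by simp
  moreover have "ip (a l) (a l) = ip v v + ip p p + ip p v + cnj (ip p v)"
    by (simp add: ip_cnj ip_def v_def algebra_simps sum.distrib sum_subtractf)
  ultimately have "complex_of_real (\<Sum>i<n. (norm (a l i))\<^sup>2) = of_real ((\<Sum>i<n. (norm (v i))\<^sup>2) + (\<Sum>i<n. (norm (p i))\<^sup>2))"
    unfolding ip_self by simp
  then have "(\<Sum>i<n. (norm (a l i))\<^sup>2) = (\<Sum>i<n. (norm (v i))\<^sup>2) + (\<Sum>i<n. (norm (p i))\<^sup>2)"
    unfolding of_real_eq_iff .
  then have le: "(\<Sum>i<n. (norm (v i))\<^sup>2) \<le> (\<Sum>i<n. (norm (a l i))\<^sup>2)" by (simp add: sum_nonneg)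
  show ?case
  proof (rule exI[of _ "w(l := v)"], rule exI[of _ "\<lambda>j k. if k = l then c j else u j k"], intro conjI allI impI)
    fix k i assume "k < Suc l"
    then show "a k i = (w(l := v)) k i + (\<Sum>j<k. (if k = l then c j else u j k) * (w(l := v)) j i)"
      using IH(1) by (cases "k = l") (auto simp: v_def p_def less_Suc_eq)
  next
    fix j k assume "j < Suc l" "k < Suc l" "j \<noteq> k"
    then show "(\<Sum>i<n. (w(l := v)) j i * cnj ((w(l := v)) k i)) = 0"
      using IH(2) vw wv unfolding ip_def by (auto simp: less_Suc_eq)
  qed (use IH(3) le in \<open>auto simp: less_Suc_eq\<close>)
qed simp

text \<open>\<open>A = W * U\<close> with \<open>U\<close> unit upper triangular and orthogonal
  columns in \<open>W\<close>. The matrix \<open>WH * W\<close> is diagonal, so its determinant is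
  the product of the squared column norms of \<open>W\<close>, which do not exceed those of
  \<open>A\<close>.\<close>

lemma Hadamard_inequality:
  fixes A :: "complex mat"
  assumes A: "A \<in> carrier_mat n n"
  shows "norm (Determinant.det A) \<le> (\<Prod>k<n. L2_set (\<lambda>i. norm (A $$ (i, k))) {..<n})"
proof -
  obtain w u where w: "\<forall>k<n. \<forall>i. A $$ (i, k) = w k i + (\<Sum>j<k. u j k * w j i)"
    "\<forall>j<n. \<forall>k<n. j \<noteq> k \<longrightarrow> (\<Sum>i<n. w j i * cnj (w k i)) = 0"
    "\<forall>k<n. (\<Sum>i<n. (norm (w k i))\<^sup>2) \<le> (\<Sum>i<n. (norm (A $$ (i, k)))\<^sup>2)"
    using orthogonal_columns_exist[of n "\<lambda>k i. A $$ (i, k)" n] by (elim exE conjE) (rule that)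
  define W where "W = Matrix.mat n n (\<lambda>(i, j). w j i)"
  define WH where "WH = Matrix.mat n n (\<lambda>(i, j). cnj (w i j))"
  define U where "U = Matrix.mat n n (\<lambda>(j, k). if j < k then u j k else if j = k then 1 else 0)"
  have c: "W \<in> carrier_mat n n" "WH \<in> carrier_mat n n" "U \<in> carrier_mat n n"
    by (simp_all add: W_def WH_def U_def)
  have "A = W * U"
  proof (rule eq_matI)
    fix i k assume "i < dim_row (W * U)" "k < dim_col (W * U)"
    then have ik: "i < n" "k < n" using c by auto
    have "(W * U) $$ (i, k) = (\<Sum>j\<in>{0..<n}. w j i * (if j < k then u j k else if j = k then 1 else 0))"
      using ik by (simp add: W_def U_def scalar_prod_def)
    also have "\<dots> = (\<Sum>j\<in>{0..<n}. (if j < k then u j k * w j i else 0) + (if j = k then w k i else 0))"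
      by (rule sum.cong) auto
    also have "\<dots> = (\<Sum>j\<in>{0..<n} \<inter> {j. j < k}. u j k * w j i) + w k i"
      unfolding sum.distrib using ik by (simp add: sum.inter_restrict)
    also have "{0..<n} \<inter> {j. j < k} = {..<k}" using ik by auto
    finally show "A $$ (i, k) = (W * U) $$ (i, k)" using w(1) ik by simp
  qed (use A c in auto)
  then have "Determinant.det A = Determinant.det W * Determinant.det U" using det_mult[OF c(1,3)] by simp
  also have "Determinant.det U = prod_list (diag_mat U)"
    by (rule det_upper_triangular[OF _ c(3)]) (auto simp: U_def upper_triangular_def)
  also have "\<dots> = 1" unfolding prod_list_diag_prod by (intro prod.neutral) (simp add: U_def)
  finally have dA: "Determinant.det A = Determinant.det W" by simp
  interpret cnj: comm_ring_hom cnj by unfold_locales auto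
  have "WH = transpose_mat (map_mat cnj W)" by (rule eq_matI) (auto simp: WH_def W_def)
  then have dWH: "Determinant.det WH = cnj (Determinant.det W)"
    using Determinant.det_transpose[of "map_mat cnj W" n] c by (simp add: cnj.hom_det)
  have entry: "(WH * W) $$ (j, k) = (if j = k then of_real (\<Sum>i<n. (norm (w k i))\<^sup>2) else 0)" if "j < n" "k < n" for j k
  proof -
    have "(WH * W) $$ (j, k) = (\<Sum>i<n. w k i * cnj (w j i))"
      using that by (simp add: WH_def W_def scalar_prod_def lessThan_atLeast0 mult.commute)
    then show ?thesis using w(2) that unfolding of_real_sum complex_norm_square by auto
  qed
  have "Determinant.det (WH * W) = prod_list (diag_mat (WH * W))"
    by (rule det_upper_triangular[of _ n]) (use entry c in \<open>auto simp: upper_triangular_def\<close>)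
  also have "\<dots> = (\<Prod>k<n. complex_of_real (\<Sum>i<n. (norm (w k i))\<^sup>2))"
    unfolding prod_list_diag_prod using c entry by (auto simp: lessThan_atLeast0 intro!: prod.cong)
  finally have "complex_of_real ((norm (Determinant.det W))\<^sup>2) = of_real (\<Prod>k<n. (\<Sum>i<n. (norm (w k i))\<^sup>2))"
    unfolding det_mult[OF c(2,1)] dWH of_real_prod complex_norm_square by (simp only: mult.commute)
  then have "(norm (Determinant.det W))\<^sup>2 = (\<Prod>k<n. (\<Sum>i<n. (norm (w k i))\<^sup>2))" unfolding of_real_eq_iff .
  also have "\<dots> \<le> (\<Prod>k<n. (\<Sum>i<n. (norm (A $$ (i, k)))\<^sup>2))"
    by (rule prod_mono) (use w(3) in \<open>auto intro: sum_nonneg\<close>)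
  also have "\<dots> = (\<Prod>k<n. L2_set (\<lambda>i. norm (A $$ (i, k))) {..<n})\<^sup>2"
    unfolding prod_power_distrib by (simp add: L2_set_def sum_nonneg)
  finally show ?thesis unfolding dA by (rule power2_le_imp_le) (simp add: prod_nonneg L2_set_nonneg)
qed

section \<open>Resolvent bounds from singular values\<close>

context compact_adjoint_pair
begin

context
  fixes n :: nat and r :: real
  assumes r: "r > 0" and sn: "sing_val n * (10 * r) \<le> 1"
begin

definition proj :: "'a \<Rightarrow> 'a" where
  "proj f = (\<Sum>k<n. cinner f (sing_vec k) *\<^sub>C sing_vec k)"

text \<open>\<open>K\<close> on the orthogonal complement of the first \<open>n\<close> singular
  vectors, of norm at most \<open>sing_val n\<close>.\<close>

definition G :: "'a \<Rightarrow> 'a" where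
  "G f = K (f - proj f)"

lemma cinner_proj: "j < n \<Longrightarrow> cinner (proj f) (sing_vec j) = cinner f (sing_vec j)"
proof -
  assume j: "j < n"
  have "cinner (proj f) (sing_vec j) = (\<Sum>k<n. if k = j then cinner f (sing_vec j) else 0)"
    unfolding proj_def cinner.sum_left cinner_scaleC_left
    by (rule sum.cong[OF refl])
       (use sing_vec_norm[of j] sing_vec_orth in \<open>auto simp: cinner_self cinner.zero_right\<close>)
  then show ?thesis using j by simp
qed

lemma norm_proj: "(norm f)\<^sup>2 = (norm (f - proj f))\<^sup>2 + (norm (proj f))\<^sup>2"
proof -
  have "cinner (f - proj f) (proj f) = 0"
    unfolding proj_def[of f, THEN arg_cong[where f = "cinner (f - proj f)"]] cinner.sum_right cinner_scaleC_right
    by (intro sum.neutral) (auto simp: cinner.diff_left cinner_proj)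
  then have "inner (f - proj f) (proj f) = 0" by (rule inner_0_if_cinner_0)
  then show ?thesis
    unfolding power2_norm_eq_inner by (simp add: inner_diff_left inner_diff_right inner_commute)
qed

lemma Bessel: "L2_set (\<lambda>k. norm (cinner f (sing_vec k))) {..<n} \<le> norm f"
proof -
  have "(norm (proj f))\<^sup>2 = (\<Sum>k<n. (norm (cinner f (sing_vec k) *\<^sub>C sing_vec k))\<^sup>2)"
    unfolding proj_def
    by (rule norm_sum_orthogonal)
       (auto intro!: inner_0_if_cinner_0 simp: cinner_scaleC_left cinner_scaleC_right sing_vec_orth)
  also have "\<dots> = (\<Sum>k<n. (norm (cinner f (sing_vec k)))\<^sup>2)"
  proof (rule sum.cong[OF refl])
    fix k show "(norm (cinner f (sing_vec k) *\<^sub>C sing_vec k))\<^sup>2 = (norm (cinner f (sing_vec k)))\<^sup>2"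
      using sing_vec_norm[of k] by (auto simp: norm_scaleC cinner.zero_right)
  qed
  finally have "(\<Sum>k<n. (norm (cinner f (sing_vec k)))\<^sup>2) \<le> (norm f)\<^sup>2"
    using norm_proj[of f] by simp
  then show ?thesis unfolding L2_set_def by (simp add: real_le_lsqrt)
qed

lemma proj_linear: "proj (f + g) = proj f + proj g" "proj (c *\<^sub>C f) = c *\<^sub>C proj f"
  by (simp_all add: proj_def cinner_add_left scaleC_add_left sum.distrib cinner_scaleC_left
      scaleC.sum_right scaleC_scaleC)

lemma G_linear: "G (f + g) = G f + G g" "G (c *\<^sub>C f) = c *\<^sub>C G f"
  by (simp_all add: G_def proj_linear add_diff_add K.add scale flip: scaleC.diff_right)

lemma norm_G: "norm (G f) \<le> sing_val n * norm f"
proof -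
  have "norm (G f) \<le> sing_val n * norm (f - proj f)"
    unfolding G_def by (rule sing_val_bound) (simp add: cinner.diff_left cinner_proj)
  also have "norm (f - proj f) \<le> norm f"
    using norm_proj[of f] by (intro power2_le_imp_le[of "norm (f - proj f)" "norm f"]) auto
  finally show ?thesis by (simp add: mult_left_mono sing_val_nonneg)
qed

lemma G_bounded_linear: "bounded_linear G"
  by (rule bounded_linear_intro[of _ "sing_val n"])
     (simp_all only: G_linear scaleR_scaleC norm_G mult.commute[of "norm _" "sing_val n"])

lemma G_sum: "G (\<Sum>k\<in>S. f k) = (\<Sum>k\<in>S. G (f k))"
  by (rule linear_sum[OF bounded_linear.linear[OF G_bounded_linear]])

lemma G_power: "norm ((G ^^ i) f) \<le> sing_val n ^ i * norm f"
proof (induction i)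
  case (Suc i)
  have "norm (G ((G ^^ i) f)) \<le> sing_val n * norm ((G ^^ i) f)" by (rule norm_G)
  also have "\<dots> \<le> sing_val n * (sing_val n ^ i * norm f)" by (intro mult_left_mono Suc sing_val_nonneg)
  finally show ?case by (simp add: mult.assoc)
qed simp

text \<open>The factor 10 in the assumption on \<open>n\<close> yields the contraction constant 1/2
  on the disc of radius \<open>5 * r\<close>, an open neighbourhood of the closed disc of radius
  \<open>4 * r\<close> on which the minimum modulus estimate uses the determinant.\<close>

lemma small: "norm z < 5 * r \<Longrightarrow> norm z * sing_val n \<le> 1/2"
proof -
  assume "norm z < 5 * r"
  then have "norm z * sing_val n \<le> (5 * r) * sing_val n" by (intro mult_right_mono sing_val_nonneg) auto
  moreover have "sing_val n * (10 * r) = 2 * ((5 * r) * sing_val n)" by simp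
  ultimately show ?thesis using sn by linarith
qed

lemma neumann_term: "norm z < 5 * r \<Longrightarrow> norm (z ^ i *\<^sub>C (G ^^ i) f) \<le> (1/2) ^ i * norm f"
proof -
  assume z: "norm z < 5 * r"
  have "norm (z ^ i *\<^sub>C (G ^^ i) f) \<le> norm z ^ i * (sing_val n ^ i * norm f)"
    by (simp add: norm_scaleC norm_power mult_left_mono G_power)
  also have "\<dots> = (norm z * sing_val n) ^ i * norm f" by (simp add: power_mult_distrib)
  also have "\<dots> \<le> (1/2) ^ i * norm f"
    by (intro mult_right_mono power_mono small z mult_nonneg_nonneg sing_val_nonneg) auto
  finally show ?thesis .
qed

definition neumann :: "complex \<Rightarrow> 'a \<Rightarrow> 'a" where
  "neumann z f = (\<Sum>i. z ^ i *\<^sub>C (G ^^ i) f)"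

context
  fixes z :: complex
  assumes z: "norm z < 5 * r"
begin

lemma neumann_summable: "summable (\<lambda>i. norm (z ^ i *\<^sub>C (G ^^ i) f))"
  by (rule summable_comparison_test[OF _ summable_mult2[OF summable_geometric[of "1/2::real"], of "norm f"]])
     (use neumann_term[OF z] in auto)

lemma neumann_sums: "(\<lambda>i. z ^ i *\<^sub>C (G ^^ i) f) sums neumann z f"
  unfolding neumann_def by (rule summable_sums[OF summable_norm_cancel[OF neumann_summable]])

lemma neumann_eq: "neumann z f - z *\<^sub>C G (neumann z f) = f"
proof -
  have bl: "bounded_linear (\<lambda>x. z *\<^sub>C G x)"
    by (rule bounded_linear_compose[OF scaleC.bounded_linear_right G_bounded_linear])
  have "(\<lambda>i. z *\<^sub>C G (z ^ i *\<^sub>C (G ^^ i) f)) sums (z *\<^sub>C G (neumann z f))"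
    by (rule bounded_linear.sums[OF bl neumann_sums])
  then have "(\<lambda>i. z ^ Suc i *\<^sub>C (G ^^ Suc i) f) sums (z *\<^sub>C G (neumann z f))"
    by (simp add: G_linear scaleC_scaleC)
  then have "(\<lambda>i. z ^ i *\<^sub>C (G ^^ i) f) sums (z *\<^sub>C G (neumann z f) + f)"
    by (subst (asm) sums_Suc_iff) (simp add: complex_vector.scale_one)
  from sums_unique2[OF this neumann_sums] show ?thesis by (simp add: algebra_simps)
qed

lemma neumann_zero: "x - z *\<^sub>C G x = 0 \<Longrightarrow> x = 0"
proof -
  assume "x - z *\<^sub>C G x = 0"
  then have "norm x = norm z * norm (G x)" by (metis eq_iff_diff_eq_0 norm_scaleC)
  also have "\<dots> \<le> norm z * (sing_val n * norm x)" by (intro mult_left_mono norm_G) simp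
  also have "\<dots> \<le> 1/2 * norm x" unfolding mult.assoc[symmetric] by (intro mult_right_mono small z) simp
  finally show ?thesis by simp
qed

lemma norm_neumann: "norm (neumann z f) \<le> 2 * norm f"
proof -
  have "neumann z f = f + z *\<^sub>C G (neumann z f)" using neumann_eq[of f] by (simp add: algebra_simps)
  then have "norm (neumann z f) \<le> norm f + norm z * norm (G (neumann z f))"
    using norm_triangle_ineq[of f "z *\<^sub>C G (neumann z f)"] by (metis norm_scaleC)
  also have "norm z * norm (G (neumann z f)) \<le> norm z * (sing_val n * norm (neumann z f))"
    by (intro mult_left_mono norm_G) simp
  also have "\<dots> \<le> 1/2 * norm (neumann z f)"
    unfolding mult.assoc[symmetric] by (intro mult_right_mono small z) simp
  finally show ?thesis by simp
qed

end

text \<open>Paired with a fixed vector, the Neumann series is a scalar power series; this is all the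
  holomorphy that the entries of the matrix require.\<close>

lemma neumann_holomorphic: "(\<lambda>z. cinner (neumann z f) e) holomorphic_on ball 0 (5 * r)"
proof (rule power_series_holomorphic)
  fix z :: complex assume "z \<in> ball 0 (5 * r)"
  then have z: "norm z < 5 * r" by simp
  have "(\<lambda>i. cinner (z ^ i *\<^sub>C (G ^^ i) f) e) sums cinner (neumann z f) e"
    by (rule bounded_linear.sums[OF cinner.bounded_linear_left neumann_sums[OF z]])
  then show "(\<lambda>i. cinner ((G ^^ i) f) e * (z - 0) ^ i) sums cinner (neumann z f) e"
    by (simp add: cinner_scaleC_left mult.commute)
qed

definition col_vec' :: "complex \<Rightarrow> nat \<Rightarrow> 'a" where
  "col_vec' z k = neumann z (K (sing_vec k))"

text \<open>\<open>1 - z K = (1 - z G) (1 - z (1 - z G)\<^sup>-\<^sup>1 K proj)\<close>; this is the matrix of the second factor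
  compressed to the span of the first \<open>n\<close> singular vectors.\<close>

definition char_mat :: "complex \<Rightarrow> complex mat" where
  "char_mat z = Matrix.mat n n (\<lambda>(j, k). (if j = k then 1 else 0) - z * cinner (col_vec' z k) (sing_vec j))"

text \<open>A substitute for the determinant of \<open>1 - z K\<close>: for
  \<open>norm z < 5 * r\<close> the factor \<open>1 - z G\<close> is invertible, so singularity of
  \<open>1 - z K\<close> shows in this finite determinant.\<close>

definition char_fun :: "complex \<Rightarrow> complex" where
  "char_fun z = Determinant.det (char_mat z)"

definition S :: real where "S = (\<Sum>k<n. sing_val k)"

lemma S_nonneg: "0 \<le> S" unfolding S_def by (intro sum_nonneg sing_val_nonneg)

lemma char_mat_carrier: "char_mat z \<in> carrier_mat n n" by (simp add: char_mat_def)

lemma char_fun_holomorphic: "char_fun holomorphic_on ball 0 (5 * r)"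
proof -
  have "char_fun z = (\<Sum>p\<in>{p. p permutes {0..<n}}. signof p * (\<Prod>i = 0..<n. (if i = p i then 1 else 0) - z * cinner (col_vec' z (p i)) (sing_vec i)))" for z
    unfolding char_fun_def det_def'[OF char_mat_carrier]
    by (intro sum.cong prod.cong arg_cong2[where f = "(*)"] refl) (auto simp: char_mat_def permutes_in_image)
  moreover have "(\<lambda>z. (\<Sum>p\<in>{p. p permutes {0..<n}}. signof p * (\<Prod>i = 0..<n. (if i = p i then 1 else 0) - z * cinner (col_vec' z (p i)) (sing_vec i)))) holomorphic_on ball 0 (5 * r)"
    unfolding col_vec'_def by (intro holomorphic_intros neumann_holomorphic)
  ultimately show ?thesis by (simp cong: holomorphic_cong)
qed

lemma char_fun_0: "char_fun 0 = 1"
proof -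
  have "char_mat 0 = 1\<^sub>m n" by (rule eq_matI) (auto simp: char_mat_def)
  then show ?thesis by (simp add: char_fun_def)
qed

text \<open>Bessel's inequality bounds a whole column of the perturbation by
  \<open>norm z * norm (col_vec' z k)\<close>, whatever \<open>n\<close> is. This keeps powers of
  \<open>n\<close> out of Hadamard's bound.\<close>

lemma col_norm:
  assumes z: "norm z < 5 * r" and k: "k < n"
  shows "L2_set (\<lambda>j. norm (char_mat z $$ (j, k))) {..<n} \<le> 1 + 2 * norm z * sing_val k"
proof -
  let ?b = "col_vec' z k"
  have "L2_set (\<lambda>j. norm (char_mat z $$ (j, k))) {..<n} \<le> L2_set (\<lambda>j. (if j = k then 1 else 0) + norm z * norm (cinner ?b (sing_vec j))) {..<n}"
  proof (rule L2_set_mono)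
    fix j assume "j \<in> {..<n}"
    then show "norm (char_mat z $$ (j, k)) \<le> (if j = k then 1 else 0) + norm z * norm (cinner ?b (sing_vec j))"
      using k norm_triangle_ineq4[of "if j = k then 1 else 0" "z * cinner ?b (sing_vec j)"]
      by (auto simp: char_mat_def norm_mult split: if_splits)
  qed simp
  also have "\<dots> \<le> L2_set (\<lambda>j. if j = k then 1 else 0) {..<n} + L2_set (\<lambda>j. norm z * norm (cinner ?b (sing_vec j))) {..<n}"
    by (rule L2_set_triangle_ineq)
  also have "L2_set (\<lambda>j. if j = k then 1 else 0) {..<n} = 1"
    unfolding L2_set_def using k by (simp add: if_distrib[of "\<lambda>x. x\<^sup>2"] cong: if_cong)
  also have "L2_set (\<lambda>j. norm z * norm (cinner ?b (sing_vec j))) {..<n} = norm z * L2_set (\<lambda>j. norm (cinner ?b (sing_vec j))) {..<n}"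
    by (rule L2_set_right_distrib[symmetric]) simp
  also have "\<dots> \<le> norm z * norm ?b" by (intro mult_left_mono Bessel) simp
  also have "\<dots> \<le> norm z * (2 * sing_val k)"
    unfolding col_vec'_def sing_val_def by (intro mult_left_mono norm_neumann z) simp
  finally show ?thesis by simp
qed

text \<open>Stated for subsets of the columns because Cramer's rule replaces one of them.\<close>

lemma prod_le_exp:
  assumes "I \<subseteq> {..<n}"
  shows "(\<Prod>k\<in>I. 1 + 2 * norm z * sing_val k) \<le> exp (2 * norm z * S)"
proof -
  have fin: "finite I" using assms finite_subset by blast
  have "(\<Prod>k\<in>I. 1 + 2 * norm z * sing_val k) \<le> (\<Prod>k\<in>I. exp (2 * norm z * sing_val k))"
    by (rule prod_mono) (use sing_val_nonneg in \<open>auto intro: exp_ge_add_one_self\<close>)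
  also have "\<dots> = exp (2 * norm z * (\<Sum>k\<in>I. sing_val k))" using fin by (simp add: exp_sum sum_distrib_left)
  also have "\<dots> \<le> exp (2 * norm z * S)"
    unfolding S_def using assms by (auto intro!: mult_left_mono sum_mono2 sing_val_nonneg)
  finally show ?thesis .
qed

lemma norm_char_fun:
  assumes z: "norm z < 5 * r"
  shows "norm (char_fun z) \<le> exp (2 * norm z * S)"
proof -
  have "norm (char_fun z) \<le> (\<Prod>k<n. L2_set (\<lambda>j. norm (char_mat z $$ (j, k))) {..<n})"
    unfolding char_fun_def by (rule Hadamard_inequality[OF char_mat_carrier])
  also have "\<dots> \<le> (\<Prod>k<n. 1 + 2 * norm z * sing_val k)"
    by (rule prod_mono) (use col_norm[OF z] in \<open>auto simp: L2_set_nonneg\<close>)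
  also have "\<dots> \<le> exp (2 * norm z * S)" by (rule prod_le_exp) simp
  finally show ?thesis .
qed

lemma neumann_expansion:
  assumes z: "norm z < 5 * r"
  defines "y \<equiv> \<lambda>c. z *\<^sub>C (\<Sum>k<n. c k *\<^sub>C col_vec' z k)"
  shows "y c - z *\<^sub>C G (y c) = z *\<^sub>C K (\<Sum>k<n. c k *\<^sub>C sing_vec k)"
proof -
  have "y c - z *\<^sub>C G (y c) = z *\<^sub>C (\<Sum>k<n. c k *\<^sub>C (col_vec' z k - z *\<^sub>C G (col_vec' z k)))"
    unfolding y_def by (simp add: G_linear G_sum scaleC.diff_right sum_subtractf scaleC.sum_right scaleC_scaleC ac_simps)
  also have "\<dots> = z *\<^sub>C K (\<Sum>k<n. c k *\<^sub>C sing_vec k)"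
    unfolding col_vec'_def neumann_eq[OF z] K.sum scale ..
  finally show ?thesis .
qed

lemma char_mat_mult:
  assumes "j < n"
  shows "vec_index (char_mat z *\<^sub>v Matrix.vec n c) j = c j - cinner (z *\<^sub>C (\<Sum>k<n. c k *\<^sub>C col_vec' z k)) (sing_vec j)"
proof -
  have "vec_index (char_mat z *\<^sub>v Matrix.vec n c) j = (\<Sum>k<n. ((if j = k then 1 else 0) - z * cinner (col_vec' z k) (sing_vec j)) * c k)"
    using assms by (simp add: char_mat_def scalar_prod_def lessThan_atLeast0)
  also have "\<dots> = (\<Sum>k<n. (if j = k then c j else 0) - z * (c k * cinner (col_vec' z k) (sing_vec j)))"
    by (intro sum.cong) (auto simp: algebra_simps)
  also have "\<dots> = c j - cinner (z *\<^sub>C (\<Sum>k<n. c k *\<^sub>C col_vec' z k)) (sing_vec j)"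
    using assms by (simp add: sum_subtractf cinner_scaleC_left cinner.sum_left sum_distrib_left)
  finally show ?thesis .
qed

text \<open>A kernel vector \<open>c\<close> of the matrix yields a \<open>u\<close> whose
  coefficients \<open>cinner u (sing_vec j)\<close> are the \<open>c j\<close>. Then
  \<open>(1 - z G) u = z K (proj u)\<close>, which is \<open>u = z K u\<close>. For the Dirac
  operator such a \<open>z\<close> is an eigenvalue.\<close>

lemma char_fun_zero:
  assumes z: "norm z < 5 * r" and D: "char_fun z = 0"
  shows "\<exists>u. u \<noteq> 0 \<and> z *\<^sub>C K u = u"
proof -
  obtain v where v: "v \<in> carrier_vec n" "v \<noteq> 0\<^sub>v n" "char_mat z *\<^sub>v v = 0\<^sub>v n"
    using D det_0_iff_vec_prod_zero[OF char_mat_carrier] unfolding char_fun_def by blast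
  define c where "c k = vec_index v k" for k
  have vc: "v = Matrix.vec n c" using v(1) by (intro eq_vecI) (auto simp: c_def)
  define u where "u = z *\<^sub>C (\<Sum>k<n. c k *\<^sub>C col_vec' z k)"
  have cj: "cinner u (sing_vec j) = c j" if "j < n" for j
    using char_mat_mult[OF that, of z c] v(3) that unfolding vc u_def by simp
  have "u \<noteq> 0"
  proof
    assume "u = 0"
    then have "c j = 0" if "j < n" for j using cj[OF that] by (simp add: cinner.zero_left)
    then have "v = 0\<^sub>v n" unfolding vc by (intro eq_vecI) auto
    with v(2) show False ..
  qed
  moreover have "proj u = (\<Sum>k<n. c k *\<^sub>C sing_vec k)" unfolding proj_def using cj by simp
  then have "u - z *\<^sub>C G u = z *\<^sub>C K (proj u)" unfolding u_def using neumann_expansion[OF z, of c] by simp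
  then have "z *\<^sub>C K u = u" unfolding G_def by (simp add: K.diff scaleC.diff_right algebra_simps)
  ultimately show ?thesis by blast
qed

text \<open>Inverting \<open>1 - z G\<close> expresses \<open>u\<close> by \<open>f\<close> and its
  coefficients \<open>c k\<close>, which solve a linear system with matrix
  \<open>char_mat z\<close>. Cramer's rule and Hadamard's inequality bound each \<open>c k\<close>,
  and summation against \<open>norm (col_vec' z k) \<le> 2 * sing_val k\<close> gives the factor
  \<open>S\<close>.\<close>

lemma solution_bound:
  assumes z: "norm z < 5 * r" and D: "char_fun z \<noteq> 0" and u: "u - z *\<^sub>C K u = f"
  shows "norm u \<le> 2 * (1 + 2 * norm z * S * exp (2 * norm z * S) / norm (char_fun z)) * norm f"
proof -
  define c where "c k = cinner u (sing_vec k)" for k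
  define bf where "bf = neumann z f"
  define y where "y = z *\<^sub>C (\<Sum>k<n. c k *\<^sub>C col_vec' z k)"
  have bf: "norm bf \<le> 2 * norm f" unfolding bf_def by (rule norm_neumann[OF z])
  have proj: "proj u = (\<Sum>k<n. c k *\<^sub>C sing_vec k)" by (simp add: proj_def c_def)
  have uG: "u - z *\<^sub>C G u = f + z *\<^sub>C K (proj u)"
    using u unfolding G_def by (simp add: K.diff scaleC.diff_right algebra_simps)
  have Gd: "G (a - b) = G a - G b" for a b
    by (rule linear_diff[OF bounded_linear.linear[OF G_bounded_linear]])
  have "(u - bf - y) - z *\<^sub>C G (u - bf - y) = (u - z *\<^sub>C G u) - (bf - z *\<^sub>C G bf) - (y - z *\<^sub>C G y)"
    by (simp only: Gd scaleC.diff_right) (simp add: algebra_simps)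
  also have "\<dots> = 0"
    unfolding uG y_def neumann_expansion[OF z] proj bf_def neumann_eq[OF z] by simp
  finally have "u - bf - y = 0" by (rule neumann_zero[OF z])
  then have u_eq: "u = bf + y" by (simp add: algebra_simps)
  define b where "b = Matrix.vec n (\<lambda>j. cinner bf (sing_vec j))"
  have Ac: "char_mat z *\<^sub>v Matrix.vec n c = b"
  proof (rule eq_vecI)
    fix j assume "j < dim_vec b"
    then have j: "j < n" by (simp add: b_def)
    show "vec_index (char_mat z *\<^sub>v Matrix.vec n c) j = vec_index b j"
      unfolding char_mat_mult[OF j] y_def[symmetric] using j arg_cong[OF u_eq, of "\<lambda>x. cinner x (sing_vec j)"]
      by (simp add: b_def c_def cinner_add_left)
  qed (simp add: b_def char_mat_def)
  \<comment> \<open>The replaced column \<open>b\<close> has norm at most \<open>2 * norm f\<close>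
    by Bessel's inequality; for the other columns \<open>col_norm\<close> applies.\<close>
  have ck: "norm (c k) * norm (char_fun z) \<le> 2 * norm f * exp (2 * norm z * S)" if k: "k < n" for k
  proof -
    let ?R = "replace_col (char_mat z) b k"
    have R: "?R \<in> carrier_mat n n" by (simp add: replace_col_def char_mat_def)
    have "Determinant.det ?R = c k * char_fun z"
      using cramer_lemma_mat[OF char_mat_carrier _ k, of "Matrix.vec n c" z] k unfolding Ac char_fun_def by simp
    then have "norm (c k) * norm (char_fun z) = norm (Determinant.det ?R)" by (simp add: norm_mult)
    also have "\<dots> \<le> (\<Prod>l<n. L2_set (\<lambda>j. norm (?R $$ (j, l))) {..<n})" by (rule Hadamard_inequality[OF R])
    also have "\<dots> = L2_set (\<lambda>j. norm (?R $$ (j, k))) {..<n} * (\<Prod>l\<in>{..<n} - {k}. L2_set (\<lambda>j. norm (?R $$ (j, l))) {..<n})"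
      using k by (intro prod.remove) auto
    also have "\<dots> \<le> (2 * norm f) * (\<Prod>l\<in>{..<n} - {k}. 1 + 2 * norm z * sing_val l)"
    proof (rule mult_mono)
      have "L2_set (\<lambda>j. norm (?R $$ (j, k))) {..<n} = L2_set (\<lambda>j. norm (cinner bf (sing_vec j))) {..<n}"
        by (rule L2_set_cong) (use k in \<open>auto simp: replace_col_def char_mat_def b_def\<close>)
      also have "\<dots> \<le> 2 * norm f" using Bessel[of bf] bf by linarith
      finally show "L2_set (\<lambda>j. norm (?R $$ (j, k))) {..<n} \<le> 2 * norm f" .
      show "(\<Prod>l\<in>{..<n} - {k}. L2_set (\<lambda>j. norm (?R $$ (j, l))) {..<n}) \<le> (\<Prod>l\<in>{..<n} - {k}. 1 + 2 * norm z * sing_val l)"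
      proof (rule prod_mono, rule conjI)
        fix l assume l: "l \<in> {..<n} - {k}"
        have "L2_set (\<lambda>j. norm (?R $$ (j, l))) {..<n} = L2_set (\<lambda>j. norm (char_mat z $$ (j, l))) {..<n}"
          by (rule L2_set_cong) (use k l in \<open>auto simp: replace_col_def char_mat_def\<close>)
        then show "L2_set (\<lambda>j. norm (?R $$ (j, l))) {..<n} \<le> 1 + 2 * norm z * sing_val l"
          using col_norm[OF z, of l] l by simp
      qed (rule L2_set_nonneg)
    qed (auto intro!: prod_nonneg L2_set_nonneg)
    also have "\<dots> \<le> 2 * norm f * exp (2 * norm z * S)" by (intro mult_left_mono prod_le_exp) auto
    finally show ?thesis .
  qed
  define Q where "Q = exp (2 * norm z * S) / norm (char_fun z)"
  have cQ: "norm (c k) \<le> 2 * norm f * Q" if "k < n" for k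
    using ck[OF that] D by (simp add: Q_def field_simps)
  have Q0: "0 \<le> Q" by (simp add: Q_def)
  have "norm (\<Sum>k<n. c k *\<^sub>C col_vec' z k) \<le> (\<Sum>k<n. (2 * norm f * Q) * (2 * sing_val k))"
  proof (rule sum_norm_le)
    fix k assume "k \<in> {..<n}"
    then show "norm (c k *\<^sub>C col_vec' z k) \<le> (2 * norm f * Q) * (2 * sing_val k)"
      unfolding norm_scaleC using cQ norm_neumann[OF z, of "K (sing_vec k)"] Q0
      by (intro mult_mono) (auto simp: col_vec'_def sing_val_def)
  qed
  also have "\<dots> = 4 * norm f * Q * S" unfolding S_def sum_distrib_left by (rule sum.cong) auto
  finally have "norm y \<le> norm z * (4 * norm f * Q * S)"
    unfolding y_def norm_scaleC by (rule mult_left_mono) simp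
  then have "norm u \<le> 2 * norm f + norm z * (4 * norm f * Q * S)"
    using norm_triangle_ineq[of bf y] bf unfolding u_eq by linarith
  then show ?thesis by (simp add: Q_def algebra_simps)
qed

text \<open>\<open>B = exp (8 * r * S)\<close> bounds the determinant for
  \<open>norm z \<le> 4 * r\<close>, and \<open>B \<le> (4/3) ^ N\<close> provides the number of
  divisions. \<open>q\<close> is chosen to turn the gap \<open>\<delta> * r\<close> into the
  separation required in the minimum modulus estimate. The \<open>+ 1\<close> in the exponent
  absorbs constants, as \<open>r * S\<close> may be small.\<close>

lemma resolvent_bound:
  assumes w: "norm w = r" and \<delta>: "\<delta> > 0"
    and gap: "\<And>z u. u \<noteq> 0 \<Longrightarrow> z *\<^sub>C K u = u \<Longrightarrow> \<delta> * r \<le> norm (w - z)"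
    and u: "u - w *\<^sub>C K u = f"
  defines "q \<equiv> min 1 (4 * \<delta> / 19)"
  shows "norm u \<le> exp ((12 + ln 6 + (8 / ln (4/3) + 1) * ln (1 / q)) * (r * S + 1)) * norm f"
proof -
  have q: "q > 0" "q \<le> 1" using \<delta> by (simp_all add: q_def)
  define X where "X = r * S"
  have X: "X \<ge> 0" using r S_nonneg by (simp add: X_def)
  define B where "B = exp (8 * X)"
  have B0: "B > 0" by (simp add: B_def)
  define N where "N = nat \<lceil>8 * X / ln (4/3)\<rceil>"
  have l43: "ln (4/3 :: real) > 0" by simp
  have "0 \<le> 8 * X / ln (4/3)" using X l43 by simp
  then have N: "8 * X / ln (4/3) \<le> real N" "real N \<le> 8 * X / ln (4/3) + 1"
    unfolding N_def by linarith+
  have "8 * X \<le> real N * ln (4/3)" using N(1) l43 by (simp add: pos_divide_le_eq)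
  then have "B \<le> exp (real N * ln (4/3))" by (simp add: B_def)
  also have "\<dots> = (4/3) ^ N" unfolding exp_of_nat_mult by simp
  finally have BN: "B \<le> norm (char_fun 0) * (4/3) ^ N" by (simp add: char_fun_0)
  have zeros: "19 * q * r \<le> 4 * norm (w - z)" if "norm z \<le> 3 * r" "char_fun z = 0" for z
  proof -
    have "norm z < 5 * r" using that(1) r by linarith
    from char_fun_zero[OF this that(2)] gap have "\<delta> * r \<le> norm (w - z)" by blast
    moreover have "19 * q * r \<le> 4 * \<delta> * r" using r by (intro mult_right_mono) (auto simp: q_def)
    ultimately show ?thesis by simp
  qed
  have le_B: "norm (char_fun z) \<le> B" if z: "norm z \<le> 4 * r" for z
  proof -
    have "norm (char_fun z) \<le> exp (2 * norm z * S)" by (rule norm_char_fun) (use z r in linarith)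
    also have "\<dots> \<le> B"
      using mult_right_mono[OF z S_nonneg] by (simp add: B_def X_def)
    finally show ?thesis .
  qed
  have "q ^ N * (norm (char_fun 0))\<^sup>2 \<le> (B + 1) * norm (char_fun w)"
    by (rule minimum_modulus_induct[OF char_fun_holomorphic r le_B B0 w q zeros BN])
  then have low: "q ^ N \<le> (B + 1) * norm (char_fun w)" by (simp add: char_fun_0)
  then have D: "char_fun w \<noteq> 0" using zero_less_power[OF q(1), of N] by auto
  have inv: "1 / norm (char_fun w) \<le> (B + 1) / q ^ N"
    using low D q by (simp add: field_simps)
  have w5: "norm w < 5 * r" using w r by simp
  have "norm u \<le> 2 * (1 + 2 * X * exp (2 * X) * (1 / norm (char_fun w))) * norm f"
    using solution_bound[OF w5 D u] unfolding w by (simp add: X_def mult.assoc)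
  also have "\<dots> \<le> 2 * (1 + 2 * X * exp (2 * X) * ((B + 1) / q ^ N)) * norm f"
    using X inv by (intro mult_right_mono mult_left_mono add_left_mono) auto
  \<comment> \<open>\<open>12 = 2 + 2 + 8\<close>: from \<open>2 * X \<le> exp (2 * X)\<close>, from
    the factor \<open>exp (2 * X)\<close> of Cramer's rule, and from \<open>B\<close>.\<close>
  also have "\<dots> \<le> (6 * (exp (12 * X) / q ^ N)) * norm f"
  proof (rule mult_right_mono)
    have "2 * X \<le> exp (2 * X)" using exp_ge_add_one_self[of "2 * X"] by linarith
    moreover have "B + 1 \<le> 2 * exp (8 * X)" using X by (simp add: B_def)
    ultimately have "2 * X * exp (2 * X) * (B + 1) \<le> exp (2 * X) * exp (2 * X) * (2 * exp (8 * X))"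
      using X by (intro mult_mono) (auto simp: B_def)
    also have "\<dots> = 2 * exp (12 * X)" by (simp flip: exp_add)
    finally have a: "2 * X * exp (2 * X) * (B + 1) / q ^ N \<le> 2 * exp (12 * X) / q ^ N"
      using q by (intro divide_right_mono) auto
    have "1 \<le> exp (12 * X)" using X by simp
    moreover have "q ^ N \<le> 1" using q by (simp add: power_le_one)
    ultimately have "q ^ N \<le> exp (12 * X)" by linarith
    then have "1 \<le> exp (12 * X) / q ^ N" using q by (simp add: le_divide_eq)
    with a show "2 * (1 + 2 * X * exp (2 * X) * ((B + 1) / q ^ N)) \<le> 6 * (exp (12 * X) / q ^ N)" by simp
  qed simp
  also have "6 * (exp (12 * X) / q ^ N) = exp (ln 6 + 12 * X + real N * ln (1 / q))"
    using q by (simp add: exp_add exp_of_nat_mult power_one_over)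
  also have "\<dots> \<le> exp ((12 + ln 6 + (8 / ln (4/3) + 1) * ln (1 / q)) * (X + 1))"
  proof -
    have lq: "0 \<le> ln (1 / q)" using q by (simp add: ln_div)
    have "0 \<le> 8 / ln (4/3 :: real)" using l43 by simp
    moreover have "(8 / ln (4/3) + 1) * (X + 1) = 8 * X / ln (4/3) + 8 / ln (4/3) + X + 1"
      by (simp add: distrib_left distrib_right)
    ultimately have "real N \<le> (8 / ln (4/3) + 1) * (X + 1)" using N(2) X by linarith
    then have "real N * ln (1 / q) \<le> (8 / ln (4/3) + 1) * (X + 1) * ln (1 / q)" by (rule mult_right_mono[OF _ lq])
    moreover have "ln 6 + 12 * X \<le> (12 + ln 6) * (X + 1)" using X by (simp add: algebra_simps)
    ultimately show ?thesis by (simp add: algebra_simps)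
  qed
  finally show ?thesis by (simp add: X_def mult_right_mono)
qed

end

end

section \<open>The resolvent of the Dirac operator\<close>

text \<open>The comparison with the integral of \<open>x powr (- t)\<close>, done by induction:
  Young's inequality bounds \<open>real n powr (1 - t) * x powr t\<close> by
  \<open>(1 - t) * n + t * x\<close>, which is \<open>x - (1 - t)\<close> for
  \<open>x = n + 1\<close>.\<close>

lemma sum_powr_le:
  fixes t :: real
  assumes t: "0 < t" "t < 1"
  shows "(\<Sum>k<n. real (Suc k) powr (- t)) \<le> real n powr (1 - t) / (1 - t)"
proof (induction n)
  case (Suc n)
  define x where "x = real (Suc n)"
  have x: "x > 0" by (simp add: x_def)
  have "real n powr (1 - t) * x powr t \<le> x - (1 - t)"
  proof (cases "n = 0")
    case False
    then have "real n powr (1 - t) * x powr t \<le> (1 - t) * real n + t * x"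
      using t x by (intro Youngs_inequality_0) auto
    then show ?thesis by (simp add: x_def algebra_simps)
  qed (use t in \<open>simp add: x_def\<close>)
  also have "\<dots> = (x powr (1 - t) - (1 - t) * x powr (- t)) * x powr t"
    using x by (simp add: left_diff_distrib mult.assoc flip: powr_add)
  finally have "real n powr (1 - t) + (1 - t) * x powr (- t) \<le> x powr (1 - t)"
    using x by simp
  from divide_right_mono[OF this, of "1 - t"]
  have "real n powr (1 - t) / (1 - t) + x powr (- t) \<le> x powr (1 - t) / (1 - t)"
    using t by (simp add: add_divide_distrib)
  with Suc show ?case unfolding x_def by simp
qed simp

context dirac_potential
begin

lemma inverse_eq_K: "op_app ((dirac m V)\<inverse>) = K"
proof -
  have "op_shift (dirac m V) 0 = dirac m V"
    unfolding op_shift_def by (simp add: scaleC.zero_left)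
  then show ?thesis by (simp add: resolvent_def)
qed

lemma singular_value_bigo:
  assumes g: "potential_growth V \<gamma> x0" "\<gamma> > 0"
  shows "singular_value K \<in> O(\<lambda>k. real k powr (- (1 / ((\<gamma> + 1) / \<gamma>))))"
proof -
  interpret P: compact_adjoint_pair K K' by (rule compact_adjoint_pair_K[OF growth_imp_filterlim(1)[OF g]])
  define t where "t = 1 / ((\<gamma> + 1) / \<gamma>)"
  have t: "t > 0" using g(2) by (simp add: t_def)
  obtain B where B: "B > 0" "\<And>n. singular_value K n \<le> B * real (Suc n) powr (- t)"
    using singular_value_bound[OF g] unfolding t_def by blast
  have "norm (singular_value K k) \<le> B * norm (real k powr (- t))" if "k \<ge> 1" for k
  proof -
    have "real (Suc k) powr (- t) \<le> real k powr (- t)"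
      using that t by (intro powr_mono2') auto
    then have "B * real (Suc k) powr (- t) \<le> B * real k powr (- t)" using B(1) by simp
    then show ?thesis using B(2)[of k] P.sing_val_nonneg[of k] by (simp add: P.singular_value_eq)
  qed
  then show ?thesis
    unfolding t_def[symmetric] by (intro bigoI[of _ B]) (auto simp: eventually_at_top_linorder)
qed

text \<open>For \<open>u\<close> the resolvent at \<open>\<mu>\<close> applied to \<open>f\<close>,
  the equation \<open>u - \<mu> K u = K f\<close> holds, so \<open>resolvent_bound\<close> applies.
  With \<open>t = 1 / p\<close> the sum \<open>S\<close> is of order \<open>n powr (1 - t)\<close>,
  hence of order \<open>r powr (p - 1)\<close>; multiplied by \<open>r\<close> it has the claimed
  power.\<close>

lemma resolvent_growth:
  assumes g: "potential_growth V \<gamma> x0" "\<gamma> > 0" and \<delta>: "\<delta> > 0"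
  shows "\<exists>c>0. \<forall>\<mu>\<in>resolvent_set (dirac m V).
    norm \<mu> \<ge> exp 1 \<and> dist_to_set \<mu> (spectrum (dirac m V)) \<ge> ereal (\<delta> * norm \<mu>) \<longrightarrow>
    ln (onorm (resolvent (dirac m V) \<mu>)) \<le> c * norm \<mu> powr ((\<gamma> + 1) / \<gamma>)"
proof -
  interpret P: compact_adjoint_pair K K' by (rule compact_adjoint_pair_K[OF growth_imp_filterlim(1)[OF g]])
  define p where "p = (\<gamma> + 1) / \<gamma>"
  define t where "t = 1 / p"
  have p: "p > 1" using g(2) by (simp add: p_def)
  then have t: "0 < t" "t < 1" "p * t = 1" by (simp_all add: t_def)
  obtain B where B: "B > 0" "\<And>n. P.sing_val n \<le> B * real (Suc n) powr (- t)"
    using singular_value_bound[OF g] unfolding t_def p_def P.singular_value_eq by blast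
  define D where "D = (10 * B) powr p + 1"
  have D: "D > 0" by (simp add: D_def add_nonneg_pos)
  define C where "C = B * D powr (1 - t) / (1 - t)"
  have C: "C \<ge> 0" using B(1) t by (simp add: C_def)
  define c1 where "c1 = 12 + ln 6 + (8 / ln (4/3) + 1) * ln (1 / min 1 (4 * \<delta> / 19))"
  have "0 \<le> ln (1 / min 1 (4 * \<delta> / 19))" using \<delta> by (intro ln_ge_zero) (auto simp: le_divide_eq)
  moreover have "0 \<le> 8 / ln (4/3 :: real) + 1" by simp
  moreover have "0 \<le> ln (6 :: real)" by simp
  ultimately have c1: "c1 > 0" unfolding c1_def by (intro add_pos_nonneg mult_nonneg_nonneg) linarith+
  show ?thesis
  proof (rule exI[of _ "c1 * (C + 1) + \<bar>ln m\<bar>"], intro conjI ballI impI)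
    show "0 < c1 * (C + 1) + \<bar>ln m\<bar>" using c1 C by (simp add: add_pos_nonneg add_nonneg_pos)
    fix \<mu> assume \<mu>: "\<mu> \<in> resolvent_set (dirac m V)"
      and far: "norm \<mu> \<ge> exp 1 \<and> dist_to_set \<mu> (spectrum (dirac m V)) \<ge> ereal (\<delta> * norm \<mu>)"
    define r where "r = norm \<mu>"
    have "(1::real) \<le> exp 1" by simp
    then have r: "r \<ge> 1" using far unfolding r_def by linarith
    then have rp: "1 \<le> r powr p" using p by (simp add: ge_one_powr_ge_zero)
    \<comment> \<open>Chosen so that the decay bound \<open>B * (n + 1) powr (- t)\<close> on
      \<open>sing_val n\<close> is at most \<open>1 / (10 * r)\<close>.\<close>
    define n where "n = nat \<lceil>(10 * B * r) powr p\<rceil>"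
    have n: "(10 * B * r) powr p \<le> real n" "real n \<le> (10 * B * r) powr p + 1"
      unfolding n_def by (simp_all add: real_nat_ceiling_ge of_nat_ceiling)
    have "10 * B * r = ((10 * B * r) powr p) powr t" using B(1) r t(3) by (simp add: powr_powr)
    also have "\<dots> \<le> real (Suc n) powr t" using n(1) t by (intro powr_mono2) auto
    finally have "B * real (Suc n) powr (- t) * (10 * r) \<le> 1"
      by (simp add: powr_minus_divide ac_simps)
    moreover have "P.sing_val n * (10 * r) \<le> B * real (Suc n) powr (- t) * (10 * r)"
      using B(2)[of n] r by (intro mult_right_mono) auto
    ultimately have sn: "P.sing_val n * (10 * r) \<le> 1" by linarith
    have r0: "r > 0" using r by simp
    have "real n \<le> (10 * B) powr p * r powr p + 1 * r powr p"
      using n(2) rp B(1) r by (simp add: powr_mult)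
    then have "real n \<le> D * r powr p" by (simp add: D_def distrib_right)
    then have "real n powr (1 - t) \<le> (D * r powr p) powr (1 - t)" using t by (intro powr_mono2) auto
    also have "\<dots> = D powr (1 - t) * r powr (p - 1)"
      using D r t(3) by (simp add: powr_mult powr_powr right_diff_distrib)
    finally have nt: "real n powr (1 - t) \<le> D powr (1 - t) * r powr (p - 1)" .
    have "P.S n \<le> (\<Sum>k<n. B * real (Suc k) powr (- t))"
      unfolding P.S_def[OF r0 sn] by (rule sum_mono) (rule B(2))
    also have "\<dots> = B * (\<Sum>k<n. real (Suc k) powr (- t))" by (simp add: sum_distrib_left)
    also have "\<dots> \<le> B * (D powr (1 - t) * r powr (p - 1) / (1 - t))"
      by (intro mult_left_mono order_trans[OF sum_powr_le[OF t(1,2)] divide_right_mono[OF nt]])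
         (use B(1) t in simp_all)
    also have "\<dots> = C * r powr (p - 1)" by (simp add: C_def)
    finally have "r * P.S n \<le> C * (r * r powr (p - 1))" using r by simp
    also have "r * r powr (p - 1) = r powr p" using r by (simp add: powr_mult_base)
    finally have rS: "r * P.S n + 1 \<le> (C + 1) * r powr p" using rp by (simp add: distrib_right)
    \<comment> \<open>If \<open>z K u = u\<close> with \<open>u \<noteq> 0\<close>, then
      \<open>u\<close> is an eigenvector of the Dirac operator for \<open>z\<close>, so
      \<open>z\<close> lies in the spectrum and the distance assumption applies. With an empty
      spectrum there is no such \<open>z\<close>.\<close>
    have gap: "\<delta> * r \<le> norm (\<mu> - z)" if u: "u \<noteq> 0" "z *\<^sub>C K u = u" for z u
    proof -
      have uz: "(u, 0 + z *\<^sub>C u) \<in> dirac m V"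
        using graph_subspace_dirac K_in[of u] unfolding graph_subspace_def
        by (metis u(2) add_0)
      have "z \<notin> resolvent_set (dirac m V)"
      proof
        assume z: "z \<in> resolvent_set (dirac m V)"
        have "u = resolvent (dirac m V) z 0" using resolvent_eqI[OF z uz] by simp
        also have "\<dots> = 0" by (rule linear_0[OF bounded_linear.linear[OF resolvent_bounded_linear[OF z]]])
        finally show False using u(1) by simp
      qed
      then have "dist_to_set \<mu> (spectrum (dirac m V)) \<le> ereal (dist \<mu> z)"
        unfolding dist_to_set_def by (intro INF_lower) (simp add: spectrum_def)
      then have "ereal (\<delta> * r) \<le> ereal (dist \<mu> z)" using far order_trans unfolding r_def by blast
      then show ?thesis by (simp add: dist_norm)
    qed
    let ?E = "exp (c1 * (C + 1) * r powr p) / m"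
    have "norm (resolvent (dirac m V) \<mu> f) \<le> ?E * norm f" for f
    proof -
      define u where "u = resolvent (dirac m V) \<mu> f"
      have "(u, (f + \<mu> *\<^sub>C u) + 0 *\<^sub>C u) \<in> dirac m V"
        using resolvent_in[OF \<mu>, of f] by (simp add: u_def scaleC.zero_left)
      from resolvent_eqI[OF zero_in_resolvent_set this] have "u - \<mu> *\<^sub>C K u = K f"
        by (simp add: P.K.add K_scaleC algebra_simps)
      from P.resolvent_bound[OF r0 sn r_def[symmetric] \<delta> gap this]
      have "norm u \<le> exp (c1 * (r * P.S n + 1)) * norm (K f)" unfolding c1_def .
      also have "\<dots> \<le> exp (c1 * (C + 1) * r powr p) * (norm f / m)"
      proof (rule mult_mono)
        have "c1 * (r * P.S n + 1) \<le> c1 * ((C + 1) * r powr p)" using rS c1 by simp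
        then show "exp (c1 * (r * P.S n + 1)) \<le> exp (c1 * (C + 1) * r powr p)" by (simp add: mult.assoc)
        show "norm (K f) \<le> norm f / m" using strip_resolvent(2)[of 0 f] m by simp
      qed auto
      finally show ?thesis by (simp add: u_def)
    qed
    then have le: "onorm (resolvent (dirac m V) \<mu>) \<le> ?E" using m by (intro onorm_bound) auto
    show "ln (onorm (resolvent (dirac m V) \<mu>)) \<le> (c1 * (C + 1) + \<bar>ln m\<bar>) * norm \<mu> powr ((\<gamma> + 1) / \<gamma>)"
    \<comment> \<open>The logarithm of 0 is 0 by convention, so the degenerate case only requires a
      nonnegative right-hand side; otherwise \<open>ln\<close> is monotone.\<close>
    proof (cases "onorm (resolvent (dirac m V) \<mu>) = 0")
      case False
      then have "ln (onorm (resolvent (dirac m V) \<mu>)) \<le> ln ?E"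
        using le onorm_pos_le[OF resolvent_bounded_linear[OF \<mu>]] m by (intro ln_mono) auto
      also have "\<dots> = c1 * (C + 1) * r powr p - ln m" using m by (simp add: ln_div)
      also have "\<dots> \<le> c1 * (C + 1) * r powr p + \<bar>ln m\<bar> * 1" by simp
      also have "\<dots> \<le> c1 * (C + 1) * r powr p + \<bar>ln m\<bar> * r powr p"
        using rp by (intro add_left_mono mult_left_mono) auto
      finally show ?thesis by (simp add: p_def r_def distrib_right)
    qed (use c1 C in auto)
  qed
qed

lemma op_app_op_on: "u \<in> D \<Longrightarrow> op_app (op_on D F) u = F u"
  by (auto simp: op_app_def op_on_def)

text \<open>The graph estimate with one constant for all three terms:
  \<open>\<kappa> \<le> 1\<close> allows the same coefficient everywhere on the left, and division
  by \<open>C0 + 1\<close> absorbs the coefficient of \<open>(norm u)\<^sup>2\<close> on the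
  right.\<close>

lemma graph_norm_bound:
  assumes "u \<in> Domain (dirac m V)"
  shows "\<kappa> / (C0 + 1) * ((norm (weak_derivative u))\<^sup>2 + (norm (mult_op V u))\<^sup>2 + (norm u)\<^sup>2)
    \<le> (norm (op_app (dirac m V) u))\<^sup>2 + (norm u)\<^sup>2"
proof -
  have u: "u \<in> H1" "u \<in> mult_dom V" using assms by (simp_all add: Domain_dirac)
  define a where "a = (norm (weak_derivative u))\<^sup>2"
  define b where "b = (norm (mult_op V u))\<^sup>2"
  define c where "c = (norm u)\<^sup>2"
  define h where "h = (norm (dirac_fun m V u))\<^sup>2"
  note defs = a_def b_def c_def h_def
  have nn: "a \<ge> 0" "c \<ge> 0" "h \<ge> 0" by (simp_all add: defs)
  have "a + \<kappa> * b \<le> h + C0 * c" using graph_estimate[OF u] by (simp add: defs)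
  moreover have "\<kappa> * a \<le> 1 * a" "\<kappa> * c \<le> 1 * c" by (intro mult_right_mono \<kappa> nn)+
  ultimately have "\<kappa> * (a + b + c) \<le> h + (C0 + 1) * c" by (simp add: algebra_simps)
  also have "\<dots> \<le> (C0 + 1) * (h + c)" using C0 nn by (simp add: algebra_simps)
  finally show ?thesis
    using C0 u by (simp add: dirac_eq op_app_op_on pos_divide_le_eq mult.commute flip: defs)
qed

end

theorem theorem2p1:
  fixes m \<epsilon> M\<^sub>\<epsilon> :: real and V :: "real \<Rightarrow> real"
  assumes "m > 0"
    and "V C1_differentiable_on UNIV"
    and "0 < \<epsilon>" and "\<epsilon> < 1" and "M\<^sub>\<epsilon> > 0"
    and "\<And>x. \<bar>deriv V x\<bar> \<le> \<epsilon> * \<bar>V x\<bar>\<^sup>2 + M\<^sub>\<epsilon>"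
  shows
    "op_adjoint (dirac m V) =
       op_on (Domain (dirac m V))
         (\<lambda>u. (-\<i>) *\<^sub>C mat_op \<sigma>1 (weak_derivative u) + complex_of_real m *\<^sub>C mat_op \<sigma>3 u
               - \<i> *\<^sub>C mult_op V u)
     \<and>
     (\<exists>C>0. \<forall>u\<in>Domain (dirac m V).
        (norm (op_app (dirac m V) u))\<^sup>2 + (norm u)\<^sup>2
          \<ge> C * ((norm (weak_derivative u))\<^sup>2 + (norm (mult_op V u))\<^sup>2 + (norm u)\<^sup>2) \<and>
        (norm (op_app (op_adjoint (dirac m V)) u))\<^sup>2 + (norm u)\<^sup>2
          \<ge> C * ((norm (weak_derivative u))\<^sup>2 + (norm (mult_op V u))\<^sup>2 + (norm u)\<^sup>2)) \<and>
     is_core Cc_infinity (dirac m V) \<and> is_core Cc_infinity (op_adjoint (dirac m V))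
     \<and>
     resolvent_set (dirac m V) \<noteq> {} \<and>
     {z. Re z \<in> {-m<..<m}} \<subseteq> resolvent_set (dirac m V)
     \<and>
     (filterlim (\<lambda>x. \<bar>V x\<bar>) at_top at_infinity \<longrightarrow>
        (\<forall>z\<in>resolvent_set (dirac m V). compact_operator (resolvent (dirac m V) z))) \<and>
     (\<forall>\<gamma>>0. \<forall>x\<^sub>0\<ge>0. potential_growth V \<gamma> x\<^sub>0 \<longrightarrow>
        singular_value (op_app ((dirac m V)\<inverse>)) \<in> O(\<lambda>k. real k powr (- (1 / ((\<gamma> + 1) / \<gamma>)))))
     \<and>
     (\<forall>\<gamma>>0. \<forall>x\<^sub>0\<ge>0. potential_growth V \<gamma> x\<^sub>0 \<longrightarrow>
        (\<forall>\<delta>>0. \<exists>c>0. \<forall>\<mu>\<in>resolvent_set (dirac m V).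
           norm \<mu> \<ge> exp 1 \<and> dist_to_set \<mu> (spectrum (dirac m V)) \<ge> ereal (\<delta> * norm \<mu>) \<longrightarrow>
           ln (onorm (resolvent (dirac m V) \<mu>)) \<le> c * norm \<mu> powr ((\<gamma> + 1) / \<gamma>)))"
proof -
  obtain V' where "\<And>x. (V has_vector_derivative V' x) (at x)" and V'_cont: "continuous_on UNIV V'"
    using assms(2) unfolding C1_differentiable_on_def by blast
  then have V': "(V has_real_derivative V' x) (at x)" for x
    by (simp add: has_real_derivative_iff_has_vector_derivative)
  interpret dirac_potential m V V' \<epsilon> M\<^sub>\<epsilon>
    using assms(6) V' V'_cont assms(1,3,4,5) DERIV_imp_deriv[OF V'] by unfold_locales auto
  interpret neg: dirac_potential m "\<lambda>x. - V x" "\<lambda>x. - V' x" \<epsilon> M\<^sub>\<epsilon>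
    by (rule uminus)
  have adjoint: "op_adjoint (dirac m V) = op_on (Domain (dirac m V))
    (\<lambda>u. (-\<i>) *\<^sub>C mat_op \<sigma>1 (weak_derivative u) + complex_of_real m *\<^sub>C mat_op \<sigma>3 u - \<i> *\<^sub>C mult_op V u)"
    unfolding adjoint_eq(1) dirac_uminus Domain_dirac ..
  \<comment> \<open>The constants depend only on \<open>\<epsilon>\<close>, the bound and
    \<open>m\<close>, so the same \<open>C\<close> serves the operator and its adjoint.\<close>
  have "neg.\<kappa> / (neg.C0 + 1) = \<kappa> / (C0 + 1)"
    by (simp add: \<kappa>_def neg.\<kappa>_def C0_def neg.C0_def)
  moreover have "norm (mult_op (\<lambda>x. - V x) u) = norm (mult_op V u)" if "u \<in> Domain (dirac m V)" for u
    using that by (simp add: Domain_dirac mult_op_uminus norm_scaleC)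
  moreover have "Domain (dirac m (\<lambda>x. - V x)) = Domain (dirac m V)"
    by (simp add: neg.Domain_dirac Domain_dirac mult_dom_uminus)
  ultimately have estimates: "\<exists>C>0. \<forall>u\<in>Domain (dirac m V).
        (norm (op_app (dirac m V) u))\<^sup>2 + (norm u)\<^sup>2
          \<ge> C * ((norm (weak_derivative u))\<^sup>2 + (norm (mult_op V u))\<^sup>2 + (norm u)\<^sup>2) \<and>
        (norm (op_app (op_adjoint (dirac m V)) u))\<^sup>2 + (norm u)\<^sup>2
          \<ge> C * ((norm (weak_derivative u))\<^sup>2 + (norm (mult_op V u))\<^sup>2 + (norm u)\<^sup>2)"
    using graph_norm_bound neg.graph_norm_bound \<kappa> C0 unfolding adjoint_eq(1)
    by (intro exI[of _ "\<kappa> / (C0 + 1)"]) auto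
  have strip: "{z. Re z \<in> {-m<..<m}} \<subseteq> resolvent_set (dirac m V)"
    using strip_resolvent(1) by (auto simp: abs_less_iff)
  show ?thesis
    using adjoint estimates core neg.core strip zero_in_resolvent_set compact_resolvent
      singular_value_bigo resolvent_growth
    unfolding adjoint_eq(1)[symmetric] inverse_eq_K by blast
qed

end
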